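(* Assume that there exists a verification family $((Y^{\mathbf t;\mathbf b}_s)_{0\le s\le T}:(\mathbf t,\mathbf b)\in\mathcal D^f)$. Then the family is unique (i.e. there is at most one verification family, up to indistinguishability) and: (i) it satisfies $Y_0=\sup_{u\in\mathcal U}J(u)$, where $Y:=Y^{\emptyset}$; (ii) it defines an optimal control $u^*=(\tau_1^*,\ldots,\tau_{N^*}^*;\beta_1^*,\ldots,\beta_{N^*}^* )$ for the problem of finding $u^*\in\mathcal U$ with $J(u^* )=\sup_{u\in\mathcal U}J(u)$, where, with $(\tau_0^*,\beta_0^* ):=(0,b_0)$, $(\tau_j^* )_{1\le j\le N^*}$ is the sequence of $\mathbb F$-stopping times given by $$\tau_j^*:=\inf\Big\{s\ge\tau_{j-1}^*:\ Y_s^{\tau_1^*,\ldots,\tau_{j-1}^*;\beta_1^*,\ldots,\beta_{j-1}^*}=\max_{\beta\in\mathcal I^{-\beta_{j-1}^*}}\big\{-c_{\beta_{j-1}^*,\beta}(s)+Y_s^{\tau_1^*,\ldots,\tau_{j-1}^*,s;\beta_1^*,\ldots,\beta_{j-1}^*,\beta}\big\}\Big\}\wedge T,$$ $(\beta_j^* )_{1\le j\le N^*}$ is defined as a measurable selection of $$\beta_j^*\in\mathop{\arg\max}_{\beta\in\mathcal I^{-\beta_{j-1}^*}}\Big\{-c_{\beta_{j-1}^*,\beta}(\tau_j^* )+Y_{\tau_j^*}^{\tau_1^*,\ldots,\tau_j^*;\beta_1^*,\ldots,\beta_{j-1}^*,\beta}\Big\},$$ and $N^*=\max\{j:\tau_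j^*<T\}$.
   Context: **Setup.** $T\in(0,\infty)$ is fixed, $\mathcal I=\{1,\ldots,m\}$, $\mathcal I^{-b}:=\mathcal I\setminus\{b\}$, $b_0\in\mathcal I$ is the initial mode. $(\Omega,\mathcal F,\mathbb F,\mathbb P)$, $\mathbb F=(\mathcal F_t)_{0\le t\le T}$, is a filtered probability space satisfying the usual conditions, with $\mathbb F$ quasi-left continuous ($\mathcal F_\gamma=\mathcal F_{\gamma-}$ for every predictable stopping time $\gamma$). A càdlàg process $X$ is quasi-left continuous if $\lim_k X_{\gamma_k}=X_\gamma$ a.s. for each predictable stopping time $\gamma$ and every announcing sequence $\gamma_k\nearrow\gamma$. $\mathcal S^p$ is the set of real-valued progressively measurable càdlàg processes $Z$ on $[0,T]$ with $\mathbb E[\sup_{t\in[0,T]}|Z_t|^p]<\infty$, and $\mathcal S^p_{qlc}$ its subset of quasi-left continuous processes. $\mathcal T$ is the set of $\mathbb F$-stopping times (with values in $[0,T]$), $\mathcal T_\gamma:=\{\tau\in\mathcal T:\tau\ge\gamma\text{ a.s.}\}$. **Controls.** $\mathcal U$ is the set of $u=(\tau_1,\ldots,\tau_N;\beta_1,\ldots,\beta_N)$ ($N$ random, possibly infinite), where $(\tau_j)$ is a non-decreasing sequence of $\mathbb F$-stopping times (with $\lim_{j\to\infty}\tau_j=T$ a.s.) and $\beta_j\in\mathcal I^{-\beta_{j-1}}$ is $\mathcal F_{\tau_j}$-measurable, $\beta_0:=b_0$. $\mathcal U^f:=\{u\in\mathcal U: N<\infty\text{ a.s.}\}$, $\mathcal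 U^k:=\{u\in\mathcal U:N\le k\}$; $\mathcal U_\gamma,\mathcal U^f_\gamma,\mathcal U^k_\gamma$ are the subsets with $\tau_1\in\mathcal T_\gamma$. $\mathcal D:=\{(t_1,\ldots;b_1,\ldots):t_1\le t_2\le\cdots,\ b_{j+1}\in\mathcal I^{-b_j}\}$ (times in $[0,T]$, modes in $\mathcal I$), $\mathcal D^f$ is its subset of finite sequences (including the empty one). For $(\mathbf t,\mathbf b)\in\mathcal D^f$, $t_n$ and $b_n$ denote the last elements of $\mathbf t$ and $\mathbf b$ (for the empty sequence, $0$ and $b_0$). When a control is appended to a sequence of modes with last element $b$, one puts $\beta_0:=b$ (so $\beta_1\ne b$). $\bar{\mathcal I}^n:=\{(b_1,\ldots,b_n)\in\mathcal I^n:b_j\in\mathcal I^{-b_{j-1}}\}$ and $\bar{\mathcal T}^n:=\{(\eta_1,\ldots,\eta_n)\in\mathcal T^n:\eta_1\le\cdots\le\eta_n\}$. For $l\ge0$, $\Pi_l:=\{0,T2^{-l},2T2^{-l},\ldots,T\}$ and $\Gamma^l(\eta_1,\ldots,\eta_j):=(\inf\{s\in\Pi_l:s\ge\eta_1\},\ldots,\inf\{s\in\Pi_l:s\ge\eta_j\})$. **Objective.** $\Psi$ is an $\mathcal F_T\otimes\mathcal B(\mathcal D)$-measurable real-valued random map on $\mathcal D$, $c_{b,b'}:\Omega\times[0,T]\to\mathbb R$ ($(b,b')\in\bar{\mathcal I}^2$) are progressively measurable, and $$J(u):=\mathbb E\Big[\Psi(\tau_1,\ldots,\tau_N;\beta_1,\ldots,\beta_N)-\sum_j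 c_{\beta_{j-1},\beta_j}(\tau_j)\Big].$$ **Standing assumption 1.** (i) $\Psi$ is a.s. right-continuous in the intervention times, and a) $\sup_{u\in\mathcal U}\mathbb E[|\Psi(\tau_1,\ldots;\beta_1,\ldots)|^2]<\infty$; b) for all $(\mathbf t,\mathbf b)\in\mathcal D^f$ and $b\in\mathcal I^{-b_n}$, $\sup_{u\in\mathcal U}\mathbb E[\sup_{s\in[t_n,T]}|\Psi(\mathbf t,s,\tau_1\vee s,\ldots;\mathbf b,b,\beta_1,\ldots)|^2]<\infty$. (ii) For each $(\mathbf t,\mathbf b)\in\mathcal D^f$ and $b\in\mathcal I^{-b_n}$, $\Psi(\mathbf t;\mathbf b)>\Psi(\mathbf t,T;\mathbf b,b)-c_{b_n,b}(T)$ a.s. (iii) $c_{b,b'}\in\mathcal S^2_{qlc}$ for all $(b,b')\in\bar{\mathcal I}^2$ and: a) $c_{b,b'}\ge0$ a.s.; b) there is $\epsilon>0$ such that for each $0\le t_1\le\cdots\le t_n\le T$ and $b_1,\ldots,b_n$ with $b_1\in\mathcal I^{-b_n}$, $b_j\in\mathcal I^{-b_{j-1}}$ ($j=2,\ldots,n$), $c_{b_1,b_2}(t_1)+\cdots+c_{b_n,b_1}(t_n)\ge\epsilon$ a.s. **Value processes.** For $(\mathbf t,\mathbf b)\in\mathcal D^f$, $u\in\mathcal U$ and $\beta_0:=b_n$, $$V^{\mathbf t;\mathbf b,u}_s:=\mathbb E\Big[\Psi(\mathbf t,t_n\vee s\vee\tau_1,\ldots,t_n\vee s\vee\tau_N;\mathbf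 b,\beta_1,\ldots,\beta_N)-\sum_{j=1}^Nc_{\beta_{j-1},\beta_j}(t_n\vee s\vee\tau_j)\Big|\mathcal F_s\Big].$$ **Random indices.** For stopping times $\eta_1\le\cdots\le\eta_n$ and modes $\beta_j$ ($\mathcal F_{\eta_j}$-measurable), $V^{\eta;\beta,u}$ is defined by the same formula with $(\eta;\beta)$ in place of $(\mathbf t;\mathbf b)$; for a family $(Y^{\mathbf t;\mathbf b})$, $Y^{\eta;\beta}_s$ is the family evaluated at the random index if $s\ge\eta_n$, and in general $Y^{\eta;\beta}_s:=\mathbb E[Y^{\mathbf t;\mathbf b}_{s\vee t_n}|_{(\mathbf t;\mathbf b)=(\eta;\beta)}\,|\,\mathcal F_s]$. **Standing assumption 2.** (i) For each $n\ge0$, $(\eta,\mathbf b)\in\bar{\mathcal T}^n\times\bar{\mathcal I}^n$ and $b\in\mathcal I^{-b_n}$ there is a sequence of maps $(\mathcal U\to\mathcal U:u\mapsto\hat u^l)_{l\ge0}$ such that $$\lim_{l\to\infty}\sup_{u\in\mathcal U}\mathbb E\Big[\sup_{s\in[0,T]}\big|(V^{\eta;\mathbf b,u}_s-V^{\Gamma^l(\eta);\mathbf b,\hat u^l}_s)^++(V^{\eta,s\vee\eta_n;\mathbf b,b,u}_s-V^{\Gamma^l(\eta),s\vee\Gamma^l(\eta_n);\mathbf b,b,\hat u^l}_s)^+\big|^2\Big]=0,$$ and furthermore $$\lim_{l\to\infty}\sup_{u\in\mathcal U_{\Gamma^l(\eta_n)}}\mathbb E\Big[\sup_{s\in[0,T]}\big|(V^{\Gamma^l(\eta);\mathbf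 b,u}_s-V^{\eta;\mathbf b,u}_s)^++(V^{\Gamma^l(\eta),s\vee\Gamma^l(\eta_n);\mathbf b,b,u}_s-V^{\eta,s\vee\eta_n;\mathbf b,b,u}_s)^+\big|^2\Big]=0.$$ (ii) For all $(\mathbf t,\mathbf b)\in\mathcal D^f$, $b\in\mathcal I^{-b_n}$ and $k=0,1,\ldots$, the process $(\operatorname{ess\,sup}_{u\in\mathcal U^k}V^{\mathbf t,s\vee t_n;\mathbf b,b,u}_s:0\le s\le T)$ is in $\mathcal S^2_{qlc}$. **Verification family.** A family of càdlàg supermartingales $((Y^{\mathbf t;\mathbf b}_s)_{0\le s\le T}:(\mathbf t,\mathbf b)\in\mathcal D^f)$ such that: a) $Y^{\mathbf t;\mathbf b}_s=\operatorname{ess\,sup}_{\tau\in\mathcal T_{s\vee t_n}}\mathbb E\big[\mathbf 1_{[\tau\ge T]}\Psi(\mathbf t;\mathbf b)+\mathbf 1_{[\tau<T]}\max_{\beta\in\mathcal I^{-b_n}}\{-c_{b_n,\beta}(\tau)+Y^{\mathbf t,\tau;\mathbf b,\beta}_\tau\}\big|\mathcal F_s\big]$; b) $\sup_{u\in\mathcal U^f}\mathbb E[\sup_{s\in[0,T]}|Y^{\tau_1,\ldots,\tau_N;\beta_1,\ldots,\beta_N}_s|^2]<\infty$; c) for all $n\ge1$, $\mathbf b\in\bar{\mathcal I}^n$, $\eta\in\bar{\mathcal T}^n$: $\lim_{l\to\infty}\mathbb E[\sup_{s\in[0,T]}|Y^{\Gamma^l(\eta);\mathbf b}_s-Y^{\eta;\mathbf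 b}_s|^2]=0$, and for all $b\in\mathcal I^{-b_n}$, $\lim_{l\to\infty}\mathbb E[\sup_{s\in[0,T]}|Y^{\Gamma^l(\eta),s\vee\Gamma^l(\eta_n);\mathbf b,b}_s-Y^{\eta,s\vee\eta_n;\mathbf b,b}_s|^2]=0$; d) for every $(\mathbf t,\mathbf b)\in\mathcal D^f$ and $b\in\mathcal I^{-b_n}$, the process $(Y^{\mathbf t,s\vee t_n;\mathbf b,b}_s:0\le s\le T)$ is in $\mathcal S^2_{qlc}$.
   Formalization: In (i), Y_0 is F_0-measurable and may be random, as F_0 is not assumed trivial; what is proved is E[Y_0] = sup_u J(u) in general, and Y_0 = sup_u J(u) a.s. when F_0 is P-trivial. Also m ≥ 2 is assumed, so that the maxima are over nonempty sets. *)

theory Defs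
  imports "HOL-Probability.Probability"
begin

section \<open>Switching plans\<close>

text \<open>
  A finite or infinite sequence \<open>(t\<^sub>1,t\<^sub>2,\<dots>;b\<^sub>1,b\<^sub>2,\<dots>)\<close> is a function on \<open>nat\<close>: entry \<open>i\<close> is
  \<open>Some (t\<^sub>i\<^sub>+\<^sub>1, b\<^sub>i\<^sub>+\<^sub>1)\<close> as long as \<open>i\<close> is below the length, and \<open>None\<close> from there on.
  Finite sequences also occur as lists.
\<close>

type_synonym plan = "nat \<Rightarrow> (real \<times> nat) option"
type_synonym history = "(real \<times> nat) list"
type_synonym 'a control = "'a \<Rightarrow> plan"

abbreviation alternatives :: "nat \<Rightarrow> nat \<Rightarrow> nat set" where
  "alternatives m b \<equiv> {1..m} - {b}"

definition prev_mode :: "nat \<Rightarrow> plan \<Rightarrow> nat \<Rightarrow> nat" where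
  "prev_mode b d i = (case i of 0 \<Rightarrow> b | Suc k \<Rightarrow> snd (the (d k)))"

text \<open>\<open>plans T m b\<close> is the set \<open>D\<close> when \<open>b\<close> is the mode in force before the first entry,
  so the first mode of the sequence differs from \<open>b\<close>.\<close>

definition plans :: "real \<Rightarrow> nat \<Rightarrow> nat \<Rightarrow> plan set" where
  "plans T m b = {d. \<forall>i. case d i of
       None \<Rightarrow> d (Suc i) = None
     | Some (t, b') \<Rightarrow> t \<in> {0..T} \<and> b' \<in> alternatives m (prev_mode b d i) \<and>
         (\<forall>k<i. d k \<noteq> None \<and> fst (the (d k)) \<le> t)}"

definition append_plan :: "history \<Rightarrow> plan \<Rightarrow> plan" where
  "append_plan h d = (\<lambda>i. if i < length h then Some (h ! i) else d (i - length h))"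

definition plan_of :: "history \<Rightarrow> plan" where
  "plan_of h = append_plan h (\<lambda>_. None)"

text \<open>Inverse of \<^const>\<open>plan_of\<close>; only meaningful for finite plans.\<close>

definition history_of :: "plan \<Rightarrow> history" where
  "history_of d = map (\<lambda>i. the (d i)) [0..<(LEAST i. d i = None)]"

definition delay :: "real \<Rightarrow> plan \<Rightarrow> plan" where
  "delay s d = (\<lambda>i. map_option (\<lambda>(t, b). (max s t, b)) (d i))"

text \<open>The Borel sets of \<open>D\<close>: since the length of a plan is read off from the positions of \<open>None\<close>,
  the trace of the product \<open>\<sigma>\<close>-algebra is the Borel \<open>\<sigma>\<close>-algebra of the disjoint union, over the
  lengths \<open>n \<le> \<infinity>\<close>, of the sets of plans of length \<open>n\<close> with their product topologies.\<close>

definition step_borel :: "(real \<times> nat) option measure" where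
  "step_borel = sigma UNIV {A. Some -` A \<in> sets borel}"

definition plan_space :: "real \<Rightarrow> nat \<Rightarrow> nat \<Rightarrow> plan measure" where
  "plan_space T m b = restrict_space (Pi\<^sub>M UNIV (\<lambda>_::nat. step_borel)) (plans T m b)"

text \<open>\<open>D k\<close> has the same length and modes as \<open>d\<close>, and its times decrease to those of \<open>d\<close>
  in the sense that they converge and are never smaller.\<close>

definition converges_from_right :: "(nat \<Rightarrow> plan) \<Rightarrow> plan \<Rightarrow> bool" where
  "converges_from_right D d \<longleftrightarrow>
     (\<forall>k i. rel_option (\<lambda>(t, b) (t', b'). t \<le> t' \<and> b = b') (d i) (D k i)) \<and>
     (\<forall>i. d i \<noteq> None \<longrightarrow> (\<lambda>k. fst (the (D k i))) \<longlonglongrightarrow> fst (the (d i)))"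

definition grid :: "real \<Rightarrow> nat \<Rightarrow> real set" where
  "grid T l = {real k * T / 2 ^ l | k. k \<le> 2 ^ l}"

definition grid_up :: "real \<Rightarrow> nat \<Rightarrow> real \<Rightarrow> real" where
  "grid_up T l t = Inf {s \<in> grid T l. t \<le> s}"


section \<open>Essential suprema and extended differences\<close>

definition is_ess_sup ::
  "'a measure \<Rightarrow> ('a \<Rightarrow> 'b::linorder_topology) set \<Rightarrow> ('a \<Rightarrow> 'b) \<Rightarrow> bool" where
  "is_ess_sup M S Z \<longleftrightarrow> Z \<in> borel_measurable M \<and>
     (\<forall>X\<in>S. AE \<omega> in M. X \<omega> \<le> Z \<omega>) \<and>
     (\<forall>Z'\<in>borel_measurable M. (\<forall>X\<in>S. AE \<omega> in M. X \<omega> \<le> Z' \<omega>) \<longrightarrow> (AE \<omega> in M. Z \<omega> \<le> Z' \<omega>))"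

text \<open>A version of the essential supremum, which always exists for values in \<open>[0,\<infinity>]\<close>.\<close>

definition ess_sup :: "'a measure \<Rightarrow> ('a \<Rightarrow> ennreal) set \<Rightarrow> 'a \<Rightarrow> ennreal" where
  "ess_sup M S = (SOME Z. is_ess_sup M S Z)"

text \<open>\<open>(x - y)\<^sup>+\<close>, read as \<open>0\<close> if \<open>x = y = -\<infinity>\<close> (in \<^typ>\<open>ereal\<close>, \<open>-\<infinity> - (-\<infinity>) = \<infinity>\<close>).\<close>

definition pos_diff :: "ereal \<Rightarrow> ereal \<Rightarrow> ennreal" where
  "pos_diff x y = (if x \<le> y then 0 else e2ennreal (x - y))"


section \<open>Filtered probability space\<close>

definition cadlag_on :: "real \<Rightarrow> (real \<Rightarrow> real) \<Rightarrow> bool" where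
  "cadlag_on T f \<longleftrightarrow> (\<forall>t\<in>{0..<T}. (f \<longlongrightarrow> f t) (at_right t)) \<and>
                      (\<forall>t\<in>{0<..T}. \<exists>l. (f \<longlongrightarrow> l) (at_left t))"

text \<open>The filtration is indexed by all reals in order to use the library's \<^locale>\<open>filtration\<close>;
  only its values on \<open>[0,T]\<close> matter, and every filtration on \<open>[0,T]\<close> extends (constantly).
  Processes are functions of time and then of \<open>\<omega>\<close>.\<close>

locale usual_basis = prob_space M + filtration "space M" F
  for M :: "'a measure" and F :: "real \<Rightarrow> 'a measure" +
  fixes T :: real
  assumes T_pos: "0 < T"
    and subalgebra_F: "subalgebra M (F t)"
    and F_complete: "A \<in> null_sets M \<Longrightarrow> B \<subseteq> A \<Longrightarrow> B \<in> sets (F 0)"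
    and F_right_continuous: "t \<in> {0..<T} \<Longrightarrow> sets (F t) = (\<Inter>s\<in>{t<..T}. sets (F s))"
begin

definition stopping_times :: "('a \<Rightarrow> real) set" where
  "stopping_times = {\<tau>. stopping_time F \<tau> \<and> (\<forall>\<omega>\<in>space M. \<tau> \<omega> \<in> {0..T})}"

definition stopping_times_from :: "('a \<Rightarrow> real) \<Rightarrow> ('a \<Rightarrow> real) set" where
  "stopping_times_from \<gamma> = {\<tau> \<in> stopping_times. AE \<omega> in M. \<gamma> \<omega> \<le> \<tau> \<omega>}"

definition announces :: "(nat \<Rightarrow> 'a \<Rightarrow> real) \<Rightarrow> ('a \<Rightarrow> real) \<Rightarrow> bool" where
  "announces \<gamma>s \<gamma> \<longleftrightarrow> range \<gamma>s \<subseteq> stopping_times \<and>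
     (AE \<omega> in M. incseq (\<lambda>k. \<gamma>s k \<omega>) \<and> (\<lambda>k. \<gamma>s k \<omega>) \<longlonglongrightarrow> \<gamma> \<omega> \<and>
        (0 < \<gamma> \<omega> \<longrightarrow> (\<forall>k. \<gamma>s k \<omega> < \<gamma> \<omega>)))"

definition predictable_times :: "('a \<Rightarrow> real) set" where
  "predictable_times = {\<gamma> \<in> stopping_times. \<exists>\<gamma>s. announces \<gamma>s \<gamma>}"

definition strict_past :: "('a \<Rightarrow> real) \<Rightarrow> 'a measure" where
  "strict_past \<gamma> = sigma (space M)
     (sets (F 0) \<union> {A \<inter> {\<omega> \<in> space M. t < \<gamma> \<omega>} | A t. 0 \<le> t \<and> A \<in> sets (F t)})"

definition filtration_qlc :: bool where
  "filtration_qlc \<longleftrightarrow> (\<forall>\<gamma>\<in>predictable_times. sets (pre_sigma \<gamma>) = sets (strict_past \<gamma>))"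

definition progressive :: "(real \<Rightarrow> 'a \<Rightarrow> real) \<Rightarrow> bool" where
  "progressive X \<longleftrightarrow>
     (\<forall>t\<in>{0..T}. (\<lambda>(s, \<omega>). X s \<omega>) \<in> borel_measurable (restrict_space borel {0..t} \<Otimes>\<^sub>M F t))"

definition cadlag_process :: "(real \<Rightarrow> 'a \<Rightarrow> real) \<Rightarrow> bool" where
  "cadlag_process X \<longleftrightarrow> progressive X \<and> (AE \<omega> in M. cadlag_on T (\<lambda>t. X t \<omega>))"

text \<open>\<open>E[sup\<^sub>s |X\<^sub>s|\<^sup>2]\<close>\<close>

definition sup_moment2 :: "(real \<Rightarrow> 'a \<Rightarrow> real) \<Rightarrow> ennreal" where
  "sup_moment2 X = (\<integral>\<^sup>+ \<omega>. (SUP s\<in>{0..T}. ennreal (\<bar>X s \<omega>\<bar>\<^sup>2)) \<partial>M)"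

definition S2 :: "(real \<Rightarrow> 'a \<Rightarrow> real) set" where
  "S2 = {X. cadlag_process X \<and> sup_moment2 X < \<infinity>}"

definition process_qlc :: "(real \<Rightarrow> 'a \<Rightarrow> real) \<Rightarrow> bool" where
  "process_qlc X \<longleftrightarrow> (\<forall>\<gamma>\<in>predictable_times. \<forall>\<gamma>s. announces \<gamma>s \<gamma> \<longrightarrow>
     (AE \<omega> in M. (\<lambda>k. X (\<gamma>s k \<omega>) \<omega>) \<longlonglongrightarrow> X (\<gamma> \<omega>) \<omega>))"

definition S2_qlc :: "(real \<Rightarrow> 'a \<Rightarrow> real) set" where
  "S2_qlc = {X \<in> S2. process_qlc X}"

definition cadlag_supermartingale :: "(real \<Rightarrow> 'a \<Rightarrow> real) \<Rightarrow> bool" where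
  "cadlag_supermartingale X \<longleftrightarrow> cadlag_process X \<and> (\<forall>t\<in>{0..T}. integrable M (X t)) \<and>
     (\<forall>s t. 0 \<le> s \<and> s \<le> t \<and> t \<le> T \<longrightarrow> (AE \<omega> in M. real_cond_exp M (F s) (X t) \<omega> \<le> X s \<omega>))"

text \<open>Nondecreasing tuples of stopping times, and their values paired with a tuple of modes.\<close>

definition ordered_times :: "('a \<Rightarrow> real) list set" where
  "ordered_times = {\<eta>. set \<eta> \<subseteq> stopping_times \<and> (\<forall>\<omega>\<in>space M. sorted (map (\<lambda>\<tau>. \<tau> \<omega>) \<eta>))}"

definition random_history :: "('a \<Rightarrow> real) list \<Rightarrow> nat list \<Rightarrow> 'a \<Rightarrow> history" where
  "random_history \<eta> bs \<omega> = zip (map (\<lambda>\<tau>. \<tau> \<omega>) \<eta>) bs"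

definition discretize :: "nat \<Rightarrow> ('a \<Rightarrow> real) list \<Rightarrow> ('a \<Rightarrow> real) list" where
  "discretize l \<eta> = map (\<lambda>\<tau> \<omega>. grid_up T l (\<tau> \<omega>)) \<eta>"

end


section \<open>The switching problem\<close>

definition last_time :: "history \<Rightarrow> real" where
  "last_time h = (if h = [] then 0 else fst (last h))"

text \<open>\<open>m \<ge> 2\<close> is implicit in the maxima over the modes different from the current one.\<close>

locale switching_problem = usual_basis M F T
  for M :: "'a measure" and F :: "real \<Rightarrow> 'a measure" and T :: real +
  fixes m :: nat and b0 :: nat
    and Psi :: "'a \<Rightarrow> plan \<Rightarrow> real"
    and c :: "nat \<Rightarrow> nat \<Rightarrow> real \<Rightarrow> 'a \<Rightarrow> real"
  assumes F_qlc: filtration_qlc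
    and m_ge_2: "2 \<le> m"
    and b0_mode: "b0 \<in> {1..m}"
    and Psi_measurable: "(\<lambda>(\<omega>, d). Psi \<omega> d) \<in> borel_measurable (F T \<Otimes>\<^sub>M plan_space T m b0)"
    and c_progressive: "b \<in> {1..m} \<Longrightarrow> b' \<in> alternatives m b \<Longrightarrow> progressive (c b b')"
begin

subsection \<open>Controls and objective\<close>

definition last_mode :: "history \<Rightarrow> nat" where
  "last_mode h = (if h = [] then b0 else snd (last h))"

text \<open>The set \<open>D\<^sup>f\<close>.\<close>

definition histories :: "history set" where
  "histories = {h. plan_of h \<in> plans T m b0}"

text \<open>The mode tuples \<open>(b\<^sub>1,\<dots>,b\<^sub>n)\<close> with \<open>b\<^sub>j \<noteq> b\<^sub>j\<^sub>-\<^sub>1\<close> for \<open>j = 1,\<dots>,n\<close>.\<close>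

definition mode_tuples :: "nat list set" where
  "mode_tuples = {bs. \<forall>i<length bs. bs ! i \<in> alternatives m ((b0 # bs) ! i)}"

text \<open>Interventions that do not take place are scheduled at \<open>T\<close>; thus every \<open>\<tau>\<^sub>j\<close> is defined on
  all of \<open>\<Omega>\<close>, and \<open>N\<close> enters only through the measurability of the optional mode
  (an intervention at \<open>T\<close> may or may not take place, depending on an event in \<open>F\<^sub>T\<close>).\<close>

definition intervention_time :: "'a control \<Rightarrow> nat \<Rightarrow> 'a \<Rightarrow> real" where
  "intervention_time u i \<omega> = (case u \<omega> i of None \<Rightarrow> T | Some (t, b) \<Rightarrow> t)"

definition intervention_mode :: "'a control \<Rightarrow> nat \<Rightarrow> 'a \<Rightarrow> nat option" where
  "intervention_mode u i \<omega> = map_option snd (u \<omega> i)"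

text \<open>Controls with \<open>\<beta>\<^sub>0 = b\<close>. The controls of the problem are those with \<open>b = b\<^sub>0\<close>; the
  others are the ones that may be appended to a history ending in mode \<open>b\<close>.\<close>

definition controls :: "nat \<Rightarrow> 'a control set" where
  "controls b = {u. (\<forall>\<omega>\<in>space M. u \<omega> \<in> plans T m b) \<and>
     (\<forall>i. intervention_time u i \<in> stopping_times \<and>
          intervention_mode u i \<in> measurable (pre_sigma (intervention_time u i)) (count_space UNIV)) \<and>
     (AE \<omega> in M. (\<lambda>i. intervention_time u i \<omega>) \<longlonglongrightarrow> T)}"

definition controls_finite :: "nat \<Rightarrow> 'a control set" where
  "controls_finite b = {u \<in> controls b. AE \<omega> in M. \<exists>i. u \<omega> i = None}"

definition controls_le :: "nat \<Rightarrow> nat \<Rightarrow> 'a control set" where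
  "controls_le b k = {u \<in> controls b. AE \<omega> in M. u \<omega> k = None}"

definition controls_from :: "nat \<Rightarrow> ('a \<Rightarrow> real) \<Rightarrow> 'a control set" where
  "controls_from b \<gamma> = {u \<in> controls b. intervention_time u 0 \<in> stopping_times_from \<gamma>}"

text \<open>The switching costs may add up to \<open>\<infinity>\<close>; as they are nonnegative almost surely, they are summed
  and integrated in \<open>[0,\<infinity>]\<close>, so that the objective and the value processes
  take values in \<open>[-\<infinity>,\<infinity>)\<close>.\<close>

definition plan_cost :: "nat \<Rightarrow> plan \<Rightarrow> 'a \<Rightarrow> ennreal" where
  "plan_cost b d \<omega> = (\<Sum>i. case d i of None \<Rightarrow> 0
                                   | Some (t, b') \<Rightarrow> ennreal (c (prev_mode b d i) b' t \<omega>))"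

definition J :: "'a control \<Rightarrow> ereal" where
  "J u = ereal (\<integral>\<omega>. Psi \<omega> (u \<omega>) \<partial>M) - enn2ereal (\<integral>\<^sup>+ \<omega>. plan_cost b0 (u \<omega>) \<omega> \<partial>M)"

text \<open>\<open>V\<^sub>s\<close> for the (possibly random) history \<open>h\<close> and the control \<open>u\<close>.\<close>

definition V :: "('a \<Rightarrow> history) \<Rightarrow> 'a control \<Rightarrow> real \<Rightarrow> 'a \<Rightarrow> ereal" where
  "V h u s =
     (let d = (\<lambda>\<omega>. delay (max (last_time (h \<omega>)) s) (u \<omega>)) in
      (\<lambda>\<omega>. ereal (real_cond_exp M (F s) (\<lambda>\<omega>. Psi \<omega> (append_plan (h \<omega>) (d \<omega>))) \<omega>)
         - enn2ereal (nn_cond_exp M (F s) (\<lambda>\<omega>. plan_cost (last_mode (h \<omega>)) (d \<omega>) \<omega>) \<omega>)))"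

text \<open>The history \<open>(\<eta>, s \<or> \<eta>\<^sub>n; b, b')\<close>.\<close>

definition extend :: "('a \<Rightarrow> history) \<Rightarrow> nat \<Rightarrow> real \<Rightarrow> 'a \<Rightarrow> history" where
  "extend h b s \<omega> = h \<omega> @ [(max s (last_time (h \<omega>)), b)]"


subsection \<open>Standing assumptions\<close>

definition Psi_right_continuous :: bool where
  "Psi_right_continuous \<longleftrightarrow> (AE \<omega> in M. \<forall>d\<in>plans T m b0. \<forall>D. range D \<subseteq> plans T m b0 \<longrightarrow>
     converges_from_right D d \<longrightarrow> (\<lambda>k. Psi \<omega> (D k)) \<longlonglongrightarrow> Psi \<omega> d)"

definition Psi_bounded :: bool where
  "Psi_bounded \<longleftrightarrow>
     (SUP u\<in>controls b0. \<integral>\<^sup>+ \<omega>. ennreal (\<bar>Psi \<omega> (u \<omega>)\<bar>\<^sup>2) \<partial>M) < \<infinity> \<and>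
     (\<forall>h\<in>histories. \<forall>b\<in>alternatives m (last_mode h).
        (SUP u\<in>controls b. \<integral>\<^sup>+ \<omega>. (SUP s\<in>{last_time h..T}.
            ennreal (\<bar>Psi \<omega> (append_plan (h @ [(s, b)]) (delay s (u \<omega>)))\<bar>\<^sup>2)) \<partial>M) < \<infinity>)"

definition no_switch_at_T :: bool where
  "no_switch_at_T \<longleftrightarrow> (\<forall>h\<in>histories. \<forall>b\<in>alternatives m (last_mode h).
     AE \<omega> in M. Psi \<omega> (plan_of h) > Psi \<omega> (plan_of (h @ [(T, b)])) - c (last_mode h) b T \<omega>)"

definition costs_nonneg :: bool where
  "costs_nonneg \<longleftrightarrow> (\<forall>b\<in>{1..m}. \<forall>b'\<in>alternatives m b. AE \<omega> in M. \<forall>t\<in>{0..T}. 0 \<le> c b b' t \<omega>)"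

definition no_free_loop :: bool where
  "no_free_loop \<longleftrightarrow> (\<exists>\<epsilon>>0. \<forall>ts bs. ts \<noteq> [] \<and> length bs = length ts \<and>
       sorted ts \<and> set ts \<subseteq> {0..T} \<and> set bs \<subseteq> {1..m} \<and>
       (\<forall>i<length bs. bs ! i \<noteq> bs ! (Suc i mod length bs)) \<longrightarrow>
     (AE \<omega> in M. (\<Sum>i<length ts. c (bs ! i) (bs ! (Suc i mod length bs)) (ts ! i) \<omega>) \<ge> \<epsilon>))"

definition standing_assumption_1 :: bool where
  "standing_assumption_1 \<longleftrightarrow> Psi_right_continuous \<and> Psi_bounded \<and> no_switch_at_T \<and>
     (\<forall>b\<in>{1..m}. \<forall>b'\<in>alternatives m b. c b b' \<in> S2_qlc) \<and> costs_nonneg \<and> no_free_loop"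

text \<open>\<open>E[sup\<^sub>s |(V\<^sub>s(h;u) - V\<^sub>s(h';u'))\<^sup>+ + (V\<^sub>s(h,s;b,w) - V\<^sub>s(h',s;b,w'))\<^sup>+|\<^sup>2]\<close>, where
  \<open>u, u'\<close> continue after the last mode of \<open>h\<close> and \<open>w, w'\<close> after \<open>b\<close>.  Each \<open>V\<^sub>s\<close> is
  a conditional expectation and so given only up to a null set depending on \<open>s\<close>, and for infinite
  costs no right-continuous version need exist; the supremum over \<open>s\<close> is therefore the essential
  one, which does not depend on versions and is the pathwise supremum of right-continuous
  versions whenever these exist.\<close>

definition V_excess ::
  "nat \<Rightarrow> ('a \<Rightarrow> history) \<Rightarrow> ('a \<Rightarrow> history) \<Rightarrow>
    'a control \<Rightarrow> 'a control \<Rightarrow> 'a control \<Rightarrow> 'a control \<Rightarrow> ennreal" where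
  "V_excess b h h' u u' w w' =
     (\<integral>\<^sup>+ \<omega>. ess_sup M ((\<lambda>s \<omega>. (pos_diff (V h u s \<omega>) (V h' u' s \<omega>) +
                pos_diff (V (extend h b s) w s \<omega>) (V (extend h' b s) w' s \<omega>))\<^sup>2) ` {0..T}) \<omega> \<partial>M)"

text \<open>The controls appended to \<open>(\<eta>;b)\<close> and to \<open>(\<eta>,s;b,b')\<close> start from different modes, so the
  supremum runs over one control of each kind.\<close>

definition V_discretizable :: bool where
  "V_discretizable \<longleftrightarrow>
     (\<forall>\<eta>\<in>ordered_times. \<forall>bs\<in>mode_tuples. length bs = length \<eta> \<longrightarrow>
      (\<forall>b\<in>alternatives m (last (b0 # bs)).
       let h = random_history \<eta> bs; hl = (\<lambda>l. random_history (discretize l \<eta>) bs);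
           a = last (b0 # bs) in
       \<exists>hat :: nat \<Rightarrow> 'a control \<Rightarrow> 'a control.
         (\<forall>l. \<forall>e\<in>{a, b}. hat l ` controls e \<subseteq> controls e) \<and>
         (\<lambda>l. SUP u\<in>controls a. SUP w\<in>controls b.
                V_excess b h (hl l) u (hat l u) w (hat l w)) \<longlonglongrightarrow> 0 \<and>
         (\<lambda>l. SUP u\<in>controls_from a (\<lambda>\<omega>. last_time (hl l \<omega>)).
              SUP w\<in>controls_from b (\<lambda>\<omega>. last_time (hl l \<omega>)).
                V_excess b (hl l) h u u w w) \<longlonglongrightarrow> 0))"

definition V_regular :: bool where
  "V_regular \<longleftrightarrow> (\<forall>h\<in>histories. \<forall>b\<in>alternatives m (last_mode h). \<forall>k.
     \<exists>Z\<in>S2_qlc. \<forall>s\<in>{0..T}.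
       is_ess_sup M {V (extend (\<lambda>_. h) b s) u s | u. u \<in> controls_le b k} (\<lambda>\<omega>. ereal (Z s \<omega>)))"

definition standing_assumption_2 :: bool where
  "standing_assumption_2 \<longleftrightarrow> V_discretizable \<and> V_regular"


subsection \<open>Verification families\<close>

definition switch_value :: "(history \<Rightarrow> real \<Rightarrow> 'a \<Rightarrow> real) \<Rightarrow> history \<Rightarrow> real \<Rightarrow> 'a \<Rightarrow> nat \<Rightarrow> real" where
  "switch_value Y h s \<omega> b = - c (last_mode h) b s \<omega> + Y (h @ [(s, b)]) s \<omega>"

definition best_switch_value :: "(history \<Rightarrow> real \<Rightarrow> 'a \<Rightarrow> real) \<Rightarrow> history \<Rightarrow> real \<Rightarrow> 'a \<Rightarrow> real" where
  "best_switch_value Y h s \<omega> = Max (switch_value Y h s \<omega> ` alternatives m (last_mode h))"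

text \<open>\<open>Z\<close> is the process \<open>Y\<close> at the random index \<open>h\<close> (which may depend on \<open>s\<close>, as in
  \<open>Y\<^sub>s(\<eta>, s \<or> \<eta>\<^sub>n; b, b')\<close>): a cadlag version of the conditional expectations
  \<open>E[Y\<^sub>s\<^sub>\<or>\<^sub>t(t;b) at (t;b) = h | F\<^sub>s]\<close>, with \<open>t\<close> the last time of the index, which from
  time \<open>\<gamma>\<close> on coincides with the family evaluated at the random index.\<close>

definition at_random_index ::
  "(history \<Rightarrow> real \<Rightarrow> 'a \<Rightarrow> real) \<Rightarrow> (real \<Rightarrow> 'a \<Rightarrow> history) \<Rightarrow> ('a \<Rightarrow> real) \<Rightarrow>
    (real \<Rightarrow> 'a \<Rightarrow> real) \<Rightarrow> bool" where
  "at_random_index Y h \<gamma> Z \<longleftrightarrow> cadlag_process Z \<and>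
     (\<forall>s\<in>{0..T}. let X = (\<lambda>\<omega>. Y (h s \<omega>) (max s (last_time (h s \<omega>))) \<omega>) in
        integrable M X \<and> (AE \<omega> in M. Z s \<omega> = real_cond_exp M (F s) X \<omega>)) \<and>
     (AE \<omega> in M. \<forall>s\<in>{\<gamma> \<omega>..T}. Z s \<omega> = Y (h s \<omega>) s \<omega>)"

definition snell_property :: "(history \<Rightarrow> real \<Rightarrow> 'a \<Rightarrow> real) \<Rightarrow> bool" where
  "snell_property Y \<longleftrightarrow> (\<forall>h\<in>histories. \<forall>s\<in>{0..T}.
     is_ess_sup M
       {real_cond_exp M (F s)
          (\<lambda>\<omega>. if \<tau> \<omega> \<ge> T then Psi \<omega> (plan_of h) else best_switch_value Y h (\<tau> \<omega>) \<omega>)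
        | \<tau>. \<tau> \<in> stopping_times_from (\<lambda>_. max s (last_time h))}
       (Y h s))"

text \<open>The number of interventions of a control is in general known only at time \<open>T\<close>, so only there is
  the process the family evaluated at the random index.\<close>

definition family_bounded :: "(history \<Rightarrow> real \<Rightarrow> 'a \<Rightarrow> real) \<Rightarrow> bool" where
  "family_bounded Y \<longleftrightarrow> (\<exists>Z.
     (\<forall>u\<in>controls_finite b0. at_random_index Y (\<lambda>s \<omega>. history_of (u \<omega>)) (\<lambda>_. T) (Z u)) \<and>
     (SUP u\<in>controls_finite b0. sup_moment2 (Z u)) < \<infinity>)"

definition L2_approximable ::
  "(history \<Rightarrow> real \<Rightarrow> 'a \<Rightarrow> real) \<Rightarrow> (nat \<Rightarrow> real \<Rightarrow> 'a \<Rightarrow> history) \<Rightarrow> (nat \<Rightarrow> 'a \<Rightarrow> real) \<Rightarrow>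
    (real \<Rightarrow> 'a \<Rightarrow> history) \<Rightarrow> ('a \<Rightarrow> real) \<Rightarrow> bool" where
  "L2_approximable Y hl \<gamma>l h \<gamma> \<longleftrightarrow> (\<exists>Zl Z.
     (\<forall>l. at_random_index Y (hl l) (\<gamma>l l) (Zl l)) \<and> at_random_index Y h \<gamma> Z \<and>
     (\<lambda>l. sup_moment2 (\<lambda>s \<omega>. Zl l s \<omega> - Z s \<omega>)) \<longlonglongrightarrow> 0)"

definition family_discretizable :: "(history \<Rightarrow> real \<Rightarrow> 'a \<Rightarrow> real) \<Rightarrow> bool" where
  "family_discretizable Y \<longleftrightarrow>
     (\<forall>\<eta>\<in>ordered_times. \<forall>bs\<in>mode_tuples. \<eta> \<noteq> [] \<and> length bs = length \<eta> \<longrightarrow>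
      (let h = random_history \<eta> bs; hl = (\<lambda>l. random_history (discretize l \<eta>) bs);
           \<gamma> = (\<lambda>\<omega>. last_time (h \<omega>)); \<gamma>l = (\<lambda>l \<omega>. last_time (hl l \<omega>)) in
       L2_approximable Y (\<lambda>l s. hl l) \<gamma>l (\<lambda>s. h) \<gamma> \<and>
       (\<forall>b\<in>alternatives m (last bs). L2_approximable Y (\<lambda>l. extend (hl l) b) \<gamma>l (extend h b) \<gamma>)))"

definition family_regular :: "(history \<Rightarrow> real \<Rightarrow> 'a \<Rightarrow> real) \<Rightarrow> bool" where
  "family_regular Y \<longleftrightarrow> (\<forall>h\<in>histories. \<forall>b\<in>alternatives m (last_mode h).
     (\<lambda>s. Y (h @ [(max s (last_time h), b)]) s) \<in> S2_qlc)"

definition verification_family :: "(history \<Rightarrow> real \<Rightarrow> 'a \<Rightarrow> real) \<Rightarrow> bool" where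
  "verification_family Y \<longleftrightarrow> (\<forall>h\<in>histories. cadlag_supermartingale (Y h)) \<and>
     snell_property Y \<and> family_bounded Y \<and> family_discretizable Y \<and> family_regular Y"

definition indistinguishable_families ::
  "(history \<Rightarrow> real \<Rightarrow> 'a \<Rightarrow> real) \<Rightarrow> (history \<Rightarrow> real \<Rightarrow> 'a \<Rightarrow> real) \<Rightarrow> bool" where
  "indistinguishable_families Y Y' \<longleftrightarrow>
     (\<forall>h\<in>histories. AE \<omega> in M. \<forall>s\<in>{0..T}. Y h s \<omega> = Y' h s \<omega>)"


subsection \<open>The control defined by a family\<close>

definition rule_history :: "(nat \<Rightarrow> 'a \<Rightarrow> real) \<Rightarrow> (nat \<Rightarrow> 'a \<Rightarrow> nat) \<Rightarrow> nat \<Rightarrow> 'a \<Rightarrow> history" where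
  "rule_history tau beta j \<omega> = map (\<lambda>i. (tau i \<omega>, beta i \<omega>)) [1..<Suc j]"

text \<open>\<open>inf A \<and> T\<close> is written as the infimum of \<open>A \<union> {T}\<close> because \<open>Inf {}\<close> is unspecified on the reals.\<close>

definition switching_rule ::
  "(history \<Rightarrow> real \<Rightarrow> 'a \<Rightarrow> real) \<Rightarrow> (nat \<Rightarrow> 'a \<Rightarrow> real) \<Rightarrow> (nat \<Rightarrow> 'a \<Rightarrow> nat) \<Rightarrow> bool" where
  "switching_rule Y tau beta \<longleftrightarrow>
     (\<forall>\<omega>\<in>space M. tau 0 \<omega> = 0 \<and> beta 0 \<omega> = b0 \<and>
       (\<forall>j. let h = rule_history tau beta j \<omega> in
         tau (Suc j) \<omega> = Inf (insert T {s \<in> {tau j \<omega>..T}. Y h s \<omega> = best_switch_value Y h s \<omega>}) \<and>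
         (tau (Suc j) \<omega> < T \<longrightarrow>
            is_arg_max (switch_value Y h (tau (Suc j) \<omega>) \<omega>)
              (\<lambda>b. b \<in> alternatives m (last_mode h)) (beta (Suc j) \<omega>)))) \<and>
     (\<forall>j. beta (Suc j) \<in> measurable (pre_sigma (tau (Suc j))) (count_space UNIV))"

text \<open>Truncation at \<open>N = max {j. \<tau>\<^sub>j < T}\<close>.\<close>

definition rule_control :: "(nat \<Rightarrow> 'a \<Rightarrow> real) \<Rightarrow> (nat \<Rightarrow> 'a \<Rightarrow> nat) \<Rightarrow> 'a control" where
  "rule_control tau beta \<omega> i =
     (if tau (Suc i) \<omega> < T then Some (tau (Suc i) \<omega>, beta (Suc i) \<omega>) else None)"

end

end

theory Submission
  imports Defs
begin

text \<open>
  Along a history whose last time is a stopping time, the family is a Snell envelope from that time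
  on: this is the definition for deterministic histories, passes to histories with times on a grid
  by mixing over their finitely many values, and to all histories by the discretization property.
  Quasi-left continuity then makes the first time at which the envelope meets its obstacle optimal.
  Following any control, optional sampling shows that the current value of the family, minus the
  costs paid so far, decreases in mean and dominates the payoff; following the rule, it stays
  constant, and the moment bound on the family bounds the expected costs.  Since every \<open>m\<close>
  transitions contain a loop, whose cost is at least \<open>\<epsilon>\<close>, finite costs force finitely many
  interventions.  Hence the family at any stopping time is the payoff of its own rule, which bounds
  every other family from below; so the obstacles of two families agree at stopping times, and so
  do their essential suprema.
\<close>

section \<open>Time grids and cadlag processes\<close>

text \<open>Each property of the family holds only outside a null set that depends on the history,
  and histories form an uncountable set; evaluating \<open>Y\<close> at a random history therefore
  says nothing by itself. Hence facts about \<open>Y\<close> along a control are moved to a single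
  cadlag process that agrees with \<open>Y\<close> from a random time on. Conditional expectations
  and essential suprema behave badly under such a change of index, so the envelope property is
  restated through integrals over events and through nearly optimal stopping times, both of which
  survive finite mixtures and limits. A second obstacle is that the rule is not known beforehand to
  stop, while \<open>Y\<close> is bounded only along controls with finitely many interventions.
  Estimates are therefore made for the rule cut off after \<open>k\<close> interventions, with
  constants free of \<open>k\<close>, and finiteness of \<open>N\<close> comes out of bounded
  expected costs. Uniqueness needs the rule started after arbitrary earlier interventions, which is
  why rules and optimality carry the index \<open>n\<close> of the first free stage.\<close>

lemma finite_grid: "finite (grid T l)"
proof -
  have "grid T l = (\<lambda>k. real k * T / 2 ^ l) ` {..2 ^ l}"
    by (auto simp: grid_def)
  then show ?thesis by simp
qed

lemma grid_subset: "0 < T \<Longrightarrow> grid T l \<subseteq> {0..T}"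
proof
  fix x assume T: "0 < T" and "x \<in> grid T l"
  then obtain k where k: "x = real k * T / 2 ^ l" "k \<le> 2 ^ l" by (auto simp: grid_def)
  have "real k \<le> real (2 ^ l)" using k(2) by (simp only: of_nat_le_iff)
  then have "real k * T \<le> T * 2 ^ l" using T by (simp add: mult.commute)
  then have "x \<le> T" unfolding k(1) by (subst pos_divide_le_eq) auto
  moreover have "0 \<le> x" unfolding k(1) using T by simp
  ultimately show "x \<in> {0..T}" by simp
qed

lemma grid_T: "T \<in> grid T l"
  unfolding grid_def by (auto intro!: exI[of _ "2 ^ l"])

lemma grid_up_Min:
  assumes "t \<le> T"
  shows "grid_up T l t = Min {s \<in> grid T l. t \<le> s}" "{s \<in> grid T l. t \<le> s} \<noteq> {}"
    "finite {s \<in> grid T l. t \<le> s}"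
proof -
  show ne: "{s \<in> grid T l. t \<le> s} \<noteq> {}" using grid_T assms by auto
  show fin: "finite {s \<in> grid T l. t \<le> s}" using finite_grid by simp
  show "grid_up T l t = Min {s \<in> grid T l. t \<le> s}"
    unfolding grid_up_def by (rule cInf_eq_Min[OF fin ne])
qed

lemma grid_up_in: "t \<le> T \<Longrightarrow> grid_up T l t \<in> grid T l"
  and grid_up_ge: "t \<le> T \<Longrightarrow> t \<le> grid_up T l t"
  using Min_in[OF grid_up_Min(3) grid_up_Min(2)] by (auto simp: grid_up_Min(1))

lemma grid_up_le: "t \<le> T \<Longrightarrow> s \<in> grid T l \<Longrightarrow> t \<le> s \<Longrightarrow> grid_up T l t \<le> s"
  by (simp add: grid_up_Min(1) finite_grid)

lemma grid_up_mono: "t \<le> t' \<Longrightarrow> t' \<le> T \<Longrightarrow> grid_up T l t \<le> grid_up T l t'"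
  using grid_up_in grid_up_ge grid_up_le by (meson order_trans)

lemma grid_up_range: "0 < T \<Longrightarrow> t \<le> T \<Longrightarrow> grid_up T l t \<in> {0..T}"
  using grid_up_in grid_subset by blast

lemma grid_up_upper:
  assumes "0 < T" "0 \<le> t" "t \<le> T"
  shows "grid_up T l t \<le> t + T / 2 ^ l"
proof -
  define k where "k = nat \<lceil>t * 2 ^ l / T\<rceil>"
  have k1: "t * 2 ^ l / T \<le> real k" unfolding k_def using assms by (simp add: real_nat_ceiling_ge)
  have "t * 2 ^ l / T \<ge> 0" using assms by simp
  then have k2: "real k \<le> t * 2 ^ l / T + 1" unfolding k_def by linarith
  have "t * 2 ^ l / T \<le> 2 ^ l" using assms by (simp add: divide_simps mult.commute)
  then have "\<lceil>t * 2 ^ l / T\<rceil> \<le> 2 ^ l" by (simp add: ceiling_le_iff)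
  then have "k \<le> 2 ^ l" unfolding k_def by (simp add: nat_le_iff)
  then have "real k * T / 2 ^ l \<in> grid T l" by (auto simp: grid_def)
  moreover have "t \<le> real k * T / 2 ^ l" using k1 assms by (simp add: divide_simps)
  ultimately have "grid_up T l t \<le> real k * T / 2 ^ l" using assms grid_up_le by blast
  also have "\<dots> \<le> (t * 2 ^ l / T + 1) * T / 2 ^ l" using k2 assms by (intro divide_right_mono mult_right_mono) auto
  also have "\<dots> = t + T / 2 ^ l" using assms by (simp add: field_simps)
  finally show ?thesis .
qed

lemma grid_up_tendsto:
  assumes "0 < T" "0 \<le> t" "t \<le> T"
  shows "(\<lambda>l. grid_up T l t) \<longlonglongrightarrow> t"
proof (rule tendsto_sandwich[where f="\<lambda>_. t" and h="\<lambda>l. t + T / 2 ^ l"])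
  have "(\<lambda>l. t + T * (1/2) ^ l) \<longlonglongrightarrow> t + T * 0"
    by (intro tendsto_intros LIMSEQ_power_zero) auto
  then show "(\<lambda>l. t + T / 2 ^ l) \<longlonglongrightarrow> t" by (simp add: power_divide)
qed (use assms grid_up_upper grid_up_ge in auto)

text \<open>Statements about all times are reduced to countably many null sets through such a
  sequence; strictness on both sides keeps it away from \<open>t\<close> and from
  \<open>T\<close>.\<close>

lemma rat_right_sequence:
  fixes t T :: real
  assumes "t < T"
  obtains q where "\<And>n. q n \<in> \<rat>" "\<And>n. t < q n" "\<And>n. q n < T" "q \<longlonglongrightarrow> t"
proof -
  have "\<exists>q\<in>\<rat>. t < q \<and> q < min T (t + 1 / Suc n)" for n
    using Rats_dense_in_real[of t "min T (t + 1 / Suc n)"] assms by auto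
  then obtain q where q: "\<And>n. q n \<in> \<rat>" "\<And>n. t < q n" "\<And>n. q n < min T (t + 1 / Suc n)" by metis
  have "q \<longlonglongrightarrow> t"
  proof (rule tendsto_sandwich[where f="\<lambda>_. t" and h="\<lambda>n. t + 1 / Suc n"])
    show "(\<lambda>n. t + 1 / real (Suc n)) \<longlonglongrightarrow> t"
      using tendsto_add[OF tendsto_const[of t] LIMSEQ_inverse_real_of_nat] by (simp add: inverse_eq_divide)
  qed (use q(2) q(3) less_imp_le in \<open>auto intro!: always_eventually simp: less_eq_real_def\<close>)
  then show ?thesis using that q by force
qed

text \<open>The sequence may return to \<open>t\<close>, so right-continuity is used relative to the
  closed half line. At \<open>t = T\<close>, where \<open>cadlag_on\<close> prescribes no right
  limit, the sequence can only be constant.\<close>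

lemma cadlag_on_right:
  assumes f: "cadlag_on T f" and t: "t \<in> {0..T}" and s: "\<And>n. s n \<in> {t..T}" "s \<longlonglongrightarrow> t"
  shows "(\<lambda>n. f (s n)) \<longlonglongrightarrow> f t"
proof (cases "t = T")
  case True
  then have "s n = T" for n using s(1)[of n] by auto
  with True show ?thesis by simp
next
  case False
  with f t have "(f \<longlongrightarrow> f t) (at_right t)" by (auto simp: cadlag_on_def)
  then have "(f \<longlongrightarrow> f t) (at t within {t..})" by (simp add: at_within_Ici_at_right)
  then have "continuous (at t within {t..}) f" by (simp add: continuous_within)
  then show ?thesis
    using s by (auto simp: continuous_within_sequentially o_def)
qed

text \<open>Rational times from the right reach every time before \<open>T\<close>. The endpoint has
  no times of the interval to its right, hence its separate hypothesis.\<close>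

lemma cadlag_on_closed:
  assumes f: "cadlag_on T f" and C: "closed C" and a: "0 \<le> a"
    and q: "\<And>q. q \<in> \<rat> \<Longrightarrow> q \<in> {a..<T} \<Longrightarrow> f q \<in> C" and T: "f T \<in> C" and t: "t \<in> {a..T}"
  shows "f t \<in> C"
proof (cases "t = T")
  case False
  with t have "t < T" by auto
  then obtain r where r: "\<And>n. r n \<in> \<rat>" "\<And>n. t < r n" "\<And>n. r n < T" "r \<longlonglongrightarrow> t"
    using rat_right_sequence by metis
  have "(\<lambda>n. f (r n)) \<longlonglongrightarrow> f t"
    using r t a by (intro cadlag_on_right[OF f]) (auto intro: less_imp_le)
  moreover have "\<forall>n. f (r n) \<in> C"
  proof
    fix n show "f (r n) \<in> C" using q[of "r n"] r(1)[of n] r(2)[of n] r(3)[of n] t by simp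
  qed
  ultimately show ?thesis by (intro Lim_in_closed_set[OF C _ sequentially_bot]) simp_all
qed (use T in simp)

lemma cadlag_on_binop:
  fixes op2 :: "real \<Rightarrow> real \<Rightarrow> real"
  assumes op2: "\<And>(F :: real filter) g h x y. (g \<longlongrightarrow> x) F \<Longrightarrow> (h \<longlongrightarrow> y) F \<Longrightarrow> ((\<lambda>t. op2 (g t) (h t)) \<longlongrightarrow> op2 x y) F"
    and "cadlag_on T f" "cadlag_on T g"
  shows "cadlag_on T (\<lambda>t. op2 (f t) (g t))"
  unfolding cadlag_on_def
proof (intro conjI ballI)
  fix t assume "t \<in> {0..<T}"
  then show "((\<lambda>t. op2 (f t) (g t)) \<longlongrightarrow> op2 (f t) (g t)) (at_right t)"
    using op2[of f "f t" "at_right t" g "g t"] assms(2,3) by (auto simp: cadlag_on_def)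
next
  fix t assume "t \<in> {0<..T}"
  then obtain l l' where "(f \<longlongrightarrow> l) (at_left t)" "(g \<longlongrightarrow> l') (at_left t)"
    using assms(2,3) unfolding cadlag_on_def by blast
  then show "\<exists>l. ((\<lambda>t. op2 (f t) (g t)) \<longlongrightarrow> l) (at_left t)" using op2 by blast
qed

lemma cadlag_on_diff: "cadlag_on T f \<Longrightarrow> cadlag_on T g \<Longrightarrow> cadlag_on T (\<lambda>t. f t - g t)"
  by (rule cadlag_on_binop) (auto intro: tendsto_diff)

lemma cadlag_on_max: "cadlag_on T f \<Longrightarrow> cadlag_on T g \<Longrightarrow> cadlag_on T (\<lambda>t. max (f t) (g t))"
  by (rule cadlag_on_binop) (auto intro: tendsto_max)

context usual_basis
begin

lemma T_nonneg: "0 \<le> T" using T_pos by simp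

lemma space_F': "space (F t) = space M" by (rule space_F)

lemma sets_F_subset: "sets (F t) \<subseteq> sets M"
  using subalgebra_F by (auto simp: subalgebra_def)

section \<open>Completeness of the filtration: changes on null sets\<close>

lemma null_in_F: "A \<in> null_sets M \<Longrightarrow> B \<subseteq> A \<Longrightarrow> 0 \<le> t \<Longrightarrow> B \<in> sets (F t)"
  using F_complete sets_F_mono[of 0 t] by auto

lemma AE_space_cong_null:
  assumes "A \<subseteq> space M" "B \<subseteq> space M" "AE w in M. w \<in> A \<longleftrightarrow> w \<in> B"
  obtains N where "N \<in> null_sets M" "A - B \<subseteq> N" "B - A \<subseteq> N"
proof -
  from assms(3) obtain N where "{w\<in>space M. \<not> (w \<in> A \<longleftrightarrow> w \<in> B)} \<subseteq> N" "N \<in> null_sets M"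
    by (auto elim!: AE_E simp: null_sets_def)
  then show ?thesis using assms by (intro that[of N]) auto
qed

text \<open>\<open>F t\<close> with \<open>0 \<le> t\<close> contains all subsets of null sets,
  since completeness is assumed at time 0 and the filtration increases. This is what lets stopping
  times be read off from paths that are cadlag only almost surely.\<close>

lemma sets_F_AE_cong:
  assumes A: "A \<in> sets (F t)" and t: "0 \<le> t" and B: "B \<subseteq> space M" "AE w in M. w \<in> A \<longleftrightarrow> w \<in> B"
  shows "B \<in> sets (F t)"
proof -
  have "A \<subseteq> space M" using A sets.sets_into_space space_F by metis
  then obtain N where N: "N \<in> null_sets M" "A - B \<subseteq> N" "B - A \<subseteq> N"
    using AE_space_cong_null B by metis
  have "B = (A - (A - B)) \<union> (B - A)" by auto
  also have "\<dots> \<in> sets (F t)"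
    using A null_in_F[OF N(1) N(2) t] null_in_F[OF N(1) N(3) t] by auto
  finally show ?thesis .
qed

lemma sets_M_AE_cong:
  assumes A: "A \<in> sets M" and B: "B \<subseteq> space M" "AE w in M. w \<in> A \<longleftrightarrow> w \<in> B"
  shows "B \<in> sets M"
proof -
  have "A \<subseteq> space M" using A sets.sets_into_space by metis
  then obtain N where N: "N \<in> null_sets M" "A - B \<subseteq> N" "B - A \<subseteq> N"
    using AE_space_cong_null B by metis
  have "B = (A - (A - B)) \<union> (B - A)" by auto
  also have "\<dots> \<in> sets M"
    using A null_in_F[OF N(1) N(2), of 0] null_in_F[OF N(1) N(3), of 0] sets_F_subset[of 0] by auto
  finally show ?thesis .
qed

section \<open>Stopping times with values in the time interval\<close>

lemma stopping_timesD:
  assumes "\<tau> \<in> stopping_times"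
  shows "stopping_time F \<tau>" "\<And>w. w \<in> space M \<Longrightarrow> 0 \<le> \<tau> w" "\<And>w. w \<in> space M \<Longrightarrow> \<tau> w \<le> T"
    "\<And>t. {w\<in>space M. \<tau> w \<le> t} \<in> sets (F t)"
  using assms stopping_timeD[of F \<tau>] by (auto simp: stopping_times_def pred_def space_F)

text \<open>Only times in \<open>[0,T)\<close> carry information: for a time with values in
  \<open>{0..T}\<close> the event is empty before 0 and the whole space from \<open>T\<close>
  on.\<close>

lemma stopping_timesI:
  assumes "\<And>w. w \<in> space M \<Longrightarrow> \<tau> w \<in> {0..T}"
    and "\<And>t. 0 \<le> t \<Longrightarrow> t < T \<Longrightarrow> {w\<in>space M. \<tau> w \<le> t} \<in> sets (F t)"
  shows "\<tau> \<in> stopping_times"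
proof -
  have "{w\<in>space M. \<tau> w \<le> t} \<in> sets (F t)" for t
  proof -
    consider "t < 0" | "0 \<le> t" "t < T" | "T \<le> t" by linarith
    then show ?thesis
    proof cases
      case 1
      then have "{w\<in>space M. \<tau> w \<le> t} = {}" using assms(1) by force
      then show ?thesis by (simp only: sets.empty_sets)
    next
      case 3
      then have "{w\<in>space M. \<tau> w \<le> t} = space (F t)" using assms(1) by (force simp: space_F)
      then show ?thesis by simp
    qed (use assms in auto)
  qed
  then show ?thesis using assms(1) by (auto simp: stopping_times_def stopping_time_def pred_def space_F)
qed

text \<open>Right-continuity of the filtration at times before \<open>T\<close>: the event
  \<open>\<tau> w \<le> t\<close> is a countable intersection of strict events at times just after
  \<open>t\<close>, hence lies in \<open>F s\<close> for every later \<open>s\<close>.\<close>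

lemma stopping_timesI_less:
  assumes "\<And>w. w \<in> space M \<Longrightarrow> \<tau> w \<in> {0..T}"
    and "\<And>t. 0 < t \<Longrightarrow> t \<le> T \<Longrightarrow> {w\<in>space M. \<tau> w < t} \<in> sets (F t)"
  shows "\<tau> \<in> stopping_times"
proof (rule stopping_timesI)
  fix t assume t: "0 \<le> t" "t < T"
  have "{w\<in>space M. \<tau> w \<le> t} \<in> sets (F s)" if s: "s \<in> {t<..T}" for s
  proof -
    \<comment> \<open>\<open>r\<close> starts at \<open>r 0 = s\<close> and decreases to
      \<open>t\<close> without reaching it, so all the strict events lie in
      \<open>F s\<close>.\<close>
    define r where "r n = t + (s - t) / Suc n" for n
    have r: "t < r n" "r n \<le> s" for n
      using s by (auto simp: r_def field_simps mult_right_mono)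
    have rl: "r \<longlonglongrightarrow> t"
      using tendsto_add[OF tendsto_const[of t] tendsto_mult[OF tendsto_const[of "s - t"] LIMSEQ_inverse_real_of_nat]]
      unfolding r_def by (simp add: inverse_eq_divide)
    have "{w\<in>space M. \<tau> w \<le> t} = (\<Inter>n. {w\<in>space M. \<tau> w < r n})"
    proof (intro set_eqI iffI)
      fix w assume "w \<in> (\<Inter>n. {w\<in>space M. \<tau> w < r n})"
      then have "w \<in> space M" "\<And>n. \<tau> w < r n" by auto
      then show "w \<in> {w\<in>space M. \<tau> w \<le> t}" using LIMSEQ_le_const[OF rl, of "\<tau> w"] by (auto intro: less_imp_le)
    qed (use le_less_trans[OF _ r(1)] in auto)
    moreover have "{w\<in>space M. \<tau> w < r n} \<in> sets (F s)" for n
    proof -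
      have "0 < r n" "r n \<le> T" using r[of n] t s by auto
      then have "{w\<in>space M. \<tau> w < r n} \<in> sets (F (r n))" by (rule assms(2))
      then show ?thesis using sets_F_mono[OF r(2)[of n]] by auto
    qed
    ultimately show ?thesis by auto
  qed
  then show "{w\<in>space M. \<tau> w \<le> t} \<in> sets (F t)"
    using F_right_continuous[of t] t by auto
qed (use assms in auto)

lemma stopping_times_AE_cong:
  assumes "\<tau> \<in> stopping_times" "AE w in M. \<tau> w = \<sigma> w" "\<And>w. w \<in> space M \<Longrightarrow> \<sigma> w \<in> {0..T}"
  shows "\<sigma> \<in> stopping_times"
proof (rule stopping_timesI)
  fix t :: real assume "0 \<le> t"
  show "{w\<in>space M. \<sigma> w \<le> t} \<in> sets (F t)"
  proof (rule sets_F_AE_cong[OF stopping_timesD(4)[OF assms(1)] \<open>0 \<le> t\<close>])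
    show "AE w in M. w \<in> {w\<in>space M. \<tau> w \<le> t} \<longleftrightarrow> w \<in> {w\<in>space M. \<sigma> w \<le> t}"
      using assms(2) by eventually_elim simp
  qed simp
qed (use assms in auto)

lemma const_stopping_times: "t \<in> {0..T} \<Longrightarrow> (\<lambda>_. t) \<in> stopping_times"
  by (auto simp: stopping_times_def intro: stopping_time_const)

lemma max_stopping_times: "\<sigma> \<in> stopping_times \<Longrightarrow> \<tau> \<in> stopping_times \<Longrightarrow> (\<lambda>w. max (\<sigma> w) (\<tau> w)) \<in> stopping_times"
  by (auto simp: stopping_times_def intro: stopping_time_max)

lemma min_stopping_times: "\<sigma> \<in> stopping_times \<Longrightarrow> \<tau> \<in> stopping_times \<Longrightarrow> (\<lambda>w. min (\<sigma> w) (\<tau> w)) \<in> stopping_times"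
  by (auto simp: stopping_times_def intro: stopping_time_min)

text \<open>The limit is at most \<open>t\<close> exactly when every term is: a countable
  intersection of events known at time \<open>t\<close>.\<close>

lemma incseq_stopping_times:
  assumes "\<And>n. \<theta> n \<in> stopping_times" "\<And>w. w \<in> space M \<Longrightarrow> incseq (\<lambda>n. \<theta> n w)"
    "\<And>w. w \<in> space M \<Longrightarrow> (\<lambda>n. \<theta> n w) \<longlonglongrightarrow> \<tau> w"
  shows "\<tau> \<in> stopping_times" "\<And>w n. w \<in> space M \<Longrightarrow> \<theta> n w \<le> \<tau> w"
proof -
  show le: "\<theta> n w \<le> \<tau> w" if "w \<in> space M" for w n
    using assms(2,3)[OF that] by (rule incseq_le)
  show "\<tau> \<in> stopping_times"
  proof (rule stopping_timesI)
    fix w assume w: "w \<in> space M"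
    have "\<tau> w \<le> T" using LIMSEQ_le_const2[OF assms(3)[OF w], of T] stopping_timesD(3)[OF assms(1) w] by auto
    then show "\<tau> w \<in> {0..T}" using le[OF w, of 0] stopping_timesD(2)[OF assms(1) w, of 0] by auto
  next
    fix t :: real
    have "{w\<in>space M. \<tau> w \<le> t} = (\<Inter>n. {w\<in>space M. \<theta> n w \<le> t})"
      using le LIMSEQ_le_const2[OF assms(3)] by (auto intro: order_trans)
    also have "\<dots> \<in> sets (F t)" using stopping_timesD(4)[OF assms(1)] by auto
    finally show "{w\<in>space M. \<tau> w \<le> t} \<in> sets (F t)" .
  qed
qed

lemma grid_up_stopping_times:
  assumes \<tau>: "\<tau> \<in> stopping_times"
  shows "(\<lambda>w. grid_up T l (\<tau> w)) \<in> stopping_times"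
proof (rule stopping_timesI)
  fix w assume "w \<in> space M"
  then show "grid_up T l (\<tau> w) \<in> {0..T}" using grid_up_range T_pos stopping_timesD(3)[OF \<tau>] by blast
next
  fix t :: real
  have "{w\<in>space M. grid_up T l (\<tau> w) \<le> t} = (\<Union>s\<in>{s\<in>grid T l. s \<le> t}. {w\<in>space M. \<tau> w \<le> s})"
  proof (intro set_eqI iffI)
    fix w assume "w \<in> {w\<in>space M. grid_up T l (\<tau> w) \<le> t}"
    then show "w \<in> (\<Union>s\<in>{s\<in>grid T l. s \<le> t}. {w\<in>space M. \<tau> w \<le> s})"
      using grid_up_in[of "\<tau> w" T l] grid_up_ge[of "\<tau> w" T l] stopping_timesD(3)[OF \<tau>, of w] by blast
  next
    fix w assume "w \<in> (\<Union>s\<in>{s\<in>grid T l. s \<le> t}. {w\<in>space M. \<tau> w \<le> s})"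
    then obtain s where "w \<in> space M" "s \<in> grid T l" "s \<le> t" "\<tau> w \<le> s" by blast
    then show "w \<in> {w\<in>space M. grid_up T l (\<tau> w) \<le> t}"
      using grid_up_le[of "\<tau> w" T s l] stopping_timesD(3)[OF \<tau>, of w] by auto
  qed
  also have "\<dots> \<in> sets (F t)"
  proof (intro sets.finite_UN)
    fix s assume "s \<in> {s\<in>grid T l. s \<le> t}"
    then have "sets (F s) \<subseteq> sets (F t)" by (intro sets_F_mono) simp
    then show "{w\<in>space M. \<tau> w \<le> s} \<in> sets (F t)" using stopping_timesD(4)[OF \<tau>] by blast
  qed (simp add: finite_grid)
  finally show "{w\<in>space M. grid_up T l (\<tau> w) \<le> t} \<in> sets (F t)" .
qed

section \<open>The sigma-algebra of a stopping time\<close>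

lemma sets_pre_sigma':
  "\<tau> \<in> stopping_times \<Longrightarrow> sets (pre_sigma \<tau>) = {A. \<forall>t. {w\<in>A. \<tau> w \<le> t} \<in> sets (F t)}"
  by (rule sets_pre_sigma) (rule stopping_timesD)

lemma pre_sigma_sets_M:
  assumes "\<tau> \<in> stopping_times" shows "sets (pre_sigma \<tau>) \<subseteq> sets (F T)"
proof
  fix A assume A: "A \<in> sets (pre_sigma \<tau>)"
  then have "A \<subseteq> space M" using sets.sets_into_space space_pre_sigma by metis
  then have "A = {w\<in>A. \<tau> w \<le> T}" using stopping_timesD(3)[OF assms] by auto
  also have "\<dots> \<in> sets (F T)" using A sets_pre_sigma'[OF assms] by blast
  finally show "A \<in> sets (F T)" .
qed

lemma pre_sigma_mono:
  assumes "\<sigma> \<in> stopping_times" "\<tau> \<in> stopping_times" "\<And>w. w \<in> space M \<Longrightarrow> \<sigma> w \<le> \<tau> w"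
  shows "sets (pre_sigma \<sigma>) \<subseteq> sets (pre_sigma \<tau>)"
  using assms by (intro mono_pre_sigma) (auto dest: stopping_timesD)

lemma pre_sigma_const:
  assumes "t \<in> {0..T}" shows "sets (pre_sigma (\<lambda>_. t)) = sets (F t)"
proof -
  have "A \<in> sets (F t) \<longleftrightarrow> (\<forall>s. {w\<in>A. t \<le> s} \<in> sets (F s))" for A
  proof
    assume A: "A \<in> sets (F t)"
    show "\<forall>s. {w\<in>A. t \<le> s} \<in> sets (F s)"
    proof
      fix s show "{w\<in>A. t \<le> s} \<in> sets (F s)"
      proof (cases "t \<le> s")
        case True
        then have "{w\<in>A. t \<le> s} = A" by blast
        then show ?thesis using A sets_F_mono[OF True] by auto
      next
        case False
        then have "{w\<in>A. t \<le> s} = {}" by blast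
        then show ?thesis by (simp only: sets.empty_sets)
      qed
    qed
  next
    assume "\<forall>s. {w\<in>A. t \<le> s} \<in> sets (F s)"
    from this[rule_format, of t] show "A \<in> sets (F t)" by simp
  qed
  then show ?thesis unfolding sets_pre_sigma'[OF const_stopping_times[OF assms]] by blast
qed

lemma sets_pre_sigma_AE_cong:
  assumes \<tau>: "\<tau> \<in> stopping_times" and A: "A \<in> sets (pre_sigma \<tau>)"
    and B: "B \<subseteq> space M" "AE w in M. w \<in> A \<longleftrightarrow> w \<in> B"
  shows "B \<in> sets (pre_sigma \<tau>)"
  unfolding sets_pre_sigma'[OF \<tau>]
proof (intro CollectI allI)
  fix t
  show "{w\<in>B. \<tau> w \<le> t} \<in> sets (F t)"
  proof (cases "t < 0")
    case True
    then have "{w\<in>B. \<tau> w \<le> t} = {}" using B(1) stopping_timesD(2)[OF \<tau>] by force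
    then show ?thesis by (simp only: sets.empty_sets)
  next
    case False
    have "{w\<in>A. \<tau> w \<le> t} \<in> sets (F t)" using A sets_pre_sigma'[OF \<tau>] by blast
    then show ?thesis
    proof (rule sets_F_AE_cong)
      show "AE w in M. w \<in> {w\<in>A. \<tau> w \<le> t} \<longleftrightarrow> w \<in> {w\<in>B. \<tau> w \<le> t}"
        using B(2) by eventually_elim simp
    qed (use False B in auto)
  qed
qed

lemma measurable_pre_sigma_AE_cong:
  assumes \<tau>: "\<tau> \<in> stopping_times" and f: "f \<in> measurable (pre_sigma \<tau>) N"
    and g: "AE w in M. f w = g w" "g \<in> space M \<rightarrow> space N"
  shows "g \<in> measurable (pre_sigma \<tau>) N"
proof (rule measurableI)
  fix w assume "w \<in> space (pre_sigma \<tau>)" then show "g w \<in> space N"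
    using g(2) by (auto simp: space_pre_sigma)
next
  fix A assume A: "A \<in> sets N"
  then have "f -` A \<inter> space (pre_sigma \<tau>) \<in> sets (pre_sigma \<tau>)" using f measurable_sets by blast
  then show "g -` A \<inter> space (pre_sigma \<tau>) \<in> sets (pre_sigma \<tau>)"
  proof (rule sets_pre_sigma_AE_cong[OF \<tau>])
    show "AE w in M. w \<in> f -` A \<inter> space (pre_sigma \<tau>) \<longleftrightarrow> w \<in> g -` A \<inter> space (pre_sigma \<tau>)"
      using g(1) by eventually_elim simp
  qed (simp add: space_pre_sigma)
qed

lemma measurable_M_AE_cong:
  assumes f: "f \<in> measurable M N" and g: "AE w in M. f w = g w" "g \<in> space M \<rightarrow> space N"
  shows "g \<in> measurable M N"
proof (rule measurableI)
  fix A assume A: "A \<in> sets N"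
  then have "f -` A \<inter> space M \<in> sets M" using f measurable_sets by blast
  then show "g -` A \<inter> space M \<in> sets M"
  proof (rule sets_M_AE_cong)
    show "AE w in M. w \<in> f -` A \<inter> space M \<longleftrightarrow> w \<in> g -` A \<inter> space M"
      using g(1) by eventually_elim simp
  qed simp
qed (use g(2) in auto)

lemma measurable_F_M: "f \<in> measurable (F t) N \<Longrightarrow> f \<in> measurable M N"
  by (rule measurable_from_subalg[OF subalgebra_F])

lemma pre_sigma_subalgebra: "\<tau> \<in> stopping_times \<Longrightarrow> subalgebra M (pre_sigma \<tau>)"
  unfolding subalgebra_def space_pre_sigma
  using order_trans[OF pre_sigma_sets_M sets_F_subset] by simp

lemma measurable_pre_sigma_M:
  "\<tau> \<in> stopping_times \<Longrightarrow> f \<in> measurable (pre_sigma \<tau>) N \<Longrightarrow> f \<in> measurable M N"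
  by (rule measurable_from_subalg[OF pre_sigma_subalgebra])

lemma stopping_times_measurable: "\<tau> \<in> stopping_times \<Longrightarrow> \<tau> \<in> borel_measurable M"
  by (rule measurable_stopping_time[OF stopping_timesD(1) sets_F_subset space_F])

text \<open>On the event that \<open>\<tau>\<close> is at most \<open>t\<close>, the stopped value
  is the composition of \<open>w \<mapsto> (min (\<tau> w) t, w)\<close> with the restriction of
  \<open>X\<close> to times up to \<open>t\<close>. Joint measurability of that restriction with
  respect to \<open>F t\<close>, that is, progressive measurability, is exactly what the composition
  requires.\<close>

lemma progressive_stopped:
  assumes X: "progressive X" and \<tau>: "\<tau> \<in> stopping_times"
  shows "(\<lambda>w. X (\<tau> w) w) \<in> borel_measurable (pre_sigma \<tau>)"
proof (rule measurableI)
  fix A :: "real set" assume A: "A \<in> sets borel"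
  have main: "{w\<in>space M. X (\<tau> w) w \<in> A \<and> \<tau> w \<le> t} \<in> sets (F t)" if t: "t \<in> {0..T}" for t
  proof -
    have "(\<lambda>w. min (\<tau> w) t) \<in> borel_measurable (F t)"
    proof (rule borel_measurableI_le)
      fix s
      have "{w\<in>space M. \<tau> w \<le> s} \<in> sets (F t)" if "s < t"
        using stopping_timesD(4)[OF \<tau>, of s] sets_F_mono[of s t] that by auto
      moreover have "{x \<in> space (F t). min (\<tau> x) t \<le> s} = (if s < t then {w\<in>space M. \<tau> w \<le> s} else space (F t))"
        by (auto simp: space_F min_def)
      ultimately show "{x \<in> space (F t). min (\<tau> x) t \<le> s} \<in> sets (F t)" by auto
    qed
    then have 1: "(\<lambda>w. (min (\<tau> w) t, w)) \<in> measurable (F t) (restrict_space borel {0..t} \<Otimes>\<^sub>M F t)"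
      using stopping_timesD(2)[OF \<tau>] t
      by (intro measurable_Pair measurable_restrict_space2) (auto simp: space_F)
    have "(\<lambda>w. X (min (\<tau> w) t) w) \<in> borel_measurable (F t)"
      using measurable_compose[OF 1, of "\<lambda>(s, w). X s w"] X t by (auto simp: progressive_def)
    from measurable_sets[OF this A] have "{w\<in>space M. X (min (\<tau> w) t) w \<in> A} \<in> sets (F t)"
      by (simp add: vimage_def Int_def space_F conj_commute)
    from sets.Int[OF this stopping_timesD(4)[OF \<tau>, of t]] show ?thesis
      by (rule back_subst[of "\<lambda>S. S \<in> sets (F t)"]) (auto simp: min_def)
  qed
  show "(\<lambda>w. X (\<tau> w) w) -` A \<inter> space (pre_sigma \<tau>) \<in> sets (pre_sigma \<tau>)"
    unfolding sets_pre_sigma'[OF \<tau>]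
  proof (intro CollectI allI)
    fix t
    let ?S = "{w \<in> (\<lambda>w. X (\<tau> w) w) -` A \<inter> space (pre_sigma \<tau>). \<tau> w \<le> t}"
    consider "t < 0" | "t \<in> {0..T}" | "T < t" by fastforce
    then show "?S \<in> sets (F t)"
    proof cases
      case 1
      then have "?S = {}" using stopping_timesD(2)[OF \<tau>] by (force simp: space_pre_sigma)
      then show ?thesis by (simp only: sets.empty_sets)
    next
      case 2
      have "?S = {w\<in>space M. X (\<tau> w) w \<in> A \<and> \<tau> w \<le> t}" by (auto simp: space_pre_sigma)
      then show ?thesis using main[OF 2] by simp
    next
      case 3
      have "?S = {w\<in>space M. X (\<tau> w) w \<in> A \<and> \<tau> w \<le> T}"
        using 3 stopping_timesD(3)[OF \<tau>] by (force simp: space_pre_sigma)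
      then show ?thesis using main[of T] T_nonneg sets_F_mono[of T t] 3 by auto
    qed
  qed
qed simp

lemma progressive_F:
  assumes X: "progressive X" and t: "t \<in> {0..T}"
  shows "X t \<in> borel_measurable (F t)"
proof -
  have "X t \<in> borel_measurable (pre_sigma (\<lambda>_. t))"
    by (rule progressive_stopped[OF X const_stopping_times[OF t]])
  also have "borel_measurable (pre_sigma (\<lambda>_. t)) = borel_measurable (F t)"
    by (rule measurable_cong_sets[OF pre_sigma_const[OF t] refl])
  finally show ?thesis .
qed

lemma progressive_stopped_M: "progressive X \<Longrightarrow> \<tau> \<in> stopping_times \<Longrightarrow> (\<lambda>w. X (\<tau> w) w) \<in> borel_measurable M"
  by (rule measurable_pre_sigma_M[OF _ progressive_stopped])

lemma progressive_M: "progressive X \<Longrightarrow> t \<in> {0..T} \<Longrightarrow> X t \<in> borel_measurable M"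
  by (rule measurable_F_M[OF progressive_F])

lemma progressive_binop:
  fixes op2 :: "real \<Rightarrow> real \<Rightarrow> real"
  assumes op2: "\<And>(N :: (real \<times> 'a) measure) g h. g \<in> borel_measurable N \<Longrightarrow> h \<in> borel_measurable N \<Longrightarrow> (\<lambda>x. op2 (g x) (h x)) \<in> borel_measurable N"
    and "progressive X" "progressive Z"
  shows "progressive (\<lambda>t w. op2 (X t w) (Z t w))"
  unfolding progressive_def
proof
  fix t assume "t \<in> {0..T}"
  then have "(\<lambda>x. op2 ((\<lambda>(s, w). X s w) x) ((\<lambda>(s, w). Z s w) x)) \<in> borel_measurable (restrict_space borel {0..t} \<Otimes>\<^sub>M F t)"
    using assms(2,3) unfolding progressive_def by (intro op2) blast+
  then show "(\<lambda>(s, w). op2 (X s w) (Z s w)) \<in> borel_measurable (restrict_space borel {0..t} \<Otimes>\<^sub>M F t)"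
    by (simp add: case_prod_beta')
qed

lemma progressive_diff:
  assumes "progressive X" "progressive Z" shows "progressive (\<lambda>t w. X t w - Z t w)"
  by (rule progressive_binop[of "(-)", OF borel_measurable_diff assms])

lemma progressive_max:
  assumes "progressive X" "progressive Z" shows "progressive (\<lambda>t w. max (X t w) (Z t w))"
  by (rule progressive_binop[of max, OF borel_measurable_max assms])

section \<open>Cadlag processes and their determination by countably many times\<close>

lemma cadlag_process_diff:
  assumes "cadlag_process X" "cadlag_process Z"
  shows "cadlag_process (\<lambda>t w. X t w - Z t w)"
  unfolding cadlag_process_def
proof
  show "progressive (\<lambda>t w. X t w - Z t w)"
    using assms by (intro progressive_diff) (auto simp: cadlag_process_def)
  have "AE w in M. cadlag_on T (\<lambda>t. X t w)" "AE w in M. cadlag_on T (\<lambda>t. Z t w)"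
    using assms by (auto simp: cadlag_process_def)
  then show "AE w in M. cadlag_on T (\<lambda>t. X t w - Z t w)"
    by eventually_elim (rule cadlag_on_diff)
qed

lemma cadlag_process_max:
  assumes "cadlag_process X" "cadlag_process Z"
  shows "cadlag_process (\<lambda>t w. max (X t w) (Z t w))"
  unfolding cadlag_process_def
proof
  show "progressive (\<lambda>t w. max (X t w) (Z t w))"
    using assms by (intro progressive_max) (auto simp: cadlag_process_def)
  have "AE w in M. cadlag_on T (\<lambda>t. X t w)" "AE w in M. cadlag_on T (\<lambda>t. Z t w)"
    using assms by (auto simp: cadlag_process_def)
  then show "AE w in M. cadlag_on T (\<lambda>t. max (X t w) (Z t w))"
    by eventually_elim (rule cadlag_on_max)
qed

lemma cadlag_process_Max:
  assumes "finite B" "B \<noteq> {}" "\<And>b. b \<in> B \<Longrightarrow> cadlag_process (X b)"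
  shows "cadlag_process (\<lambda>t w. Max ((\<lambda>b. X b t w) ` B))"
  using assms
proof (induction B rule: finite_ne_induct)
  case (insert b B)
  have "cadlag_process (\<lambda>t w. max (X b t w) (Max ((\<lambda>b. X b t w) ` B)))"
    using insert by (intro cadlag_process_max) auto
  then show ?case using insert.hyps by simp
qed simp

text \<open>Only rational times and \<open>T\<close> contribute to the exceptional null set;
  right-continuity carries the closed constraint to all times from \<open>\<gamma> w\<close> on.
  Where \<open>\<gamma> w\<close> exceeds \<open>T\<close> the interval is empty, so a suitable
  \<open>\<gamma>\<close> also restricts the claim to an event.\<close>

lemma cadlag_process_closed:
  assumes X: "cadlag_process X" and C: "closed C" and g: "\<And>w. w \<in> space M \<Longrightarrow> 0 \<le> \<gamma> w"
    and ae: "\<And>s. s \<in> {0..T} \<Longrightarrow> AE w in M. \<gamma> w \<le> s \<longrightarrow> X s w \<in> C"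
  shows "AE w in M. \<forall>s\<in>{\<gamma> w..T}. X s w \<in> C"
proof -
  have "AE w in M. \<forall>q\<in>\<rat> \<inter> {0..T}. \<gamma> w \<le> q \<longrightarrow> X q w \<in> C"
    by (intro AE_ball_countable[THEN iffD2] ballI ae countable_Int1 countable_rat) auto
  moreover have "AE w in M. \<gamma> w \<le> T \<longrightarrow> X T w \<in> C" using ae T_nonneg by auto
  moreover have "AE w in M. cadlag_on T (\<lambda>t. X t w)" using X by (auto simp: cadlag_process_def)
  ultimately show ?thesis using AE_space
  proof eventually_elim
    case (elim w)
    then have w: "w \<in> space M" by simp
    show ?case
    proof
      fix s assume s: "s \<in> {\<gamma> w..T}"
      show "X s w \<in> C"
      proof (rule cadlag_on_closed[OF elim(3) C, of "\<gamma> w"])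
        fix q assume "q \<in> \<rat>" "q \<in> {\<gamma> w..<T}"
        then show "X q w \<in> C" using elim(1) g[OF w] by simp
      qed (use elim(2) g[OF w] s in simp_all)
    qed
  qed
qed

lemma cadlag_process_le:
  assumes X: "cadlag_process X" "cadlag_process Z" and g: "\<And>w. w \<in> space M \<Longrightarrow> 0 \<le> \<gamma> w"
    and ae: "\<And>s. s \<in> {0..T} \<Longrightarrow> AE w in M. \<gamma> w \<le> s \<longrightarrow> X s w \<le> Z s w"
  shows "AE w in M. \<forall>s\<in>{\<gamma> w..T}. X s w \<le> Z s w"
proof -
  have 1: "AE w in M. \<gamma> w \<le> s \<longrightarrow> X s w - Z s w \<in> {..0}" if "s \<in> {0..T}" for s
    using ae[OF that] by eventually_elim simp
  have "AE w in M. \<forall>s\<in>{\<gamma> w..T}. X s w - Z s w \<in> {..0}"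
    using cadlag_process_closed[where C="{..0}" and \<gamma>=\<gamma>, OF cadlag_process_diff[OF X] closed_atMost g 1] .
  then show ?thesis by eventually_elim simp
qed
lemma cadlag_process_eq:
  assumes X: "cadlag_process X" "cadlag_process Z" and g: "\<And>w. w \<in> space M \<Longrightarrow> 0 \<le> \<gamma> w"
    and ae: "\<And>s. s \<in> {0..T} \<Longrightarrow> AE w in M. \<gamma> w \<le> s \<longrightarrow> X s w = Z s w"
  shows "AE w in M. \<forall>s\<in>{\<gamma> w..T}. X s w = Z s w"
proof -
  have 1: "AE w in M. \<gamma> w \<le> s \<longrightarrow> X s w - Z s w \<in> {0}" if "s \<in> {0..T}" for s
    using ae[OF that] by eventually_elim simp
  have "AE w in M. \<forall>s\<in>{\<gamma> w..T}. X s w - Z s w \<in> {0}"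
    using cadlag_process_closed[where C="{0}" and \<gamma>=\<gamma>, OF cadlag_process_diff[OF X] closed_singleton g 1] .
  then show ?thesis by eventually_elim simp
qed

section \<open>Optional sampling and quasi-left continuity\<close>

text \<open>The pathwise supremum runs over uncountably many times; the one over rational times and
  \<open>T\<close> is measurable and still bounds cadlag paths. \<open>D\<close> is the square root
  of that supremum of squares. The last bound is Jensen's inequality, read off from the variance of
  \<open>D\<close> being nonnegative.\<close>

lemma cadlag_process_dominated:
  assumes X: "cadlag_process X" and fin: "sup_moment2 X < \<infinity>"
  obtains D where "D \<in> borel_measurable M" "integrable M (\<lambda>w. (D w)\<^sup>2)" "integrable M D" "\<And>w. 0 \<le> D w"
    "AE w in M. \<forall>s\<in>{0..T}. \<bar>X s w\<bar> \<le> D w" "ennreal ((\<integral>w. D w \<partial>M)\<^sup>2) \<le> sup_moment2 X"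
proof -
  define S where "S = insert T (\<rat> \<inter> {0..T})"
  have S: "countable S" "S \<subseteq> {0..T}" using T_nonneg countable_rat by (auto simp: S_def)
  define g where "g w = (SUP s\<in>S. ennreal (\<bar>X s w\<bar>\<^sup>2))" for w
  have XM: "X s \<in> borel_measurable M" if "s \<in> S" for s
    using X S that progressive_M by (auto simp: cadlag_process_def)
  have g[measurable]: "g \<in> borel_measurable M"
    unfolding g_def using S XM by (intro borel_measurable_SUP) auto
  have gle: "(\<integral>\<^sup>+w. g w \<partial>M) \<le> sup_moment2 X"
    unfolding sup_moment2_def g_def using S by (intro nn_integral_mono SUP_subset_mono) auto
  then have gfin: "(\<integral>\<^sup>+w. g w \<partial>M) \<noteq> \<infinity>" using fin by auto
  then have AEg: "AE w in M. g w \<noteq> \<infinity>" by (intro nn_integral_PInf_AE) auto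
  define D where "D w = sqrt (enn2real (g w))" for w
  have D[measurable]: "D \<in> borel_measurable M" unfolding D_def by measurable
  have D2: "(D w)\<^sup>2 = enn2real (g w)" for w by (simp add: D_def)
  have nnD: "(\<integral>\<^sup>+w. ennreal ((D w)\<^sup>2) \<partial>M) = (\<integral>\<^sup>+w. g w \<partial>M)"
    unfolding D2 using AEg by (intro nn_integral_cong_AE) (auto simp: less_top)
  have i2: "integrable M (\<lambda>w. (D w)\<^sup>2)"
    by (rule integrableI_nonneg) (use nnD gfin in \<open>auto simp: less_top\<close>)
  have i1: "integrable M D" by (rule square_integrable_imp_integrable[OF D i2])
  have "(\<integral>w. D w \<partial>M)\<^sup>2 \<le> (\<integral>w. (D w)\<^sup>2 \<partial>M)"
    using variance_eq[OF i1 i2] variance_positive[of D] by simp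
  then have "ennreal ((\<integral>w. D w \<partial>M)\<^sup>2) \<le> ennreal (\<integral>w. (D w)\<^sup>2 \<partial>M)" by (rule ennreal_leI)
  also have "\<dots> = (\<integral>\<^sup>+w. ennreal ((D w)\<^sup>2) \<partial>M)" using i2 by (intro nn_integral_eq_integral[symmetric]) auto
  also have "\<dots> \<le> sup_moment2 X" using nnD gle by simp
  finally have bd: "ennreal ((\<integral>w. D w \<partial>M)\<^sup>2) \<le> sup_moment2 X" .
  have "AE w in M. cadlag_on T (\<lambda>t. X t w)" using X by (auto simp: cadlag_process_def)
  with AEg have "AE w in M. \<forall>s\<in>{0..T}. \<bar>X s w\<bar> \<le> D w"
  proof eventually_elim
    case (elim w)
    have q: "X q w \<in> {- D w..D w}" if "q \<in> S" for q
    proof -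
      have "ennreal (\<bar>X q w\<bar>\<^sup>2) \<le> g w" unfolding g_def using that by (rule SUP_upper)
      also have "g w = ennreal ((D w)\<^sup>2)" using elim(1) by (simp add: D2 less_top)
      finally have "\<bar>X q w\<bar>\<^sup>2 \<le> (D w)\<^sup>2" by (simp add: ennreal_le_iff)
      then have "\<bar>X q w\<bar> \<le> D w" by (rule power2_le_imp_le) (simp add: D_def)
      then show ?thesis by auto
    qed
    have "X s w \<in> {- D w..D w}" if "s \<in> {0..T}" for s
      by (rule cadlag_on_closed[OF elim(2), of _ 0]) (use q that in \<open>auto simp: S_def\<close>)
    then show ?case by (auto simp: abs_le_iff minus_le_iff)
  qed
  from that[OF D i2 i1 _ this bd] show ?thesis by (simp add: D_def)
qed

lemma cadlag_process_bound:
  assumes "cadlag_process X" "sup_moment2 X < \<infinity>"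
  shows "\<exists>D. integrable M D \<and> integrable M (\<lambda>w. (D w)\<^sup>2) \<and> (\<forall>w. 0 \<le> D w) \<and> (AE w in M. \<forall>s\<in>{0..T}. \<bar>X s w\<bar> \<le> D w)"
  by (rule cadlag_process_dominated[OF assms]) blast

lemma stopped_integrable:
  assumes X: "cadlag_process X" and fin: "sup_moment2 X < \<infinity>" and \<tau>: "\<tau> \<in> stopping_times"
  shows "integrable M (\<lambda>w. X (\<tau> w) w)"
proof -
  obtain D where D: "integrable M D" "AE w in M. \<forall>s\<in>{0..T}. \<bar>X s w\<bar> \<le> D w" "\<And>w. 0 \<le> D w"
    using cadlag_process_bound[OF X fin] by blast
  show ?thesis
  proof (rule Bochner_Integration.integrable_bound[OF D(1)])
    show "(\<lambda>w. X (\<tau> w) w) \<in> borel_measurable M"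
      using X \<tau> by (auto simp: cadlag_process_def intro: progressive_stopped_M)
    show "AE w in M. norm (X (\<tau> w) w) \<le> norm (D w)"
      using D(2) AE_space
    proof eventually_elim
      case (elim w)
      then show ?case using stopping_timesD(2,3)[OF \<tau>, of w] D(3)[of w] by auto
    qed
  qed
qed

text \<open>The supermartingale inequality in integrated form, tested only on events known at time
  \<open>s\<close> on which \<open>\<gamma>\<close> has passed; before \<open>\<gamma>\<close> the
  process is unconstrained. Integrals over events pass directly to mixtures and limits.\<close>

definition supermartingale_from :: "('a \<Rightarrow> real) \<Rightarrow> (real \<Rightarrow> 'a \<Rightarrow> real) \<Rightarrow> bool" where
  "supermartingale_from \<gamma> Z \<longleftrightarrow> (\<forall>s t A. 0 \<le> s \<and> s \<le> t \<and> t \<le> T \<and> A \<in> sets (F s) \<and> (\<forall>w\<in>A. \<gamma> w \<le> s) \<longrightarrow>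
     (\<integral>w. Z t w * indicator A w \<partial>M) \<le> (\<integral>w. Z s w * indicator A w \<partial>M))"

text \<open>Between two grid-valued times the increment of \<open>Z\<close> telescopes over grid
  steps, and the step after \<open>g k\<close> is taken on an event known at time
  \<open>g k\<close>.\<close>

lemma optional_sampling_grid:
  assumes Z: "cadlag_process Z" "sup_moment2 Z < \<infinity>" "supermartingale_from \<gamma> Z"
    and \<sigma>: "\<sigma> \<in> stopping_times" and \<theta>: "\<theta> \<in> stopping_times"
    and le: "\<And>w. w \<in> space M \<Longrightarrow> \<gamma> w \<le> \<sigma> w" "\<And>w. w \<in> space M \<Longrightarrow> \<sigma> w \<le> \<theta> w"
    and grid: "\<And>w. w \<in> space M \<Longrightarrow> \<sigma> w \<in> grid T l" "\<And>w. w \<in> space M \<Longrightarrow> \<theta> w \<in> grid T l"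
    and G: "G \<in> sets (pre_sigma \<sigma>)"
  shows "(\<integral>w. Z (\<theta> w) w * indicator G w \<partial>M) \<le> (\<integral>w. Z (\<sigma> w) w * indicator G w \<partial>M)"
proof -
  define g where "g k = real k * T / 2 ^ l" for k
  have g_le: "g i \<le> g j \<longleftrightarrow> i \<le> j" and g_less: "g i < g j \<longleftrightarrow> i < j" for i j
    using T_pos by (auto simp: g_def divide_simps)
  have g_grid: "g k \<in> grid T l" if "k \<le> 2 ^ l" for k using that by (auto simp: grid_def g_def)
  have g_range: "g k \<in> {0..T}" if "k \<le> 2 ^ l" for k using g_grid[OF that] grid_subset[OF T_pos] by blast
  \<comment> \<open>The event, within \<open>G\<close>, that the step from \<open>g k\<close> to
    \<open>g (Suc k)\<close> lies between \<open>\<sigma>\<close> and \<open>\<theta>\<close>. It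
    belongs to \<open>F (g k)\<close> because \<open>G\<close> is known at \<open>\<sigma>\<close>
    and whether \<open>\<theta>\<close> has come by time \<open>g k\<close> is decided then.\<close>
  define A where "A k = {w\<in>G. \<sigma> w \<le> g k} \<inter> {w\<in>space M. g k < \<theta> w}" for k
  have AF: "A k \<in> sets (F (g k))" for k
  proof -
    have "{w\<in>space M. g k < \<theta> w} = space (F (g k)) - {w\<in>space M. \<theta> w \<le> g k}"
      by (auto simp: space_F)
    then have "{w\<in>space M. g k < \<theta> w} \<in> sets (F (g k))" using stopping_timesD(4)[OF \<theta>] by auto
    moreover have "{w\<in>G. \<sigma> w \<le> g k} \<in> sets (F (g k))" using G sets_pre_sigma'[OF \<sigma>] by blast
    ultimately show ?thesis unfolding A_def by blast
  qed
  have AM: "A k \<in> sets M" for k using AF sets_F_subset by blast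
  have int: "integrable M (Z (g k))" if "k \<le> 2 ^ l" for k
    using stopped_integrable[OF Z(1,2) const_stopping_times] g_range[OF that] by auto
  have intA: "integrable M (\<lambda>w. Z (g i) w * indicator (A k) w)" if "i \<le> 2 ^ l" for i k
    using int[OF that] AM by (rule integrable_real_mult_indicator[rotated])
  have GM: "G \<in> sets M" using G pre_sigma_sets_M[OF \<sigma>] sets_F_subset by blast
  have tele: "Z (\<theta> w) w * indicator G w - Z (\<sigma> w) w * indicator G w =
      (\<Sum>k<2 ^ l. Z (g (Suc k)) w * indicator (A k) w - Z (g k) w * indicator (A k) w)"
    if w: "w \<in> space M" for w
  proof (cases "w \<in> G")
    case True
    obtain i where i: "\<sigma> w = g i" using grid(1)[OF w] by (auto simp: grid_def g_def)
    obtain j where j: "\<theta> w = g j" "j \<le> 2 ^ l" using grid(2)[OF w] by (auto simp: grid_def g_def)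
    have ij: "i \<le> j" using le(2)[OF w] i j g_le by simp
    have "(\<Sum>k<2 ^ l. Z (g (Suc k)) w * indicator (A k) w - Z (g k) w * indicator (A k) w)
      = (\<Sum>k<2 ^ l. if k \<in> {i..<j} then Z (g (Suc k)) w - Z (g k) w else 0)"
      using True w i j g_le g_less by (intro sum.cong) (auto simp: A_def indicator_def)
    also have "\<dots> = (\<Sum>k\<in>{i..<j}. Z (g (Suc k)) w - Z (g k) w)"
      using j(2) by (subst sum.inter_restrict[symmetric]) (auto intro!: sum.cong)
    also have "\<dots> = Z (g j) w - Z (g i) w" using ij by (rule sum_Suc_diff')
    finally show ?thesis using True i j by simp
  qed (simp add: A_def)
  have "(\<integral>w. Z (\<theta> w) w * indicator G w - Z (\<sigma> w) w * indicator G w \<partial>M)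
     = (\<integral>w. (\<Sum>k<2 ^ l. Z (g (Suc k)) w * indicator (A k) w - Z (g k) w * indicator (A k) w) \<partial>M)"
    using tele by (intro Bochner_Integration.integral_cong) auto
  also have "\<dots> = (\<Sum>k<2 ^ l. (\<integral>w. Z (g (Suc k)) w * indicator (A k) w \<partial>M) - (\<integral>w. Z (g k) w * indicator (A k) w \<partial>M))"
    using intA by (subst Bochner_Integration.integral_sum) (auto intro!: sum.cong Bochner_Integration.integral_diff)
  also have "\<dots> \<le> 0"
  proof (intro sum_nonpos)
    fix k :: nat assume k: "k \<in> {..<2 ^ l}"
    have "\<forall>w\<in>A k. \<gamma> w \<le> g k"
      using le(1) sets.sets_into_space[OF AM[of k]] by (force simp: A_def intro: order_trans)
    then have "(\<integral>w. Z (g (Suc k)) w * indicator (A k) w \<partial>M) \<le> (\<integral>w. Z (g k) w * indicator (A k) w \<partial>M)"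
      using Z(3) AF[of k] g_range[of k] g_range[of "Suc k"] g_le[of k "Suc k"] k
      unfolding supermartingale_from_def by auto
    then show "(\<integral>w. Z (g (Suc k)) w * indicator (A k) w \<partial>M) - (\<integral>w. Z (g k) w * indicator (A k) w \<partial>M) \<le> 0" by simp
  qed
  finally show ?thesis
    using stopped_integrable[OF Z(1,2) \<sigma>] stopped_integrable[OF Z(1,2) \<theta>] GM
    by (subst (asm) Bochner_Integration.integral_diff) (auto intro!: integrable_real_mult_indicator)
qed

text \<open>Rounding both times up to the grid keeps their order and can only enlarge the
  sigma-algebra at \<open>\<sigma>\<close>, so \<open>G\<close> remains admissible. Right-continuous
  paths and an integrable bound on \<open>Z\<close> carry the inequality to the limit.\<close>

lemma optional_sampling:
  assumes Z: "cadlag_process Z" "sup_moment2 Z < \<infinity>" "supermartingale_from \<gamma> Z"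
    and \<sigma>: "\<sigma> \<in> stopping_times" and \<theta>: "\<theta> \<in> stopping_times"
    and le: "\<And>w. w \<in> space M \<Longrightarrow> \<gamma> w \<le> \<sigma> w" "\<And>w. w \<in> space M \<Longrightarrow> \<sigma> w \<le> \<theta> w"
    and G: "G \<in> sets (pre_sigma \<sigma>)"
  shows "(\<integral>w. Z (\<theta> w) w * indicator G w \<partial>M) \<le> (\<integral>w. Z (\<sigma> w) w * indicator G w \<partial>M)"
proof -
  obtain D where D: "integrable M D" "AE w in M. \<forall>s\<in>{0..T}. \<bar>Z s w\<bar> \<le> D w" "\<And>w. 0 \<le> D w"
    using cadlag_process_bound[OF Z(1,2)] by blast
  have GM: "G \<in> sets M" using G pre_sigma_sets_M[OF \<sigma>] sets_F_subset by blast
  have lim: "(\<lambda>l. \<integral>w. Z (grid_up T l (\<tau> w)) w * indicator G w \<partial>M) \<longlonglongrightarrow> (\<integral>w. Z (\<tau> w) w * indicator G w \<partial>M)"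
    if \<tau>: "\<tau> \<in> stopping_times" for \<tau>
  proof (rule integral_dominated_convergence[where w=D])
    show "(\<lambda>w. Z (\<tau> w) w * indicator G w) \<in> borel_measurable M"
      using stopped_integrable[OF Z(1,2) \<tau>] GM by auto
    show "(\<lambda>w. Z (grid_up T l (\<tau> w)) w * indicator G w) \<in> borel_measurable M" for l
      using stopped_integrable[OF Z(1,2) grid_up_stopping_times[OF \<tau>]] GM by auto
    show "integrable M D" using D by simp
    have "AE w in M. cadlag_on T (\<lambda>t. Z t w)" using Z by (auto simp: cadlag_process_def)
    then show "AE w in M. (\<lambda>l. Z (grid_up T l (\<tau> w)) w * indicator G w) \<longlonglongrightarrow> Z (\<tau> w) w * indicator G w"
      using AE_space
    proof eventually_elim
      case (elim w)
      have r: "0 \<le> \<tau> w" "\<tau> w \<le> T" using stopping_timesD(2,3)[OF \<tau> elim(2)] by auto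
      show ?case
      proof (intro tendsto_mult tendsto_const cadlag_on_right[OF elim(1)])
        show "(\<lambda>l. grid_up T l (\<tau> w)) \<longlonglongrightarrow> \<tau> w" using r T_pos by (intro grid_up_tendsto)
        show "grid_up T l (\<tau> w) \<in> {\<tau> w..T}" for l using r grid_up_ge grid_up_range[OF T_pos, of "\<tau> w" l] by auto
      qed (use r in auto)
    qed
    show "AE w in M. norm (Z (grid_up T l (\<tau> w)) w * indicator G w) \<le> D w" for l
      using D(2) AE_space
    proof eventually_elim
      case (elim w)
      have "\<tau> w \<le> T" using stopping_timesD(3)[OF \<tau> elim(2)] .
      then have "grid_up T l (\<tau> w) \<in> {0..T}" using grid_up_range[OF T_pos] by blast
      then show ?case using elim(1) D(3)[of w] by (auto simp: indicator_def)
    qed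
  qed
  show ?thesis
  proof (rule LIMSEQ_le[OF lim[OF \<theta>] lim[OF \<sigma>]], intro exI allI impI)
    fix l
    show "(\<integral>w. Z (grid_up T l (\<theta> w)) w * indicator G w \<partial>M) \<le> (\<integral>w. Z (grid_up T l (\<sigma> w)) w * indicator G w \<partial>M)"
    proof (rule optional_sampling_grid[OF Z grid_up_stopping_times[OF \<sigma>] grid_up_stopping_times[OF \<theta>]])
      show "G \<in> sets (pre_sigma (\<lambda>w. grid_up T l (\<sigma> w)))"
        using G pre_sigma_mono[OF \<sigma> grid_up_stopping_times[OF \<sigma>, of l]] grid_up_ge stopping_timesD(3)[OF \<sigma>] by blast
      fix w assume w: "w \<in> space M"
      have b: "\<sigma> w \<le> T" "\<theta> w \<le> T" using stopping_timesD(3) \<sigma> \<theta> w by blast+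
      show "grid_up T l (\<sigma> w) \<in> grid T l" "grid_up T l (\<theta> w) \<in> grid T l" using b by (auto intro: grid_up_in)
      show "\<gamma> w \<le> grid_up T l (\<sigma> w)" using le(1)[OF w] grid_up_ge[OF b(1), of l] by simp
      show "grid_up T l (\<sigma> w) \<le> grid_up T l (\<theta> w)" using le(2)[OF w] b by (intro grid_up_mono)
    qed
  qed
qed

text \<open>Both sequences stay strictly to the left of \<open>t\<close> and run into the same left
  limit, which must then be \<open>L\<close>. That \<open>s 0\<close> is nonnegative ensures
  \<open>0 < t\<close>, where a left limit exists.\<close>

lemma cadlag_on_left_sequence:
  assumes f: "cadlag_on T f" and t: "t \<in> {0..T}"
    and s: "\<And>n. s n < t" "s \<longlonglongrightarrow> t" "0 \<le> s 0" and r: "\<And>n. r n < t" "r \<longlonglongrightarrow> t"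
    and lim: "(\<lambda>n. f (s n)) \<longlonglongrightarrow> L"
  shows "(\<lambda>n. f (r n)) \<longlonglongrightarrow> L"
proof -
  have "0 < t" using s(1)[of 0] s(3) by simp
  then obtain l where l: "(f \<longlongrightarrow> l) (at_left t)" using f t unfolding cadlag_on_def by fastforce
  have "filterlim s (at_left t) sequentially" "filterlim r (at_left t) sequentially"
    using s r by (auto intro!: tendsto_imp_filterlim_at_left always_eventually)
  then have "(\<lambda>n. f (s n)) \<longlonglongrightarrow> l" and 1: "(\<lambda>n. f (r n)) \<longlonglongrightarrow> l"
    using l by (auto intro: filterlim_compose)
  then have "l = L" using lim LIMSEQ_unique by blast
  with 1 show ?thesis by simp
qed

text \<open>Quasi-left continuity concerns announcing sequences, which stay strictly below their
  limit, whereas \<open>\<theta> n\<close> may reach \<open>\<theta>'\<close> after finitely many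
  steps. On the event of no arrival an announcing sequence with limit \<open>\<theta>'\<close> is
  built and compared with \<open>\<theta> n\<close> through left limits; on arrival
  \<open>\<theta> n w\<close> is eventually constant. Because one sequence of stopping times has to
  serve both events, arrival redirects it towards \<open>T\<close>.\<close>

lemma process_qlc_incseq:
  assumes X: "cadlag_process X" "process_qlc X"
    and \<theta>: "\<And>n. \<theta> n \<in> stopping_times" "\<And>w. w \<in> space M \<Longrightarrow> incseq (\<lambda>n. \<theta> n w)"
    and lim: "\<And>w. w \<in> space M \<Longrightarrow> (\<lambda>n. \<theta> n w) \<longlonglongrightarrow> \<theta>' w"
  shows "AE w in M. (\<lambda>n. X (\<theta> n w) w) \<longlonglongrightarrow> X (\<theta>' w) w"
proof -
  have \<theta>': "\<theta>' \<in> stopping_times" and le: "\<And>w n. w \<in> space M \<Longrightarrow> \<theta> n w \<le> \<theta>' w"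
    using incseq_stopping_times[OF \<theta> lim] by auto
  \<comment> \<open>A deterministic sequence increasing from \<open>T / 2\<close> to
    \<open>T\<close> without reaching it; it keeps the redirected times strictly before
    \<open>T\<close>.\<close>
  define a where "a n = T * (1 - 1 / (real n + 2))" for n
  have a: "0 \<le> a n" "a n < T" for n using T_pos by (auto simp: a_def field_simps)
  have a_mono: "a i \<le> a j" if "i \<le> j" for i j
    using that T_pos unfolding a_def by (intro mult_left_mono) (auto simp: field_simps)
  have a_lim: "a \<longlonglongrightarrow> T"
  proof -
    have "(\<lambda>n. T * (1 - inverse (real (Suc (n + 1))))) \<longlonglongrightarrow> T * (1 - 0)"
      by (intro tendsto_intros LIMSEQ_ignore_initial_segment[OF LIMSEQ_inverse_real_of_nat])
    then show ?thesis by (simp add: a_def[abs_def] inverse_eq_divide add.commute)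
  qed
  define e where "e n w = (if \<theta> n w < \<theta>' w then \<theta> n w else T)" for n w
  define \<delta> where "\<delta> n w = min (e n w) (a n)" for n w
  define \<gamma> where "\<gamma> w = (if \<forall>n. \<theta> n w < \<theta>' w then \<theta>' w else T)" for w
  have e: "e n \<in> stopping_times" for n
  proof (rule stopping_timesI)
    fix t assume t: "0 \<le> t" "t < T"
    \<comment> \<open>Whether \<open>\<theta> n\<close> lies strictly before
      \<open>\<theta>'\<close> is decided at time \<open>\<theta> n\<close>; hence moving to
      \<open>T\<close> on the complementary event preserves the stopping property.\<close>
    have "Measurable.pred (pre_sigma (\<theta> n)) (\<lambda>w. \<theta> n w < \<theta>' w)"
      using \<theta>(1) \<theta>' stopping_timesD(1) by (intro stopping_time_less) auto
    then have "{w\<in>space M. \<theta> n w < \<theta>' w} \<in> sets (pre_sigma (\<theta> n))" by (simp add: pred_def space_pre_sigma)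
    then have "{w\<in>{w\<in>space M. \<theta> n w < \<theta>' w}. \<theta> n w \<le> t} \<in> sets (F t)" using sets_pre_sigma'[OF \<theta>(1)] by blast
    then show "{w\<in>space M. e n w \<le> t} \<in> sets (F t)"
      by (rule back_subst[of "\<lambda>S. S \<in> sets (F t)"]) (use t in \<open>auto simp: e_def\<close>)
  qed (use stopping_timesD(2,3)[OF \<theta>(1)] T_nonneg in \<open>auto simp: e_def\<close>)
  have \<delta>: "\<delta> n \<in> stopping_times" for n
    unfolding \<delta>_def using a by (intro min_stopping_times e const_stopping_times) (auto intro: less_imp_le)
  have e_le: "e i w \<le> e j w" if "w \<in> space M" "i \<le> j" for w i j
  proof -
    have "\<theta> i w \<le> \<theta> j w" using \<theta>(2)[OF that(1)] that(2) by (auto simp: incseq_def)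
    then show ?thesis using le[OF that(1), of j] stopping_timesD(3)[OF \<theta>(1) that(1), of i] by (auto simp: e_def)
  qed
  have mono: "incseq (\<lambda>n. \<delta> n w)" if "w \<in> space M" for w
    unfolding incseq_def \<delta>_def using e_le[OF that] a_mono by (blast intro: min.mono)
  have conv: "(\<lambda>n. \<delta> n w) \<longlonglongrightarrow> \<gamma> w" if w: "w \<in> space M" for w
  proof -
    have "(\<lambda>n. e n w) \<longlonglongrightarrow> \<gamma> w"
    proof (cases "\<forall>n. \<theta> n w < \<theta>' w")
      case True
      then show ?thesis using lim[OF w] by (simp add: e_def \<gamma>_def)
    next
      case False
      then obtain N where N: "\<not> \<theta> N w < \<theta>' w" by auto
      have "e n w = T" if "n \<ge> N" for n
      proof -
        have "\<theta> N w \<le> \<theta> n w" using \<theta>(2)[OF w] that by (auto simp: incseq_def)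
        then show ?thesis using N by (auto simp: e_def)
      qed
      moreover have "\<gamma> w = T" using N by (auto simp: \<gamma>_def)
      ultimately show ?thesis by (intro tendsto_eventually eventually_sequentiallyI[of N]) simp
    qed
    moreover have "min (\<gamma> w) T = \<gamma> w" using stopping_timesD(3)[OF \<theta>' w] by (simp add: \<gamma>_def)
    ultimately show ?thesis using tendsto_min[OF _ a_lim, of "\<lambda>n. e n w" "\<gamma> w"] by (simp add: \<delta>_def)
  qed
  have \<gamma>: "\<gamma> \<in> stopping_times" using incseq_stopping_times[OF \<delta> mono conv] by simp
  have less: "\<delta> n w < \<gamma> w" for n w
    using a(2)[of n] by (auto simp: \<delta>_def \<gamma>_def e_def min_less_iff_disj)
  have ann: "announces \<delta> \<gamma>"
    unfolding announces_def using \<delta> mono conv less by auto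
  then have "AE w in M. (\<lambda>n. X (\<delta> n w) w) \<longlonglongrightarrow> X (\<gamma> w) w"
    using X(2) \<gamma> by (auto simp: process_qlc_def predictable_times_def)
  moreover have "AE w in M. cadlag_on T (\<lambda>t. X t w)" using X by (auto simp: cadlag_process_def)
  ultimately show ?thesis using AE_space
  proof eventually_elim
    case (elim w)
    show ?case
    proof (cases "\<forall>n. \<theta> n w < \<theta>' w")
      case True
      then have g: "\<gamma> w = \<theta>' w" by (simp add: \<gamma>_def)
      show ?thesis
      proof (rule cadlag_on_left_sequence[OF elim(2)])
        show "\<theta>' w \<in> {0..T}" using stopping_timesD(2,3)[OF \<theta>' elim(3)] by simp
        show "\<delta> n w < \<theta>' w" for n using less[of n w] by (simp only: g)
        show "(\<lambda>n. \<delta> n w) \<longlonglongrightarrow> \<theta>' w" using conv[OF elim(3)] by (simp only: g)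
        show "0 \<le> \<delta> 0 w" using stopping_timesD(2)[OF \<delta> elim(3)] .
        show "\<theta> n w < \<theta>' w" for n using True by blast
        show "(\<lambda>n. \<theta> n w) \<longlonglongrightarrow> \<theta>' w" using lim[OF elim(3)] .
        show "(\<lambda>n. X (\<delta> n w) w) \<longlonglongrightarrow> X (\<theta>' w) w" using elim(1) by (simp only: g)
      qed
    next
      case False
      then obtain N where N: "\<not> \<theta> N w < \<theta>' w" by auto
      have "\<theta> n w = \<theta>' w" if "n \<ge> N" for n
      proof -
        have "\<theta> N w \<le> \<theta> n w" using \<theta>(2)[OF elim(3)] that by (auto simp: incseq_def)
        then show ?thesis using N le[OF elim(3), of n] by auto
      qed
      then show ?thesis by (intro tendsto_eventually eventually_sequentiallyI[of N]) simp
    qed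
  qed
qed

lemma stopped_integrable_on:
  assumes "cadlag_process X" "sup_moment2 X < \<infinity>" "\<tau> \<in> stopping_times" "G \<in> sets M"
  shows "integrable M (\<lambda>w. X (\<tau> w) w * indicator G w)"
  using integrable_real_mult_indicator[OF assms(4) stopped_integrable[OF assms(1-3)]] .

end

section \<open>Snell envelopes and their hitting times\<close>

lemma Inf_insert_upper:
  fixes S :: "real set"
  assumes "S \<subseteq> {g..T}" "g \<le> T"
  shows "Inf (insert T S) \<in> {g..T}" "s \<in> S \<Longrightarrow> Inf (insert T S) \<le> s"
    "Inf (insert T S) < t \<Longrightarrow> t \<le> T \<Longrightarrow> \<exists>s\<in>S. s < t"
proof -
  have bdd: "bdd_below (insert T S)" using assms by (intro bdd_belowI[of _ g]) auto
  show "Inf (insert T S) \<in> {g..T}"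
  proof -
    have "g \<le> Inf (insert T S)" by (rule cInf_greatest) (use assms in auto)
    then show ?thesis using cInf_lower[OF _ bdd, of T] by simp
  qed
  show "Inf (insert T S) \<le> s" if "s \<in> S" using cInf_lower[OF _ bdd, of s] that by simp
  show "\<exists>s\<in>S. s < t" if "Inf (insert T S) < t" "t \<le> T"
    using cInf_less_iff[OF _ bdd, of t] that by auto
qed

text \<open>An infimum below \<open>T\<close> does not come from the adjoined \<open>T\<close>, so
  elements of \<open>S\<close> approach it from the right, and right-continuity applies.\<close>

lemma cadlag_on_Inf_closed:
  assumes f: "cadlag_on T f" and C: "closed C" and S: "S \<subseteq> {g..T}" "0 \<le> g" "g \<le> T" "\<And>s. s \<in> S \<Longrightarrow> f s \<in> C"
    and less: "Inf (insert T S) < T"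
  shows "f (Inf (insert T S)) \<in> C"
proof -
  define i where "i = Inf (insert T S)"
  note Inf = Inf_insert_upper[OF S(1,3), folded i_def]
  have "\<exists>s\<in>S. s < min T (i + inverse (real (Suc n)))" for n
    using less by (intro Inf(3)) (auto simp: i_def[symmetric])
  then obtain s where s: "\<And>n. s n \<in> S" "\<And>n. s n < min T (i + inverse (real (Suc n)))" by metis
  have "s \<longlonglongrightarrow> i"
  proof (rule tendsto_sandwich[where f="\<lambda>_. i" and h="\<lambda>n. i + inverse (real (Suc n))"])
    show "(\<lambda>n. i + inverse (real (Suc n))) \<longlonglongrightarrow> i"
      using tendsto_add[OF tendsto_const[of i] LIMSEQ_inverse_real_of_nat] by simp
    show "\<forall>\<^sub>F n in sequentially. s n \<le> i + inverse (real (Suc n))"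
      by (rule always_eventually, rule allI) (use s(2) in \<open>simp add: less_imp_le\<close>)
    show "\<forall>\<^sub>F n in sequentially. i \<le> s n" using Inf(2) s(1) by simp
  qed simp
  moreover have "s n \<in> {i..T}" for n using Inf(2)[OF s(1)] s(1)[of n] S(1) by auto
  moreover have "i \<in> {0..T}" using Inf(1) S(2) by auto
  ultimately have "(\<lambda>n. f (s n)) \<longlonglongrightarrow> f i" by (intro cadlag_on_right[OF f])
  then show ?thesis unfolding i_def[symmetric]
    by (intro Lim_in_closed_set[OF C _ sequentially_bot]) (simp_all add: S(4) s(1))
qed

context usual_basis
begin

text \<open>\<open>W s w < e\<close> is an open condition, so a cadlag path satisfying it at some
  time before \<open>t\<close> also does so at a slightly later rational time. The event of hitting
  before \<open>t\<close> is thus a countable union, up to the null set where paths fail to be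
  cadlag.\<close>

lemma hitting_time_stopping:
  assumes W: "cadlag_process W" and \<gamma>: "\<gamma> \<in> stopping_times"
    and \<theta>: "\<And>w. w \<in> space M \<Longrightarrow> \<theta> w = Inf (insert T {s\<in>{\<gamma> w..T}. W s w < e})"
  shows "\<theta> \<in> stopping_times"
proof (rule stopping_timesI_less)
  fix w assume w: "w \<in> space M"
  have "\<theta> w \<in> {\<gamma> w..T}" unfolding \<theta>[OF w] using stopping_timesD(3)[OF \<gamma> w] by (intro Inf_insert_upper) auto
  then show "\<theta> w \<in> {0..T}" using stopping_timesD(2)[OF \<gamma> w] by auto
next
  fix t assume t: "0 < t" "t \<le> T"
  define U where "U = (\<Union>q\<in>\<rat> \<inter> {0..<t}. {w\<in>space M. \<gamma> w \<le> q} \<inter> {w\<in>space M. W q w < e})"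
  have U: "U \<in> sets (F t)"
    unfolding U_def
  proof (intro sets.countable_UN'' countable_Int1 countable_rat)
    fix q assume q: "q \<in> \<rat> \<inter> {0..<t}"
    have Wq: "W q \<in> borel_measurable (F q)" using W q t by (intro progressive_F) (auto simp: cadlag_process_def)
    have "{w\<in>space M. W q w < e} \<in> sets (F q)"
      using measurable_sets[OF Wq, of "{..<e}"] by (simp add: space_F vimage_def Int_def conj_commute)
    then have "{w\<in>space M. \<gamma> w \<le> q} \<inter> {w\<in>space M. W q w < e} \<in> sets (F q)"
      using stopping_timesD(4)[OF \<gamma>] by blast
    then show "{w\<in>space M. \<gamma> w \<le> q} \<inter> {w\<in>space M. W q w < e} \<in> sets (F t)"
      using sets_F_mono[of q t] q by auto
  qed
  have "AE w in M. cadlag_on T (\<lambda>t. W t w)" using W by (auto simp: cadlag_process_def)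
  then have ae: "AE w in M. w \<in> U \<longleftrightarrow> w \<in> {w\<in>space M. \<theta> w < t}"
    using AE_space
  proof eventually_elim
    case (elim w)
    note w = elim(2)
    let ?S = "{s\<in>{\<gamma> w..T}. W s w < e}"
    have g: "0 \<le> \<gamma> w" "\<gamma> w \<le> T" using stopping_timesD(2,3)[OF \<gamma> w] by auto
    have "?S \<subseteq> {\<gamma> w..T}" by auto
    note Inf = Inf_insert_upper[OF this g(2), folded \<theta>[OF w]]
    show ?case
    proof
      assume "w \<in> U"
      then obtain q where q: "q \<in> {0..<t}" "\<gamma> w \<le> q" "W q w < e" by (auto simp: U_def)
      then have "\<theta> w \<le> q" using t by (intro Inf(2)) auto
      then show "w \<in> {w\<in>space M. \<theta> w < t}" using q w by auto
    next
      assume "w \<in> {w\<in>space M. \<theta> w < t}"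
      then obtain s where s: "s \<in> ?S" "s < t" using Inf(3)[of t] t by auto
      obtain q where q: "\<And>n. q n \<in> \<rat>" "\<And>n. s < q n" "\<And>n. q n < t" "q \<longlonglongrightarrow> s"
        using rat_right_sequence[OF s(2)] by blast
      have "(\<lambda>n. W (q n) w) \<longlonglongrightarrow> W s w"
      proof (rule cadlag_on_right[OF elim(1) _ _ q(4)])
        fix n show "q n \<in> {s..T}" using q(2)[of n] q(3)[of n] t by simp
      qed (use s g in auto)
      then have "\<forall>\<^sub>F n in sequentially. W (q n) w < e" using s(1) by (intro order_tendstoD(2)) auto
      then obtain n where "W (q n) w < e" by (auto simp: eventually_sequentially)
      moreover have "0 \<le> q n" "\<gamma> w \<le> q n" "q n < t" using s(1) g q(2)[of n] q(3)[of n] by auto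
      ultimately show "w \<in> U" unfolding U_def using q(1)[of n] w by (intro UN_I[of "q n"]) simp_all
    qed
  qed
  show "{w\<in>space M. \<theta> w < t} \<in> sets (F t)"
    by (rule sets_F_AE_cong[OF U _ _ ae]) (use t in auto)
qed

text \<open>What is kept of the essential supremum: a small loss of expected reward forces both
  clauses, the second by Markov's inequality. Stopping at \<open>T\<close> counts as success because
  the reward there is \<open>Z\<close> itself. Only expectations and one probability occur, so
  errors of approximating processes can simply be added.\<close>

definition near_optimal :: "('a \<Rightarrow> real) \<Rightarrow> (real \<Rightarrow> 'a \<Rightarrow> real) \<Rightarrow> (real \<Rightarrow> 'a \<Rightarrow> real) \<Rightarrow> bool" where
  "near_optimal \<gamma> Z X \<longleftrightarrow> (\<forall>e>0. \<forall>d>0. \<exists>\<tau>\<in>stopping_times. (\<forall>w\<in>space M. \<gamma> w \<le> \<tau> w) \<and>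
     (\<integral>w. Z (\<gamma> w) w \<partial>M) - d \<le> (\<integral>w. Z (\<tau> w) w \<partial>M) \<and>
     measure M {w\<in>space M. \<tau> w < T \<and> X (\<tau> w) w + e \<le> Z (\<tau> w) w} \<le> d)"

text \<open>Stated for all increasing sequences, including those that reach their limit, because the
  hitting times to which it is applied may do either.\<close>

definition qlc_from :: "('a \<Rightarrow> real) \<Rightarrow> (real \<Rightarrow> 'a \<Rightarrow> real) \<Rightarrow> bool" where
  "qlc_from \<gamma> X \<longleftrightarrow> (\<forall>\<theta> \<theta>'. (\<forall>n. \<theta> n \<in> stopping_times) \<and>
     (\<forall>w\<in>space M. (\<forall>n. \<gamma> w \<le> \<theta> n w) \<and> incseq (\<lambda>n. \<theta> n w) \<and> (\<lambda>n. \<theta> n w) \<longlonglongrightarrow> \<theta>' w) \<longrightarrow>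
     (AE w in M. (\<lambda>n. X (\<theta> n w) w) \<longlonglongrightarrow> X (\<theta>' w) w))"

text \<open>\<open>Z\<close> is from time \<open>\<gamma>\<close> on the Snell envelope of the reward that pays \<open>X\<close> before \<open>T\<close>
  and \<open>Z\<^sub>T\<close> at \<open>T\<close>. The minimality of the envelope is encoded by near-optimal stopping times, which
  survives mixtures and limits.\<close>

definition snell_from :: "('a \<Rightarrow> real) \<Rightarrow> (real \<Rightarrow> 'a \<Rightarrow> real) \<Rightarrow> (real \<Rightarrow> 'a \<Rightarrow> real) \<Rightarrow> bool" where
  "snell_from \<gamma> Z X \<longleftrightarrow> \<gamma> \<in> stopping_times \<and> cadlag_process Z \<and> cadlag_process X \<and> sup_moment2 Z < \<infinity> \<and>
     (AE w in M. \<forall>s\<in>{\<gamma> w..T}. X s w \<le> Z s w) \<and> supermartingale_from \<gamma> Z \<and> near_optimal \<gamma> Z X \<and> qlc_from \<gamma> X"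

lemma snell_fromD:
  assumes "snell_from \<gamma> Z X"
  shows "\<gamma> \<in> stopping_times" "cadlag_process Z" "cadlag_process X" "sup_moment2 Z < \<infinity>"
    "AE w in M. \<forall>s\<in>{\<gamma> w..T}. X s w \<le> Z s w" "supermartingale_from \<gamma> Z" "near_optimal \<gamma> Z X" "qlc_from \<gamma> X"
  using assms unfolding snell_from_def by blast+

text \<open>For a nearly optimal \<open>\<tau>\<close>, the time
  \<open>\<rho> = min \<tau> \<theta>\<close> has at least the expected value of
  \<open>\<tau>\<close> by optional sampling, and it differs from \<open>\<theta>\<close> only on
  the small event \<open>B\<close> where \<open>\<tau>\<close> stops far above the obstacle. The
  probability bound \<open>1 / K^2\<close> for \<open>B\<close> is chosen against the size of
  \<open>Z\<close> there.\<close>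

lemma near_hitting_martingale:
  assumes S: "snell_from \<gamma> Z X" and e: "0 < e"
    and \<theta>: "\<And>w. w \<in> space M \<Longrightarrow> \<theta> w = Inf (insert T {s\<in>{\<gamma> w..T}. Z s w - X s w < e})"
  shows "(\<integral>w. Z (\<gamma> w) w \<partial>M) \<le> (\<integral>w. Z (\<theta> w) w \<partial>M)"
proof -
  note S' = snell_fromD[OF S]
  have st: "\<theta> \<in> stopping_times"
    by (rule hitting_time_stopping[OF cadlag_process_diff[OF S'(2,3)] S'(1)]) (rule \<theta>)
  obtain D where D: "integrable M D" "integrable M (\<lambda>w. (D w)\<^sup>2)" "\<And>w. 0 \<le> D w" "AE w in M. \<forall>s\<in>{0..T}. \<bar>Z s w\<bar> \<le> D w"
    using cadlag_process_bound[OF S'(2,4)] by blast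
  define I where "I = (\<integral>w. (D w)\<^sup>2 \<partial>M)"
  have I: "0 \<le> I" by (simp add: I_def)
  have step: "(\<integral>w. Z (\<gamma> w) w \<partial>M) - (\<integral>w. Z (\<theta> w) w \<partial>M) \<le> (3 + 2 * I) * inverse (real (Suc n))" for n
  proof -
    define K where "K = real (Suc n)"
    have K: "1 \<le> K" by (simp add: K_def)
    have "0 < inverse (K * K)" using K by simp
    then obtain \<tau> where \<tau>: "\<tau> \<in> stopping_times" "\<And>w. w \<in> space M \<Longrightarrow> \<gamma> w \<le> \<tau> w"
      "(\<integral>w. Z (\<gamma> w) w \<partial>M) - inverse (K * K) \<le> (\<integral>w. Z (\<tau> w) w \<partial>M)"
      "measure M {w\<in>space M. \<tau> w < T \<and> X (\<tau> w) w + e \<le> Z (\<tau> w) w} \<le> inverse (K * K)"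
      using S'(7) e unfolding near_optimal_def by blast
    define B where "B = {w\<in>space M. \<tau> w < T \<and> X (\<tau> w) w + e \<le> Z (\<tau> w) w}"
    have m: "(\<lambda>w. X (\<tau> w) w) \<in> borel_measurable M" "(\<lambda>w. Z (\<tau> w) w) \<in> borel_measurable M" "\<tau> \<in> borel_measurable M"
      using S'(2,3) \<tau>(1) stopping_times_measurable progressive_stopped_M by (auto simp: cadlag_process_def)
    have B: "B \<in> sets M" unfolding B_def using m by measurable
    define \<rho> where "\<rho> w = min (\<tau> w) (\<theta> w)" for w
    have \<rho>: "\<rho> \<in> stopping_times" unfolding \<rho>_def by (rule min_stopping_times[OF \<tau>(1) st])
    have g\<theta>: "\<gamma> w \<le> \<theta> w" "\<theta> w \<le> T" if "w \<in> space M" for w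
      using Inf_insert_upper(1)[of "{s\<in>{\<gamma> w..T}. Z s w - X s w < e}" "\<gamma> w" T] stopping_timesD(3)[OF S'(1) that] \<theta>[OF that]
      by (auto simp: subset_iff)
    \<comment> \<open>Off \<open>B\<close>, either \<open>\<tau> w\<close> already satisfies the
      condition whose first occurrence is \<open>\<theta> w\<close>, or it equals
      \<open>T\<close>.\<close>
    have outB: "\<theta> w \<le> \<tau> w" if "w \<in> space M" "w \<notin> B" for w
    proof (cases "\<tau> w < T")
      case True
      then have "\<tau> w \<in> {s\<in>{\<gamma> w..T}. Z s w - X s w < e}" using that \<tau>(2)[OF that(1)] by (auto simp: B_def)
      then show ?thesis unfolding \<theta>[OF that(1)]
        using stopping_timesD(3)[OF S'(1) that(1)] by (intro Inf_insert_upper(2)[where g="\<gamma> w"]) auto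
    next
      case False
      then show ?thesis using g\<theta>[OF that(1)] by simp
    qed
    have int: "integrable M (\<lambda>w. Z (\<sigma> w) w)" if "\<sigma> \<in> stopping_times" for \<sigma>
      by (rule stopped_integrable[OF S'(2,4) that])
    have "(\<integral>w. Z (\<tau> w) w * indicator (space M) w \<partial>M) \<le> (\<integral>w. Z (\<rho> w) w * indicator (space M) w \<partial>M)"
    proof (rule optional_sampling[OF S'(2,4,6) \<rho> \<tau>(1)])
      show "space M \<in> sets (pre_sigma \<rho>)" using sets.top[of "pre_sigma \<rho>"] by (simp add: space_pre_sigma)
    qed (use \<tau>(2) g\<theta> in \<open>auto simp: \<rho>_def\<close>)
    then have 1: "(\<integral>w. Z (\<tau> w) w \<partial>M) \<le> (\<integral>w. Z (\<rho> w) w \<partial>M)"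
      by (simp add: Bochner_Integration.integral_cong[OF refl, of M "\<lambda>w. _ w * indicator (space M) w"])
    have "(\<integral>w. Z (\<rho> w) w - Z (\<theta> w) w \<partial>M) \<le> (\<integral>w. 2 * K * indicator B w + (2 * inverse K) * (D w)\<^sup>2 \<partial>M)"
    proof (rule integral_mono_AE)
      show "integrable M (\<lambda>w. Z (\<rho> w) w - Z (\<theta> w) w)" using int \<rho> st by simp
      show "integrable M (\<lambda>w. 2 * K * indicator B w + (2 * inverse K) * (D w)\<^sup>2)"
        using B D(2) by (intro Bochner_Integration.integrable_add integrable_mult_right integrable_real_indicator) (auto simp: less_top[symmetric])
      show "AE w in M. Z (\<rho> w) w - Z (\<theta> w) w \<le> 2 * K * indicator B w + (2 * inverse K) * (D w)\<^sup>2"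
        using D(4) AE_space
      proof eventually_elim
        case (elim w)
        show ?case
        proof (cases "w \<in> B")
          case True
          have "\<rho> w \<in> {0..T}" "\<theta> w \<in> {0..T}" using stopping_timesD(2,3) \<rho> st elim(2) by auto
          then have "\<bar>Z (\<rho> w) w\<bar> \<le> D w" "\<bar>Z (\<theta> w) w\<bar> \<le> D w" using elim(1) by blast+
          then have "Z (\<rho> w) w - Z (\<theta> w) w \<le> 2 * D w" by linarith
          \<comment> \<open>Square integrability in place of boundedness: below level
            \<open>K\<close> the probability \<open>1 / K^2\<close> of \<open>B\<close> suffices,
            above it the square dominates. Both parts contribute terms of order
            \<open>1 / K\<close>.\<close>
          also have "D w \<le> K + inverse K * (D w)\<^sup>2"
          proof (cases "D w \<le> K")
            case False
            then have "K * D w \<le> (D w)\<^sup>2" unfolding power2_eq_square using D(3) by (intro mult_right_mono) auto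
            then have "D w \<le> inverse K * (D w)\<^sup>2" using K by (simp add: field_simps)
            then show ?thesis using K by linarith
          qed (use K in \<open>simp add: add_increasing2\<close>)
          finally show ?thesis using True by simp
        next
          case False
          then have "\<rho> w = \<theta> w" using outB elim(2) by (auto simp: \<rho>_def)
          then show ?thesis using False K by simp
        qed
      qed
    qed
    also have "\<dots> = 2 * K * measure M B + 2 * inverse K * I"
      using B D(2) unfolding I_def
      by (subst Bochner_Integration.integral_add) (auto simp: less_top[symmetric] intro!: integrable_mult_right integrable_real_indicator)
    also have "\<dots> \<le> 2 * K * inverse (K * K) + 2 * inverse K * I"
      using \<tau>(4) K by (intro add_right_mono mult_left_mono) (auto simp: B_def)
    also have "2 * K * inverse (K * K) = 2 * inverse K" using K by (simp add: field_simps)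
    finally have 2: "(\<integral>w. Z (\<rho> w) w \<partial>M) - (\<integral>w. Z (\<theta> w) w \<partial>M) \<le> 2 * inverse K + 2 * inverse K * I"
      using int \<rho> st by simp
    have "inverse (K * K) \<le> inverse K" using K by (intro le_imp_inverse_le) auto
    then have "(\<integral>w. Z (\<gamma> w) w \<partial>M) - (\<integral>w. Z (\<theta> w) w \<partial>M) \<le> 3 * inverse K + 2 * inverse K * I"
      using 1 2 \<tau>(3) by linarith
    then show ?thesis unfolding K_def[symmetric] by (simp add: algebra_simps)
  qed
  have "(\<lambda>n. (3 + 2 * I) * inverse (real (Suc n))) \<longlonglongrightarrow> (3 + 2 * I) * 0"
    by (intro tendsto_mult tendsto_const LIMSEQ_inverse_real_of_nat)
  then have "(\<integral>w. Z (\<gamma> w) w \<partial>M) - (\<integral>w. Z (\<theta> w) w \<partial>M) \<le> (3 + 2 * I) * 0"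
    by (rule LIMSEQ_le_const) (use step in blast)
  then show ?thesis by simp
qed

lemma space_in_pre_sigma: "space M \<in> sets (pre_sigma \<sigma>)"
  using sets.top[of "pre_sigma \<sigma>"] by (simp add: space_pre_sigma)

lemma integral_indicator_space: "(\<integral>w. f w * indicator (space M) w \<partial>M) = (\<integral>w. (f w :: real) \<partial>M)"
  by (intro Bochner_Integration.integral_cong) auto

lemma integral_split_indicator:
  fixes f :: "'a \<Rightarrow> real"
  assumes f: "integrable M f" and G: "G \<in> sets M"
  shows "(\<integral>w. f w \<partial>M) = (\<integral>w. f w * indicator G w \<partial>M) + (\<integral>w. f w * indicator (space M - G) w \<partial>M)"
proof -
  have "(\<integral>w. f w \<partial>M) = (\<integral>w. f w * indicator G w + f w * indicator (space M - G) w \<partial>M)"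
    by (intro Bochner_Integration.integral_cong) (auto simp: indicator_def)
  also have "\<dots> = (\<integral>w. f w * indicator G w \<partial>M) + (\<integral>w. f w * indicator (space M - G) w \<partial>M)"
    by (rule Bochner_Integration.integral_add[OF integrable_real_mult_indicator[OF G f]
      integrable_real_mult_indicator[OF sets.compl_sets[OF G] f]])
  finally show ?thesis .
qed

text \<open>The near-hitting times \<open>\<eta> n\<close> do not lower the expected value of
  \<open>Z\<close> and increase to a limit \<open>\<theta>'\<close>. \<open>Z\<close> is not known
  to converge along them, but before \<open>T\<close> it is there within \<open>1 / (n + 1)\<close>
  of \<open>X\<close>, which does converge. Expected \<open>Z\<close> at \<open>\<gamma>\<close> is
  then at most expected \<open>R\<close>, hence at most expected \<open>Z\<close> at
  \<open>\<theta>'\<close>, hence at most expected \<open>Z\<close> at \<open>\<gamma>\<close>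
  again; equality throughout forces contact with the obstacle at \<open>\<theta>'\<close>.\<close>

theorem snell_hitting_time:
  assumes S: "snell_from \<gamma> Z X"
    and \<theta>: "\<And>w. w \<in> space M \<Longrightarrow> \<theta> w = Inf (insert T {s\<in>{\<gamma> w..T}. Z s w = X s w})"
  shows "\<theta> \<in> stopping_times" "AE w in M. \<theta> w < T \<longrightarrow> Z (\<theta> w) w = X (\<theta> w) w"
    "\<And>G. G \<in> sets (pre_sigma \<gamma>) \<Longrightarrow> (\<integral>w. Z (\<theta> w) w * indicator G w \<partial>M) = (\<integral>w. Z (\<gamma> w) w * indicator G w \<partial>M)"
proof -
  note S' = snell_fromD[OF S]
  have g: "0 \<le> \<gamma> w" "\<gamma> w \<le> T" if "w \<in> space M" for w using stopping_timesD(2,3)[OF S'(1) that] by auto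
  define \<eta> where "\<eta> n w = Inf (insert T {s\<in>{\<gamma> w..T}. Z s w - X s w < inverse (real (Suc n))})" for n w
  have sub: "{s\<in>{\<gamma> w..T}. P s} \<subseteq> {\<gamma> w..T}" for P w by auto
  have \<eta>_st: "\<eta> n \<in> stopping_times" for n
    by (rule hitting_time_stopping[OF cadlag_process_diff[OF S'(2,3)] S'(1), where e="inverse (real (Suc n))"]) (simp add: \<eta>_def)
  have \<eta>r: "\<eta> n w \<in> {\<gamma> w..T}" if "w \<in> space M" for n w
    unfolding \<eta>_def using g[OF that] by (intro Inf_insert_upper(1)) auto
  have \<eta>_mono: "incseq (\<lambda>n. \<eta> n w)" if w: "w \<in> space M" for w
    unfolding incseq_def
  proof (intro allI impI)
    fix m n :: nat assume mn: "m \<le> n"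
    have "inverse (real (Suc n)) \<le> inverse (real (Suc m))" using mn by (intro le_imp_inverse_le) auto
    then have "{s\<in>{\<gamma> w..T}. Z s w - X s w < inverse (real (Suc n))} \<subseteq> {s\<in>{\<gamma> w..T}. Z s w - X s w < inverse (real (Suc m))}"
      by (blast intro: less_le_trans)
    then show "\<eta> m w \<le> \<eta> n w" unfolding \<eta>_def using g[OF w]
      by (intro cInf_superset_mono) (auto intro!: bdd_belowI[of _ "\<gamma> w"])
  qed
  define \<theta>' where "\<theta>' w = (SUP n. \<eta> n w)" for w
  have bdd: "bdd_above (range (\<lambda>n. \<eta> n w))" if "w \<in> space M" for w
    using \<eta>r[OF that] by (intro bdd_aboveI[of _ T]) auto
  have lim: "(\<lambda>n. \<eta> n w) \<longlonglongrightarrow> \<theta>' w" if "w \<in> space M" for w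
    unfolding \<theta>'_def by (rule LIMSEQ_incseq_SUP[OF bdd[OF that] \<eta>_mono[OF that]])
  have \<theta>'_st: "\<theta>' \<in> stopping_times" and \<eta>_le: "\<And>w n. w \<in> space M \<Longrightarrow> \<eta> n w \<le> \<theta>' w"
    using incseq_stopping_times[OF \<eta>_st \<eta>_mono lim] by auto
  obtain D where D: "integrable M D" "\<And>w. 0 \<le> D w" "AE w in M. \<forall>s\<in>{0..T}. \<bar>Z s w\<bar> \<le> D w"
    using cadlag_process_bound[OF S'(2,4)] by blast
  \<comment> \<open>The reward collected at \<open>\<theta>'\<close>. If
    \<open>\<theta>' w = T\<close>, either some \<open>\<eta> n\<close> equals \<open>T\<close> and
    the value is \<open>Z T\<close>, or \<open>T\<close> is only approached and the limit
    \<open>X T\<close> is at most \<open>Z T\<close>; \<open>R\<close> covers both cases.\<close>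
  define R where "R w = (if \<theta>' w < T then X (\<theta>' w) w else Z T w)" for w
  have cad: "AE w in M. cadlag_on T (\<lambda>t. Z t w - X t w)"
    using cadlag_process_diff[OF S'(2,3)] by (auto simp: cadlag_process_def)
  have Xlim: "AE w in M. (\<lambda>n. X (\<eta> n w) w) \<longlonglongrightarrow> X (\<theta>' w) w"
    using S'(8)[unfolded qlc_from_def, rule_format, of \<eta> \<theta>'] \<eta>_st \<eta>r \<eta>_mono lim by auto
  have near: "AE w in M. \<forall>n. \<eta> n w < T \<longrightarrow> Z (\<eta> n w) w \<le> X (\<eta> n w) w + inverse (real (Suc n))"
    using cad AE_space
  proof eventually_elim
    case (elim w)
    show ?case
    proof (intro allI impI)
      fix n assume "\<eta> n w < T"
      then have "(\<lambda>t. Z t w - X t w) (\<eta> n w) \<in> {..inverse (real (Suc n))}"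
        unfolding \<eta>_def
        by (intro cadlag_on_Inf_closed[OF elim(1) closed_atMost sub]) (use g[OF elim(2)] in auto)
      then show "Z (\<eta> n w) w \<le> X (\<eta> n w) w + inverse (real (Suc n))" by simp
    qed
  qed
  \<comment> \<open>Along \<open>\<eta> n\<close> the values of \<open>Z\<close> are only bounded
    above in the limit. The maximum with \<open>R\<close> turns this upper bound into convergence,
    so dominated convergence applies.\<close>
  have maxlim: "AE w in M. (\<lambda>n. max (Z (\<eta> n w) w) (R w)) \<longlonglongrightarrow> R w"
    using near Xlim S'(5) AE_space
  proof eventually_elim
    case (elim w)
    note w = elim(4)
    show ?case
    proof (cases "\<exists>n. \<eta> n w = T")
      case True
      then obtain N where N: "\<eta> N w = T" by auto
      have "\<eta> n w = T" if "n \<ge> N" for n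
        using \<eta>_mono[OF w, unfolded incseq_def] that N \<eta>r[OF w, of n] by (force intro: antisym)
      moreover have "R w = Z T w" using \<eta>_le[OF w, of N] N by (simp add: R_def)
      ultimately show ?thesis by (intro tendsto_eventually eventually_sequentiallyI[of N]) simp
    next
      case False
      then have less: "\<eta> n w < T" for n using \<eta>r[OF w, of n] by (auto simp: less_le)
      have XR: "X (\<theta>' w) w \<le> R w"
        using elim(3) g[OF w] stopping_timesD(3)[OF \<theta>'_st w] by (auto simp: R_def)
      show ?thesis
      proof (rule tendsto_sandwich)
        show "\<forall>\<^sub>F n in sequentially. R w \<le> max (Z (\<eta> n w) w) (R w)" by simp
        show "\<forall>\<^sub>F n in sequentially. max (Z (\<eta> n w) w) (R w) \<le> max (X (\<eta> n w) w + inverse (real (Suc n))) (R w)"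
          using elim(1) less by (intro always_eventually allI max.mono) auto
        have "(\<lambda>n. max (X (\<eta> n w) w + inverse (real (Suc n))) (R w)) \<longlonglongrightarrow> max (X (\<theta>' w) w + 0) (R w)"
          by (intro tendsto_max tendsto_add elim(2) LIMSEQ_inverse_real_of_nat tendsto_const)
        then show "(\<lambda>n. max (X (\<eta> n w) w + inverse (real (Suc n))) (R w)) \<longlonglongrightarrow> R w"
          using XR by (simp add: max_absorb2)
      qed simp
    qed
  qed
  have RZ: "AE w in M. R w \<le> Z (\<theta>' w) w"
    using S'(5) AE_space
  proof eventually_elim
    case (elim w)
    have "\<theta>' w \<in> {\<gamma> w..T}" using stopping_timesD(3)[OF \<theta>'_st elim(2)] \<eta>_le[OF elim(2), of 0] \<eta>r[OF elim(2), of 0] by auto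
    then show ?case using elim(1) by (auto simp: R_def not_less)
  qed
  have Rbd: "AE w in M. \<bar>R w\<bar> \<le> D w"
    using maxlim RZ D(3) AE_space
  proof eventually_elim
    case (elim w)
    have bd: "\<bar>Z (\<eta> n w) w\<bar> \<le> D w" for n using elim(3) stopping_timesD(2,3)[OF \<eta>_st elim(4), of n] by auto
    have "- D w \<le> R w"
    proof (rule LIMSEQ_le_const[OF elim(1)], intro exI allI impI)
      fix n show "- D w \<le> max (Z (\<eta> n w) w) (R w)" using bd[of n] by linarith
    qed
    moreover have "R w \<le> D w" using elim(2,3) stopping_timesD(2,3)[OF \<theta>'_st elim(4)] by force
    ultimately show ?case by auto
  qed
  have Rm: "R \<in> borel_measurable M"
    unfolding R_def using stopping_times_measurable[OF \<theta>'_st] S'(2,3) \<theta>'_st T_nonneg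
    by (intro measurable_If progressive_stopped_M progressive_M) (auto simp: cadlag_process_def)
  have Ri: "integrable M R"
    by (rule Bochner_Integration.integrable_bound[OF D(1) Rm]) (use Rbd D(2) in \<open>auto simp: \<close>)
  have Zi: "integrable M (\<lambda>w. Z (\<sigma> w) w)" if "\<sigma> \<in> stopping_times" for \<sigma>
    by (rule stopped_integrable[OF S'(2,4) that])
  have mlim: "(\<lambda>n. \<integral>w. max (Z (\<eta> n w) w) (R w) \<partial>M) \<longlonglongrightarrow> (\<integral>w. R w \<partial>M)"
  proof (rule integral_dominated_convergence[OF Rm _ D(1) maxlim])
    show "(\<lambda>w. max (Z (\<eta> n w) w) (R w)) \<in> borel_measurable M" for n
      using Zi[OF \<eta>_st[of n]] Rm by auto
    show "AE w in M. norm (max (Z (\<eta> n w) w) (R w)) \<le> D w" for n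
      using Rbd D(3) AE_space
    proof eventually_elim
      case (elim w)
      have bd: "\<bar>Z (\<eta> n w) w\<bar> \<le> D w" using elim(2) stopping_timesD(2,3)[OF \<eta>_st elim(3), of n] by auto
      then show ?case using elim(1) by (simp add: max_def)
    qed
  qed
  have mle: "(\<integral>w. Z (\<gamma> w) w \<partial>M) \<le> (\<integral>w. max (Z (\<eta> n w) w) (R w) \<partial>M)" for n
  proof -
    have "(\<integral>w. Z (\<gamma> w) w \<partial>M) \<le> (\<integral>w. Z (\<eta> n w) w \<partial>M)"
      by (rule near_hitting_martingale[OF S, where e="inverse (real (Suc n))"]) (simp_all add: \<eta>_def)
    also have "\<dots> \<le> (\<integral>w. max (Z (\<eta> n w) w) (R w) \<partial>M)"
      using Zi[OF \<eta>_st] Ri by (intro integral_mono) auto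
    finally show ?thesis .
  qed
  have ZR: "(\<integral>w. Z (\<gamma> w) w \<partial>M) \<le> (\<integral>w. R w \<partial>M)"
    by (rule LIMSEQ_le_const[OF mlim]) (use mle in blast)
  have g\<theta>': "\<gamma> w \<le> \<theta>' w" if "w \<in> space M" for w using \<eta>_le[OF that, of 0] \<eta>r[OF that, of 0] by auto
  have os: "(\<integral>w. Z (\<theta>' w) w * indicator G w \<partial>M) \<le> (\<integral>w. Z (\<gamma> w) w * indicator G w \<partial>M)"
    if "G \<in> sets (pre_sigma \<gamma>)" for G
    by (rule optional_sampling[OF S'(2,4,6,1) \<theta>'_st]) (use g\<theta>' that in auto)
  have Z\<theta>': "(\<integral>w. Z (\<theta>' w) w \<partial>M) \<le> (\<integral>w. Z (\<gamma> w) w \<partial>M)"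
    using os[OF space_in_pre_sigma] by (simp only: integral_indicator_space)
  have RZi: "(\<integral>w. R w \<partial>M) \<le> (\<integral>w. Z (\<theta>' w) w \<partial>M)"
    by (rule integral_mono_AE[OF Ri Zi[OF \<theta>'_st] RZ])
  have "(\<integral>w. Z (\<theta>' w) w - R w \<partial>M) = 0"
    using ZR Z\<theta>' RZi Ri Zi[OF \<theta>'_st] by simp
  then have "AE w in M. Z (\<theta>' w) w - R w = 0"
    using RZ Ri Zi[OF \<theta>'_st] by (subst (asm) integral_nonneg_eq_0_iff_AE) (auto simp: )
  then have eqR: "AE w in M. \<theta>' w < T \<longrightarrow> Z (\<theta>' w) w = X (\<theta>' w) w"
    by eventually_elim (auto simp: R_def)
  \<comment> \<open>Contact makes the gap smaller than every threshold, so no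
    \<open>\<eta> n\<close> comes later than \<open>\<theta>\<close>; conversely
    \<open>\<theta>'\<close> is itself a contact time unless it equals \<open>T\<close>.\<close>
  have eq: "AE w in M. \<theta>' w = \<theta> w"
    using eqR AE_space
  proof eventually_elim
    case (elim w)
    note w = elim(2)
    have "{s\<in>{\<gamma> w..T}. Z s w = X s w} \<subseteq> {\<gamma> w..T}" by auto
    note Inf = Inf_insert_upper[OF this g(2)[OF w], folded \<theta>[OF w]]
    have "\<eta> n w \<le> \<theta> w" for n
      unfolding \<eta>_def \<theta>[OF w] using g[OF w]
      by (intro cInf_superset_mono) (auto intro!: bdd_belowI[of _ "\<gamma> w"])
    then have "\<theta>' w \<le> \<theta> w" using LIMSEQ_le_const2[OF lim[OF w]] by auto
    moreover have "\<theta> w \<le> \<theta>' w"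
    proof (cases "\<theta>' w < T")
      case True
      then show ?thesis using elim(1) g\<theta>'[OF w] by (intro Inf(2)) auto
    next
      case False
      then show ?thesis using Inf(1) by auto
    qed
    ultimately show ?case by simp
  qed
  show "\<theta> \<in> stopping_times"
  proof (rule stopping_times_AE_cong[OF \<theta>'_st eq])
    fix w assume w: "w \<in> space M"
    have "{s\<in>{\<gamma> w..T}. Z s w = X s w} \<subseteq> {\<gamma> w..T}" by auto
    then show "\<theta> w \<in> {0..T}"
      using Inf_insert_upper(1)[OF _ g(2)[OF w], of "{s\<in>{\<gamma> w..T}. Z s w = X s w}", folded \<theta>[OF w]] g[OF w] by auto
  qed
  show "AE w in M. \<theta> w < T \<longrightarrow> Z (\<theta> w) w = X (\<theta> w) w"
    using eq eqR by eventually_elim simp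
  fix G assume G: "G \<in> sets (pre_sigma \<gamma>)"
  \<comment> \<open>Equality of expectations is localised here: optional sampling gives an
    inequality on \<open>G\<close> and one on its complement, and neither can be strict when their
    sum is an equality.\<close>
  have G': "space M - G \<in> sets (pre_sigma \<gamma>)" using sets.compl_sets[OF G] by (simp add: space_pre_sigma)
  have GM: "G \<in> sets M" "space M - G \<in> sets M" using G G' pre_sigma_sets_M[OF S'(1)] sets_F_subset by blast+
  have split: "(\<integral>w. Z (\<sigma> w) w \<partial>M) = (\<integral>w. Z (\<sigma> w) w * indicator G w \<partial>M) + (\<integral>w. Z (\<sigma> w) w * indicator (space M - G) w \<partial>M)"
    if "\<sigma> \<in> stopping_times" for \<sigma>
    by (rule integral_split_indicator[OF Zi[OF that] GM(1)])
  have "(\<integral>w. Z (\<theta>' w) w * indicator G w \<partial>M) = (\<integral>w. Z (\<gamma> w) w * indicator G w \<partial>M)"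
    using os[OF G] os[OF G'] split[OF S'(1)] split[OF \<theta>'_st] ZR RZi by linarith
  moreover have "(\<integral>w. Z (\<theta>' w) w * indicator G w \<partial>M) = (\<integral>w. Z (\<theta> w) w * indicator G w \<partial>M)"
  proof (rule integral_cong_AE)
    show 1: "(\<lambda>w. Z (\<theta>' w) w * indicator G w) \<in> borel_measurable M"
      using stopped_integrable_on[OF S'(2,4) \<theta>'_st GM(1)] by simp
    show 2: "AE w in M. Z (\<theta>' w) w * indicator G w = Z (\<theta> w) w * indicator G w" using eq by eventually_elim simp
    show "(\<lambda>w. Z (\<theta> w) w * indicator G w) \<in> borel_measurable M"
      by (rule measurable_M_AE_cong[OF 1 2]) simp
  qed
  ultimately show "(\<integral>w. Z (\<theta> w) w * indicator G w \<partial>M) = (\<integral>w. Z (\<gamma> w) w * indicator G w \<partial>M)" by simp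
qed

end

section \<open>Snell envelopes from random starting times\<close>

lemma incseq_max_const: "incseq f \<Longrightarrow> incseq (\<lambda>n. max (f n) (c :: real))"
  unfolding incseq_def by (intro allI impI max.mono) auto

context usual_basis
begin

text \<open>The event that \<open>h\<close> takes the value \<open>k\<close> is known at time
  \<open>t k\<close>, when the envelope for \<open>k\<close> begins, so stopping times and test
  events may be chosen separately on each of the finitely many pieces.\<close>

lemma snell_from_mixture:
  fixes h :: "'a \<Rightarrow> 'b" and t :: "'b \<Rightarrow> real"
  assumes fin: "finite (h ` space M)"
    and t: "\<And>w. w \<in> space M \<Longrightarrow> t (h w) \<in> {0..T}"
    and ht: "\<And>k. k \<in> h ` space M \<Longrightarrow> {w\<in>space M. h w = k} \<in> sets (F (t k))"
    and Sk: "\<And>k. k \<in> h ` space M \<Longrightarrow> snell_from (\<lambda>_. t k) (Zk k) (Xk k)"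
    and Z: "cadlag_process Z" "sup_moment2 Z < \<infinity>" and X: "cadlag_process X"
    and \<gamma>: "\<And>w. w \<in> space M \<Longrightarrow> \<gamma> w = t (h w)"
    and eq: "AE w in M. \<forall>s\<in>{\<gamma> w..T}. Z s w = Zk (h w) s w \<and> X s w = Xk (h w) s w"
  shows "snell_from \<gamma> Z X"
proof -
  let ?K = "h ` space M"
  define H where "H k = {w\<in>space M. h w = k}" for k
  note S' = snell_fromD[OF Sk]
  have tk: "t k \<in> {0..T}" if "k \<in> ?K" for k using t that by auto
  have HF: "H k \<in> sets (F s)" if "k \<in> ?K" "t k \<le> s" for k s
    using ht[OF that(1)] sets_F_mono[OF that(2)] unfolding H_def by blast
  have HM: "H k \<in> sets M" if "k \<in> ?K" for k using HF[OF that order_refl] sets_F_subset by blast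
  have \<gamma>st: "\<gamma> \<in> stopping_times"
  proof (rule stopping_timesI)
    show "\<gamma> w \<in> {0..T}" if "w \<in> space M" for w using \<gamma> t that by auto
    fix s
    have "{w\<in>space M. \<gamma> w \<le> s} = (\<Union>k\<in>{k\<in>?K. t k \<le> s}. H k)"
      using \<gamma> by (auto simp: H_def)
    also have "\<dots> \<in> sets (F s)" using fin HF by (intro sets.finite_UN) auto
    finally show "{w\<in>space M. \<gamma> w \<le> s} \<in> sets (F s)" .
  qed
  have Zki: "integrable M (\<lambda>w. Zk k (\<sigma> w) w)" if "k \<in> ?K" "\<sigma> \<in> stopping_times" for k \<sigma>
    by (rule stopped_integrable[OF S'(2,4)[OF that(1)] that(2)])
  have Zkio: "integrable M (\<lambda>w. Zk k (\<sigma> w) w * indicator G w)" if "k \<in> ?K" "\<sigma> \<in> stopping_times" "G \<in> sets M" for k \<sigma> G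
    by (rule stopped_integrable_on[OF S'(2,4)[OF that(1)] that(2,3)])
  have sum_int: "(\<integral>w. Z (r w) w * indicator G w \<partial>M) = (\<Sum>k\<in>?K. \<integral>w. Zk k (\<sigma> k w) w * indicator (G \<inter> H k) w \<partial>M)"
    if r: "r \<in> stopping_times" and G: "G \<in> sets M" and rG: "\<And>w. w \<in> G \<Longrightarrow> \<gamma> w \<le> r w"
      and \<sigma>: "\<And>k. k \<in> ?K \<Longrightarrow> \<sigma> k \<in> stopping_times" "\<And>w k. w \<in> G \<Longrightarrow> h w = k \<Longrightarrow> \<sigma> k w = r w" for r G \<sigma>
  proof -
    have "(\<integral>w. Z (r w) w * indicator G w \<partial>M) = (\<integral>w. (\<Sum>k\<in>?K. Zk k (\<sigma> k w) w * indicator (G \<inter> H k) w) \<partial>M)"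
    proof (rule integral_cong_AE)
      show "(\<lambda>w. Z (r w) w * indicator G w) \<in> borel_measurable M"
        using stopped_integrable_on[OF Z r G] by simp
      show "(\<lambda>w. \<Sum>k\<in>?K. Zk k (\<sigma> k w) w * indicator (G \<inter> H k) w) \<in> borel_measurable M"
        using Zkio \<sigma>(1) G HM by (intro borel_measurable_sum) (auto dest!: borel_measurable_integrable)
      show "AE w in M. Z (r w) w * indicator G w = (\<Sum>k\<in>?K. Zk k (\<sigma> k w) w * indicator (G \<inter> H k) w)"
        using eq AE_space
      proof eventually_elim
        case (elim w)
        show ?case
        proof (cases "w \<in> G")
          case True
          have "(\<Sum>k\<in>?K. Zk k (\<sigma> k w) w * indicator (G \<inter> H k) w) = (\<Sum>k\<in>?K. if k = h w then Zk k (r w) w else 0)"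
            using True elim(2) \<sigma>(2) by (intro sum.cong) (auto simp: H_def indicator_def)
          also have "\<dots> = Zk (h w) (r w) w" using fin elim(2) by (simp add: sum.delta)
          also have "\<dots> = Z (r w) w" using elim(1) rG[OF True] stopping_timesD(3)[OF r elim(2)] by auto
          finally show ?thesis using True by simp
        qed simp
      qed
    qed
    also have "\<dots> = (\<Sum>k\<in>?K. \<integral>w. Zk k (\<sigma> k w) w * indicator (G \<inter> H k) w \<partial>M)"
      using Zkio \<sigma>(1) G HM by (intro Bochner_Integration.integral_sum) auto
    finally show ?thesis .
  qed
  have le: "AE w in M. \<forall>s\<in>{\<gamma> w..T}. X s w \<le> Z s w"
  proof -
    have "AE w in M. \<forall>k\<in>?K. \<forall>s\<in>{t k..T}. Xk k s w \<le> Zk k s w"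
      using S'(5) by (intro AE_finite_allI[OF fin]) auto
    then show ?thesis using eq AE_space
    proof eventually_elim
      case (elim w)
      then show ?case using \<gamma>[OF elim(3)] by auto
    qed
  qed
  have sm: "supermartingale_from \<gamma> Z"
    unfolding supermartingale_from_def
  proof (intro allI impI, elim conjE)
    fix s u A assume su: "0 \<le> s" "s \<le> u" "u \<le> T" and A: "A \<in> sets (F s)" "\<forall>w\<in>A. \<gamma> w \<le> s"
    have AM: "A \<in> sets M" using A sets_F_subset by blast
    have sp: "w \<in> space M" if "w \<in> A" for w using sets.sets_into_space[OF AM] that by blast
    have st: "(\<lambda>_. s) \<in> stopping_times" "(\<lambda>_. u) \<in> stopping_times" using su by (auto intro: const_stopping_times)
    have "(\<integral>w. Z u w * indicator A w \<partial>M) = (\<Sum>k\<in>?K. \<integral>w. Zk k u w * indicator (A \<inter> H k) w \<partial>M)"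
      using A(2) su by (intro sum_int[OF st(2) AM] st(2)) auto
    also have "\<dots> \<le> (\<Sum>k\<in>?K. \<integral>w. Zk k s w * indicator (A \<inter> H k) w \<partial>M)"
    proof (rule sum_mono)
      fix k assume k: "k \<in> ?K"
      show "(\<integral>w. Zk k u w * indicator (A \<inter> H k) w \<partial>M) \<le> (\<integral>w. Zk k s w * indicator (A \<inter> H k) w \<partial>M)"
      proof (cases "A \<inter> H k = {}")
        case False
        then obtain w where "w \<in> A" "w \<in> H k" by blast
        then have "t k \<le> s" using A(2) \<gamma> by (auto simp: H_def)
        then show ?thesis
          using S'(6)[OF k] su A(1) HF[OF k, of s] unfolding supermartingale_from_def by blast
      qed simp
    qed
    also have "\<dots> = (\<integral>w. Z s w * indicator A w \<partial>M)"
      using A(2) by (intro sum_int[OF st(1) AM, symmetric] st(1)) auto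
    finally show "(\<integral>w. Z u w * indicator A w \<partial>M) \<le> (\<integral>w. Z s w * indicator A w \<partial>M)" .
  qed
  have no: "near_optimal \<gamma> Z X"
    unfolding near_optimal_def
  proof (intro allI impI)
    fix e d :: real assume e: "0 < e" and d: "0 < d"
    \<comment> \<open>The tolerance is split evenly over the values of \<open>h\<close>, so that
      losses and probabilities add up to at most \<open>d\<close>.\<close>
    define c where "c = real (card ?K)"
    have "?K \<noteq> {}" using not_empty by blast
    then have c: "0 < c" using fin by (simp add: c_def card_gt_0_iff)
    define good where "good k \<tau> \<longleftrightarrow> \<tau> \<in> stopping_times \<and> (\<forall>w\<in>space M. t k \<le> \<tau> w) \<and>
       (\<integral>w. Zk k (t k) w \<partial>M) - d / c \<le> (\<integral>w. Zk k (\<tau> w) w \<partial>M) \<and>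
       measure M {w\<in>space M. \<tau> w < T \<and> Xk k (\<tau> w) w + e \<le> Zk k (\<tau> w) w} \<le> d / c" for k \<tau>
    have "\<forall>k\<in>?K. \<exists>\<tau>. good k \<tau>"
    proof
      fix k assume "k \<in> ?K"
      from S'(7)[OF this, unfolded near_optimal_def, rule_format, of e "d / c"] e d c
      show "\<exists>\<tau>. good k \<tau>" unfolding good_def by auto
    qed
    from bchoice[OF this] obtain \<tau>k where good: "\<And>k. k \<in> ?K \<Longrightarrow> good k (\<tau>k k)" by blast
    have \<tau>k: "\<And>k. k \<in> ?K \<Longrightarrow> \<tau>k k \<in> stopping_times"
      "\<And>k w. k \<in> ?K \<Longrightarrow> w \<in> space M \<Longrightarrow> t k \<le> \<tau>k k w"
      "\<And>k. k \<in> ?K \<Longrightarrow> (\<integral>w. Zk k (t k) w \<partial>M) - d / c \<le> (\<integral>w. Zk k (\<tau>k k w) w \<partial>M)"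
      "\<And>k. k \<in> ?K \<Longrightarrow> measure M {w\<in>space M. \<tau>k k w < T \<and> Xk k (\<tau>k k w) w + e \<le> Zk k (\<tau>k k w) w} \<le> d / c"
      using good unfolding good_def by blast+
    define \<tau> where "\<tau> w = \<tau>k (h w) w" for w
    have \<tau>ge: "\<gamma> w \<le> \<tau> w" if "w \<in> space M" for w using \<tau>k(2) that \<gamma> by (auto simp: \<tau>_def)
    have \<tau>st: "\<tau> \<in> stopping_times"
    proof (rule stopping_timesI)
      show "\<tau> w \<in> {0..T}" if "w \<in> space M" for w
        using stopping_timesD(2,3)[OF \<tau>k(1)] that by (auto simp: \<tau>_def)
      fix s
      have "{w\<in>space M. \<tau> w \<le> s} = (\<Union>k\<in>{k\<in>?K. t k \<le> s}. H k \<inter> {w\<in>space M. \<tau>k k w \<le> s})"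
        using \<tau>k(2) by (force simp: H_def \<tau>_def)
      also have "\<dots> \<in> sets (F s)" using fin HF stopping_timesD(4)[OF \<tau>k(1)] by (intro sets.finite_UN) auto
      finally show "{w\<in>space M. \<tau> w \<le> s} \<in> sets (F s)" .
    qed
    have tkst: "(\<lambda>_. t k) \<in> stopping_times" if "k \<in> ?K" for k using tk[OF that] by (rule const_stopping_times)
    have "(\<integral>w. Z (\<gamma> w) w * indicator (space M) w \<partial>M) = (\<Sum>k\<in>?K. \<integral>w. Zk k (t k) w * indicator (space M \<inter> H k) w \<partial>M)"
      using \<gamma> tkst by (intro sum_int[OF \<gamma>st]) auto
    also have "\<dots> \<le> (\<Sum>k\<in>?K. (\<integral>w. Zk k (\<tau>k k w) w * indicator (space M \<inter> H k) w \<partial>M) + d / c)"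
    proof (rule sum_mono)
      fix k assume k: "k \<in> ?K"
      have sH: "space M \<inter> H k = H k" by (auto simp: H_def)
      have "space M - H k = space (F (t k)) - H k" by (simp add: space_F)
      then have G: "space M - H k \<in> sets (F (t k))" using HF[OF k order_refl] by auto
      have GM: "space M - H k \<in> sets M" using HM[OF k] by blast
      \<comment> \<open>\<open>\<tau>k k\<close> is nearly optimal on the whole space, but only its
        part on \<open>H k\<close> is used. Since waiting cannot gain anything on the complement,
        the loss on \<open>H k\<close> is at most the total loss.\<close>
      have "(\<integral>w. Zk k (\<tau>k k w) w * indicator (space M - H k) w \<partial>M) \<le> (\<integral>w. Zk k (t k) w * indicator (space M - H k) w \<partial>M)"
      proof (rule optional_sampling[OF S'(2,4,6)[OF k] tkst[OF k] \<tau>k(1)[OF k]])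
        show "space M - H k \<in> sets (pre_sigma (\<lambda>_. t k))" using G pre_sigma_const[OF tk[OF k]] by blast
      qed (use \<tau>k(2)[OF k] in auto)
      moreover have "(\<integral>w. Zk k (\<sigma> w) w \<partial>M) = (\<integral>w. Zk k (\<sigma> w) w * indicator (H k) w \<partial>M) + (\<integral>w. Zk k (\<sigma> w) w * indicator (space M - H k) w \<partial>M)"
        if "\<sigma> \<in> stopping_times" for \<sigma>
        by (rule integral_split_indicator[OF Zki[OF k that] HM[OF k]])
      note this[OF tkst[OF k]] this[OF \<tau>k(1)[OF k]]
      ultimately show "(\<integral>w. Zk k (t k) w * indicator (space M \<inter> H k) w \<partial>M) \<le> (\<integral>w. Zk k (\<tau>k k w) w * indicator (space M \<inter> H k) w \<partial>M) + d / c"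
        using \<tau>k(3)[OF k] unfolding sH by linarith
    qed
    also have "\<dots> = (\<Sum>k\<in>?K. (\<integral>w. Zk k (\<tau>k k w) w * indicator (space M \<inter> H k) w \<partial>M)) + d"
      using c by (simp add: sum.distrib c_def)
    also have "(\<Sum>k\<in>?K. (\<integral>w. Zk k (\<tau>k k w) w * indicator (space M \<inter> H k) w \<partial>M)) = (\<integral>w. Z (\<tau> w) w * indicator (space M) w \<partial>M)"
      using \<tau>ge \<tau>k(1) by (intro sum_int[OF \<tau>st, symmetric]) (auto simp: \<tau>_def)
    finally have 1: "(\<integral>w. Z (\<gamma> w) w \<partial>M) - d \<le> (\<integral>w. Z (\<tau> w) w \<partial>M)" by (simp only: integral_indicator_space)
    define B where "B k = {w\<in>space M. \<tau>k k w < T \<and> Xk k (\<tau>k k w) w + e \<le> Zk k (\<tau>k k w) w}" for k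
    have B: "B k \<in> sets M" if "k \<in> ?K" for k
    proof -
      have "(\<lambda>w. Xk k (\<tau>k k w) w) \<in> borel_measurable M" "(\<lambda>w. Zk k (\<tau>k k w) w) \<in> borel_measurable M" "\<tau>k k \<in> borel_measurable M"
        using S'(2,3)[OF that] \<tau>k(1)[OF that] stopping_times_measurable progressive_stopped_M by (auto simp: cadlag_process_def)
      then show ?thesis unfolding B_def by measurable
    qed
    have "measure M {w\<in>space M. \<tau> w < T \<and> X (\<tau> w) w + e \<le> Z (\<tau> w) w} \<le> measure M (\<Union>k\<in>?K. B k)"
    proof (rule finite_measure_mono_AE)
      show "(\<Union>k\<in>?K. B k) \<in> sets M" using fin B by (intro sets.finite_UN)
      show "AE w in M. w \<in> {w\<in>space M. \<tau> w < T \<and> X (\<tau> w) w + e \<le> Z (\<tau> w) w} \<longrightarrow> w \<in> (\<Union>k\<in>?K. B k)"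
        using eq AE_space
      proof eventually_elim
        case (elim w)
        have "\<tau> w \<in> {\<gamma> w..T}" using \<tau>ge[OF elim(2)] stopping_timesD(3)[OF \<tau>st elim(2)] by simp
        then have "Z (\<tau> w) w = Zk (h w) (\<tau> w) w" "X (\<tau> w) w = Xk (h w) (\<tau> w) w" using elim(1) by blast+
        then show ?case using elim(2) by (auto simp: B_def \<tau>_def)
      qed
    qed
    also have "\<dots> \<le> (\<Sum>k\<in>?K. measure M (B k))"
      using fin B by (intro finite_measure_subadditive_finite) auto
    also have "\<dots> \<le> (\<Sum>k\<in>?K. d / c)" using \<tau>k(4) by (intro sum_mono) (simp add: B_def)
    also have "\<dots> = d" using c by (simp add: c_def)
    finally show "\<exists>\<tau>\<in>stopping_times. (\<forall>w\<in>space M. \<gamma> w \<le> \<tau> w) \<and>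
      (\<integral>w. Z (\<gamma> w) w \<partial>M) - d \<le> (\<integral>w. Z (\<tau> w) w \<partial>M) \<and>
      measure M {w\<in>space M. \<tau> w < T \<and> X (\<tau> w) w + e \<le> Z (\<tau> w) w} \<le> d"
      using \<tau>st \<tau>ge 1 by blast
  qed
  have ql: "qlc_from \<gamma> X"
    unfolding qlc_from_def
  proof (intro allI impI, elim conjE)
    fix \<theta> \<theta>' assume \<theta>: "\<forall>n. \<theta> n \<in> stopping_times"
      "\<forall>w\<in>space M. (\<forall>n. \<gamma> w \<le> \<theta> n w) \<and> incseq (\<lambda>n. \<theta> n w) \<and> (\<lambda>n. \<theta> n w) \<longlonglongrightarrow> \<theta>' w"
    have \<theta>': "\<theta>' \<in> stopping_times" and \<theta>le: "\<And>w n. w \<in> space M \<Longrightarrow> \<theta> n w \<le> \<theta>' w"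
      using incseq_stopping_times[of \<theta> \<theta>'] \<theta> by auto
    \<comment> \<open>The times are raised to at least \<open>t k\<close> so that the property of
      the envelope for \<open>k\<close> applies everywhere; where \<open>h\<close> equals
      \<open>k\<close> this changes nothing.\<close>
    have "AE w in M. (\<lambda>n. Xk k (max (\<theta> n w) (t k)) w) \<longlonglongrightarrow> Xk k (max (\<theta>' w) (t k)) w" if k: "k \<in> ?K" for k
    proof (rule S'(8)[OF k, unfolded qlc_from_def, rule_format], intro conjI allI ballI)
      show "(\<lambda>w. max (\<theta> n w) (t k)) \<in> stopping_times" for n
        using \<theta> tk[OF k] by (intro max_stopping_times const_stopping_times) auto
      fix w assume w: "w \<in> space M"
      show "incseq (\<lambda>n. max (\<theta> n w) (t k))" using \<theta>(2) w by (intro incseq_max_const) auto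
      show "(\<lambda>n. max (\<theta> n w) (t k)) \<longlonglongrightarrow> max (\<theta>' w) (t k)" using \<theta>(2) w by (intro tendsto_max) auto
    qed auto
    then have "AE w in M. \<forall>k\<in>?K. (\<lambda>n. Xk k (max (\<theta> n w) (t k)) w) \<longlonglongrightarrow> Xk k (max (\<theta>' w) (t k)) w"
      by (intro AE_finite_allI[OF fin])
    then show "AE w in M. (\<lambda>n. X (\<theta> n w) w) \<longlonglongrightarrow> X (\<theta>' w) w"
      using eq AE_space
    proof eventually_elim
      case (elim w)
      note w = elim(3)
      have g: "\<gamma> w = t (h w)" using \<gamma>[OF w] .
      have b: "\<theta> n w \<in> {\<gamma> w..T}" for n using \<theta>(2) w stopping_timesD(3)[OF \<theta>(1)[rule_format] w] by auto
      have b': "\<theta>' w \<in> {\<gamma> w..T}" using b[of 0] \<theta>le[OF w, of 0] stopping_timesD(3)[OF \<theta>' w] by auto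
      have m: "max (\<theta> n w) (t (h w)) = \<theta> n w" "max (\<theta>' w) (t (h w)) = \<theta>' w" for n
        using b[of n] b' g by auto
      have "X (\<theta> n w) w = Xk (h w) (\<theta> n w) w" "X (\<theta>' w) w = Xk (h w) (\<theta>' w) w" for n
        using elim(2) b b' by blast+
      moreover have "(\<lambda>n. Xk (h w) (\<theta> n w) w) \<longlonglongrightarrow> Xk (h w) (\<theta>' w) w"
        using elim(1)[rule_format, of "h w"] w unfolding m by blast
      ultimately show ?case by simp
    qed
  qed
  show ?thesis unfolding snell_from_def using \<gamma>st Z X le sm no ql by blast
qed

text \<open>The approximating envelopes start at \<open>\<gamma>l l\<close>, which is never before
  \<open>\<gamma>\<close> and converges to it, so each property is inherited at times after
  \<open>\<gamma>\<close> and reaches \<open>\<gamma>\<close> by right-continuity. Distances are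
  controlled uniformly in time by \<open>d l\<close>, which makes the approximation usable at
  arbitrary stopping times.\<close>

lemma snell_from_limit:
  assumes S: "\<And>l. snell_from (\<gamma>l l) (Zl l) (Xl l)" and \<gamma>: "\<gamma> \<in> stopping_times"
    and Z: "cadlag_process Z" "sup_moment2 Z < \<infinity>" and X: "cadlag_process X"
    and \<gamma>l: "\<And>w l. w \<in> space M \<Longrightarrow> \<gamma> w \<le> \<gamma>l l w" "\<And>w. w \<in> space M \<Longrightarrow> (\<lambda>l. \<gamma>l l w) \<longlonglongrightarrow> \<gamma> w"
    and d: "\<And>l. integrable M (d l)" "(\<lambda>l. \<integral>w. d l w \<partial>M) \<longlonglongrightarrow> 0" "AE w in M. (\<lambda>l. d l w) \<longlonglongrightarrow> 0"
    and bd: "AE w in M. \<forall>l. \<forall>s\<in>{0..T}. \<bar>Zl l s w - Z s w\<bar> \<le> d l w \<and> \<bar>Xl l s w - X s w\<bar> \<le> d l w"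
  shows "snell_from \<gamma> Z X"
proof -
  note S' = snell_fromD[OF S]
  have g: "0 \<le> \<gamma> w" "\<gamma> w \<le> T" "\<gamma>l l w \<le> T" if "w \<in> space M" for w l
    using stopping_timesD(2,3)[OF \<gamma> that] stopping_timesD(3)[OF S'(1) that] by auto
  have gap: "\<bar>(\<integral>w. Zl l (\<tau> w) w * indicator G w \<partial>M) - (\<integral>w. Z (\<tau> w) w * indicator G w \<partial>M)\<bar> \<le> (\<integral>w. d l w \<partial>M)"
    if \<tau>: "\<tau> \<in> stopping_times" and G: "G \<in> sets M" for \<tau> G l
  proof -
    note i = stopped_integrable_on[OF S'(2,4)[of l] \<tau> G] stopped_integrable_on[OF Z \<tau> G]
    have "\<bar>(\<integral>w. Zl l (\<tau> w) w * indicator G w \<partial>M) - (\<integral>w. Z (\<tau> w) w * indicator G w \<partial>M)\<bar>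
       = \<bar>\<integral>w. Zl l (\<tau> w) w * indicator G w - Z (\<tau> w) w * indicator G w \<partial>M\<bar>"
      using i by simp
    also have "\<dots> \<le> (\<integral>w. \<bar>Zl l (\<tau> w) w * indicator G w - Z (\<tau> w) w * indicator G w\<bar> \<partial>M)"
      by (rule integral_abs_bound)
    also have "\<dots> \<le> (\<integral>w. d l w \<partial>M)"
    proof (rule integral_mono_AE)
      show "integrable M (\<lambda>w. \<bar>Zl l (\<tau> w) w * indicator G w - Z (\<tau> w) w * indicator G w\<bar>)" using i by simp
      show "AE w in M. \<bar>Zl l (\<tau> w) w * indicator G w - Z (\<tau> w) w * indicator G w\<bar> \<le> d l w"
        using bd AE_space
      proof eventually_elim
        case (elim w)
        have "\<tau> w \<in> {0..T}" using stopping_timesD(2,3)[OF \<tau> elim(2)] by simp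
        then have "\<bar>Zl l (\<tau> w) w - Z (\<tau> w) w\<bar> \<le> d l w" using elim(1) by blast
        then show ?case by (auto simp: indicator_def)
      qed
    qed (rule d(1))
    finally show ?thesis .
  qed
  have gap1: "\<bar>(\<integral>w. Zl l (\<tau> w) w \<partial>M) - (\<integral>w. Z (\<tau> w) w \<partial>M)\<bar> \<le> (\<integral>w. d l w \<partial>M)"
    if \<tau>: "\<tau> \<in> stopping_times" for \<tau> l
    using gap[OF \<tau> sets.top, of l] by (simp only: integral_indicator_space)
  obtain D where D: "integrable M D" "\<And>w. 0 \<le> D w" "AE w in M. \<forall>s\<in>{0..T}. \<bar>Z s w\<bar> \<le> D w"
    using cadlag_process_bound[OF Z] by blast
  have dct: "(\<lambda>n. \<integral>w. Z (\<tau> n w) w * indicator (G n) w \<partial>M) \<longlonglongrightarrow> (\<integral>w. Z (\<sigma> w) w * indicator A w \<partial>M)"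
    if \<tau>: "\<And>n. \<tau> n \<in> stopping_times" and \<sigma>: "\<sigma> \<in> stopping_times" and G: "\<And>n. G n \<in> sets M" "A \<in> sets M"
      and lim: "AE w in M. (\<lambda>n. Z (\<tau> n w) w * indicator (G n) w) \<longlonglongrightarrow> Z (\<sigma> w) w * indicator A w"
    for \<tau> \<sigma> A and G :: "nat \<Rightarrow> 'a set"
  proof (rule integral_dominated_convergence[OF _ _ D(1) lim])
    show "(\<lambda>w. Z (\<sigma> w) w * indicator A w) \<in> borel_measurable M"
      using stopped_integrable_on[OF Z \<sigma> G(2)] by simp
    show "(\<lambda>w. Z (\<tau> n w) w * indicator (G n) w) \<in> borel_measurable M" for n
      using stopped_integrable_on[OF Z \<tau> G(1)] by simp
    show "AE w in M. norm (Z (\<tau> n w) w * indicator (G n) w) \<le> D w" for n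
      using D(3) AE_space
    proof eventually_elim
      case (elim w)
      have "\<tau> n w \<in> {0..T}" using stopping_timesD(2,3)[OF \<tau> elim(2)] by simp
      then have "\<bar>Z (\<tau> n w) w\<bar> \<le> D w" using elim(1) by blast
      then show ?case using D(2)[of w] by (auto simp: indicator_def)
    qed
  qed
  have Zcad: "AE w in M. cadlag_on T (\<lambda>t. Z t w)" using Z by (auto simp: cadlag_process_def)
  have le: "AE w in M. \<forall>s\<in>{\<gamma> w..T}. X s w \<le> Z s w"
  proof -
    have "AE w in M. \<forall>l. \<forall>s\<in>{\<gamma>l l w..T}. Xl l s w \<le> Zl l s w"
      using S'(5) by (simp add: AE_all_countable)
    moreover have "AE w in M. cadlag_on T (\<lambda>t. X t w - Z t w)"
      using cadlag_process_diff[OF X Z(1)] by (auto simp: cadlag_process_def)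
    ultimately show ?thesis using d(3) bd AE_space
    proof eventually_elim
      case (elim w)
      note w = elim(5)
      \<comment> \<open>The inequality passes to the limit at \<open>s\<close> as soon as the
        approximating envelopes have started by then: eventually if \<open>s\<close> is after
        \<open>\<gamma> w\<close>, and always if \<open>s = T\<close>.\<close>
      have claim: "X s w - Z s w \<le> 0" if s: "s \<in> {0..T}" "\<forall>\<^sub>F l in sequentially. \<gamma>l l w \<le> s" for s
      proof -
        have "\<forall>\<^sub>F l in sequentially. X s w - Z s w \<le> 2 * d l w"
          using s(2)
        proof eventually_elim
          case (elim l)
          have "Xl l s w \<le> Zl l s w" using \<open>\<forall>l. \<forall>s\<in>{\<gamma>l l w..T}. Xl l s w \<le> Zl l s w\<close> elim s(1) by auto
          moreover have "\<bar>Zl l s w - Z s w\<bar> \<le> d l w" "\<bar>Xl l s w - X s w\<bar> \<le> d l w"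
            using \<open>\<forall>l. \<forall>s\<in>{0..T}. \<bar>Zl l s w - Z s w\<bar> \<le> d l w \<and> \<bar>Xl l s w - X s w\<bar> \<le> d l w\<close> s(1) by blast+
          ultimately show ?case by linarith
        qed
        moreover have "(\<lambda>l. 2 * d l w) \<longlonglongrightarrow> 2 * 0" by (intro tendsto_mult tendsto_const elim(3))
        ultimately have "X s w - Z s w \<le> 2 * 0"
          by (intro tendsto_lowerbound[of "\<lambda>l. 2 * d l w"]) auto
        then show ?thesis by simp
      qed
      have later: "X s w - Z s w \<le> 0" if s: "\<gamma> w < s" "s \<le> T" for s
      proof (rule claim)
        show "s \<in> {0..T}" using s g(1)[OF w] by simp
        show "\<forall>\<^sub>F l in sequentially. \<gamma>l l w \<le> s"
          using order_tendstoD(2)[OF \<gamma>l(2)[OF w] s(1)] by (rule eventually_mono) simp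
      qed
      have atT: "X T w - Z T w \<le> 0"
        by (rule claim) (use T_nonneg g(3)[OF w] in auto)
      have "X s w - Z s w \<in> {..0}" if "s \<in> {\<gamma> w..T}" for s
      proof (cases "s = \<gamma> w \<and> s < T")
        case True
        then obtain q where q: "\<And>n. s < q n" "\<And>n. q n < T" "q \<longlonglongrightarrow> s"
          using rat_right_sequence[of s T] by metis
        have "(\<lambda>n. X (q n) w - Z (q n) w) \<longlonglongrightarrow> X s w - Z s w"
        proof (rule cadlag_on_right[OF elim(2) _ _ q(3)])
          show "s \<in> {0..T}" using True g(1)[OF w] by simp
          show "q n \<in> {s..T}" for n using q(1)[of n] q(2)[of n] by simp
        qed
        moreover have "X (q n) w - Z (q n) w \<le> 0" for n using later[of "q n"] q(1)[of n] q(2)[of n] True by simp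
        ultimately have "X s w - Z s w \<le> 0" by (intro LIMSEQ_le_const2[of "\<lambda>n. X (q n) w - Z (q n) w"]) auto
        then show ?thesis by simp
      next
        case False
        then show ?thesis using that later[of s] atT by (cases "s = T") auto
      qed
      then show ?case by auto
    qed
  qed
  have sm: "supermartingale_from \<gamma> Z"
    unfolding supermartingale_from_def
  proof (intro allI impI, elim conjE)
    fix s u A assume su: "0 \<le> s" "s \<le> u" "u \<le> T" and A: "A \<in> sets (F s)" "\<forall>w\<in>A. \<gamma> w \<le> s"
    have AM: "A \<in> sets M" using A sets_F_subset by blast
    have claim: "(\<integral>w. Z u w * indicator A w \<partial>M) \<le> (\<integral>w. Z r w * indicator A w \<partial>M)" if r: "s < r" "r \<le> u" for r
    proof -
      \<comment> \<open>The part of \<open>A\<close> on which the envelope number \<open>l\<close>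
        has started by time \<open>r\<close>. As \<open>r\<close> exceeds \<open>s\<close>, every
        point of \<open>A\<close> eventually belongs to it.\<close>
      define G where "G l = A \<inter> {w\<in>space M. \<gamma>l l w \<le> r}" for l
      have GF: "G l \<in> sets (F r)" for l
        using A(1) sets_F_mono[of s r] r stopping_timesD(4)[OF S'(1)] by (auto simp: G_def)
      have GM: "G l \<in> sets M" for l using GF sets_F_subset by blast
      have st: "(\<lambda>_. x) \<in> stopping_times" if "x \<in> {r, u}" for x using that r su by (auto intro: const_stopping_times)
      have "(\<lambda>l. \<integral>w. Z x w * indicator (G l) w \<partial>M) \<longlonglongrightarrow> (\<integral>w. Z x w * indicator A w \<partial>M)" if x: "x \<in> {r, u}" for x
      proof (rule dct[OF st[OF x] st[OF x] GM AM])
        have "(\<lambda>l. indicator (G l) w :: real) \<longlonglongrightarrow> indicator A w" if w: "w \<in> space M" for w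
        proof (cases "w \<in> A")
          case True
          then have "\<gamma> w < r" using A(2) r by force
          then have "\<forall>\<^sub>F l in sequentially. \<gamma>l l w < r" by (rule order_tendstoD(2)[OF \<gamma>l(2)[OF w]])
          then have "\<forall>\<^sub>F l in sequentially. indicator (G l) w = (indicator A w :: real)"
            by (rule eventually_mono) (use True w in \<open>simp add: G_def\<close>)
          then show ?thesis by (rule tendsto_eventually)
        qed (simp add: G_def)
        then show "AE w in M. (\<lambda>l. Z x w * indicator (G l) w) \<longlonglongrightarrow> Z x w * indicator A w"
          using AE_space by (auto intro!: tendsto_mult tendsto_const elim!: eventually_mono)
      qed
      note lims = this[of u] this[of r]
      have "(\<lambda>l. (\<integral>w. Z r w * indicator (G l) w \<partial>M) + 2 * (\<integral>w. d l w \<partial>M)) \<longlonglongrightarrow> (\<integral>w. Z r w * indicator A w \<partial>M) + 2 * 0"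
        using lims(2) by (intro tendsto_add tendsto_mult tendsto_const d(2)) auto
      moreover have "(\<integral>w. Z u w * indicator (G l) w \<partial>M) \<le> (\<integral>w. Z r w * indicator (G l) w \<partial>M) + 2 * (\<integral>w. d l w \<partial>M)" for l
      proof -
        have "(\<integral>w. Zl l u w * indicator (G l) w \<partial>M) \<le> (\<integral>w. Zl l r w * indicator (G l) w \<partial>M)"
          using S'(6)[of l] r su GF[of l] unfolding supermartingale_from_def by (auto simp: G_def)
        then show ?thesis using gap[OF st GM, of u l l] gap[OF st GM, of r l l] by simp
      qed
      ultimately have "(\<integral>w. Z u w * indicator A w \<partial>M) \<le> (\<integral>w. Z r w * indicator A w \<partial>M) + 2 * 0"
        using lims(1) by (intro LIMSEQ_le[of _ "\<integral>w. Z u w * indicator A w \<partial>M"]) auto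
      then show ?thesis by simp
    qed
    show "(\<integral>w. Z u w * indicator A w \<partial>M) \<le> (\<integral>w. Z s w * indicator A w \<partial>M)"
    proof (cases "s = u")
      case False
      then have "s < u" using su by simp
      then obtain q where q: "\<And>n. s < q n" "\<And>n. q n < u" "q \<longlonglongrightarrow> s"
        using rat_right_sequence[of s u] by metis
      have qT: "q n \<in> {s..T}" for n using q(1)[of n] q(2)[of n] su by simp
      have "(\<lambda>n. \<integral>w. Z (q n) w * indicator A w \<partial>M) \<longlonglongrightarrow> (\<integral>w. Z s w * indicator A w \<partial>M)"
      proof (rule dct)
        show "AE w in M. (\<lambda>n. Z (q n) w * indicator A w) \<longlonglongrightarrow> Z s w * indicator A w"
          using Zcad
        proof eventually_elim
          case (elim w)
          then show ?case using su qT q(3) by (intro tendsto_mult tendsto_const cadlag_on_right[OF elim]) auto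
        qed
        show "(\<lambda>_. q n) \<in> stopping_times" for n using qT[of n] su by (intro const_stopping_times) auto
        show "(\<lambda>_. s) \<in> stopping_times" using su by (intro const_stopping_times) auto
      qed (rule AM)+
      then show ?thesis
        by (rule LIMSEQ_le_const) (use claim q(1,2) less_imp_le in blast)
    qed simp
  qed
  have no: "near_optimal \<gamma> Z X"
    unfolding near_optimal_def
  proof (intro allI impI)
    fix e k :: real assume e: "0 < e" and k: "0 < k"
    have "(\<lambda>l. \<integral>w. Z (\<gamma>l l w) w * indicator (space M) w \<partial>M) \<longlonglongrightarrow> (\<integral>w. Z (\<gamma> w) w * indicator (space M) w \<partial>M)"
    proof (rule dct[OF S'(1) \<gamma>])
      show "AE w in M. (\<lambda>n. Z (\<gamma>l n w) w * indicator (space M) w) \<longlonglongrightarrow> Z (\<gamma> w) w * indicator (space M) w"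
        using Zcad AE_space
      proof eventually_elim
        case (elim w)
        then show ?case using \<gamma>l g by (intro tendsto_mult tendsto_const cadlag_on_right[OF elim(1)]) auto
      qed
    qed simp_all
    then have "\<forall>\<^sub>F l in sequentially. (\<integral>w. Z (\<gamma> w) w \<partial>M) - k / 4 < (\<integral>w. Z (\<gamma>l l w) w \<partial>M)"
      unfolding integral_indicator_space using k by (intro order_tendstoD(1)) auto
    moreover have "\<forall>\<^sub>F l in sequentially. (\<integral>w. d l w \<partial>M) < min (k / 4) (e * k / 8)"
      using e k by (intro order_tendstoD(2)[OF d(2)]) auto
    ultimately have "\<forall>\<^sub>F l in sequentially. (\<integral>w. Z (\<gamma> w) w \<partial>M) - k / 4 < (\<integral>w. Z (\<gamma>l l w) w \<partial>M) \<and> (\<integral>w. d l w \<partial>M) < min (k / 4) (e * k / 8)"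
      by (rule eventually_conj)
    then obtain l where l: "(\<integral>w. Z (\<gamma> w) w \<partial>M) - k / 4 < (\<integral>w. Z (\<gamma>l l w) w \<partial>M)" "(\<integral>w. d l w \<partial>M) < k / 4" "(\<integral>w. d l w \<partial>M) < e * k / 8"
      by (auto simp: eventually_sequentially)
    obtain \<tau> where \<tau>: "\<tau> \<in> stopping_times" "\<And>w. w \<in> space M \<Longrightarrow> \<gamma>l l w \<le> \<tau> w"
      "(\<integral>w. Zl l (\<gamma>l l w) w \<partial>M) - k / 4 \<le> (\<integral>w. Zl l (\<tau> w) w \<partial>M)"
      "measure M {w\<in>space M. \<tau> w < T \<and> Xl l (\<tau> w) w + e / 2 \<le> Zl l (\<tau> w) w} \<le> k / 4"
      using S'(7)[of l, unfolded near_optimal_def, rule_format, of "e / 2" "k / 4"] e k by auto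
    have 1: "(\<integral>w. Z (\<gamma> w) w \<partial>M) - k \<le> (\<integral>w. Z (\<tau> w) w \<partial>M)"
      using l \<tau>(3) gap1[OF \<tau>(1), of l] gap1[OF S'(1), of l l] by linarith
    \<comment> \<open>Off \<open>B\<close> both errors are below \<open>e / 4\<close>, so a gap of
      \<open>e\<close> for the limit is a gap of at least \<open>e / 2\<close> for the
      approximation. Markov's inequality with the mean bound \<open>e * k / 8\<close> gives
      \<open>B\<close> probability at most \<open>k / 2\<close>.\<close>
    define B where "B = {w\<in>space M. e / 4 \<le> d l w}"
    have B: "B \<in> sets M" using d(1)[of l] unfolding B_def by measurable
    have "measure M B = (\<integral>w. indicator B w \<partial>M)" using B by simp
    also have "\<dots> \<le> (\<integral>w. (4 / e) * d l w \<partial>M)"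
    proof (rule integral_mono_AE)
      show "integrable M (indicator B :: 'a \<Rightarrow> real)" using B by (intro integrable_real_indicator) (auto simp: less_top[symmetric])
      show "integrable M (\<lambda>w. (4 / e) * d l w)" using d(1) by simp
      show "AE w in M. indicator B w \<le> (4 / e) * d l w"
        using bd
      proof eventually_elim
        case (elim w)
        then have "\<bar>Zl l 0 w - Z 0 w\<bar> \<le> d l w" using T_nonneg by auto
        then have "0 \<le> d l w" by linarith
        then show ?case using e by (auto simp: B_def indicator_def field_simps)
      qed
    qed
    also have "\<dots> = (4 / e) * (\<integral>w. d l w \<partial>M)" by simp
    also have "\<dots> \<le> (4 / e) * (e * k / 8)" using e l(3) by (intro mult_left_mono) auto
    also have "\<dots> = k / 2" using e by simp
    finally have mB: "measure M B \<le> k / 2" .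
    define C where "C = {w\<in>space M. \<tau> w < T \<and> Xl l (\<tau> w) w + e / 2 \<le> Zl l (\<tau> w) w}"
    have C: "C \<in> sets M"
    proof -
      have "(\<lambda>w. Xl l (\<tau> w) w) \<in> borel_measurable M" "(\<lambda>w. Zl l (\<tau> w) w) \<in> borel_measurable M" "\<tau> \<in> borel_measurable M"
        using S'(2,3)[of l] \<tau>(1) stopping_times_measurable progressive_stopped_M by (auto simp: cadlag_process_def)
      then show ?thesis unfolding C_def by measurable
    qed
    have "measure M {w\<in>space M. \<tau> w < T \<and> X (\<tau> w) w + e \<le> Z (\<tau> w) w} \<le> measure M (B \<union> C)"
    proof (rule finite_measure_mono_AE)
      show "B \<union> C \<in> sets M" using B C by blast
      show "AE w in M. w \<in> {w\<in>space M. \<tau> w < T \<and> X (\<tau> w) w + e \<le> Z (\<tau> w) w} \<longrightarrow> w \<in> B \<union> C"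
        using bd AE_space
      proof eventually_elim
        case (elim w)
        have "\<tau> w \<in> {0..T}" using stopping_timesD(2,3)[OF \<tau>(1) elim(2)] by simp
        then have "\<bar>Zl l (\<tau> w) w - Z (\<tau> w) w\<bar> \<le> d l w" "\<bar>Xl l (\<tau> w) w - X (\<tau> w) w\<bar> \<le> d l w" using elim(1) by blast+
        then show ?case using elim(2) by (auto simp: B_def C_def)
      qed
    qed
    also have "\<dots> \<le> measure M B + measure M C" using B C by (rule measure_Un_le)
    also have "\<dots> \<le> k" using mB \<tau>(4) k unfolding C_def by linarith
    finally have 2: "measure M {w\<in>space M. \<tau> w < T \<and> X (\<tau> w) w + e \<le> Z (\<tau> w) w} \<le> k" .
    have "\<forall>w\<in>space M. \<gamma> w \<le> \<tau> w" using \<gamma>l(1) \<tau>(2) order_trans by blast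
    then show "\<exists>\<tau>\<in>stopping_times. (\<forall>w\<in>space M. \<gamma> w \<le> \<tau> w) \<and>
      (\<integral>w. Z (\<gamma> w) w \<partial>M) - k \<le> (\<integral>w. Z (\<tau> w) w \<partial>M) \<and>
      measure M {w\<in>space M. \<tau> w < T \<and> X (\<tau> w) w + e \<le> Z (\<tau> w) w} \<le> k"
      using \<tau>(1) 1 2 by blast
  qed
  have ql: "qlc_from \<gamma> X"
    unfolding qlc_from_def
  proof (intro allI impI, elim conjE)
    fix \<theta> \<theta>' assume \<theta>: "\<forall>n. \<theta> n \<in> stopping_times"
      "\<forall>w\<in>space M. (\<forall>n. \<gamma> w \<le> \<theta> n w) \<and> incseq (\<lambda>n. \<theta> n w) \<and> (\<lambda>n. \<theta> n w) \<longlonglongrightarrow> \<theta>' w"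
    have \<theta>': "\<theta>' \<in> stopping_times" and \<theta>le: "\<And>w n. w \<in> space M \<Longrightarrow> \<theta> n w \<le> \<theta>' w"
      using incseq_stopping_times[of \<theta> \<theta>'] \<theta> by auto
    have "AE w in M. (\<lambda>n. Xl l (max (\<theta> n w) (\<gamma>l l w)) w) \<longlonglongrightarrow> Xl l (max (\<theta>' w) (\<gamma>l l w)) w" for l
    proof (rule S'(8)[unfolded qlc_from_def, rule_format], intro conjI allI ballI)
      show "(\<lambda>w. max (\<theta> n w) (\<gamma>l l w)) \<in> stopping_times" for n
        using \<theta> S'(1) by (intro max_stopping_times) auto
      fix w assume w: "w \<in> space M"
      show "incseq (\<lambda>n. max (\<theta> n w) (\<gamma>l l w))" using \<theta>(2) w by (intro incseq_max_const) auto
      show "(\<lambda>n. max (\<theta> n w) (\<gamma>l l w)) \<longlonglongrightarrow> max (\<theta>' w) (\<gamma>l l w)" using \<theta>(2) w by (intro tendsto_max) auto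
    qed auto
    then have "AE w in M. \<forall>l. (\<lambda>n. Xl l (max (\<theta> n w) (\<gamma>l l w)) w) \<longlonglongrightarrow> Xl l (max (\<theta>' w) (\<gamma>l l w)) w"
      by (simp add: AE_all_countable)
    then show "AE w in M. (\<lambda>n. X (\<theta> n w) w) \<longlonglongrightarrow> X (\<theta>' w) w"
      using d(3) bd AE_space
    proof eventually_elim
      case (elim w)
      note w = elim(4)
      have r: "\<theta> n w \<in> {0..T}" "\<theta>' w \<in> {0..T}" "\<gamma> w \<le> \<theta> n w" for n
        using stopping_timesD(2,3)[OF _ w] \<theta> \<theta>' w by auto
      show ?case
      \<comment> \<open>If \<open>\<theta>' w\<close> is later than \<open>\<gamma> w\<close>, some
        approximating envelope with small error starts strictly before it and its continuity can be
        used; otherwise all \<open>\<theta> n w\<close> equal \<open>\<gamma> w\<close>.\<close>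
      proof (cases "\<gamma> w < \<theta>' w")
        case True
        show ?thesis
        proof (rule tendstoI)
          fix e :: real assume e: "0 < e"
          have "\<forall>\<^sub>F l in sequentially. \<gamma>l l w < \<theta>' w" by (rule order_tendstoD(2)[OF \<gamma>l(2)[OF w] True])
          moreover have "\<forall>\<^sub>F l in sequentially. d l w < e / 3" using e by (intro order_tendstoD(2)[OF elim(2)]) simp
          ultimately have "\<forall>\<^sub>F l in sequentially. \<gamma>l l w < \<theta>' w \<and> d l w < e / 3" by (rule eventually_conj)
          then obtain l where l: "\<gamma>l l w < \<theta>' w" "d l w < e / 3" by (auto simp: eventually_sequentially)
          have near: "\<bar>Xl l s w - X s w\<bar> < e / 3" if "s \<in> {0..T}" for s
            using elim(3) that l(2) by (meson le_less_trans)
          have "(\<lambda>n. Xl l (max (\<theta> n w) (\<gamma>l l w)) w) \<longlonglongrightarrow> Xl l (\<theta>' w) w"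
            using elim(1)[rule_format, of l] l(1) by (simp add: max_absorb1)
          then have "\<forall>\<^sub>F n in sequentially. dist (Xl l (max (\<theta> n w) (\<gamma>l l w)) w) (Xl l (\<theta>' w) w) < e / 3"
            using e by (intro tendstoD) auto
          moreover have "\<forall>\<^sub>F n in sequentially. \<gamma>l l w < \<theta> n w"
            using \<theta>(2) w by (intro order_tendstoD(1)[OF _ l(1)]) auto
          ultimately show "\<forall>\<^sub>F n in sequentially. dist (X (\<theta> n w) w) (X (\<theta>' w) w) < e"
          proof eventually_elim
            case (elim n)
            then have "\<bar>Xl l (\<theta> n w) w - Xl l (\<theta>' w) w\<bar> < e / 3" by (simp add: max_absorb1 dist_real_def)
            then show ?case using near[OF r(1)[of n]] near[OF r(2)] unfolding dist_real_def by linarith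
          qed
        qed
      next
        case False
        then have "\<theta> n w = \<theta>' w" for n using r(3)[of n] \<theta>le[OF w, of n] by simp
        then show ?thesis by simp
      qed
    qed
  qed
  show ?thesis unfolding snell_from_def using \<gamma> Z X le sm no ql by blast
qed

section \<open>Essential suprema of conditional expectations\<close>

lemma sigma_finite_F: "sigma_finite_subalgebra M (F t)"
proof -
  interpret finite_measure_subalgebra M "F t"
    by unfold_locales (rule subalgebra_F)
  show ?thesis by unfold_locales
qed

lemma cond_exp_set_integral:
  assumes f: "integrable M f" and A: "A \<in> sets (F t)"
  shows "(\<integral>w. f w * indicator A w \<partial>M) = (\<integral>w. real_cond_exp M (F t) f w * indicator A w \<partial>M)"
  using sigma_finite_subalgebra.real_cond_exp_intA[OF sigma_finite_F f A]
  by (simp add: set_lebesgue_integral_def mult.commute)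

lemma integrable_cond_exp: "integrable M f \<Longrightarrow> integrable M (real_cond_exp M (F t) f)"
  by (rule sigma_finite_subalgebra.real_cond_exp_int[OF sigma_finite_F])

lemma integral_cond_exp: "integrable M f \<Longrightarrow> (\<integral>w. real_cond_exp M (F t) f w \<partial>M) = (\<integral>w. f w \<partial>M)"
  by (rule sigma_finite_subalgebra.real_cond_exp_int[OF sigma_finite_F])

lemma cond_exp_F_meas: "integrable M f \<Longrightarrow> f \<in> borel_measurable (F t) \<Longrightarrow> AE w in M. real_cond_exp M (F t) f w = f w"
  by (rule sigma_finite_subalgebra.real_cond_exp_F_meas[OF sigma_finite_F])

lemma cond_exp_cong:
  assumes "AE w in M. f w = g w" "f \<in> borel_measurable M" "g \<in> borel_measurable M"
  shows "AE w in M. real_cond_exp M (F t) f w = real_cond_exp M (F t) g w"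
  by (rule sigma_finite_subalgebra.real_cond_exp_cong[OF sigma_finite_F assms])

text \<open>The conditional expectations of the rewards are directed upwards: two stopping times can be
  pasted along the event that the first of them is the better one.\<close>

lemma paste_stopping_times:
  assumes t: "t \<in> {0..T}" and \<sigma>: "\<sigma> \<in> stopping_times" "\<And>w. w \<in> space M \<Longrightarrow> t \<le> \<sigma> w"
    and \<tau>: "\<tau> \<in> stopping_times" "\<And>w. w \<in> space M \<Longrightarrow> t \<le> \<tau> w"
    and r: "\<And>\<tau>. \<tau> \<in> stopping_times \<Longrightarrow> integrable M (\<lambda>w. r (\<tau> w) w)"
  shows "\<exists>\<rho>\<in>stopping_times. (\<forall>w\<in>space M. t \<le> \<rho> w) \<and>
    (AE w in M. real_cond_exp M (F t) (\<lambda>w. r (\<rho> w) w) w =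
       max (real_cond_exp M (F t) (\<lambda>w. r (\<sigma> w) w) w) (real_cond_exp M (F t) (\<lambda>w. r (\<tau> w) w) w))"
proof -
  define f where "f = real_cond_exp M (F t) (\<lambda>w. r (\<sigma> w) w)"
  define g where "g = real_cond_exp M (F t) (\<lambda>w. r (\<tau> w) w)"
  have fg[measurable]: "f \<in> borel_measurable (F t)" "g \<in> borel_measurable (F t)" by (auto simp: f_def g_def)
  have fgi: "integrable M f" "integrable M g" unfolding f_def g_def by (rule integrable_cond_exp[OF r]; fact)+
  define B where "B = {w\<in>space (F t). g w \<le> f w}"
  have B: "B \<in> sets (F t)" unfolding B_def by measurable
  define B' where "B' = space M - B"
  have B': "B' \<in> sets (F t)" using sets.compl_sets[OF B] by (simp add: B'_def space_F)
  define \<rho> where "\<rho> w = (if w \<in> B then \<sigma> w else \<tau> w)" for w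
  have \<rho>: "\<rho> \<in> stopping_times"
  proof (rule stopping_timesI)
    show "\<rho> w \<in> {0..T}" if "w \<in> space M" for w
      using stopping_timesD(2,3)[OF \<sigma>(1) that] stopping_timesD(2,3)[OF \<tau>(1) that] by (simp add: \<rho>_def)
    fix s
    show "{w\<in>space M. \<rho> w \<le> s} \<in> sets (F s)"
    proof (cases "t \<le> s")
      case True
      have "{w\<in>space M. \<rho> w \<le> s} = (B \<inter> {w\<in>space M. \<sigma> w \<le> s}) \<union> (B' \<inter> {w\<in>space M. \<tau> w \<le> s})"
        by (auto simp: \<rho>_def B'_def)
      moreover have "B \<in> sets (F s)" "B' \<in> sets (F s)" using B B' sets_F_mono[OF True] by blast+
      ultimately show ?thesis using stopping_timesD(4)[OF \<sigma>(1), of s] stopping_timesD(4)[OF \<tau>(1), of s] by simp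
    next
      case False
      then have "{w\<in>space M. \<rho> w \<le> s} = {}" using \<sigma>(2) \<tau>(2) by (force simp: \<rho>_def)
      then show ?thesis by (simp only: sets.empty_sets)
    qed
  qed
  have "AE w in M. real_cond_exp M (F t) (\<lambda>w. r (\<rho> w) w) w = max (f w) (g w)"
  proof (rule sigma_finite_subalgebra.real_cond_exp_charact[OF sigma_finite_F])
    show "integrable M (\<lambda>w. r (\<rho> w) w)" by (rule r[OF \<rho>])
    show "integrable M (\<lambda>w. max (f w) (g w))" using fgi by simp
    show "(\<lambda>w. max (f w) (g w)) \<in> borel_measurable (F t)" by measurable
    fix A assume A: "A \<in> sets (F t)"
    have AB: "A \<inter> B \<in> sets (F t)" "A \<inter> B' \<in> sets (F t)" using A B B' by auto
    have ABM: "A \<inter> B \<in> sets M" "A \<inter> B' \<in> sets M" using AB sets_F_subset by blast+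
    have spl: "indicator A w = (indicator (A \<inter> B) w + indicator (A \<inter> B') w :: real)" if "w \<in> space M" for w
      using that by (auto simp: B'_def indicator_def)
    note im = integrable_real_mult_indicator[OF ABM(1)] integrable_real_mult_indicator[OF ABM(2)]
    have "(\<integral>w. r (\<rho> w) w * indicator A w \<partial>M) = (\<integral>w. r (\<sigma> w) w * indicator (A \<inter> B) w + r (\<tau> w) w * indicator (A \<inter> B') w \<partial>M)"
      by (intro Bochner_Integration.integral_cong) (auto simp: \<rho>_def B'_def indicator_def)
    also have "\<dots> = (\<integral>w. r (\<sigma> w) w * indicator (A \<inter> B) w \<partial>M) + (\<integral>w. r (\<tau> w) w * indicator (A \<inter> B') w \<partial>M)"
      by (rule Bochner_Integration.integral_add[OF im(1)[OF r[OF \<sigma>(1)]] im(2)[OF r[OF \<tau>(1)]]])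
    also have "\<dots> = (\<integral>w. f w * indicator (A \<inter> B) w \<partial>M) + (\<integral>w. g w * indicator (A \<inter> B') w \<partial>M)"
      unfolding f_def g_def cond_exp_set_integral[OF r[OF \<sigma>(1)] AB(1)] cond_exp_set_integral[OF r[OF \<tau>(1)] AB(2)] ..
    also have "\<dots> = (\<integral>w. f w * indicator (A \<inter> B) w + g w * indicator (A \<inter> B') w \<partial>M)"
      by (rule Bochner_Integration.integral_add[symmetric, OF im(1)[OF fgi(1)] im(2)[OF fgi(2)]])
    also have "\<dots> = (\<integral>w. max (f w) (g w) * indicator A w \<partial>M)"
      by (intro Bochner_Integration.integral_cong) (auto simp: B_def B'_def indicator_def space_F)
    finally show "(\<integral>w\<in>A. r (\<rho> w) w \<partial>M) = (\<integral>w\<in>A. max (f w) (g w) \<partial>M)"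
      by (simp add: set_lebesgue_integral_def mult.commute)
  qed
  moreover have "\<forall>w\<in>space M. t \<le> \<rho> w" using \<sigma>(2) \<tau>(2) by (simp add: \<rho>_def)
  ultimately show ?thesis unfolding f_def g_def using \<rho> by blast
qed

text \<open>Pasting yields stopping times whose conditional rewards increase and whose expected
  rewards tend to the supremum \<open>a\<close>. Their limit \<open>L\<close> dominates every
  conditional reward: one that exceeds it on an event of positive probability would, after taking
  the maximum, push the expectation above \<open>a\<close>. By minimality of the essential supremum
  \<open>Yt\<close> lies below \<open>L\<close>, so the increasing sequence exhausts
  \<open>Yt\<close>.\<close>

lemma ess_sup_near_attained:
  assumes t: "t \<in> {0..T}" and r: "\<And>\<tau>. \<tau> \<in> stopping_times \<Longrightarrow> integrable M (\<lambda>w. r (\<tau> w) w)"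
    and Yt: "integrable M Yt"
    and ess: "is_ess_sup M {real_cond_exp M (F t) (\<lambda>w. r (\<tau> w) w) |\<tau>. \<tau> \<in> stopping_times_from (\<lambda>_. t)} Yt"
    and d: "0 < d"
  shows "\<exists>\<tau>\<in>stopping_times. (\<forall>w\<in>space M. t \<le> \<tau> w) \<and> (\<integral>w. Yt w \<partial>M) - d \<le> (\<integral>w. r (\<tau> w) w \<partial>M)"
proof -
  define S where "S = {\<tau>\<in>stopping_times. \<forall>w\<in>space M. t \<le> \<tau> w}"
  define C where "C \<tau> = real_cond_exp M (F t) (\<lambda>w. r (\<tau> w) w)" for \<tau>
  define E where "E \<tau> = (\<integral>w. r (\<tau> w) w \<partial>M)" for \<tau>
  have Sst: "\<tau> \<in> stopping_times" if "\<tau> \<in> S" for \<tau> using that by (simp add: S_def)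
  have CY: "AE w in M. C \<tau> w \<le> Yt w" if "\<tau> \<in> S" for \<tau>
  proof -
    have "\<tau> \<in> stopping_times_from (\<lambda>_. t)" using that by (auto simp: S_def stopping_times_from_def)
    then show ?thesis using ess unfolding is_ess_sup_def C_def by blast
  qed
  have Ci: "integrable M (C \<tau>)" if "\<tau> \<in> S" for \<tau> unfolding C_def by (rule integrable_cond_exp[OF r[OF Sst[OF that]]])
  have CE: "(\<integral>w. C \<tau> w \<partial>M) = E \<tau>" if "\<tau> \<in> S" for \<tau> unfolding C_def E_def by (rule integral_cond_exp[OF r[OF Sst[OF that]]])
  have EY: "E \<tau> \<le> (\<integral>w. Yt w \<partial>M)" if "\<tau> \<in> S" for \<tau>
    unfolding CE[OF that, symmetric] by (rule integral_mono_AE[OF Ci[OF that] Yt CY[OF that]])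
  have tS: "(\<lambda>_. t) \<in> S" using const_stopping_times[OF t] by (simp add: S_def)
  have bdd: "bdd_above (E ` S)" using EY by (intro bdd_aboveI[of _ "\<integral>w. Yt w \<partial>M"]) auto
  define a where "a = Sup (E ` S)"
  have Ea: "E \<tau> \<le> a" if "\<tau> \<in> S" for \<tau> unfolding a_def using bdd that by (intro cSup_upper) auto
  have "\<exists>\<tau>\<in>S. a - inverse (real (Suc n)) < E \<tau>" for n
    using less_cSup_iff[of "E ` S" "a - inverse (real (Suc n))"] bdd tS by (auto simp: a_def[symmetric])
  then obtain T0 where T0: "\<And>n. T0 n \<in> S" "\<And>n. a - inverse (real (Suc n)) < E (T0 n)" by metis
  have "\<exists>\<rho>\<in>S. AE w in M. C \<rho> w = max (C \<sigma> w) (C \<tau> w)" if "\<sigma> \<in> S" "\<tau> \<in> S" for \<sigma> \<tau>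
  proof -
    have "\<exists>\<rho>\<in>stopping_times. (\<forall>w\<in>space M. t \<le> \<rho> w) \<and> (AE w in M. C \<rho> w = max (C \<sigma> w) (C \<tau> w))"
      unfolding C_def by (rule paste_stopping_times[OF t]) (use that r in \<open>auto simp: S_def\<close>)
    then show ?thesis unfolding S_def by blast
  qed
  then have "\<forall>\<sigma>\<in>S. \<forall>\<tau>\<in>S. \<exists>\<rho>. \<rho> \<in> S \<and> (AE w in M. C \<rho> w = max (C \<sigma> w) (C \<tau> w))" by blast
  then obtain J where J: "\<And>\<sigma> \<tau>. \<sigma> \<in> S \<Longrightarrow> \<tau> \<in> S \<Longrightarrow> J \<sigma> \<tau> \<in> S \<and> (AE w in M. C (J \<sigma> \<tau>) w = max (C \<sigma> w) (C \<tau> w))"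
    by (subst (asm) bchoice_iff, subst (asm) bchoice_iff) blast
  \<comment> \<open>The maximising sequence \<open>T0\<close> is made increasing by pasting each of
    its terms onto what has been built so far.\<close>
  define \<sigma> where "\<sigma> = rec_nat (T0 0) (\<lambda>n \<tau>. J \<tau> (T0 (Suc n)))"
  have \<sigma>0: "\<sigma> 0 = T0 0" and \<sigma>Suc: "\<sigma> (Suc n) = J (\<sigma> n) (T0 (Suc n))" for n by (simp_all add: \<sigma>_def)
  have \<sigma>S: "\<sigma> n \<in> S" for n by (induction n) (use T0(1) J in \<open>auto simp: \<sigma>0 \<sigma>Suc\<close>)
  have inc: "AE w in M. \<forall>n. C (\<sigma> n) w \<le> C (\<sigma> (Suc n)) w"
    unfolding AE_all_countable
  proof
    fix n
    have "AE w in M. C (\<sigma> (Suc n)) w = max (C (\<sigma> n) w) (C (T0 (Suc n)) w)"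
      using J[OF \<sigma>S T0(1)] by (simp add: \<sigma>Suc)
    then show "AE w in M. C (\<sigma> n) w \<le> C (\<sigma> (Suc n)) w" by eventually_elim simp
  qed
  have E\<sigma>: "a - inverse (real (Suc n)) \<le> E (\<sigma> n)" for n
  proof (cases n)
    case 0
    then show ?thesis using T0(2)[of 0] by (simp add: \<sigma>0)
  next
    case (Suc k)
    have "AE w in M. C (T0 n) w \<le> C (\<sigma> n) w"
      using J[OF \<sigma>S[of k] T0(1)[of n], THEN conjunct2] unfolding Suc \<sigma>Suc by eventually_elim simp
    then have "E (T0 n) \<le> E (\<sigma> n)"
      unfolding CE[OF \<sigma>S, symmetric] CE[OF T0(1), symmetric]
      by (rule integral_mono_AE[OF Ci[OF T0(1)] Ci[OF \<sigma>S]])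
    then show ?thesis using T0(2)[of n] by simp
  qed
  define L where "L w = (SUP n. C (\<sigma> n) w)" for w
  have lim: "AE w in M. (\<lambda>n. C (\<sigma> n) w) \<longlonglongrightarrow> L w"
  proof -
    have "AE w in M. \<forall>n. C (\<sigma> n) w \<le> Yt w" using CY[OF \<sigma>S] by (simp add: AE_all_countable)
    then show ?thesis using inc
    proof eventually_elim
      case (elim w)
      show ?case unfolding L_def
        using elim by (intro LIMSEQ_incseq_SUP bdd_aboveI[of _ "Yt w"]) (auto intro: incseq_SucI)
    qed
  qed
  have Cm: "C \<tau> \<in> borel_measurable M" for \<tau> unfolding C_def by simp
  have Lm: "L \<in> borel_measurable M"
  proof -
    have "(\<lambda>w. lim (\<lambda>n. C (\<sigma> n) w)) \<in> borel_measurable M" using Cm by measurable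
    then show ?thesis by (rule measurable_M_AE_cong) (use lim in \<open>auto elim!: eventually_mono simp: limI\<close>)
  qed
  define bd where "bd w = \<bar>C (\<sigma> 0) w\<bar> + \<bar>Yt w\<bar>" for w
  have bd: "integrable M bd" unfolding bd_def using Ci[OF \<sigma>S] Yt by simp
  have between: "AE w in M. \<forall>n. C (\<sigma> 0) w \<le> C (\<sigma> n) w \<and> C (\<sigma> n) w \<le> Yt w"
  proof -
    have "AE w in M. \<forall>n. C (\<sigma> n) w \<le> Yt w" using CY[OF \<sigma>S] by (simp add: AE_all_countable)
    then show ?thesis using inc
    proof eventually_elim
      case (elim w)
      have "C (\<sigma> 0) w \<le> C (\<sigma> n) w" for n
        by (induction n) (use elim(2) order_trans in blast)+
      then show ?case using elim(1) by blast
    qed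
  qed
  have key: "AE w in M. C \<tau> w \<le> L w" if \<tau>: "\<tau> \<in> S" for \<tau>
  proof -
    have 1: "(\<lambda>n. \<integral>w. C (\<sigma> n) w \<partial>M) \<longlonglongrightarrow> (\<integral>w. L w \<partial>M)"
    proof (rule integral_dominated_convergence[OF Lm Cm bd lim])
      show "AE w in M. norm (C (\<sigma> n) w) \<le> bd w" for n
        using between
      proof eventually_elim
        case (elim w)
        then have "C (\<sigma> 0) w \<le> C (\<sigma> n) w" "C (\<sigma> n) w \<le> Yt w" by blast+
        then show ?case by (auto simp: bd_def)
      qed
    qed
    have 2: "(\<lambda>n. \<integral>w. max (C (\<sigma> n) w) (C \<tau> w) \<partial>M) \<longlonglongrightarrow> (\<integral>w. max (L w) (C \<tau> w) \<partial>M)"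
    proof (rule integral_dominated_convergence[where w="\<lambda>w. bd w + \<bar>C \<tau> w\<bar>"])
      show "AE w in M. (\<lambda>n. max (C (\<sigma> n) w) (C \<tau> w)) \<longlonglongrightarrow> max (L w) (C \<tau> w)"
        using lim by eventually_elim (intro tendsto_max tendsto_const)
      show "AE w in M. norm (max (C (\<sigma> n) w) (C \<tau> w)) \<le> bd w + \<bar>C \<tau> w\<bar>" for n
        using between
      proof eventually_elim
        case (elim w)
        then have "C (\<sigma> 0) w \<le> C (\<sigma> n) w" "C (\<sigma> n) w \<le> Yt w" by blast+
        then show ?case by (auto simp: bd_def max_def)
      qed
    qed (use Lm Cm bd Ci[OF \<tau>] in auto)
    have Li: "integrable M L"
    proof (rule Bochner_Integration.integrable_bound[OF bd Lm])
      show "AE w in M. norm (L w) \<le> norm (bd w)"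
        using between lim
      proof eventually_elim
        case (elim w)
        have "C (\<sigma> 0) w \<le> L w" by (rule LIMSEQ_le_const[OF elim(2)]) (use elim(1) in blast)
        moreover have "L w \<le> Yt w" by (rule LIMSEQ_le_const2[OF elim(2)]) (use elim(1) in blast)
        ultimately show ?case by (auto simp: bd_def)
      qed
    qed
    have "(\<lambda>n. a - inverse (real (Suc n))) \<longlonglongrightarrow> a - 0"
      by (intro tendsto_diff tendsto_const LIMSEQ_inverse_real_of_nat)
    then have "a - 0 \<le> (\<integral>w. L w \<partial>M)"
      by (rule LIMSEQ_le[OF _ 1]) (use E\<sigma> CE[OF \<sigma>S] in auto)
    \<comment> \<open>The maximum with \<open>C \<tau>\<close> is again the conditional reward of a
      pasted stopping time, hence its expectation cannot exceed \<open>a\<close>.\<close>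
    moreover have "(\<integral>w. max (L w) (C \<tau> w) \<partial>M) \<le> a"
    proof (rule LIMSEQ_le_const2[OF 2], intro exI allI impI)
      fix n
      have "(\<integral>w. max (C (\<sigma> n) w) (C \<tau> w) \<partial>M) = (\<integral>w. C (J (\<sigma> n) \<tau>) w \<partial>M)"
        using J[OF \<sigma>S \<tau>, of n] Cm by (intro integral_cong_AE) (auto elim!: eventually_mono)
      also have "\<dots> \<le> a" using J[OF \<sigma>S \<tau>, of n] CE Ea by auto
      finally show "(\<integral>w. max (C (\<sigma> n) w) (C \<tau> w) \<partial>M) \<le> a" .
    qed
    ultimately have "(\<integral>w. max (L w) (C \<tau> w) - L w \<partial>M) \<le> 0" using Li Ci[OF \<tau>] by simp
    moreover have "0 \<le> (\<integral>w. max (L w) (C \<tau> w) - L w \<partial>M)" by (rule integral_nonneg_AE) simp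
    ultimately have "(\<integral>w. max (L w) (C \<tau> w) - L w \<partial>M) = 0" by simp
    then have "AE w in M. max (L w) (C \<tau> w) - L w = 0"
      using Li Ci[OF \<tau>] by (subst (asm) integral_nonneg_eq_0_iff_AE) auto
    then show ?thesis by eventually_elim simp
  qed
  have "AE w in M. Yt w \<le> L w"
  proof -
    have "AE w in M. X w \<le> L w"
      if "X \<in> {real_cond_exp M (F t) (\<lambda>w. r (\<tau> w) w) |\<tau>. \<tau> \<in> stopping_times_from (\<lambda>_. t)}" for X
    proof -
      obtain \<tau> where \<tau>: "\<tau> \<in> stopping_times" "AE w in M. t \<le> \<tau> w" "X = C \<tau>"
        using \<open>X \<in> _\<close> by (auto simp: stopping_times_from_def C_def)
      \<comment> \<open>Admissible times are at least \<open>t\<close> only almost surely; raising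
        them to \<open>t\<close> changes the reward on a null set and brings them into
        \<open>S\<close>.\<close>
      define \<rho> where "\<rho> w = max (\<tau> w) t" for w
      have \<rho>: "\<rho> \<in> stopping_times" unfolding \<rho>_def by (intro max_stopping_times \<tau>(1) const_stopping_times t)
      have "AE w in M. r (\<rho> w) w = r (\<tau> w) w" using \<tau>(2) by eventually_elim (simp add: \<rho>_def max_absorb1)
      then have "AE w in M. C \<rho> w = C \<tau> w"
        unfolding C_def by (rule cond_exp_cong) (use r[OF \<rho>] r[OF \<tau>(1)] in auto)
      moreover have "\<rho> \<in> S" using \<rho> by (simp add: S_def \<rho>_def)
      note key[OF this]
      ultimately show ?thesis unfolding \<tau>(3) by eventually_elim simp
    qed
    then show ?thesis using ess Lm unfolding is_ess_sup_def by blast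
  qed
  then have ae: "AE w in M. (\<lambda>n. C (\<sigma> n) w) \<longlonglongrightarrow> Yt w"
    using lim between
  proof eventually_elim
    case (elim w)
    have "L w \<le> Yt w" by (rule LIMSEQ_le_const2[OF elim(2)]) (use elim(3) in blast)
    then show ?case using elim by simp
  qed
  have "(\<lambda>n. \<integral>w. C (\<sigma> n) w \<partial>M) \<longlonglongrightarrow> (\<integral>w. Yt w \<partial>M)"
  proof (rule integral_dominated_convergence[OF _ Cm bd ae])
    show "AE w in M. norm (C (\<sigma> n) w) \<le> bd w" for n
      using between
    proof eventually_elim
      case (elim w)
      then have "C (\<sigma> 0) w \<le> C (\<sigma> n) w" "C (\<sigma> n) w \<le> Yt w" by blast+
      then show ?case by (auto simp: bd_def)
    qed
  qed (use Yt in auto)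
  then have "\<forall>\<^sub>F n in sequentially. (\<integral>w. Yt w \<partial>M) - d < (\<integral>w. C (\<sigma> n) w \<partial>M)"
    using d by (intro order_tendstoD(1)) auto
  then obtain n where "(\<integral>w. Yt w \<partial>M) - d < (\<integral>w. C (\<sigma> n) w \<partial>M)" by (auto simp: eventually_sequentially)
  then show ?thesis using \<sigma>S[of n] CE[OF \<sigma>S] by (intro bexI[of _ "\<sigma> n"]) (auto simp: S_def E_def)
qed

end

section \<open>Histories and verification families\<close>

lemma tendsto_Max:
  fixes f :: "'b \<Rightarrow> 'c \<Rightarrow> real"
  assumes "finite B" "B \<noteq> {}" "\<And>b. b \<in> B \<Longrightarrow> (f b \<longlongrightarrow> l b) G"
  shows "((\<lambda>x. Max ((\<lambda>b. f b x) ` B)) \<longlongrightarrow> Max (l ` B)) G"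
  using assms
proof (induction B rule: finite_ne_induct)
  case (insert b B)
  have "((\<lambda>x. max (f b x) (Max ((\<lambda>b. f b x) ` B))) \<longlongrightarrow> max (l b) (Max (l ` B))) G"
    using insert by (intro tendsto_max) auto
  then show ?case using insert.hyps by simp
qed simp

lemma integrable_Max:
  fixes f :: "'b \<Rightarrow> 'c \<Rightarrow> real"
  assumes "finite B" "B \<noteq> {}" "\<And>b. b \<in> B \<Longrightarrow> integrable M (f b)"
  shows "integrable M (\<lambda>x. Max ((\<lambda>b. f b x) ` B))"
  using assms
proof (induction B rule: finite_ne_induct)
  case (insert b B)
  have "integrable M (\<lambda>x. max (f b x) (Max ((\<lambda>b. f b x) ` B)))"
    using insert by (intro Bochner_Integration.integrable_max) auto
  then show ?case using insert.hyps by simp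
qed simp

lemma is_ess_sup_measurable: "is_ess_sup M S Z \<Longrightarrow> Z \<in> borel_measurable M"
  by (simp add: is_ess_sup_def)

lemma is_ess_sup_upper: "is_ess_sup M S Z \<Longrightarrow> X \<in> S \<Longrightarrow> AE w in M. X w \<le> Z w"
  by (simp add: is_ess_sup_def)

lemma is_ess_sup_least:
  "is_ess_sup M S Z \<Longrightarrow> Z' \<in> borel_measurable M \<Longrightarrow> (\<And>X. X \<in> S \<Longrightarrow> AE w in M. X w \<le> Z' w) \<Longrightarrow> AE w in M. Z w \<le> Z' w"
  by (simp add: is_ess_sup_def)

lemma plan_of_nth: "plan_of h i = (if i < length h then Some (h ! i) else None)"
  by (simp add: plan_of_def append_plan_def)

lemma plans_None_mono:
  assumes d: "d \<in> plans T m b" and i: "d i = None" "i \<le> j"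
  shows "d j = None"
  using i(2)
proof (induction j rule: dec_induct)
  case (step j)
  have "case d j of None \<Rightarrow> d (Suc j) = None | Some (t, b') \<Rightarrow> t \<in> {0..T} \<and> b' \<in> alternatives m (prev_mode b d j) \<and>
         (\<forall>k<j. d k \<noteq> None \<and> fst (the (d k)) \<le> t)"
    using d unfolding plans_def by blast
  then show ?case using step.IH by simp
qed (rule i(1))

lemma history_of_plan_of: "history_of (plan_of h) = h"
proof -
  have "(LEAST i. plan_of h i = None) = length h"
    by (rule Least_equality) (auto simp: plan_of_nth split: if_splits)
  then show ?thesis unfolding history_of_def by (auto simp: plan_of_nth intro!: nth_equalityI)
qed

context switching_problem
begin

lemma histories_iff:
  "h \<in> histories \<longleftrightarrow> (\<forall>i<length h. fst (h ! i) \<in> {0..T} \<and>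
     snd (h ! i) \<in> alternatives m (if i = 0 then b0 else snd (h ! (i - 1))) \<and> (\<forall>k<i. fst (h ! k) \<le> fst (h ! i)))"
    (is "_ \<longleftrightarrow> (\<forall>i<length h. ?P i)")
proof -
  have "h \<in> histories \<longleftrightarrow> (\<forall>i. case plan_of h i of None \<Rightarrow> plan_of h (Suc i) = None
     | Some (t, b') \<Rightarrow> t \<in> {0..T} \<and> b' \<in> alternatives m (prev_mode b0 (plan_of h) i) \<and>
         (\<forall>k<i. plan_of h k \<noteq> None \<and> fst (the (plan_of h k)) \<le> t))"
    by (simp add: histories_def plans_def)
  also have "\<dots> \<longleftrightarrow> (\<forall>i<length h. ?P i)"
  proof (intro iff_allI)
    fix i
    have pm: "prev_mode b0 (plan_of h) i = (if i = 0 then b0 else snd (h ! (i - 1)))" if "i < length h"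
      using that by (cases i) (simp_all add: prev_mode_def plan_of_nth)
    show "(case plan_of h i of None \<Rightarrow> plan_of h (Suc i) = None
     | Some (t, b') \<Rightarrow> t \<in> {0..T} \<and> b' \<in> alternatives m (prev_mode b0 (plan_of h) i) \<and>
         (\<forall>k<i. plan_of h k \<noteq> None \<and> fst (the (plan_of h k)) \<le> t)) \<longleftrightarrow> (i < length h \<longrightarrow> ?P i)"
    proof (cases "i < length h")
      case True
      have "plan_of h k = Some (h ! k)" if "k \<le> i" for k using True that by (simp add: plan_of_nth)
      then show ?thesis using True unfolding pm[OF True] by (simp add: plan_of_nth split: prod.split)
    qed (simp add: plan_of_nth)
  qed
  finally show ?thesis .
qed

lemma histories_Nil: "[] \<in> histories"
  by (simp add: histories_iff)

lemma last_time_range: "h \<in> histories \<Longrightarrow> last_time h \<in> {0..T}"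
  using T_nonneg by (auto simp: last_time_def histories_iff last_conv_nth)

lemma last_mode_range: "h \<in> histories \<Longrightarrow> last_mode h \<in> {1..m}"
proof (cases "h = []")
  case False
  assume "h \<in> histories"
  then have "snd (h ! (length h - 1)) \<in> {1..m}" using False unfolding histories_iff by fastforce
  then show ?thesis using False by (simp add: last_mode_def last_conv_nth)
qed (use b0_mode in \<open>simp add: last_mode_def\<close>)

lemma histories_snoc:
  "h @ [(t, b)] \<in> histories \<longleftrightarrow> h \<in> histories \<and> last_time h \<le> t \<and> t \<le> T \<and> b \<in> alternatives m (last_mode h)"
proof -
  let ?n = "length h" and ?h = "h @ [(t, b)]"
  have "?h \<in> histories \<longleftrightarrow> h \<in> histories \<and> t \<in> {0..T} \<and> b \<in> alternatives m (if ?n = 0 then b0 else snd (h ! (?n - 1))) \<and> (\<forall>k<?n. fst (h ! k) \<le> t)"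
  proof -
    let ?P = "\<lambda>h i. fst (h ! i) \<in> {0..T} \<and> snd (h ! i) \<in> alternatives m (if i = 0 then b0 else snd (h ! (i - 1))) \<and> (\<forall>k<i. fst (h ! k) \<le> fst (h ! i))"
    have 1: "?P ?h i \<longleftrightarrow> ?P h i" if "i < ?n" for i
    proof -
      have "?h ! k = h ! k" if "k \<le> i" for k using \<open>i < ?n\<close> that by (simp add: nth_append)
      then show ?thesis by simp
    qed
    have 2: "?P ?h ?n \<longleftrightarrow> t \<in> {0..T} \<and> b \<in> alternatives m (if ?n = 0 then b0 else snd (h ! (?n - 1))) \<and> (\<forall>k<?n. fst (h ! k) \<le> t)"
      by (simp add: nth_append)
    have 3: "?h \<in> histories \<longleftrightarrow> (\<forall>i<?n. ?P ?h i) \<and> ?P ?h ?n"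
      unfolding histories_iff[of ?h] length_append_singleton All_less_Suc by (rule conj_commute)
    have 4: "(\<forall>i<?n. ?P ?h i) \<longleftrightarrow> h \<in> histories"
      unfolding histories_iff[of h] by (intro iff_allI imp_cong refl 1)
    show ?thesis by (simp only: 3 2 4)
  qed
  also have "(if ?n = 0 then b0 else snd (h ! (?n - 1))) = last_mode h"
    by (simp add: last_mode_def last_conv_nth)
  also have "h \<in> histories \<and> t \<in> {0..T} \<and> b \<in> alternatives m (last_mode h) \<and> (\<forall>k<?n. fst (h ! k) \<le> t) \<longleftrightarrow>
    h \<in> histories \<and> last_time h \<le> t \<and> t \<le> T \<and> b \<in> alternatives m (last_mode h)"
  proof (cases "h = []")
    case False
    have "fst (h ! k) \<le> last_time h" if "h \<in> histories" "k < ?n" for k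
    proof (cases "k = ?n - 1")
      case F: False
      then have "k < ?n - 1" "?n - 1 < ?n" using that by auto
      then have "fst (h ! k) \<le> fst (h ! (?n - 1))" using that(1) unfolding histories_iff by blast
      then show ?thesis using False by (simp add: last_time_def last_conv_nth)
    qed (use False in \<open>simp add: last_time_def last_conv_nth\<close>)
    moreover have "last_time h \<le> t" if "\<forall>k<?n. fst (h ! k) \<le> t"
      using that False by (simp add: last_time_def last_conv_nth)
    ultimately show ?thesis using last_time_range[of h] by fastforce
  qed (auto simp: last_time_def)
  finally show ?thesis .
qed

lemma alternatives_nonempty: "alternatives m b \<noteq> {}"
proof -
  have "1 \<in> alternatives m b \<or> 2 \<in> alternatives m b" using m_ge_2 by auto
  then show ?thesis by blast
qed

text \<open>Interventions that do not take place are scheduled at \<open>T\<close>, so the times of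
  a finite plan are eventually \<open>T\<close> and the convergence demanded of a control is
  automatic.\<close>

lemma controls_finiteI:
  assumes "\<And>w. w \<in> space M \<Longrightarrow> u w \<in> plans T m b" "\<And>i. intervention_time u i \<in> stopping_times"
    "\<And>i. intervention_mode u i \<in> measurable (pre_sigma (intervention_time u i)) (count_space UNIV)"
    "AE w in M. \<exists>i. u w i = None"
  shows "u \<in> controls_finite b"
proof -
  have "AE w in M. (\<lambda>i. intervention_time u i w) \<longlonglongrightarrow> T"
    using assms(4) AE_space
  proof eventually_elim
    case (elim w)
    then obtain N where N: "u w N = None" by blast
    have "intervention_time u i w = T" if "N \<le> i" for i
      using plans_None_mono[OF assms(1)[OF elim(2)] N that] by (simp add: intervention_time_def)
    then show ?case by (intro tendsto_eventually eventually_sequentiallyI[of N]) simp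
  qed
  then show ?thesis using assms by (simp add: controls_finite_def controls_def)
qed

lemma controlsD:
  assumes "u \<in> controls b"
  shows "\<And>w. w \<in> space M \<Longrightarrow> u w \<in> plans T m b" "\<And>i. intervention_time u i \<in> stopping_times"
    "\<And>i. intervention_mode u i \<in> measurable (pre_sigma (intervention_time u i)) (count_space UNIV)"
    "AE w in M. (\<lambda>i. intervention_time u i w) \<longlonglongrightarrow> T"
  using assms by (auto simp: controls_def)

lemma controls_finite_subset: "controls_finite b \<subseteq> controls b"
  by (auto simp: controls_finite_def)

text \<open>Moment bounds on \<open>Psi\<close> and on the family are stated for controls; this
  makes them available for a fixed history.\<close>

lemma const_control: "h \<in> histories \<Longrightarrow> (\<lambda>_. plan_of h) \<in> controls_finite b0"
proof (rule controls_finiteI)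
  assume h: "h \<in> histories"
  then show "plan_of h \<in> plans T m b0" by (simp add: histories_def)
  fix i
  have "intervention_time (\<lambda>_. plan_of h) i = (\<lambda>_. if i < length h then fst (h ! i) else T)"
    by (auto simp: intervention_time_def plan_of_nth fun_eq_iff split: prod.split)
  then show "intervention_time (\<lambda>_. plan_of h) i \<in> stopping_times"
    using h T_nonneg const_stopping_times by (auto simp: histories_iff)
next
  fix i
  show "intervention_mode (\<lambda>_. plan_of h) i \<in> measurable (pre_sigma (intervention_time (\<lambda>_. plan_of h) i)) (count_space UNIV)"
    by (simp add: intervention_mode_def[abs_def])
qed (auto simp: plan_of_nth intro: exI[of _ "length h"])

lemma measurable_pre_sigma_FT:
  assumes "\<tau> \<in> stopping_times" "f \<in> measurable (pre_sigma \<tau>) N"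
  shows "f \<in> measurable (F T) N"
  by (rule measurable_from_subalg[OF _ assms(2)])
    (use pre_sigma_sets_M[OF assms(1)] in \<open>simp add: subalgebra_def space_pre_sigma space_F\<close>)

text \<open>An entry is determined by the intervention time and the optional mode. The mode takes
  countably many values, and on each of the corresponding events the entry depends on the time
  alone.\<close>

lemma control_measurable:
  assumes u: "u \<in> controls b"
  shows "u \<in> measurable (F T) (plan_space T m b)"
  unfolding plan_space_def
proof (rule measurable_restrict_space2)
  show "u \<in> space (F T) \<rightarrow> plans T m b" using controlsD(1)[OF u] by (simp add: space_F)
  have "(\<lambda>w. u w i) \<in> measurable (F T) step_borel" for i
    unfolding step_borel_def
  proof (rule measurable_measure_of)
    fix A assume "A \<in> {A. Some -` A \<in> sets (borel :: (real \<times> nat) measure)}"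
    then have A: "Some -` A \<in> sets (borel :: (real \<times> nat) measure)" by simp
    have t: "intervention_time u i \<in> borel_measurable (F T)"
      by (rule measurable_pre_sigma_FT[OF controlsD(2)[OF u] measurable_stopping_time_pre_sigma[OF stopping_timesD(1)[OF controlsD(2)[OF u]]]])
    have md: "intervention_mode u i \<in> measurable (F T) (count_space UNIV)"
      by (rule measurable_pre_sigma_FT[OF controlsD(2,3)[OF u]])
    have "(\<lambda>w. (intervention_time u i w, k)) \<in> borel_measurable (F T)" for k :: nat
      using t by (intro borel_measurable_Pair) auto
    from measurable_sets[OF this A]
    have 1: "{w\<in>space (F T). Some (intervention_time u i w, k) \<in> A} \<in> sets (F T)" for k
      by (simp add: vimage_def Int_def conj_commute)
    have 2: "{w\<in>space (F T). intervention_mode u i w = x} \<in> sets (F T)" for x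
      using measurable_sets[OF md, of "{x}"] by (simp add: vimage_def Int_def conj_commute)
    have "(\<lambda>w. u w i) -` A \<inter> space (F T) =
      (if None \<in> A then {w\<in>space (F T). intervention_mode u i w = None} else {}) \<union>
      (\<Union>k. {w\<in>space (F T). intervention_mode u i w = Some k} \<inter> {w\<in>space (F T). Some (intervention_time u i w, k) \<in> A})"
    proof (rule set_eqI)
      fix w
      show "w \<in> (\<lambda>w. u w i) -` A \<inter> space (F T) \<longleftrightarrow> w \<in>
        (if None \<in> A then {w\<in>space (F T). intervention_mode u i w = None} else {}) \<union>
        (\<Union>k. {w\<in>space (F T). intervention_mode u i w = Some k} \<inter> {w\<in>space (F T). Some (intervention_time u i w, k) \<in> A})"
        by (cases "u w i") (auto simp: intervention_mode_def intervention_time_def)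
    qed
    also have "\<dots> \<in> sets (F T)"
      by (intro sets.Un sets.countable_UN'' sets.Int 1 2) (auto intro: 2)
    finally show "(\<lambda>w. u w i) -` A \<inter> space (F T) \<in> sets (F T)" .
  qed auto
  then have "(\<lambda>w i. u w i) \<in> measurable (F T) (Pi\<^sub>M UNIV (\<lambda>_. step_borel))"
    by (intro measurable_PiM_single') (auto simp: step_borel_def space_measure_of_conv)
  then show "u \<in> measurable (F T) (Pi\<^sub>M UNIV (\<lambda>_. step_borel))" by simp
qed

lemma Psi_control_measurable:
  assumes u: "u \<in> controls b0"
  shows "(\<lambda>w. Psi w (u w)) \<in> borel_measurable (F T)"
proof -
  have "(\<lambda>w. (w, u w)) \<in> measurable (F T) (F T \<Otimes>\<^sub>M plan_space T m b0)"
    using control_measurable[OF u] by (intro measurable_Pair) auto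
  from measurable_compose[OF this Psi_measurable] show ?thesis by simp
qed

end

section \<open>Deterministic histories: terminal values and Snell envelopes\<close>

locale verified_family = switching_problem M F T m b0 Psi c
  for M :: "'a measure" and F :: "real \<Rightarrow> 'a measure" and T :: real and m b0 :: nat
    and Psi :: "'a \<Rightarrow> plan \<Rightarrow> real" and c :: "nat \<Rightarrow> nat \<Rightarrow> real \<Rightarrow> 'a \<Rightarrow> real" +
  fixes Y :: "history \<Rightarrow> real \<Rightarrow> 'a \<Rightarrow> real"
  assumes sa1: standing_assumption_1 and family: "verification_family Y"
begin

lemma Psi_L2_bound:
  obtains C where "\<And>u. u \<in> controls b0 \<Longrightarrow> integrable M (\<lambda>w. (Psi w (u w))\<^sup>2)"
    "\<And>u. u \<in> controls b0 \<Longrightarrow> (\<integral>w. (Psi w (u w))\<^sup>2 \<partial>M) \<le> C" "0 \<le> C"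
proof -
  define S where "S = (SUP u\<in>controls b0. \<integral>\<^sup>+ w. ennreal (\<bar>Psi w (u w)\<bar>\<^sup>2) \<partial>M)"
  have S: "S < \<infinity>" using sa1 by (simp add: S_def standing_assumption_1_def Psi_bounded_def)
  have nn: "(\<integral>\<^sup>+ w. ennreal ((Psi w (u w))\<^sup>2) \<partial>M) \<le> S" if "u \<in> controls b0" for u
    unfolding S_def using SUP_upper[OF that, of "\<lambda>u. \<integral>\<^sup>+ w. ennreal (\<bar>Psi w (u w)\<bar>\<^sup>2) \<partial>M"] by simp
  have i: "integrable M (\<lambda>w. (Psi w (u w))\<^sup>2)" if "u \<in> controls b0" for u
  proof (rule integrableI_nonneg)
    show "(\<lambda>w. (Psi w (u w))\<^sup>2) \<in> borel_measurable M"
      using measurable_F_M[OF Psi_control_measurable[OF that]] by measurable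
    show "(\<integral>\<^sup>+ w. ennreal ((Psi w (u w))\<^sup>2) \<partial>M) < \<infinity>" using nn[OF that] S by (rule le_less_trans)
  qed simp
  have "(\<integral>w. (Psi w (u w))\<^sup>2 \<partial>M) \<le> enn2real S" if "u \<in> controls b0" for u
  proof -
    have "ennreal (\<integral>w. (Psi w (u w))\<^sup>2 \<partial>M) = (\<integral>\<^sup>+ w. ennreal ((Psi w (u w))\<^sup>2) \<partial>M)"
      using i[OF that] by (intro nn_integral_eq_integral[symmetric]) auto
    then have "ennreal (\<integral>w. (Psi w (u w))\<^sup>2 \<partial>M) \<le> S" using nn[OF that] by simp
    moreover obtain x where "S = ennreal x" "0 \<le> x" using S by (cases S) auto
    ultimately show ?thesis by simp
  qed
  with i that[of "enn2real S"] show ?thesis by simp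
qed

lemma Psi_integrable:
  assumes u: "u \<in> controls b0"
  shows "integrable M (\<lambda>w. Psi w (u w))"
  by (rule Psi_L2_bound) (rule square_integrable_imp_integrable[OF measurable_F_M[OF Psi_control_measurable[OF u]]], use u in blast)

text \<open>The two processes represent \<open>Y\<close> and its obstacle at the random index only
  from \<open>\<gamma>\<close> on, since earlier the index need not be known yet. The terminal
  clause identifies the reward at \<open>T\<close> with a payoff.\<close>

definition envelope :: "('a \<Rightarrow> history) \<Rightarrow> ('a \<Rightarrow> real) \<Rightarrow> (real \<Rightarrow> 'a \<Rightarrow> real) \<Rightarrow> (real \<Rightarrow> 'a \<Rightarrow> real) \<Rightarrow> bool" where
  "envelope h \<gamma> Z X \<longleftrightarrow> snell_from \<gamma> Z X \<and>
     (AE w in M. (\<forall>s\<in>{\<gamma> w..T}. Z s w = Y (h w) s w \<and> X s w = best_switch_value Y (h w) s w) \<and>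
        Y (h w) T w = Psi w (plan_of (h w)))"

lemma costs_S2: "b \<in> {1..m} \<Longrightarrow> b' \<in> alternatives m b \<Longrightarrow> c b b' \<in> S2_qlc"
  using sa1 by (simp add: standing_assumption_1_def)

text \<open>At \<open>s = T\<close> every admissible stopping time equals \<open>T\<close> almost
  surely, so the essential supremum runs over versions of one random variable, which is measurable
  at time \<open>T\<close>.\<close>

lemma family_terminal:
  assumes h: "h \<in> histories"
  shows "AE w in M. Y h T w = Psi w (plan_of h)"
proof -
  define R where "R \<tau> w = (if \<tau> w \<ge> T then Psi w (plan_of h) else best_switch_value Y h (\<tau> w) w)" for \<tau> w
  have u: "(\<lambda>_. plan_of h) \<in> controls b0" using const_control[OF h] controls_finite_subset by blast
  have Pm: "(\<lambda>w. Psi w (plan_of h)) \<in> borel_measurable (F T)" by (rule Psi_control_measurable[OF u])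
  have Pi: "integrable M (\<lambda>w. Psi w (plan_of h))" by (rule Psi_integrable[OF u])
  have lt: "max T (last_time h) = T" using last_time_range[OF h] by simp
  have ess: "is_ess_sup M {real_cond_exp M (F T) (R \<tau>) |\<tau>. \<tau> \<in> stopping_times_from (\<lambda>_. T)} (Y h T)"
  proof -
    have "\<forall>s\<in>{0..T}. is_ess_sup M {real_cond_exp M (F s) (R \<tau>) |\<tau>. \<tau> \<in> stopping_times_from (\<lambda>_. max s (last_time h))} (Y h s)"
      using family h unfolding verification_family_def snell_property_def R_def[abs_def] by blast
    from this[rule_format, of T] show ?thesis using T_nonneg by (simp add: lt)
  qed
  have C: "AE w in M. real_cond_exp M (F T) (R \<tau>) w = Psi w (plan_of h)" if "\<tau> \<in> stopping_times_from (\<lambda>_. T)" for \<tau>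
  proof -
    have "AE w in M. T \<le> \<tau> w" using that by (simp add: stopping_times_from_def)
    then have ae: "AE w in M. Psi w (plan_of h) = R \<tau> w" by eventually_elim (simp add: R_def)
    have "R \<tau> \<in> borel_measurable M" by (rule measurable_M_AE_cong[OF measurable_F_M[OF Pm] ae]) simp
    from cond_exp_cong[OF ae measurable_F_M[OF Pm] this, of T] cond_exp_F_meas[OF Pi Pm]
    show ?thesis by eventually_elim simp
  qed
  have "(\<lambda>_. T) \<in> stopping_times_from (\<lambda>_. T)"
    using const_stopping_times[of T] T_nonneg by (simp add: stopping_times_from_def)
  then have "AE w in M. real_cond_exp M (F T) (R (\<lambda>_. T)) w \<le> Y h T w" by (intro is_ess_sup_upper[OF ess]) blast
  then have 1: "AE w in M. Psi w (plan_of h) \<le> Y h T w" using C[OF \<open>(\<lambda>_. T) \<in> _\<close>] by eventually_elim simp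
  have "AE w in M. Y h T w \<le> Psi w (plan_of h)"
  proof (rule is_ess_sup_least[OF ess measurable_F_M[OF Pm]])
    fix X assume "X \<in> {real_cond_exp M (F T) (R \<tau>) |\<tau>. \<tau> \<in> stopping_times_from (\<lambda>_. T)}"
    then obtain \<tau> where \<tau>: "X = real_cond_exp M (F T) (R \<tau>)" "\<tau> \<in> stopping_times_from (\<lambda>_. T)" by blast
    show "AE w in M. X w \<le> Psi w (plan_of h)" using C[OF \<tau>(2)] unfolding \<tau>(1) by eventually_elim simp
  qed
  with 1 show ?thesis by eventually_elim simp
qed

text \<open>\<open>Y h\<close> comes without a second moment bound of its own. \<open>Z\<close> is
  therefore the process that \<open>family_bounded\<close> attaches to the constant control
  \<open>plan_of h\<close>; it agrees with \<open>Y h\<close> from \<open>last_time h\<close> on.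
  The obstacle is assembled from the processes of \<open>family_regular\<close> and the costs, all
  square integrable and quasi-left continuous.\<close>

lemma deterministic_envelope:
  assumes h: "h \<in> histories"
  shows "\<exists>Z X. envelope (\<lambda>_. h) (\<lambda>_. last_time h) Z X"
proof -
  define t where "t = last_time h"
  have t: "t \<in> {0..T}" using last_time_range[OF h] by (simp add: t_def)
  define a where "a = last_mode h"
  have a: "a \<in> {1..m}" using last_mode_range[OF h] by (simp add: a_def)
  let ?B = "alternatives m a"
  have B: "finite ?B" "?B \<noteq> {}" using alternatives_nonempty by auto
  have u: "(\<lambda>_. plan_of h) \<in> controls_finite b0" by (rule const_control[OF h])
  have u': "(\<lambda>_. plan_of h) \<in> controls b0" using u controls_finite_subset by blast
  have Yh: "cadlag_process (Y h)" "\<And>s. s \<in> {0..T} \<Longrightarrow> integrable M (Y h s)"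
    "\<And>s r. 0 \<le> s \<Longrightarrow> s \<le> r \<Longrightarrow> r \<le> T \<Longrightarrow> AE w in M. real_cond_exp M (F s) (Y h r) w \<le> Y h s w"
    using family h by (auto simp: verification_family_def cadlag_supermartingale_def)
  obtain Zu where Zu: "\<forall>u\<in>controls_finite b0. at_random_index Y (\<lambda>s w. history_of (u w)) (\<lambda>_. T) (Zu u)"
    "(SUP u\<in>controls_finite b0. sup_moment2 (Zu u)) < \<infinity>"
    using family unfolding verification_family_def family_bounded_def by blast
  define Z where "Z = Zu (\<lambda>_. plan_of h)"
  have ari: "at_random_index Y (\<lambda>s w. h) (\<lambda>_. T) Z"
    using Zu(1) u unfolding Z_def by (auto simp: history_of_plan_of dest!: bspec)
  have Zc: "cadlag_process Z" using ari by (simp add: at_random_index_def)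
  have Zfin: "sup_moment2 Z < \<infinity>"
    using le_less_trans[OF SUP_upper[OF u, of "\<lambda>u. sup_moment2 (Zu u)"] Zu(2)] by (simp add: Z_def)
  have ZY0: "AE w in M. Z s w = Y h s w" if s: "s \<in> {t..T}" for s
  proof -
    have s': "s \<in> {0..T}" using s t by simp
    have "AE w in M. Z s w = real_cond_exp M (F s) (\<lambda>w. Y h (max s (last_time h)) w) w"
      using ari s' unfolding at_random_index_def Let_def by blast
    moreover have "max s (last_time h) = s" using s by (simp add: t_def)
    ultimately have 1: "AE w in M. Z s w = real_cond_exp M (F s) (Y h s) w" by simp
    have "AE w in M. real_cond_exp M (F s) (Y h s) w = Y h s w"
      using Yh(1,2) s' progressive_F by (intro cond_exp_F_meas) (auto simp: cadlag_process_def)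
    with 1 show ?thesis by eventually_elim simp
  qed
  have ZY: "AE w in M. \<forall>s\<in>{t..T}. Z s w = Y h s w"
    by (rule cadlag_process_eq[OF Zc Yh(1), where \<gamma>="\<lambda>_. t"]) (use ZY0 t in auto)
  \<comment> \<open>The appended time is raised to \<open>t\<close> so that the process is defined
    on all of \<open>{0..T}\<close>; from \<open>t\<close> on it is the value right after a switch
    at the current time.\<close>
  define Zb where "Zb b s = Y (h @ [(max s t, b)]) s" for b s
  have Zb: "Zb b \<in> S2_qlc" if "b \<in> ?B" for b
    using family h that unfolding verification_family_def family_regular_def Zb_def[abs_def] t_def a_def by blast
  have cS: "c a b \<in> S2_qlc" if "b \<in> ?B" for b using costs_S2[OF a that] .
  define X where "X s w = Max ((\<lambda>b. Zb b s w - c a b s w) ` ?B)" for s w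
  have Xc: "cadlag_process X"
    unfolding X_def[abs_def]
    using B Zb cS by (intro cadlag_process_Max cadlag_process_diff) (auto simp: S2_qlc_def S2_def)
  have Xbest: "X s w = best_switch_value Y h s w" if "t \<le> s" for s w
    using that by (simp add: X_def best_switch_value_def switch_value_def[abs_def] Zb_def a_def max_absorb1)
  have Xi: "integrable M (\<lambda>w. X (\<tau> w) w)" if "\<tau> \<in> stopping_times" for \<tau>
    unfolding X_def
    using B Zb cS that by (intro integrable_Max Bochner_Integration.integrable_diff stopped_integrable) (auto simp: S2_qlc_def S2_def)
  define r where "r s w = (if s \<ge> T then Psi w (plan_of h) else X s w)" for s w
  have Pi: "integrable M (\<lambda>w. Psi w (plan_of h))" by (rule Psi_integrable[OF u'])
  have ri: "integrable M (\<lambda>w. r (\<tau> w) w)" if "\<tau> \<in> stopping_times" for \<tau>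
  proof (rule Bochner_Integration.integrable_bound)
    show "integrable M (\<lambda>w. \<bar>Psi w (plan_of h)\<bar> + \<bar>X (\<tau> w) w\<bar>)" using Pi Xi[OF that] by simp
    show "(\<lambda>w. r (\<tau> w) w) \<in> borel_measurable M"
      unfolding r_def using Pi Xi[OF that] stopping_times_measurable[OF that] by (intro measurable_If) auto
  qed (auto simp: r_def)
  have PY: "AE w in M. Y h T w = Psi w (plan_of h)" by (rule family_terminal[OF h])
  have ess: "is_ess_sup M {real_cond_exp M (F s) (\<lambda>w. r (\<tau> w) w) |\<tau>. \<tau> \<in> stopping_times_from (\<lambda>_. s)} (Y h s)"
    if s: "s \<in> {t..T}" for s
  proof -
    define R where "R \<tau> w = (if \<tau> w \<ge> T then Psi w (plan_of h) else best_switch_value Y h (\<tau> w) w)" for \<tau> w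
    have s': "s \<in> {0..T}" "max s (last_time h) = s" using s t by (auto simp: t_def)
    have e: "is_ess_sup M {real_cond_exp M (F s) (R \<tau>) |\<tau>. \<tau> \<in> stopping_times_from (\<lambda>_. s)} (Y h s)"
    proof -
      have "\<forall>s\<in>{0..T}. is_ess_sup M {real_cond_exp M (F s) (R \<tau>) |\<tau>. \<tau> \<in> stopping_times_from (\<lambda>_. max s (last_time h))} (Y h s)"
        using family h unfolding verification_family_def snell_property_def R_def[abs_def] by blast
      from this[rule_format, OF s'(1)] show ?thesis by (simp add: s'(2))
    qed
    have Rr: "AE w in M. real_cond_exp M (F s) (R \<tau>) w = real_cond_exp M (F s) (\<lambda>w. r (\<tau> w) w) w"
      if "\<tau> \<in> stopping_times_from (\<lambda>_. s)" for \<tau>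
    proof -
      have \<tau>: "\<tau> \<in> stopping_times" "AE w in M. s \<le> \<tau> w" using that by (auto simp: stopping_times_from_def)
      have ae: "AE w in M. r (\<tau> w) w = R \<tau> w"
        using \<tau>(2) by eventually_elim (use s in \<open>auto simp: R_def r_def Xbest\<close>)
      have "R \<tau> \<in> borel_measurable M"
        by (rule measurable_M_AE_cong[OF _ ae]) (use ri[OF \<tau>(1)] in auto)
      from cond_exp_cong[OF ae _ this, of s] ri[OF \<tau>(1)] show ?thesis by (auto elim!: eventually_mono)
    qed
    show ?thesis
      unfolding is_ess_sup_def
    proof (intro conjI ballI impI)
      show "Y h s \<in> borel_measurable M" by (rule is_ess_sup_measurable[OF e])
    next
      fix f assume "f \<in> {real_cond_exp M (F s) (\<lambda>w. r (\<tau> w) w) |\<tau>. \<tau> \<in> stopping_times_from (\<lambda>_. s)}"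
      then obtain \<tau> where \<tau>: "\<tau> \<in> stopping_times_from (\<lambda>_. s)" "f = real_cond_exp M (F s) (\<lambda>w. r (\<tau> w) w)" by blast
      have "AE w in M. real_cond_exp M (F s) (R \<tau>) w \<le> Y h s w" using \<tau>(1) by (intro is_ess_sup_upper[OF e]) blast
      then show "AE w in M. f w \<le> Y h s w" using Rr[OF \<tau>(1)] unfolding \<tau>(2) by eventually_elim simp
    next
      fix Z' assume Z': "Z' \<in> borel_measurable M"
        "\<forall>f\<in>{real_cond_exp M (F s) (\<lambda>w. r (\<tau> w) w) |\<tau>. \<tau> \<in> stopping_times_from (\<lambda>_. s)}. AE w in M. f w \<le> Z' w"
      show "AE w in M. Y h s w \<le> Z' w"
      proof (rule is_ess_sup_least[OF e Z'(1)])
        fix f assume "f \<in> {real_cond_exp M (F s) (R \<tau>) |\<tau>. \<tau> \<in> stopping_times_from (\<lambda>_. s)}"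
        then obtain \<tau> where \<tau>: "\<tau> \<in> stopping_times_from (\<lambda>_. s)" "f = real_cond_exp M (F s) (R \<tau>)" by blast
        have "AE w in M. real_cond_exp M (F s) (\<lambda>w. r (\<tau> w) w) w \<le> Z' w" using \<tau>(1) by (intro Z'(2)[rule_format]) blast
        then show "AE w in M. f w \<le> Z' w" using Rr[OF \<tau>(1)] unfolding \<tau>(2) by eventually_elim simp
      qed
    qed
  qed
  \<comment> \<open>Before \<open>T\<close>, switching at once is an admissible choice in the
    essential supremum. At \<open>T\<close> the reward is \<open>Psi\<close> alone, and the obstacle
    lies below it because \<open>no_switch_at_T\<close> makes a switch at \<open>T\<close>
    unprofitable.\<close>
  have XY: "AE w in M. X s w \<le> Y h s w" if s: "s \<in> {t..T}" for s
  proof (cases "s = T")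
    case False
    have s': "s \<in> {0..T}" using s t by auto
    have st: "(\<lambda>_. s) \<in> stopping_times" by (rule const_stopping_times[OF s'])
    then have "(\<lambda>_. s) \<in> stopping_times_from (\<lambda>_. s)" by (simp add: stopping_times_from_def)
    then have 1: "AE w in M. real_cond_exp M (F s) (\<lambda>w. r s w) w \<le> Y h s w"
      by (intro is_ess_sup_upper[OF ess[OF s]]) (rule CollectI, rule exI[of _ "\<lambda>_. s"], simp)
    have 2: "AE w in M. real_cond_exp M (F s) (\<lambda>w. X s w) w = X s w"
      using Xi[OF st] progressive_F[of X s] Xc s' by (intro cond_exp_F_meas) (auto simp: cadlag_process_def)
    have "r s = X s" using False s by (auto simp: r_def)
    then have "(\<lambda>w. r s w) = (\<lambda>w. X s w)" by simp
    note 1[unfolded this]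
    with 2 show ?thesis by eventually_elim simp
  next
    case True
    have "AE w in M. Zb b T w - c a b T w \<le> Y h T w" if b: "b \<in> ?B" for b
    proof -
      have hb: "h @ [(T, b)] \<in> histories" using h b t by (simp add: histories_snoc t_def a_def)
      have "AE w in M. Psi w (plan_of h) > Psi w (plan_of (h @ [(T, b)])) - c a b T w"
        using sa1 h b unfolding standing_assumption_1_def no_switch_at_T_def a_def by blast
      then show ?thesis using family_terminal[OF hb] PY
        by eventually_elim (use t in \<open>simp add: Zb_def max_absorb1\<close>)
    qed
    then have "AE w in M. \<forall>b\<in>?B. Zb b T w - c a b T w \<le> Y h T w"
      by (intro AE_finite_allI) auto
    then show ?thesis unfolding True X_def by eventually_elim (use B in auto)
  qed
  have XZ: "AE w in M. \<forall>s\<in>{t..T}. X s w \<le> Z s w"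
  proof (rule cadlag_process_le[OF Xc Zc, where \<gamma>="\<lambda>_. t"])
    fix s assume "s \<in> {0..T}"
    show "AE w in M. t \<le> s \<longrightarrow> X s w \<le> Z s w"
    proof (cases "t \<le> s")
      case True
      then have s: "s \<in> {t..T}" using \<open>s \<in> {0..T}\<close> by simp
      show ?thesis using XY[OF s] ZY0[OF s] by eventually_elim simp
    qed simp
  qed (use t in auto)
  have sm: "supermartingale_from (\<lambda>_. t) Z"
    unfolding supermartingale_from_def
  proof (intro allI impI, elim conjE)
    fix s v A assume su: "0 \<le> s" "s \<le> v" "v \<le> T" and A: "A \<in> sets (F s)" "\<forall>w\<in>A. t \<le> s"
    show "(\<integral>w. Z v w * indicator A w \<partial>M) \<le> (\<integral>w. Z s w * indicator A w \<partial>M)"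
    proof (cases "A = {}")
      case False
      then have ts: "t \<le> s" using A(2) by blast
      have AM: "A \<in> sets M" using A(1) sets_F_subset by blast
      have Zi: "integrable M (\<lambda>w. Z x w * indicator A w)" if "x \<in> {0..T}" for x
        by (rule stopped_integrable_on[OF Zc Zfin const_stopping_times[OF that] AM])
      have Yi: "integrable M (Y h v)" "integrable M (Y h s)" using Yh(2) su by auto
      have "(\<integral>w. Z v w * indicator A w \<partial>M) = (\<integral>w. Y h v w * indicator A w \<partial>M)"
        using ZY0[of v] su ts Zi[of v] integrable_real_mult_indicator[OF AM Yi(1)]
        by (intro integral_cong_AE) (auto elim!: eventually_mono)
      also have "\<dots> = (\<integral>w. real_cond_exp M (F s) (Y h v) w * indicator A w \<partial>M)"
        by (rule cond_exp_set_integral[OF Yi(1) A(1)])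
      also have "\<dots> \<le> (\<integral>w. Y h s w * indicator A w \<partial>M)"
        using Yh(3)[OF su] integrable_real_mult_indicator[OF AM Yi(2)]
          integrable_real_mult_indicator[OF AM integrable_cond_exp[OF Yi(1)]]
        by (intro integral_mono_AE) (auto elim!: eventually_mono intro: mult_right_mono)
      also have "\<dots> = (\<integral>w. Z s w * indicator A w \<partial>M)"
        using ZY0[of s] su ts Zi[of s] integrable_real_mult_indicator[OF AM Yi(2)]
        by (intro integral_cong_AE) (auto elim!: eventually_mono)
      finally show ?thesis .
    qed simp
  qed
  have tst: "(\<lambda>_. t) \<in> stopping_times" by (rule const_stopping_times[OF t])
  have no: "near_optimal (\<lambda>_. t) Z X"
    unfolding near_optimal_def
  proof (intro allI impI)
    fix e d :: real assume e: "0 < e" and d: "0 < d"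
    \<comment> \<open>The loss \<open>k\<close> serves two purposes: it is itself at most
      \<open>d\<close>, and divided by \<open>e\<close> in Markov's inequality it is again at most
      \<open>d\<close>.\<close>
    define k where "k = min d (e * d)"
    have k: "0 < k" "k \<le> d" "k \<le> e * d" using e d by (auto simp: k_def)
    have tT: "t \<in> {t..T}" using t by simp
    obtain \<tau> where \<tau>: "\<tau> \<in> stopping_times" "\<forall>w\<in>space M. t \<le> \<tau> w" "(\<integral>w. Y h t w \<partial>M) - k \<le> (\<integral>w. r (\<tau> w) w \<partial>M)"
      using ess_sup_near_attained[where r=r, OF t ri Yh(2)[OF t] ess[OF tT] k(1)] by blast
    have Zi: "integrable M (\<lambda>w. Z (\<sigma> w) w)" if "\<sigma> \<in> stopping_times" for \<sigma> by (rule stopped_integrable[OF Zc Zfin that])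
    have EZ: "(\<integral>w. Z t w \<partial>M) = (\<integral>w. Y h t w \<partial>M)"
      using ZY0[OF tT] Zi[OF tst] Yh(2)[OF t] by (intro integral_cong_AE) auto
    have rZ: "AE w in M. r (\<tau> w) w \<le> Z (\<tau> w) w"
      using XZ ZY PY AE_space
    proof eventually_elim
      case (elim w)
      have "\<tau> w \<in> {t..T}" using \<tau>(2) stopping_timesD(3)[OF \<tau>(1) elim(4)] elim(4) by auto
      then show ?case using elim(1-3) by (cases "\<tau> w = T") (auto simp: r_def)
    qed
    have rZi: "(\<integral>w. r (\<tau> w) w \<partial>M) \<le> (\<integral>w. Z (\<tau> w) w \<partial>M)" by (rule integral_mono_AE[OF ri[OF \<tau>(1)] Zi[OF \<tau>(1)] rZ])
    have "(\<integral>w. Z (\<tau> w) w * indicator (space M) w \<partial>M) \<le> (\<integral>w. Z t w * indicator (space M) w \<partial>M)"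
      by (rule optional_sampling[OF Zc Zfin sm tst \<tau>(1) _ _ space_in_pre_sigma]) (use \<tau>(2) in auto)
    then have os: "(\<integral>w. Z (\<tau> w) w \<partial>M) \<le> (\<integral>w. Z t w \<partial>M)" by (simp only: integral_indicator_space)
    define C where "C = {w\<in>space M. \<tau> w < T \<and> X (\<tau> w) w + e \<le> Z (\<tau> w) w}"
    have C: "C \<in> sets M" unfolding C_def
      using Xi[OF \<tau>(1)] Zi[OF \<tau>(1)] stopping_times_measurable[OF \<tau>(1)] by measurable
    have "e * measure M C = (\<integral>w. e * indicator C w \<partial>M)" using C by simp
    also have "\<dots> \<le> (\<integral>w. Z (\<tau> w) w - r (\<tau> w) w \<partial>M)"
    proof (rule integral_mono_AE)
      show "integrable M (\<lambda>w. e * indicator C w)" using C by (intro integrable_mult_right integrable_real_indicator) (auto simp: less_top[symmetric])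
      show "integrable M (\<lambda>w. Z (\<tau> w) w - r (\<tau> w) w)" using Zi[OF \<tau>(1)] ri[OF \<tau>(1)] by simp
      show "AE w in M. e * indicator C w \<le> Z (\<tau> w) w - r (\<tau> w) w"
        using rZ by eventually_elim (auto simp: C_def indicator_def r_def)
    qed
    also have "\<dots> = (\<integral>w. Z (\<tau> w) w \<partial>M) - (\<integral>w. r (\<tau> w) w \<partial>M)" using Zi[OF \<tau>(1)] ri[OF \<tau>(1)] by simp
    also have "\<dots> \<le> e * d" using os EZ \<tau>(3) k by linarith
    finally have "measure M C \<le> d" using e by simp
    moreover have "(\<integral>w. Z t w \<partial>M) - d \<le> (\<integral>w. Z (\<tau> w) w \<partial>M)" using rZi EZ \<tau>(3) k by linarith
    ultimately show "\<exists>\<tau>\<in>stopping_times. (\<forall>w\<in>space M. t \<le> \<tau> w) \<and> (\<integral>w. Z t w \<partial>M) - d \<le> (\<integral>w. Z (\<tau> w) w \<partial>M) \<and>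
      measure M {w\<in>space M. \<tau> w < T \<and> X (\<tau> w) w + e \<le> Z (\<tau> w) w} \<le> d"
      using \<tau>(1,2) unfolding C_def by blast
  qed
  have ql: "qlc_from (\<lambda>_. t) X"
    unfolding qlc_from_def
  proof (intro allI impI, elim conjE)
    fix \<theta> \<theta>' assume \<theta>: "\<forall>n. \<theta> n \<in> stopping_times"
      "\<forall>w\<in>space M. (\<forall>n. t \<le> \<theta> n w) \<and> incseq (\<lambda>n. \<theta> n w) \<and> (\<lambda>n. \<theta> n w) \<longlonglongrightarrow> \<theta>' w"
    have q: "AE w in M. (\<lambda>n. W (\<theta> n w) w) \<longlonglongrightarrow> W (\<theta>' w) w" if "W \<in> S2_qlc" for W
      by (rule process_qlc_incseq) (use that \<theta> in \<open>auto simp: S2_qlc_def S2_def\<close>)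
    have "AE w in M. \<forall>b\<in>?B. (\<lambda>n. Zb b (\<theta> n w) w - c a b (\<theta> n w) w) \<longlonglongrightarrow> Zb b (\<theta>' w) w - c a b (\<theta>' w) w"
    proof (rule AE_finite_allI)
      fix b assume b: "b \<in> ?B"
      show "AE w in M. (\<lambda>n. Zb b (\<theta> n w) w - c a b (\<theta> n w) w) \<longlonglongrightarrow> Zb b (\<theta>' w) w - c a b (\<theta>' w) w"
        using q[OF Zb[OF b]] q[OF cS[OF b]] by eventually_elim (rule tendsto_diff)
    qed simp
    then show "AE w in M. (\<lambda>n. X (\<theta> n w) w) \<longlonglongrightarrow> X (\<theta>' w) w"
      unfolding X_def by eventually_elim (rule tendsto_Max, use B in auto)
  qed
  have "snell_from (\<lambda>_. t) Z X"
    unfolding snell_from_def using tst Zc Xc Zfin XZ sm no ql by blast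
  moreover have "AE w in M. (\<forall>s\<in>{t..T}. Z s w = Y h s w \<and> X s w = best_switch_value Y h s w) \<and> Y h T w = Psi w (plan_of h)"
    using ZY PY by eventually_elim (use Xbest in auto)
  ultimately show ?thesis unfolding envelope_def t_def by blast
qed

end

section \<open>The family at random histories\<close>

lemma Max_diff_bound:
  fixes f g :: "'b \<Rightarrow> real"
  assumes B: "finite B" "B \<noteq> {}" and d: "\<And>b. b \<in> B \<Longrightarrow> \<bar>f b - g b\<bar> \<le> d"
  shows "\<bar>Max (f ` B) - Max (g ` B)\<bar> \<le> d"
proof -
  have half: "Max (f ` B) \<le> Max (g ` B) + d" if "\<And>b. b \<in> B \<Longrightarrow> \<bar>f b - g b\<bar> \<le> d" for f g :: "'b \<Rightarrow> real"
  proof (rule Max.boundedI)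
    fix x assume "x \<in> f ` B"
    then obtain b where b: "b \<in> B" "x = f b" by blast
    have "g b \<le> Max (g ` B)" using B b by simp
    then show "x \<le> Max (g ` B) + d" using that[OF b(1)] b(2) by linarith
  qed (use B in auto)
  have "Max (f ` B) \<le> Max (g ` B) + d" by (rule half[OF d])
  moreover have "Max (g ` B) \<le> Max (f ` B) + d" by (rule half) (use d in \<open>simp add: abs_minus_commute\<close>)
  ultimately show ?thesis by linarith
qed

context usual_basis
begin

text \<open>Finitely many of the moments may be infinite; for those indices the zero function is
  used, so domination is claimed only eventually.\<close>

lemma L2_null_dominators:
  assumes W: "\<And>l. cadlag_process (W l)" and lim: "(\<lambda>l. sup_moment2 (W l)) \<longlonglongrightarrow> 0"
  obtains D :: "nat \<Rightarrow> 'a \<Rightarrow> real" where "\<And>l. integrable M (D l)" "\<And>l w. 0 \<le> D l w" "(\<lambda>l. \<integral>w. D l w \<partial>M) \<longlonglongrightarrow> 0"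
    "\<forall>\<^sub>F l in sequentially. AE w in M. \<forall>s\<in>{0..T}. \<bar>W l s w\<bar> \<le> D l w"
proof -
  have "\<forall>l. \<exists>D. integrable M D \<and> (\<forall>w. 0 \<le> D w) \<and> ennreal ((\<integral>w. D w \<partial>M)\<^sup>2) \<le> sup_moment2 (W l) \<and>
      (sup_moment2 (W l) < \<infinity> \<longrightarrow> (AE w in M. \<forall>s\<in>{0..T}. \<bar>W l s w\<bar> \<le> D w))" (is "\<forall>l. \<exists>D. ?P l D")
  proof
    fix l
    show "\<exists>D. ?P l D"
    proof (cases "sup_moment2 (W l) < \<infinity>")
      case True
      show ?thesis by (rule cadlag_process_dominated[OF W True]) blast
    next
      case False
      then show ?thesis by (intro exI[of _ "\<lambda>_. 0"]) simp
    qed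
  qed
  from choice[OF this] obtain D where "\<forall>l. ?P l (D l)" by blast
  then have D: "\<And>l. integrable M (D l)" "\<And>l w. 0 \<le> D l w"
    "\<And>l. ennreal ((\<integral>w. D l w \<partial>M)\<^sup>2) \<le> sup_moment2 (W l)"
    "\<And>l. sup_moment2 (W l) < \<infinity> \<Longrightarrow> AE w in M. \<forall>s\<in>{0..T}. \<bar>W l s w\<bar> \<le> D l w"
    by blast+
  have "(\<lambda>l. ennreal ((\<integral>w. D l w \<partial>M)\<^sup>2)) \<longlonglongrightarrow> 0"
    by (rule tendsto_sandwich[OF _ _ tendsto_const lim]) (simp_all add: D(3))
  then have "(\<lambda>l. (\<integral>w. D l w \<partial>M)\<^sup>2) \<longlonglongrightarrow> 0" by (subst (asm) ennreal_tendsto_0_iff) simp_all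
  then have 1: "(\<lambda>l. \<integral>w. D l w \<partial>M) \<longlonglongrightarrow> 0" by (subst (asm) power_tendsto_0_iff) simp_all
  have "\<forall>\<^sub>F l in sequentially. sup_moment2 (W l) < \<infinity>" by (rule order_tendstoD(2)[OF lim]) simp
  then have "\<forall>\<^sub>F l in sequentially. AE w in M. \<forall>s\<in>{0..T}. \<bar>W l s w\<bar> \<le> D l w" by (rule eventually_mono) (rule D(4))
  with that[OF D(1,2) 1] show ?thesis by blast
qed

lemma sup_moment2_cong:
  assumes "AE w in M. \<forall>s\<in>{0..T}. Z s w = Z' s w"
  shows "sup_moment2 Z = sup_moment2 Z'"
  unfolding sup_moment2_def
proof (rule nn_integral_cong_AE)
  show "AE w in M. (SUP s\<in>{0..T}. ennreal (\<bar>Z s w\<bar>\<^sup>2)) = (SUP s\<in>{0..T}. ennreal (\<bar>Z' s w\<bar>\<^sup>2))"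
    using assms by eventually_elim (intro SUP_cong, auto)
qed

lemma length_random_history: "length bs = length \<eta> \<Longrightarrow> length (random_history \<eta> bs w) = length \<eta>"
  by (simp add: random_history_def)

lemma random_history_nth:
  "length bs = length \<eta> \<Longrightarrow> i < length \<eta> \<Longrightarrow> random_history \<eta> bs w ! i = ((\<eta> ! i) w, bs ! i)"
  by (simp add: random_history_def)

lemma last_time_random_history:
  "length bs = length \<eta> \<Longrightarrow> last_time (random_history \<eta> bs w) = (if \<eta> = [] then 0 else last \<eta> w)"
  by (auto simp: last_time_def last_conv_nth random_history_def)

lemma ordered_timesD:
  assumes "\<eta> \<in> ordered_times"
  shows "i < length \<eta> \<Longrightarrow> \<eta> ! i \<in> stopping_times"
    "w \<in> space M \<Longrightarrow> i \<le> j \<Longrightarrow> j < length \<eta> \<Longrightarrow> (\<eta> ! i) w \<le> (\<eta> ! j) w"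
proof -
  show "i < length \<eta> \<Longrightarrow> \<eta> ! i \<in> stopping_times" using assms by (auto simp: ordered_times_def)
  assume "w \<in> space M" "i \<le> j" "j < length \<eta>"
  then show "(\<eta> ! i) w \<le> (\<eta> ! j) w"
    using assms sorted_nth_mono[of "map (\<lambda>\<tau>. \<tau> w) \<eta>" i j] by (auto simp: ordered_times_def)
qed

lemma last_time_stopping:
  assumes "\<eta> \<in> ordered_times" "length bs = length \<eta>"
  shows "(\<lambda>w. last_time (random_history \<eta> bs w)) \<in> stopping_times"
proof (cases "\<eta> = []")
  case True
  then show ?thesis using const_stopping_times[of 0] T_nonneg by (simp add: random_history_def last_time_def)
next
  case False
  then have "last \<eta> \<in> stopping_times" using assms(1) last_in_set by (auto simp: ordered_times_def)
  then show ?thesis using False by (simp add: last_time_random_history[OF assms(2)])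
qed

lemma discretize_ordered:
  assumes "\<eta> \<in> ordered_times" shows "discretize l \<eta> \<in> ordered_times"
  unfolding ordered_times_def
proof (intro CollectI conjI ballI)
  show "set (discretize l \<eta>) \<subseteq> stopping_times"
    using assms grid_up_stopping_times by (auto simp: discretize_def ordered_times_def)
  fix w assume w: "w \<in> space M"
  show "sorted (map (\<lambda>\<tau>. \<tau> w) (discretize l \<eta>))"
    unfolding sorted_iff_nth_mono discretize_def
  proof (intro allI impI)
    fix i j assume ij: "i \<le> j" "j < length (map (\<lambda>\<tau>. \<tau> w) (map (\<lambda>\<tau> w. grid_up T l (\<tau> w)) \<eta>))"
    then have "(\<eta> ! i) w \<le> (\<eta> ! j) w" "(\<eta> ! j) w \<le> T"
      using ordered_timesD[OF assms] stopping_timesD(3) w by auto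
    then show "map (\<lambda>\<tau>. \<tau> w) (map (\<lambda>\<tau> w. grid_up T l (\<tau> w)) \<eta>) ! i \<le> map (\<lambda>\<tau>. \<tau> w) (map (\<lambda>\<tau> w. grid_up T l (\<tau> w)) \<eta>) ! j"
      using ij by (simp add: grid_up_mono)
  qed
qed

lemma length_discretize: "length (discretize l \<eta>) = length \<eta>"
  by (simp add: discretize_def)

end

context switching_problem
begin

lemma random_history_in_histories:
  assumes \<eta>: "\<eta> \<in> ordered_times" and bs: "bs \<in> mode_tuples" "length bs = length \<eta>" and w: "w \<in> space M"
  shows "random_history \<eta> bs w \<in> histories"
  unfolding histories_iff length_random_history[OF bs(2)]
proof (intro allI impI conjI)
  fix i assume i: "i < length \<eta>"
  note n = random_history_nth[OF bs(2)]
  show "fst (random_history \<eta> bs w ! i) \<in> {0..T}"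
    using stopping_timesD(2,3)[OF ordered_timesD(1)[OF \<eta> i] w] by (simp add: n[OF i])
  show "snd (random_history \<eta> bs w ! i) \<in> alternatives m (if i = 0 then b0 else snd (random_history \<eta> bs w ! (i - 1)))"
  proof -
    have "bs ! i \<in> alternatives m ((b0 # bs) ! i)" using bs i by (auto simp: mode_tuples_def)
    then show ?thesis using i n[of i] n[of "i - 1"] by (cases i) auto
  qed
  fix k assume "k < i"
  then show "fst (random_history \<eta> bs w ! k) \<le> fst (random_history \<eta> bs w ! i)"
    using ordered_timesD(2)[OF \<eta> w, of k i] i n[of k] n[of i] by simp
qed

lemma last_mode_random_history:
  assumes "length bs = length \<eta>"
  shows "last_mode (random_history \<eta> bs w) = last (b0 # bs)"
  using assms by (cases "bs = []") (auto simp: last_mode_def random_history_def last_conv_nth)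

lemma random_history_control:
  assumes \<eta>: "\<eta> \<in> ordered_times" and bs: "bs \<in> mode_tuples" "length bs = length \<eta>"
  shows "(\<lambda>w. plan_of (random_history \<eta> bs w)) \<in> controls_finite b0"
proof (rule controls_finiteI)
  show "plan_of (random_history \<eta> bs w) \<in> plans T m b0" if "w \<in> space M" for w
    using random_history_in_histories[OF \<eta> bs that] by (simp add: histories_def)
  fix i
  have p: "plan_of (random_history \<eta> bs w) i = (if i < length \<eta> then Some ((\<eta> ! i) w, bs ! i) else None)" for w
    by (simp add: plan_of_nth length_random_history[OF bs(2)] random_history_nth[OF bs(2)])
  have "intervention_time (\<lambda>w. plan_of (random_history \<eta> bs w)) i = (if i < length \<eta> then \<eta> ! i else (\<lambda>_. T))"
    by (auto simp: intervention_time_def p fun_eq_iff)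
  then show "intervention_time (\<lambda>w. plan_of (random_history \<eta> bs w)) i \<in> stopping_times"
    using ordered_timesD(1)[OF \<eta>] const_stopping_times[of T] T_nonneg by simp
  have "intervention_mode (\<lambda>w. plan_of (random_history \<eta> bs w)) i = (\<lambda>_. if i < length \<eta> then Some (bs ! i) else None)"
    by (auto simp: intervention_mode_def p fun_eq_iff)
  then show "intervention_mode (\<lambda>w. plan_of (random_history \<eta> bs w)) i \<in> measurable (pre_sigma (intervention_time (\<lambda>w. plan_of (random_history \<eta> bs w)) i)) (count_space UNIV)"
    by simp
  show "AE w in M. \<exists>i. plan_of (random_history \<eta> bs w) i = None"
    by (intro AE_I2 exI[of _ "length \<eta>"]) (simp add: plan_of_nth length_random_history[OF bs(2)])
qed

text \<open>Conditional expectations at fixed times determine a cadlag process up to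
  indistinguishability. Thus the moment bound, given for processes tied to the family at
  \<open>T\<close>, carries over to processes tied to it from an earlier time.\<close>

lemma at_random_index_unique:
  assumes "at_random_index Y h \<gamma> Z" "at_random_index Y h \<gamma>' Z'"
  shows "AE w in M. \<forall>s\<in>{0..T}. Z s w = Z' s w"
proof (rule cadlag_process_eq[where \<gamma>="\<lambda>_. 0"])
  show "cadlag_process Z" "cadlag_process Z'" using assms by (auto simp: at_random_index_def)
  fix s assume s: "s \<in> {0..T}"
  have "AE w in M. Z s w = real_cond_exp M (F s) (\<lambda>w. Y (h s w) (max s (last_time (h s w))) w) w"
    "AE w in M. Z' s w = real_cond_exp M (F s) (\<lambda>w. Y (h s w) (max s (last_time (h s w))) w) w"
    using assms s unfolding at_random_index_def Let_def by blast+
  then show "AE w in M. 0 \<le> s \<longrightarrow> Z s w = Z' s w" by eventually_elim simp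
qed (use T_nonneg in auto)

end

context verified_family
begin

lemma random_history_moment:
  assumes \<eta>: "\<eta> \<in> ordered_times" and bs: "bs \<in> mode_tuples" "length bs = length \<eta>"
    and Z: "at_random_index Y (\<lambda>s. random_history \<eta> bs) \<gamma> Z"
  shows "sup_moment2 Z < \<infinity>"
proof -
  obtain Zu where Zu: "\<forall>u\<in>controls_finite b0. at_random_index Y (\<lambda>s w. history_of (u w)) (\<lambda>_. T) (Zu u)"
    "(SUP u\<in>controls_finite b0. sup_moment2 (Zu u)) < \<infinity>"
    using family unfolding verification_family_def family_bounded_def by blast
  let ?u = "\<lambda>w. plan_of (random_history \<eta> bs w)"
  have u: "?u \<in> controls_finite b0" by (rule random_history_control[OF \<eta> bs])
  have "at_random_index Y (\<lambda>s w. history_of (?u w)) (\<lambda>_. T) (Zu ?u)" by (rule Zu(1)[rule_format, OF u])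
  then have "at_random_index Y (\<lambda>s. random_history \<eta> bs) (\<lambda>_. T) (Zu ?u)" unfolding history_of_plan_of .
  then have "sup_moment2 Z = sup_moment2 (Zu ?u)" using at_random_index_unique[OF Z] by (intro sup_moment2_cong) blast
  also have "\<dots> < \<infinity>"
    using le_less_trans[OF SUP_upper[OF u, of "\<lambda>u. sup_moment2 (Zu u)"] Zu(2)] by simp
  finally show ?thesis .
qed

text \<open>Times on a grid together with fixed modes leave finitely many possible histories, so
  their deterministic envelopes share one null set and can be mixed.\<close>

lemma envelope_of_grid_times:
  assumes \<eta>: "\<eta> \<in> ordered_times" and bs: "bs \<in> mode_tuples" "length bs = length \<eta>" and ne: "\<eta> \<noteq> []"
    and grid: "\<And>i w. i < length \<eta> \<Longrightarrow> w \<in> space M \<Longrightarrow> (\<eta> ! i) w \<in> grid T l"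
    and Z: "at_random_index Y (\<lambda>s. random_history \<eta> bs) (\<lambda>w. last_time (random_history \<eta> bs w)) Z"
    and X: "cadlag_process X" "AE w in M. \<forall>s\<in>{last_time (random_history \<eta> bs w)..T}. X s w = best_switch_value Y (random_history \<eta> bs w) s w"
  shows "envelope (random_history \<eta> bs) (\<lambda>w. last_time (random_history \<eta> bs w)) Z X"
proof -
  let ?h = "random_history \<eta> bs"
  have hin: "?h w \<in> histories" if "w \<in> space M" for w by (rule random_history_in_histories[OF \<eta> bs that])
  have "?h ` space M \<subseteq> (\<lambda>ts. zip ts bs) ` {ts. set ts \<subseteq> grid T l \<and> length ts = length \<eta>}"
  proof
    fix k assume "k \<in> ?h ` space M"
    then obtain w where w: "w \<in> space M" "k = zip (map (\<lambda>\<tau>. \<tau> w) \<eta>) bs" by (auto simp: random_history_def)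
    then show "k \<in> (\<lambda>ts. zip ts bs) ` {ts. set ts \<subseteq> grid T l \<and> length ts = length \<eta>}"
      using grid by (intro image_eqI[where x="map (\<lambda>\<tau>. \<tau> w) \<eta>"]) (auto simp: in_set_conv_nth)
  qed
  then have fin: "finite (?h ` space M)"
    by (rule finite_subset) (intro finite_imageI finite_lists_length_eq finite_grid)
  have "\<forall>k\<in>histories. \<exists>ZX. envelope (\<lambda>_. k) (\<lambda>_. last_time k) (fst ZX) (snd ZX)"
    using deterministic_envelope by fastforce
  from bchoice[OF this] obtain ZX where ZX: "\<And>k. k \<in> histories \<Longrightarrow> envelope (\<lambda>_. k) (\<lambda>_. last_time k) (fst (ZX k)) (snd (ZX k))" by blast
  define Zk where "Zk k = fst (ZX k)" for k
  define Xk where "Xk k = snd (ZX k)" for k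
  have det: "snell_from (\<lambda>_. last_time k) (Zk k) (Xk k)"
    "AE w in M. (\<forall>s\<in>{last_time k..T}. Zk k s w = Y k s w \<and> Xk k s w = best_switch_value Y k s w) \<and> Y k T w = Psi w (plan_of k)"
    if "k \<in> ?h ` space M" for k
    using ZX[of k] hin that unfolding envelope_def Zk_def Xk_def by blast+
  have detall: "AE w in M. \<forall>k\<in>?h ` space M. (\<forall>s\<in>{last_time k..T}. Zk k s w = Y k s w \<and> Xk k s w = best_switch_value Y k s w) \<and> Y k T w = Psi w (plan_of k)"
    by (rule AE_finite_allI[OF fin det(2)])
  have ZY: "AE w in M. \<forall>s\<in>{last_time (?h w)..T}. Z s w = Y (?h w) s w" using Z by (simp add: at_random_index_def)
  have Zc: "cadlag_process Z" using Z by (simp add: at_random_index_def)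
  have "snell_from (\<lambda>w. last_time (?h w)) Z X"
  proof (rule snell_from_mixture[where h="?h" and t=last_time and Zk=Zk and Xk=Xk])
    show "finite (?h ` space M)" by (rule fin)
    show "last_time (?h w) \<in> {0..T}" if "w \<in> space M" for w by (rule last_time_range[OF hin[OF that]])
    \<comment> \<open>Each event that a time takes a given value is known at that value, hence by
      the last time of \<open>k\<close>.\<close>
    show "{w\<in>space M. ?h w = k} \<in> sets (F (last_time k))" if k: "k \<in> ?h ` space M" for k
    proof -
      obtain w0 where w0: "w0 \<in> space M" "k = ?h w0" using k by blast
      have len: "length k = length \<eta>" using w0 by (simp add: length_random_history[OF bs(2)])
      have "{w\<in>space M. ?h w = k} = (\<Inter>i\<in>{..<length \<eta>}. {w\<in>space M. (\<eta> ! i) w = (\<eta> ! i) w0})"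
      proof -
        have "?h w = k \<longleftrightarrow> (\<forall>i\<in>{..<length \<eta>}. (\<eta> ! i) w = (\<eta> ! i) w0)" for w
          by (simp add: w0(2) list_eq_iff_nth_eq length_random_history[OF bs(2)] random_history_nth[OF bs(2)] Ball_def)
        moreover have "0 \<in> {..<length \<eta>}" using ne by simp
        ultimately show ?thesis by (auto simp del: lessThan_iff)
      qed
      also have "\<dots> \<in> sets (F (last_time k))"
      proof (intro sets.finite_INT)
        fix i assume "i \<in> {..<length \<eta>}"
        then have i: "i < length \<eta>" by simp
        have st: "stopping_time F (\<eta> ! i)" by (rule stopping_timesD(1)[OF ordered_timesD(1)[OF \<eta> i]])
        have "(\<eta> ! i) w0 \<le> (\<eta> ! (length \<eta> - 1)) w0" using i by (intro ordered_timesD(2)[OF \<eta> w0(1)]) auto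
        also have "\<dots> = last_time k" using ne by (simp add: w0(2) last_time_random_history[OF bs(2)] last_conv_nth)
        finally have "sets (F ((\<eta> ! i) w0)) \<subseteq> sets (F (last_time k))" by (rule sets_F_mono)
        moreover have "{w\<in>space M. (\<eta> ! i) w = (\<eta> ! i) w0} \<in> sets (F ((\<eta> ! i) w0))"
          using stopping_time_eq_const[OF st, of "(\<eta> ! i) w0"] by (simp add: pred_def space_F)
        ultimately show "{w\<in>space M. (\<eta> ! i) w = (\<eta> ! i) w0} \<in> sets (F (last_time k))" by blast
      qed (use ne in auto)
      finally show ?thesis .
    qed
    show "snell_from (\<lambda>_. last_time k) (Zk k) (Xk k)" if "k \<in> ?h ` space M" for k by (rule det(1)[OF that])
    show "sup_moment2 Z < \<infinity>" by (rule random_history_moment[OF \<eta> bs Z])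
    show "AE w in M. \<forall>s\<in>{last_time (?h w)..T}. Z s w = Zk (?h w) s w \<and> X s w = Xk (?h w) s w"
      using ZY X(2) detall AE_space by eventually_elim simp
  qed (simp_all add: Zc X(1))
  moreover have "AE w in M. (\<forall>s\<in>{last_time (?h w)..T}. Z s w = Y (?h w) s w \<and> X s w = best_switch_value Y (?h w) s w) \<and> Y (?h w) T w = Psi w (plan_of (?h w))"
    using ZY X(2) detall AE_space by eventually_elim simp
  ultimately show ?thesis unfolding envelope_def by blast
qed

lemma best_switch_extend:
  assumes len: "length bs = length \<eta>" and a: "a = last (b0 # bs)"
    and Zb: "\<And>b. b \<in> alternatives m a \<Longrightarrow> at_random_index Y (extend (random_history \<eta> bs) b) (\<lambda>w. last_time (random_history \<eta> bs w)) (Zb b)"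
  shows "AE w in M. \<forall>s\<in>{last_time (random_history \<eta> bs w)..T}.
    Max ((\<lambda>b. Zb b s w - c a b s w) ` alternatives m a) = best_switch_value Y (random_history \<eta> bs w) s w"
proof -
  have "AE w in M. \<forall>b\<in>alternatives m a. \<forall>s\<in>{last_time (random_history \<eta> bs w)..T}. Zb b s w = Y (extend (random_history \<eta> bs) b s w) s w"
    using Zb by (intro AE_finite_allI) (auto simp: at_random_index_def)
  then show ?thesis
  proof eventually_elim
    case (elim w)
    show ?case
    proof
      fix s assume s: "s \<in> {last_time (random_history \<eta> bs w)..T}"
      have "Zb b s w - c a b s w = switch_value Y (random_history \<eta> bs w) s w b" if "b \<in> alternatives m a" for b
        using elim that s by (simp add: switch_value_def last_mode_random_history[OF len] a extend_def max_absorb1)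
      then show "Max ((\<lambda>b. Zb b s w - c a b s w) ` alternatives m a) = best_switch_value Y (random_history \<eta> bs w) s w"
        unfolding best_switch_value_def last_mode_random_history[OF len] a[symmetric]
        by (intro arg_cong[where f=Max] image_cong) auto
    qed
  qed
qed

text \<open>Rounding up to finer and finer grids reduces to finitely many histories.
  \<open>family_discretizable\<close> gives convergence in L2 uniformly in time, for the family and
  for each process behind the obstacle. The terminal value is passed to the limit by
  right-continuity of \<open>Psi\<close>, as the rounded times approach the given ones from the
  right.\<close>

theorem random_envelope:
  assumes \<eta>: "\<eta> \<in> ordered_times" and bs: "bs \<in> mode_tuples" "length bs = length \<eta>"
  shows "\<exists>Z X. envelope (random_history \<eta> bs) (\<lambda>w. last_time (random_history \<eta> bs w)) Z X"
proof (cases "\<eta> = []")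
  case True
  have "random_history \<eta> bs = (\<lambda>_. [])" using True by (simp add: random_history_def fun_eq_iff)
  then show ?thesis using deterministic_envelope[OF histories_Nil] by simp
next
  case ne: False
  define h where "h = random_history \<eta> bs"
  define hl where "hl l = random_history (discretize l \<eta>) bs" for l
  define \<gamma> where "\<gamma> w = last_time (h w)" for w
  define \<gamma>l where "\<gamma>l l w = last_time (hl l w)" for l w
  define a where "a = last bs"
  let ?B = "alternatives m a"
  have bne: "bs \<noteq> []" using ne bs(2) by auto
  have a': "a = last (b0 # bs)" using bne by (simp add: a_def)
  have dl: "discretize l \<eta> \<in> ordered_times" "length bs = length (discretize l \<eta>)" "discretize l \<eta> \<noteq> []" for l
    using discretize_ordered[OF \<eta>] bs(2) ne by (auto simp: length_discretize discretize_def)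
  have hin: "h w \<in> histories" "hl l w \<in> histories" if "w \<in> space M" for w l
    using random_history_in_histories[OF \<eta> bs that] random_history_in_histories[OF dl(1) bs(1) dl(2) that] by (simp_all add: h_def hl_def)
  have aI: "a \<in> {1..m}"
  proof -
    obtain w where "w \<in> space M" using not_empty by blast
    from last_mode_range[OF hin(1)[OF this]] show ?thesis
      by (simp only: h_def last_mode_random_history[OF bs(2)] a'[symmetric])
  qed
  have B: "finite ?B" "?B \<noteq> {}" using alternatives_nonempty by auto
  have fd: "L2_approximable Y (\<lambda>l s. hl l) \<gamma>l (\<lambda>s. h) \<gamma>" "\<forall>b\<in>?B. L2_approximable Y (\<lambda>l. extend (hl l) b) \<gamma>l (extend h b) \<gamma>"
  proof -
    have "\<forall>\<eta>\<in>ordered_times. \<forall>bs\<in>mode_tuples. \<eta> \<noteq> [] \<and> length bs = length \<eta> \<longrightarrow>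
      (let h = random_history \<eta> bs; hl = (\<lambda>l. random_history (discretize l \<eta>) bs);
           \<gamma> = (\<lambda>w. last_time (h w)); \<gamma>l = (\<lambda>l w. last_time (hl l w)) in
       L2_approximable Y (\<lambda>l s. hl l) \<gamma>l (\<lambda>s. h) \<gamma> \<and>
       (\<forall>b\<in>alternatives m (last bs). L2_approximable Y (\<lambda>l. extend (hl l) b) \<gamma>l (extend h b) \<gamma>))"
      using family unfolding verification_family_def family_discretizable_def by blast
    from this[rule_format, OF \<eta> bs(1)] ne bs(2)
    show "L2_approximable Y (\<lambda>l s. hl l) \<gamma>l (\<lambda>s. h) \<gamma>" "\<forall>b\<in>?B. L2_approximable Y (\<lambda>l. extend (hl l) b) \<gamma>l (extend h b) \<gamma>"
      by (auto simp: Let_def hl_def[abs_def] h_def \<gamma>_def[abs_def] \<gamma>l_def[abs_def] a_def)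
  qed
  obtain Zl Z where Zl: "\<And>l. at_random_index Y (\<lambda>s. hl l) (\<gamma>l l) (Zl l)" and Z: "at_random_index Y (\<lambda>s. h) \<gamma> Z"
    and Zlim: "(\<lambda>l. sup_moment2 (\<lambda>s w. Zl l s w - Z s w)) \<longlonglongrightarrow> 0"
    using fd(1) unfolding L2_approximable_def by blast
  have "\<forall>b\<in>?B. \<exists>P. (\<forall>l. at_random_index Y (extend (hl l) b) (\<gamma>l l) (fst P l)) \<and> at_random_index Y (extend h b) \<gamma> (snd P) \<and>
     (\<lambda>l. sup_moment2 (\<lambda>s w. fst P l s w - snd P s w)) \<longlonglongrightarrow> 0"
    using fd(2) unfolding L2_approximable_def by fastforce
  from bchoice[OF this] obtain P where P: "\<forall>b\<in>?B. (\<forall>l. at_random_index Y (extend (hl l) b) (\<gamma>l l) (fst (P b) l)) \<and> at_random_index Y (extend h b) \<gamma> (snd (P b)) \<and>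
     (\<lambda>l. sup_moment2 (\<lambda>s w. fst (P b) l s w - snd (P b) s w)) \<longlonglongrightarrow> 0" by blast
  define Zbl where "Zbl b = fst (P b)" for b
  define Zb where "Zb b = snd (P b)" for b
  have Zbl: "\<And>b l. b \<in> ?B \<Longrightarrow> at_random_index Y (extend (hl l) b) (\<gamma>l l) (Zbl b l)"
    and Zb: "\<And>b. b \<in> ?B \<Longrightarrow> at_random_index Y (extend h b) \<gamma> (Zb b)"
    and Zblim: "\<And>b. b \<in> ?B \<Longrightarrow> (\<lambda>l. sup_moment2 (\<lambda>s w. Zbl b l s w - Zb b s w)) \<longlonglongrightarrow> 0"
    using P by (auto simp: Zbl_def Zb_def)
  have cS: "cadlag_process (c a b)" if "b \<in> ?B" for b using costs_S2[OF aI that] by (auto simp: S2_qlc_def S2_def)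
  have cad: "cadlag_process (Zl l)" "cadlag_process Z" "b \<in> ?B \<Longrightarrow> cadlag_process (Zbl b l)" "b \<in> ?B \<Longrightarrow> cadlag_process (Zb b)" for l b
    using Zl Z Zbl Zb by (auto simp: at_random_index_def)
  define X where "X s w = Max ((\<lambda>b. Zb b s w - c a b s w) ` ?B)" for s w
  define Xl where "Xl l s w = Max ((\<lambda>b. Zbl b l s w - c a b s w) ` ?B)" for l s w
  have Xc: "cadlag_process X" "cadlag_process (Xl l)" for l
    unfolding X_def[abs_def] Xl_def[abs_def] using B cS cad by (intro cadlag_process_Max cadlag_process_diff; simp)+
  have Xbest: "AE w in M. \<forall>s\<in>{\<gamma> w..T}. X s w = best_switch_value Y (h w) s w"
    unfolding X_def h_def \<gamma>_def using Zb by (intro best_switch_extend[OF bs(2) a']) (simp add: h_def \<gamma>_def[abs_def])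
  have Xlbest: "AE w in M. \<forall>s\<in>{\<gamma>l l w..T}. Xl l s w = best_switch_value Y (hl l w) s w" for l
    unfolding Xl_def hl_def \<gamma>l_def using Zbl by (intro best_switch_extend[OF dl(2) a']) (simp add: hl_def \<gamma>l_def[abs_def])
  have envl: "envelope (hl l) (\<gamma>l l) (Zl l) (Xl l)" for l
    unfolding hl_def \<gamma>l_def[abs_def]
  proof (rule envelope_of_grid_times[OF dl(1) bs(1) dl(2,3), where l=l])
    show "(discretize l \<eta> ! i) w \<in> grid T l" if "i < length (discretize l \<eta>)" "w \<in> space M" for i w
      using that stopping_timesD(3)[OF ordered_timesD(1)[OF \<eta>] that(2), of i] by (auto simp: discretize_def intro!: grid_up_in)
    show "at_random_index Y (\<lambda>s. random_history (discretize l \<eta>) bs) (\<lambda>w. last_time (random_history (discretize l \<eta>) bs w)) (Zl l)"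
      using Zl[of l] by (simp add: hl_def \<gamma>l_def[abs_def])
    show "AE w in M. \<forall>s\<in>{last_time (random_history (discretize l \<eta>) bs w)..T}. Xl l s w = best_switch_value Y (random_history (discretize l \<eta>) bs w) s w"
      using Xlbest[of l] by (simp add: hl_def \<gamma>l_def)
  qed (rule Xc)
  obtain D0 where D0: "\<And>l. integrable M (D0 l)" "\<And>l w. 0 \<le> D0 l w" "(\<lambda>l. \<integral>w. D0 l w \<partial>M) \<longlonglongrightarrow> 0"
    "\<forall>\<^sub>F l in sequentially. AE w in M. \<forall>s\<in>{0..T}. \<bar>Zl l s w - Z s w\<bar> \<le> D0 l w"
    by (rule L2_null_dominators[OF cadlag_process_diff[OF cad(1,2)] Zlim]) blast
  have "\<forall>b\<in>?B. \<exists>D. (\<forall>l. integrable M (D l)) \<and> (\<forall>l w. 0 \<le> D l w) \<and> (\<lambda>l. \<integral>w. D l w \<partial>M) \<longlonglongrightarrow> 0 \<and>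
    (\<forall>\<^sub>F l in sequentially. AE w in M. \<forall>s\<in>{0..T}. \<bar>Zbl b l s w - Zb b s w\<bar> \<le> D l w)"
  proof
    fix b assume b: "b \<in> ?B"
    show "\<exists>D. (\<forall>l. integrable M (D l)) \<and> (\<forall>l w. 0 \<le> D l w) \<and> (\<lambda>l. \<integral>w. D l w \<partial>M) \<longlonglongrightarrow> 0 \<and>
      (\<forall>\<^sub>F l in sequentially. AE w in M. \<forall>s\<in>{0..T}. \<bar>Zbl b l s w - Zb b s w\<bar> \<le> D l w)"
      by (rule L2_null_dominators[OF cadlag_process_diff[OF cad(3)[OF b] cad(4)[OF b]] Zblim[OF b]]) blast
  qed
  from bchoice[OF this] obtain Db where Db: "\<And>b l. b \<in> ?B \<Longrightarrow> integrable M (Db b l)" "\<And>b l w. b \<in> ?B \<Longrightarrow> 0 \<le> Db b l w"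
    "\<And>b. b \<in> ?B \<Longrightarrow> (\<lambda>l. \<integral>w. Db b l w \<partial>M) \<longlonglongrightarrow> 0"
    "\<And>b. b \<in> ?B \<Longrightarrow> \<forall>\<^sub>F l in sequentially. AE w in M. \<forall>s\<in>{0..T}. \<bar>Zbl b l s w - Zb b s w\<bar> \<le> Db b l w" by blast
  \<comment> \<open>One dominating variable for the value and for all switch values; a finite
    maximum is nonexpansive, so it also controls the obstacle.\<close>
  define d where "d l w = D0 l w + (\<Sum>b\<in>?B. Db b l w)" for l w
  have di: "integrable M (d l)" for l unfolding d_def using D0(1) Db(1) by (intro Bochner_Integration.integrable_add Bochner_Integration.integrable_sum)
  have d0: "0 \<le> d l w" for l w unfolding d_def using D0(2) Db(2) by (intro add_nonneg_nonneg sum_nonneg)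
  have dlim: "(\<lambda>l. \<integral>w. d l w \<partial>M) \<longlonglongrightarrow> 0"
  proof -
    have "(\<integral>w. d l w \<partial>M) = (\<integral>w. D0 l w \<partial>M) + (\<Sum>b\<in>?B. \<integral>w. Db b l w \<partial>M)" for l
    proof -
      have "(\<integral>w. d l w \<partial>M) = (\<integral>w. D0 l w \<partial>M) + (\<integral>w. (\<Sum>b\<in>?B. Db b l w) \<partial>M)"
        unfolding d_def by (rule Bochner_Integration.integral_add[OF D0(1) Bochner_Integration.integrable_sum[OF Db(1)]])
      also have "(\<integral>w. (\<Sum>b\<in>?B. Db b l w) \<partial>M) = (\<Sum>b\<in>?B. \<integral>w. Db b l w \<partial>M)"
        by (rule Bochner_Integration.integral_sum[OF Db(1)])
      finally show ?thesis .
    qed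
    moreover have "(\<lambda>l. (\<integral>w. D0 l w \<partial>M) + (\<Sum>b\<in>?B. \<integral>w. Db b l w \<partial>M)) \<longlonglongrightarrow> 0 + (\<Sum>b\<in>?B. 0)"
      by (intro tendsto_add tendsto_sum D0(3) Db(3))
    ultimately show ?thesis by simp
  qed
  have "\<forall>\<^sub>F l in sequentially. \<forall>b\<in>?B. AE w in M. \<forall>s\<in>{0..T}. \<bar>Zbl b l s w - Zb b s w\<bar> \<le> Db b l w"
    by (rule eventually_ball_finite) (use Db(4) B in auto)
  with D0(4) have "\<forall>\<^sub>F l in sequentially. AE w in M. \<forall>s\<in>{0..T}. \<bar>Zl l s w - Z s w\<bar> \<le> d l w \<and> \<bar>Xl l s w - X s w\<bar> \<le> d l w"
  proof eventually_elim
    case (elim l)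
    have "AE w in M. \<forall>b\<in>?B. \<forall>s\<in>{0..T}. \<bar>Zbl b l s w - Zb b s w\<bar> \<le> Db b l w"
      by (rule AE_finite_allI[OF B(1)]) (use elim(2) in blast)
    with elim(1) show ?case
    proof eventually_elim
      case (elim w)
      show ?case
      proof (intro ballI conjI)
        fix s assume s: "s \<in> {0..T}"
        have nn: "0 \<le> (\<Sum>b\<in>?B. Db b l w)" using Db(2) by (intro sum_nonneg)
        then show "\<bar>Zl l s w - Z s w\<bar> \<le> d l w" using elim(1) s by (force simp: d_def)
        show "\<bar>Xl l s w - X s w\<bar> \<le> d l w"
          unfolding Xl_def X_def
        proof (rule Max_diff_bound[OF B])
          fix b assume b: "b \<in> ?B"
          have "\<bar>Zbl b l s w - Zb b s w\<bar> \<le> Db b l w" using elim(2) b s by blast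
          also have "\<dots> \<le> (\<Sum>b\<in>?B. Db b l w)" using b B Db(2) by (intro member_le_sum) auto
          also have "\<dots> \<le> d l w" using D0(2) by (simp add: d_def)
          finally show "\<bar>(Zbl b l s w - c a b s w) - (Zb b s w - c a b s w)\<bar> \<le> d l w" by simp
        qed
      qed
    qed
  qed
  then obtain L where L: "\<And>l. L \<le> l \<Longrightarrow> AE w in M. \<forall>s\<in>{0..T}. \<bar>Zl l s w - Z s w\<bar> \<le> d l w \<and> \<bar>Xl l s w - X s w\<bar> \<le> d l w"
    by (auto simp: eventually_sequentially)
  have "(\<lambda>l. \<integral>w. norm (d (l + L) w) \<partial>M) \<longlonglongrightarrow> 0"
    using LIMSEQ_ignore_initial_segment[OF dlim, of L] d0 by simp
  \<comment> \<open>Convergence in mean is upgraded to almost sure convergence along a subsequence,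
    as \<open>snell_from_limit\<close> asks for both. The shift by \<open>L\<close> skips the
    indices at which domination may fail.\<close>
  from tendsto_L1_AE_subseq[OF di this] obtain q where q: "strict_mono q" "AE w in M. (\<lambda>n. d (q n + L) w) \<longlonglongrightarrow> 0" by blast
  define r where "r n = q n + L" for n
  have r: "filterlim r sequentially sequentially"
    unfolding r_def by (rule filterlim_add_const_nat_at_top[THEN filterlim_compose, OF filterlim_subseq[OF q(1)]])
  have times: "(\<eta> ! i) w \<le> (discretize l \<eta> ! i) w" "(\<lambda>l. (discretize l \<eta> ! i) w) \<longlonglongrightarrow> (\<eta> ! i) w"
    if "i < length \<eta>" "w \<in> space M" for i l w
    using that stopping_timesD(2,3)[OF ordered_timesD(1)[OF \<eta> that(1)] that(2)] T_pos
    by (auto simp: discretize_def intro!: grid_up_ge grid_up_tendsto)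
  have lst: "\<gamma> w = (\<eta> ! (length \<eta> - 1)) w" "\<gamma>l l w = (discretize l \<eta> ! (length \<eta> - 1)) w" for l w
    using ne dl(3) by (simp_all add: \<gamma>_def \<gamma>l_def h_def hl_def last_time_random_history[OF bs(2)] last_time_random_history[OF dl(2)] last_conv_nth length_discretize)
  have nl: "length \<eta> - 1 < length \<eta>" using ne by (cases \<eta>) auto
  have "snell_from \<gamma> Z X"
  proof (rule snell_from_limit[where \<gamma>l="\<lambda>n. \<gamma>l (r n)" and Zl="\<lambda>n. Zl (r n)" and Xl="\<lambda>n. Xl (r n)" and d="\<lambda>n. d (r n)"])
    show "snell_from (\<gamma>l (r n)) (Zl (r n)) (Xl (r n))" for n using envl[of "r n"] by (simp add: envelope_def)
    show "\<gamma> \<in> stopping_times" using last_time_stopping[OF \<eta> bs(2)] by (simp add: \<gamma>_def[abs_def] h_def)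
    show "sup_moment2 Z < \<infinity>" using random_history_moment[OF \<eta> bs] Z by (simp add: h_def)
    show "\<gamma> w \<le> \<gamma>l (r n) w" if "w \<in> space M" for w n using times(1)[OF nl that] by (simp add: lst)
    show "(\<lambda>n. \<gamma>l (r n) w) \<longlonglongrightarrow> \<gamma> w" if "w \<in> space M" for w
      unfolding lst by (rule filterlim_compose[OF times(2)[OF nl that] r])
    show "(\<lambda>n. \<integral>w. d (r n) w \<partial>M) \<longlonglongrightarrow> 0" by (rule filterlim_compose[OF dlim r])
    show "AE w in M. (\<lambda>n. d (r n) w) \<longlonglongrightarrow> 0" using q(2) by (simp add: r_def)
    show "AE w in M. \<forall>n. \<forall>s\<in>{0..T}. \<bar>Zl (r n) s w - Z s w\<bar> \<le> d (r n) w \<and> \<bar>Xl (r n) s w - X s w\<bar> \<le> d (r n) w"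
      unfolding AE_all_countable using L by (simp add: r_def)
  qed (rule cad Xc di)+
  moreover have "AE w in M. (\<forall>s\<in>{\<gamma> w..T}. Z s w = Y (h w) s w \<and> X s w = best_switch_value Y (h w) s w) \<and> Y (h w) T w = Psi w (plan_of (h w))"
  proof -
    have 1: "AE w in M. \<forall>s\<in>{\<gamma> w..T}. Z s w = Y (h w) s w" using Z by (simp add: at_random_index_def)
    have 2: "AE w in M. \<forall>l. \<forall>s\<in>{\<gamma>l l w..T}. Zl l s w = Y (hl l w) s w" using Zl by (simp add: at_random_index_def AE_all_countable)
    have 3: "AE w in M. \<forall>l. Y (hl l w) T w = Psi w (plan_of (hl l w))"
      unfolding AE_all_countable
    proof
      fix l show "AE w in M. Y (hl l w) T w = Psi w (plan_of (hl l w))"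
        using envl[of l, unfolded envelope_def, THEN conjunct2] by eventually_elim blast
    qed
    have 4: "AE w in M. \<forall>n. \<bar>Zl (r n) T w - Z T w\<bar> \<le> d (r n) w"
      unfolding AE_all_countable
    proof
      fix n
      have "AE w in M. \<forall>s\<in>{0..T}. \<bar>Zl (r n) s w - Z s w\<bar> \<le> d (r n) w \<and> \<bar>Xl (r n) s w - X s w\<bar> \<le> d (r n) w"
        by (rule L) (simp add: r_def)
      then show "AE w in M. \<bar>Zl (r n) T w - Z T w\<bar> \<le> d (r n) w" by eventually_elim (use T_nonneg in auto)
    qed
    have 5: "AE w in M. \<forall>d\<in>plans T m b0. \<forall>D. range D \<subseteq> plans T m b0 \<longrightarrow> converges_from_right D d \<longrightarrow> (\<lambda>k. Psi w (D k)) \<longlonglongrightarrow> Psi w d"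
      using sa1 by (simp add: standing_assumption_1_def Psi_right_continuous_def)
    show ?thesis using 1 2 3 4 5 Xbest q(2) AE_space
    proof eventually_elim
      case (elim w)
      note w = elim(8)
      have gT: "\<gamma> w \<le> T" "\<gamma>l l w \<le> T" for l
        using last_time_range hin[OF w] by (auto simp: \<gamma>_def \<gamma>l_def)
      have "(\<lambda>l. Psi w (plan_of (hl l w))) \<longlonglongrightarrow> Psi w (plan_of (h w))"
      proof (rule elim(5)[rule_format])
        show "plan_of (h w) \<in> plans T m b0" using hin(1)[OF w] by (simp add: histories_def)
        show "range (\<lambda>l. plan_of (hl l w)) \<subseteq> plans T m b0" using hin(2)[OF w] by (auto simp: histories_def)
        show "converges_from_right (\<lambda>l. plan_of (hl l w)) (plan_of (h w))"
          unfolding converges_from_right_def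
        proof (intro conjI allI impI)
          fix l i show "rel_option (\<lambda>(t, b) (t', b'). t \<le> t' \<and> b = b') (plan_of (h w) i) (plan_of (hl l w) i)"
            using times(1)[OF _ w, of i l]
            by (simp add: plan_of_nth h_def hl_def length_random_history[OF bs(2)] length_random_history[OF dl(2)] length_discretize
                random_history_nth[OF bs(2)] random_history_nth[OF dl(2)])
        next
          fix i assume "plan_of (h w) i \<noteq> None"
          then have i: "i < length \<eta>" by (simp add: plan_of_nth h_def length_random_history[OF bs(2)] split: if_splits)
          then show "(\<lambda>l. fst (the (plan_of (hl l w) i))) \<longlonglongrightarrow> fst (the (plan_of (h w) i))"
            using times(2)[OF i w]
            by (simp add: plan_of_nth h_def hl_def length_random_history[OF bs(2)] length_random_history[OF dl(2)] length_discretize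
                random_history_nth[OF bs(2)] random_history_nth[OF dl(2)])
        qed
      qed
      from filterlim_compose[OF this r] have lim1: "(\<lambda>n. Psi w (plan_of (hl (r n) w))) \<longlonglongrightarrow> Psi w (plan_of (h w))" .
      have ZT: "Zl (r n) T w = Psi w (plan_of (hl (r n) w))" for n using elim(2,3) gT(2) by simp
      have "(\<lambda>n. Zl (r n) T w - Z T w) \<longlonglongrightarrow> 0"
        by (rule Lim_null_comparison[where g="\<lambda>n. d (r n) w"]) (use elim(4,7) in \<open>simp_all add: r_def\<close>)
      then have "(\<lambda>n. Zl (r n) T w) \<longlonglongrightarrow> Z T w" by (simp add: LIM_zero_iff)
      then have "Z T w = Psi w (plan_of (h w))" using lim1 LIMSEQ_unique unfolding ZT by blast
      then show ?case using elim(1,6) gT(1) by auto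
    qed
  qed
  ultimately show ?thesis unfolding envelope_def h_def[symmetric] \<gamma>_def[symmetric] by blast
qed

end

section \<open>Schemes of interventions\<close>

context switching_problem
begin

text \<open>A sequence of interventions with \<open>E k\<close> the event that at least \<open>k\<close> of them take place.\<close>

definition scheme :: "(nat \<Rightarrow> 'a \<Rightarrow> real) \<Rightarrow> (nat \<Rightarrow> 'a \<Rightarrow> nat) \<Rightarrow> (nat \<Rightarrow> 'a set) \<Rightarrow> bool" where
  "scheme tau beta E \<longleftrightarrow> tau 0 = (\<lambda>_. 0) \<and> beta 0 = (\<lambda>_. b0) \<and> E 0 = space M \<and>
     (\<forall>j. tau j \<in> stopping_times \<and> beta j \<in> measurable (pre_sigma (tau j)) (count_space UNIV) \<and>
          E j \<in> sets (pre_sigma (tau j)) \<and> E (Suc j) \<subseteq> E j \<and>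
          (\<forall>w\<in>space M. tau j w \<le> tau (Suc j) w \<and>
             (w \<in> E (Suc j) \<longrightarrow> beta (Suc j) w \<in> alternatives m (beta j w)) \<and>
             (w \<notin> E (Suc j) \<longrightarrow> tau (Suc j) w = T)))"

definition scheme_plan :: "(nat \<Rightarrow> 'a \<Rightarrow> real) \<Rightarrow> (nat \<Rightarrow> 'a \<Rightarrow> nat) \<Rightarrow> (nat \<Rightarrow> 'a set) \<Rightarrow> 'a control" where
  "scheme_plan tau beta E w i = (if w \<in> E (Suc i) then Some (tau (Suc i) w, beta (Suc i) w) else None)"

text \<open>Cutting a scheme off after \<open>k\<close> interventions yields a control with finitely
  many of them, hence one to which the moment bounds apply, before anything is known about
  termination of the scheme itself.\<close>

definition trunc_times :: "nat \<Rightarrow> (nat \<Rightarrow> 'a \<Rightarrow> real) \<Rightarrow> nat \<Rightarrow> 'a \<Rightarrow> real" where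
  "trunc_times k tau j = (if j \<le> k then tau j else (\<lambda>_. T))"

definition trunc_events :: "nat \<Rightarrow> (nat \<Rightarrow> 'a set) \<Rightarrow> nat \<Rightarrow> 'a set" where
  "trunc_events k E j = (if j \<le> k then E j else {})"

lemma rule_history_0: "rule_history tau beta 0 w = []"
  by (simp add: rule_history_def)

lemma rule_history_Suc:
  "rule_history tau beta (Suc k) w = rule_history tau beta k w @ [(tau (Suc k) w, beta (Suc k) w)]"
  by (simp add: rule_history_def)

lemma length_rule_history: "length (rule_history tau beta k w) = k"
  by (simp add: rule_history_def)

lemma rule_history_nth: "i < k \<Longrightarrow> rule_history tau beta k w ! i = (tau (Suc i) w, beta (Suc i) w)"
  by (simp add: rule_history_def del: upt_Suc)

lemma schemeD:
  assumes "scheme tau beta E"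
  shows "tau 0 = (\<lambda>_. 0)" "beta 0 = (\<lambda>_. b0)" "E 0 = space M" "\<And>j. tau j \<in> stopping_times"
    "\<And>j. beta j \<in> measurable (pre_sigma (tau j)) (count_space UNIV)" "\<And>j. E j \<in> sets (pre_sigma (tau j))"
    "\<And>j. E (Suc j) \<subseteq> E j" "\<And>j w. w \<in> space M \<Longrightarrow> tau j w \<le> tau (Suc j) w"
    "\<And>j w. w \<in> E (Suc j) \<Longrightarrow> beta (Suc j) w \<in> alternatives m (beta j w)"
    "\<And>j w. w \<in> space M \<Longrightarrow> w \<notin> E (Suc j) \<Longrightarrow> tau (Suc j) w = T"
    "\<And>j w. w \<in> E j \<Longrightarrow> w \<in> space M" "\<And>j. E j \<in> sets M"
    "\<And>i j. i \<le> j \<Longrightarrow> E j \<subseteq> E i" "\<And>i j w. w \<in> space M \<Longrightarrow> i \<le> j \<Longrightarrow> tau i w \<le> tau j w"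
proof -
  show 1: "tau 0 = (\<lambda>_. 0)" "beta 0 = (\<lambda>_. b0)" "E 0 = space M" "\<And>j. tau j \<in> stopping_times"
    "\<And>j. beta j \<in> measurable (pre_sigma (tau j)) (count_space UNIV)" "\<And>j. E j \<in> sets (pre_sigma (tau j))"
    "\<And>j. E (Suc j) \<subseteq> E j" "\<And>j w. w \<in> space M \<Longrightarrow> tau j w \<le> tau (Suc j) w"
    "\<And>j w. w \<in> space M \<Longrightarrow> w \<notin> E (Suc j) \<Longrightarrow> tau (Suc j) w = T"
    using assms unfolding scheme_def by blast+
  show sp: "w \<in> space M" if "w \<in> E j" for j w using sets.sets_into_space[OF 1(6)[of j]] that by (auto simp: space_pre_sigma)
  show "beta (Suc j) w \<in> alternatives m (beta j w)" if "w \<in> E (Suc j)" for j w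
    using assms sp[OF that] that unfolding scheme_def by blast
  show "E j \<in> sets M" for j using 1(6)[of j] pre_sigma_sets_M[OF 1(4)] sets_F_subset by blast
  show "E j \<subseteq> E i" if "i \<le> j" for i j using 1(7) that by (rule lift_Suc_antimono_le)
  show "tau i w \<le> tau j w" if "w \<in> space M" "i \<le> j" for i j w
    using lift_Suc_mono_le[of "\<lambda>j. tau j w" i j] 1(8)[OF that(1)] that(2) by blast
qed

lemma scheme_history:
  assumes sch: "scheme tau beta E" and w: "w \<in> E k"
  shows "rule_history tau beta k w \<in> histories" "last_time (rule_history tau beta k w) = tau k w"
    "last_mode (rule_history tau beta k w) = beta k w"
proof -
  note D = schemeD[OF sch]
  show 2: "last_time (rule_history tau beta k w) = tau k w" "last_mode (rule_history tau beta k w) = beta k w" for k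
    by (cases k; simp add: rule_history_0 rule_history_Suc last_time_def last_mode_def D(1,2))+
  show "rule_history tau beta k w \<in> histories" using w
  proof (induction k)
    case (Suc k)
    then have "w \<in> E k" "w \<in> space M" using D(7,11) by blast+
    then show ?case
      using Suc D(8)[of w k] D(9)[OF Suc.prems] stopping_timesD(3)[OF D(4), of w "Suc k"]
      by (simp add: rule_history_Suc histories_snoc 2)
  qed (simp add: rule_history_0 histories_Nil)
qed

lemma scheme_plan_last:
  assumes sch: "scheme tau beta E" and w: "w \<in> E k" "w \<notin> E (Suc k)"
  shows "scheme_plan tau beta E w = plan_of (rule_history tau beta k w)"
proof
  fix i
  note D = schemeD[OF sch]
  show "scheme_plan tau beta E w i = plan_of (rule_history tau beta k w) i"
  proof (cases "i < k")
    case True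
    then have "w \<in> E (Suc i)" using D(13)[of "Suc i" k] w(1) by auto
    then show ?thesis using True by (simp add: scheme_plan_def plan_of_nth length_rule_history rule_history_nth)
  next
    case False
    then have "w \<notin> E (Suc i)" using D(13)[of "Suc k" "Suc i"] w(2) by auto
    then show ?thesis using False by (simp add: scheme_plan_def plan_of_nth length_rule_history)
  qed
qed

lemma scheme_trunc:
  assumes sch: "scheme tau beta E"
  shows "scheme (trunc_times k tau) beta (trunc_events k E)"
proof -
  note D = schemeD[OF sch]
  have Tst: "(\<lambda>_. T) \<in> stopping_times" using T_nonneg by (intro const_stopping_times) auto
  have st: "trunc_times k tau j \<in> stopping_times" for j using D(4) Tst by (simp add: trunc_times_def)
  have "beta j \<in> measurable (pre_sigma (\<lambda>_. T)) (count_space UNIV)" for j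
    by (rule measurable_from_subalg[OF _ D(5)[of j]])
      (use pre_sigma_mono[OF D(4) Tst, of j] stopping_timesD(3)[OF D(4)] in \<open>simp add: subalgebra_def space_pre_sigma\<close>)
  then have "beta j \<in> measurable (pre_sigma (trunc_times k tau j)) (count_space UNIV)" for j
    using D(5)[of j] by (simp add: trunc_times_def)
  moreover have "trunc_events k E j \<in> sets (pre_sigma (trunc_times k tau j))" for j
    using D(6)[of j] by (simp add: trunc_times_def trunc_events_def)
  moreover have "trunc_events k E (Suc j) \<subseteq> trunc_events k E j" for j
    using D(7)[of j] by (auto simp: trunc_events_def)
  moreover have "trunc_times k tau j w \<le> trunc_times k tau (Suc j) w" if "w \<in> space M" for j w
    using D(8)[OF that] stopping_timesD(3)[OF D(4) that] by (simp add: trunc_times_def)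
  moreover have "beta (Suc j) w \<in> alternatives m (beta j w)" if "w \<in> trunc_events k E (Suc j)" for j w
    using D(9)[of w j] that by (auto simp: trunc_events_def split: if_splits)
  moreover have "trunc_times k tau (Suc j) w = T" if "w \<in> space M" "w \<notin> trunc_events k E (Suc j)" for j w
    using D(10)[OF that(1), of j] that(2) by (auto simp: trunc_events_def trunc_times_def split: if_splits)
  moreover have "trunc_times k tau 0 = (\<lambda>_. 0)" "trunc_events k E 0 = space M"
    using D(1,3) by (simp_all add: trunc_times_def trunc_events_def)
  ultimately show ?thesis unfolding scheme_def using st D(2) by blast
qed

lemma trunc_plan_on:
  assumes sch: "scheme tau beta E" and w: "w \<in> E k"
  shows "scheme_plan (trunc_times k tau) beta (trunc_events k E) w = plan_of (rule_history tau beta k w)"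
proof -
  have "scheme_plan (trunc_times k tau) beta (trunc_events k E) w = plan_of (rule_history (trunc_times k tau) beta k w)"
    using w by (intro scheme_plan_last[OF scheme_trunc[OF sch]]) (simp_all add: trunc_events_def)
  also have "rule_history (trunc_times k tau) beta k w = rule_history tau beta k w"
    unfolding rule_history_def by (intro map_cong) (auto simp: trunc_times_def)
  finally show ?thesis .
qed

lemma trunc_plan_off:
  assumes sch: "scheme tau beta E" and w: "w \<notin> E k"
  shows "scheme_plan (trunc_times k tau) beta (trunc_events k E) w = scheme_plan tau beta E w"
proof
  fix i show "scheme_plan (trunc_times k tau) beta (trunc_events k E) w i = scheme_plan tau beta E w i"
    using schemeD(13)[OF sch, of k "Suc i"] w by (cases "Suc i \<le> k") (auto simp: scheme_plan_def trunc_times_def trunc_events_def)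
qed

lemma scheme_plan_plans:
  assumes sch: "scheme tau beta E" and w: "w \<in> space M"
  shows "scheme_plan tau beta E w \<in> plans T m b0"
  unfolding plans_def
proof (intro CollectI allI)
  fix i
  note D = schemeD[OF sch]
  show "case scheme_plan tau beta E w i of None \<Rightarrow> scheme_plan tau beta E w (Suc i) = None
     | Some (t, b') \<Rightarrow> t \<in> {0..T} \<and> b' \<in> alternatives m (prev_mode b0 (scheme_plan tau beta E w) i) \<and>
         (\<forall>k<i. scheme_plan tau beta E w k \<noteq> None \<and> fst (the (scheme_plan tau beta E w k)) \<le> t)"
  proof (cases "w \<in> E (Suc i)")
    case True
    have in_E: "w \<in> E k" if "k \<le> Suc i" for k using D(13)[OF that] True by blast
    have "prev_mode b0 (scheme_plan tau beta E w) i = beta i w"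
      using in_E[of i] by (cases i) (simp_all add: prev_mode_def scheme_plan_def D(2))
    moreover have "scheme_plan tau beta E w k \<noteq> None \<and> fst (the (scheme_plan tau beta E w k)) \<le> tau (Suc i) w" if "k < i" for k
      using in_E[of "Suc k"] D(14)[OF w, of "Suc k" "Suc i"] that by (simp add: scheme_plan_def)
    ultimately show ?thesis
      using True D(9)[OF True] stopping_timesD(2,3)[OF D(4) w, of "Suc i"] by (simp add: scheme_plan_def)
  next
    case False
    then show ?thesis using D(7)[of "Suc i"] by (auto simp: scheme_plan_def)
  qed
qed

lemma scheme_control:
  assumes sch: "scheme tau beta E" and fin: "AE w in M. \<exists>k. w \<notin> E k"
  shows "scheme_plan tau beta E \<in> controls_finite b0"
proof (rule controls_finiteI)
  note D = schemeD[OF sch]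
  show "scheme_plan tau beta E w \<in> plans T m b0" if "w \<in> space M" for w by (rule scheme_plan_plans[OF sch that])
  fix i
  have it: "intervention_time (scheme_plan tau beta E) i w = tau (Suc i) w" if "w \<in> space M" for w
    using D(10)[OF that, of i] by (simp add: intervention_time_def scheme_plan_def)
  show st: "intervention_time (scheme_plan tau beta E) i \<in> stopping_times"
    by (rule stopping_times_AE_cong[OF D(4)[of "Suc i"]])
      (use it stopping_timesD(2,3)[OF D(4), of _ "Suc i"] in auto)
  have sets_eq: "sets (pre_sigma (intervention_time (scheme_plan tau beta E) i)) = sets (pre_sigma (tau (Suc i)))"
    using pre_sigma_mono[OF st D(4)] pre_sigma_mono[OF D(4) st] it by (intro antisym) auto
  have "(\<lambda>w. if w \<in> E (Suc i) then Some (beta (Suc i) w) else None) \<in> measurable (pre_sigma (tau (Suc i))) (count_space UNIV)"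
  proof (rule measurable_If_set)
    show "(\<lambda>w. Some (beta (Suc i) w)) \<in> measurable (pre_sigma (tau (Suc i))) (count_space UNIV)"
      by (rule measurable_compose[OF D(5)]) simp
    show "E (Suc i) \<inter> space (pre_sigma (tau (Suc i))) \<in> sets (pre_sigma (tau (Suc i)))" using D(6)[of "Suc i"] by simp
  qed simp
  also have "(\<lambda>w. if w \<in> E (Suc i) then Some (beta (Suc i) w) else None) = intervention_mode (scheme_plan tau beta E) i"
    by (auto simp: intervention_mode_def scheme_plan_def)
  finally show "intervention_mode (scheme_plan tau beta E) i \<in> measurable (pre_sigma (intervention_time (scheme_plan tau beta E) i)) (count_space UNIV)"
    by (simp only: measurable_cong_sets[OF sets_eq refl])
next
  note D = schemeD[OF sch]
  show "AE w in M. \<exists>i. scheme_plan tau beta E w i = None"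
    using fin
  proof eventually_elim
    case (elim w)
    then obtain k where "w \<notin> E k" by blast
    then have "w \<notin> E (Suc k)" using D(7) by blast
    then show ?case by (auto simp: scheme_plan_def)
  qed
qed

lemma trunc_control:
  assumes sch: "scheme tau beta E"
  shows "scheme_plan (trunc_times k tau) beta (trunc_events k E) \<in> controls_finite b0"
  by (rule scheme_control[OF scheme_trunc[OF sch]]) (auto simp: trunc_events_def intro!: AE_I2 exI[of _ "Suc k"])

text \<open>Envelopes at random histories are available for fixed modes only. Random modes are
  treated by splitting according to the modes realised so far; entry \<open>i\<close> of the list is
  the mode of intervention \<open>Suc i\<close>, the initial mode being left out.\<close>

definition mode_event :: "(nat \<Rightarrow> 'a \<Rightarrow> nat) \<Rightarrow> (nat \<Rightarrow> 'a set) \<Rightarrow> nat \<Rightarrow> nat list \<Rightarrow> 'a set" where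
  "mode_event beta E k bs = {w\<in>E k. \<forall>i\<in>{..<k}. beta (Suc i) w = bs ! i}"

abbreviation mode_lists :: "nat \<Rightarrow> nat list set" where
  "mode_lists k \<equiv> {bs\<in>mode_tuples. length bs = k}"

lemma finite_mode_lists: "finite (mode_lists k)"
proof (rule finite_subset)
  show "mode_lists k \<subseteq> {bs. set bs \<subseteq> {1..m} \<and> length bs = k}"
    by (auto simp: mode_tuples_def in_set_conv_nth)
  show "finite {bs. set bs \<subseteq> {1..m} \<and> length bs = k}" by (intro finite_lists_length_eq) simp
qed

lemma mode_event_sets:
  assumes sch: "scheme tau beta E"
  shows "mode_event beta E k bs \<in> sets (pre_sigma (tau k))"
proof -
  note D = schemeD[OF sch]
  have "{w\<in>space (pre_sigma (tau k)). \<forall>i\<in>{..<k}. beta (Suc i) w = bs ! i} \<in> sets (pre_sigma (tau k))"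
  proof (rule sets.sets_Collect_finite_All)
    fix i assume "i \<in> {..<k}"
    then have i: "Suc i \<le> k" by simp
    have "{w\<in>space M. beta (Suc i) w = bs ! i} \<in> sets (pre_sigma (tau (Suc i)))"
      using measurable_sets[OF D(5)[of "Suc i"], of "{bs ! i}"] by (simp add: vimage_def Int_def conj_commute space_pre_sigma)
    moreover have "sets (pre_sigma (tau (Suc i))) \<subseteq> sets (pre_sigma (tau k))"
      by (rule pre_sigma_mono[OF D(4,4)]) (use D(14) i in blast)
    ultimately show "{w\<in>space (pre_sigma (tau k)). beta (Suc i) w = bs ! i} \<in> sets (pre_sigma (tau k))"
      by (auto simp: space_pre_sigma)
  qed simp
  from sets.Int[OF D(6)[of k] this] show ?thesis
    by (rule back_subst[of "\<lambda>S. S \<in> sets (pre_sigma (tau k))"]) (auto simp: mode_event_def space_pre_sigma dest: D(11))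
qed

lemma mode_event_cover:
  assumes sch: "scheme tau beta E" and w: "w \<in> E k"
  shows "\<exists>!bs. bs \<in> mode_lists k \<and> w \<in> mode_event beta E k bs"
proof (rule ex1I)
  note D = schemeD[OF sch]
  let ?bs = "map (\<lambda>i. beta (Suc i) w) [0..<k]"
  have "?bs ! i \<in> alternatives m ((b0 # ?bs) ! i)" if i: "i < k" for i
  proof -
    have "w \<in> E (Suc i)" using D(13)[of "Suc i" k] i w by auto
    then have "beta (Suc i) w \<in> alternatives m (beta i w)" by (rule D(9))
    moreover have "(b0 # ?bs) ! i = beta i w" using i by (cases i) (simp_all add: D(2))
    ultimately show ?thesis using i by simp
  qed
  then show "?bs \<in> mode_lists k \<and> w \<in> mode_event beta E k ?bs" using w by (auto simp: mode_tuples_def mode_event_def)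
  fix bs assume "bs \<in> mode_lists k \<and> w \<in> mode_event beta E k bs"
  then show "bs = ?bs" by (auto simp: mode_event_def intro!: nth_equalityI)
qed

lemma mode_event_history:
  assumes "bs \<in> mode_lists k" "w \<in> mode_event beta E k bs"
  shows "rule_history tau beta k w = random_history (map tau [1..<Suc k]) bs w"
  using assms
  by (intro nth_equalityI) (auto simp: length_rule_history rule_history_nth random_history_def mode_event_def simp del: upt_Suc)

lemma scheme_ordered_times:
  assumes sch: "scheme tau beta E"
  shows "map tau [1..<Suc k] \<in> ordered_times"
  using schemeD(4,14)[OF sch] by (auto simp: ordered_times_def sorted_iff_nth_mono simp del: upt_Suc)

text \<open>\<open>f\<close> will be \<open>Y\<close> at a random history, whose measurability is
  not known in advance. Outside a null set it equals a finite sum of measurable terms on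
  \<open>A\<close>, and completeness transfers measurability to it.\<close>

lemma mode_decomposition:
  fixes f :: "'a \<Rightarrow> real"
  assumes sch: "scheme tau beta E" and A: "A \<in> sets M" "A \<subseteq> E k"
    and g: "\<And>bs. bs \<in> mode_lists k \<Longrightarrow> integrable M (g bs)"
    and fg: "\<And>bs. bs \<in> mode_lists k \<Longrightarrow> AE w in M. w \<in> mode_event beta E k bs \<longrightarrow> f w = g bs w"
  shows "integrable M (\<lambda>w. f w * indicator A w)"
    "(\<integral>w. f w * indicator A w \<partial>M) = (\<Sum>bs\<in>mode_lists k. \<integral>w. g bs w * indicator (A \<inter> mode_event beta E k bs) w \<partial>M)"
proof -
  let ?G = "mode_event beta E k"
  have GM: "A \<inter> ?G bs \<in> sets M" for bs
    using mode_event_sets[OF sch, of k bs] pre_sigma_sets_M[OF schemeD(4)[OF sch]] sets_F_subset A(1) by blast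
  have gi: "integrable M (\<lambda>w. g bs w * indicator (A \<inter> ?G bs) w)" if "bs \<in> mode_lists k" for bs
    by (rule integrable_real_mult_indicator[OF GM g[OF that]])
  have si: "integrable M (\<lambda>w. \<Sum>bs\<in>mode_lists k. g bs w * indicator (A \<inter> ?G bs) w)"
    by (rule Bochner_Integration.integrable_sum[OF gi])
  have "AE w in M. \<forall>bs\<in>mode_lists k. w \<in> ?G bs \<longrightarrow> f w = g bs w"
    by (rule AE_finite_allI[OF finite_mode_lists fg])
  then have ae: "AE w in M. (\<Sum>bs\<in>mode_lists k. g bs w * indicator (A \<inter> ?G bs) w) = f w * indicator A w"
  proof eventually_elim
    case (elim w)
    show ?case
    proof (cases "w \<in> A")
      case True
      then have "w \<in> E k" using A(2) by blast
      from mode_event_cover[OF sch this] have "\<exists>bs. (bs \<in> mode_lists k \<and> w \<in> ?G bs) \<and> (\<forall>bs'. bs' \<in> mode_lists k \<and> w \<in> ?G bs' \<longrightarrow> bs' = bs)"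
        unfolding Ex1_def .
      then obtain bs where b: "(bs \<in> mode_lists k \<and> w \<in> ?G bs) \<and> (\<forall>bs'. bs' \<in> mode_lists k \<and> w \<in> ?G bs' \<longrightarrow> bs' = bs)" ..
      have bs: "bs \<in> mode_lists k" "w \<in> ?G bs" using b by simp_all
      have "(\<Sum>bs'\<in>mode_lists k. g bs' w * indicator (A \<inter> ?G bs') w) = (\<Sum>bs'\<in>mode_lists k. if bs' = bs then g bs' w else 0)"
      proof (rule sum.cong[OF refl])
        fix bs' assume bs': "bs' \<in> mode_lists k"
        show "g bs' w * indicator (A \<inter> ?G bs') w = (if bs' = bs then g bs' w else 0)"
        proof (cases "bs' = bs")
          case True
          then show ?thesis using bs(2) \<open>w \<in> A\<close> by simp
        next
          case False
          then have "w \<notin> ?G bs'" using conjunct2[OF b] bs' by blast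
          then show ?thesis using False by simp
        qed
      qed
      also have "\<dots> = g bs w" using bs(1) by (simp add: sum.delta[OF finite_mode_lists])
      finally show ?thesis using True elim bs(1,2) by simp
    qed simp
  qed
  have fm: "(\<lambda>w. f w * indicator A w) \<in> borel_measurable M"
    by (rule measurable_M_AE_cong[OF borel_measurable_integrable[OF si] ae]) simp
  show "integrable M (\<lambda>w. f w * indicator A w)"
    using integrable_cong_AE[OF borel_measurable_integrable[OF si] fm ae] si by simp
  have "(\<integral>w. f w * indicator A w \<partial>M) = (\<integral>w. (\<Sum>bs\<in>mode_lists k. g bs w * indicator (A \<inter> ?G bs) w) \<partial>M)"
    using ae by (intro integral_cong_AE fm borel_measurable_integrable[OF si]) (auto elim!: eventually_mono)
  also have "\<dots> = (\<Sum>bs\<in>mode_lists k. \<integral>w. g bs w * indicator (A \<inter> ?G bs) w \<partial>M)"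
    by (rule Bochner_Integration.integral_sum[OF gi])
  finally show "(\<integral>w. f w * indicator A w \<partial>M) = (\<Sum>bs\<in>mode_lists k. \<integral>w. g bs w * indicator (A \<inter> ?G bs) w \<partial>M)" .
qed

end

context verified_family
begin

section \<open>Envelopes, optional sampling and hitting times along a scheme\<close>

definition mode_envelope where
  "mode_envelope tau beta E k bs Z X \<longleftrightarrow> snell_from (tau k) Z X \<and> (AE w in M. w \<in> mode_event beta E k bs \<longrightarrow>
     (\<forall>s\<in>{tau k w..T}. Z s w = Y (rule_history tau beta k w) s w \<and> X s w = best_switch_value Y (rule_history tau beta k w) s w) \<and>
     Y (rule_history tau beta k w) T w = Psi w (plan_of (rule_history tau beta k w)))"

lemma scheme_envelope:
  assumes sch: "scheme tau beta E" and bs: "bs \<in> mode_lists k"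
  shows "\<exists>Z X. mode_envelope tau beta E k bs Z X"
proof -
  let ?\<eta> = "map tau [1..<Suc k]"
  have len: "length bs = length ?\<eta>" and bsm: "bs \<in> mode_tuples" using bs by auto
  have \<gamma>: "(\<lambda>w. last_time (random_history ?\<eta> bs w)) = tau k"
  proof
    fix w
    show "last_time (random_history ?\<eta> bs w) = tau k w"
      unfolding last_time_random_history[OF len] using schemeD(1)[OF sch] by (cases k) simp_all
  qed
  obtain Z X where e: "envelope (random_history ?\<eta> bs) (\<lambda>w. last_time (random_history ?\<eta> bs w)) Z X"
    using random_envelope[OF scheme_ordered_times[OF sch] bsm len] by blast
  have sn: "snell_from (tau k) Z X" using e unfolding envelope_def \<gamma> by blast
  have "AE w in M. (\<forall>s\<in>{tau k w..T}. Z s w = Y (random_history ?\<eta> bs w) s w \<and> X s w = best_switch_value Y (random_history ?\<eta> bs w) s w) \<and>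
        Y (random_history ?\<eta> bs w) T w = Psi w (plan_of (random_history ?\<eta> bs w))"
    using e unfolding envelope_def fun_cong[OF \<gamma>] by blast
  then have "AE w in M. w \<in> mode_event beta E k bs \<longrightarrow>
     (\<forall>s\<in>{tau k w..T}. Z s w = Y (rule_history tau beta k w) s w \<and> X s w = best_switch_value Y (rule_history tau beta k w) s w) \<and>
     Y (rule_history tau beta k w) T w = Psi w (plan_of (rule_history tau beta k w))"
  proof eventually_elim
    case (elim w)
    show ?case
    proof
      assume w: "w \<in> mode_event beta E k bs"
      show "(\<forall>s\<in>{tau k w..T}. Z s w = Y (rule_history tau beta k w) s w \<and> X s w = best_switch_value Y (rule_history tau beta k w) s w) \<and>
        Y (rule_history tau beta k w) T w = Psi w (plan_of (rule_history tau beta k w))"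
        using elim unfolding mode_event_history[OF bs w] .
    qed
  qed
  with sn show ?thesis unfolding mode_envelope_def by blast
qed

lemma scheme_envelopes:
  assumes sch: "scheme tau beta E"
  shows "\<exists>Z X. \<forall>bs\<in>mode_lists k. mode_envelope tau beta E k bs (Z bs) (X bs)"
proof -
  have "\<forall>bs\<in>mode_lists k. \<exists>ZX. mode_envelope tau beta E k bs (fst ZX) (snd ZX)"
  proof
    fix bs assume "bs \<in> mode_lists k"
    from scheme_envelope[OF sch this] show "\<exists>ZX. mode_envelope tau beta E k bs (fst ZX) (snd ZX)" by auto
  qed
  from bchoice[OF this] obtain ZX where "\<forall>bs\<in>mode_lists k. mode_envelope tau beta E k bs (fst (ZX bs)) (snd (ZX bs))" by blast
  then show ?thesis by (intro exI[of _ "\<lambda>bs. fst (ZX bs)"] exI[of _ "\<lambda>bs. snd (ZX bs)"])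
qed

lemma mode_envelopesD:
  assumes me: "\<forall>bs\<in>mode_lists k. mode_envelope tau beta E k bs (Z bs) (X bs)"
  shows "\<And>bs. bs \<in> mode_lists k \<Longrightarrow> snell_from (tau k) (Z bs) (X bs)"
    "\<And>bs. bs \<in> mode_lists k \<Longrightarrow> AE w in M. w \<in> mode_event beta E k bs \<longrightarrow>
     (\<forall>s\<in>{tau k w..T}. Z bs s w = Y (rule_history tau beta k w) s w \<and> X bs s w = best_switch_value Y (rule_history tau beta k w) s w) \<and>
     Y (rule_history tau beta k w) T w = Psi w (plan_of (rule_history tau beta k w))"
    "AE w in M. \<forall>bs\<in>mode_lists k. w \<in> mode_event beta E k bs \<longrightarrow>
     (\<forall>s\<in>{tau k w..T}. Z bs s w = Y (rule_history tau beta k w) s w \<and> X bs s w = best_switch_value Y (rule_history tau beta k w) s w) \<and>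
     Y (rule_history tau beta k w) T w = Psi w (plan_of (rule_history tau beta k w))"
proof -
  show e: "bs \<in> mode_lists k \<Longrightarrow> snell_from (tau k) (Z bs) (X bs)" "bs \<in> mode_lists k \<Longrightarrow> AE w in M. w \<in> mode_event beta E k bs \<longrightarrow>
     (\<forall>s\<in>{tau k w..T}. Z bs s w = Y (rule_history tau beta k w) s w \<and> X bs s w = best_switch_value Y (rule_history tau beta k w) s w) \<and>
     Y (rule_history tau beta k w) T w = Psi w (plan_of (rule_history tau beta k w))" for bs
    using me unfolding mode_envelope_def by blast+
  show "AE w in M. \<forall>bs\<in>mode_lists k. w \<in> mode_event beta E k bs \<longrightarrow>
     (\<forall>s\<in>{tau k w..T}. Z bs s w = Y (rule_history tau beta k w) s w \<and> X bs s w = best_switch_value Y (rule_history tau beta k w) s w) \<and>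
     Y (rule_history tau beta k w) T w = Psi w (plan_of (rule_history tau beta k w))"
    by (rule AE_finite_allI[OF finite_mode_lists e(2)])
qed

lemma scheme_AE:
  assumes sch: "scheme tau beta E"
  shows "AE w in M. w \<in> E k \<longrightarrow> Y (rule_history tau beta k w) T w = Psi w (plan_of (rule_history tau beta k w)) \<and>
     (\<forall>s\<in>{tau k w..T}. best_switch_value Y (rule_history tau beta k w) s w \<le> Y (rule_history tau beta k w) s w)"
proof -
  obtain Z X where me: "\<forall>bs\<in>mode_lists k. mode_envelope tau beta E k bs (Z bs) (X bs)" using scheme_envelopes[OF sch] by blast
  note S = mode_envelopesD(1)[OF me] and e = mode_envelopesD(2)[OF me]
  note mode_envelopesD(3)[OF me]
  moreover have "AE w in M. \<forall>bs\<in>mode_lists k. \<forall>s\<in>{tau k w..T}. X bs s w \<le> Z bs s w"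
    by (rule AE_finite_allI[OF finite_mode_lists snell_fromD(5)[OF S]])
  ultimately show ?thesis
  proof eventually_elim
    case (elim w)
    show ?case
    proof
      assume "w \<in> E k"
      then obtain bs where bs: "bs \<in> mode_lists k" "w \<in> mode_event beta E k bs" using mode_event_cover[OF sch] by blast
      show "Y (rule_history tau beta k w) T w = Psi w (plan_of (rule_history tau beta k w)) \<and>
        (\<forall>s\<in>{tau k w..T}. best_switch_value Y (rule_history tau beta k w) s w \<le> Y (rule_history tau beta k w) s w)"
        using elim(1)[rule_format, OF bs] elim(2)[rule_format, OF bs(1)] by auto
    qed
  qed
qed

lemma scheme_value_integrable:
  assumes sch: "scheme tau beta E" and A: "A \<in> sets M" "A \<subseteq> E k"
    and \<sigma>: "\<sigma> \<in> stopping_times" "\<And>w. w \<in> space M \<Longrightarrow> tau k w \<le> \<sigma> w"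
  shows "integrable M (\<lambda>w. Y (rule_history tau beta k w) (\<sigma> w) w * indicator A w)"
proof -
  obtain Z X where me: "\<forall>bs\<in>mode_lists k. mode_envelope tau beta E k bs (Z bs) (X bs)" using scheme_envelopes[OF sch] by blast
  note S = mode_envelopesD(1)[OF me] and e = mode_envelopesD(2)[OF me]
  show ?thesis
  proof (rule mode_decomposition(1)[OF sch A, where g="\<lambda>bs w. Z bs (\<sigma> w) w"])
    fix bs assume bs: "bs \<in> mode_lists k"
    show "integrable M (\<lambda>w. Z bs (\<sigma> w) w)" using snell_fromD(2,4)[OF S[OF bs]] \<sigma>(1) by (rule stopped_integrable)
    show "AE w in M. w \<in> mode_event beta E k bs \<longrightarrow> Y (rule_history tau beta k w) (\<sigma> w) w = Z bs (\<sigma> w) w"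
      using e[OF bs] AE_space by eventually_elim (use \<sigma>(2) stopping_timesD(3)[OF \<sigma>(1)] in auto)
  qed
qed

lemma scheme_optional_sampling:
  assumes sch: "scheme tau beta E" and A: "A \<in> sets (pre_sigma (tau k))" "A \<subseteq> E k"
    and \<sigma>: "\<sigma> \<in> stopping_times" "\<And>w. w \<in> space M \<Longrightarrow> tau k w \<le> \<sigma> w"
  shows "(\<integral>w. Y (rule_history tau beta k w) (\<sigma> w) w * indicator A w \<partial>M) \<le> (\<integral>w. Y (rule_history tau beta k w) (tau k w) w * indicator A w \<partial>M)"
proof -
  obtain Z X where me: "\<forall>bs\<in>mode_lists k. mode_envelope tau beta E k bs (Z bs) (X bs)" using scheme_envelopes[OF sch] by blast
  note S = mode_envelopesD(1)[OF me] and e = mode_envelopesD(2)[OF me]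
  note st = schemeD(4)[OF sch, of k]
  have AM: "A \<in> sets M" using A(1) pre_sigma_sets_M[OF st] sets_F_subset by blast
  have dec: "(\<integral>w. Y (rule_history tau beta k w) (\<rho> w) w * indicator A w \<partial>M) =
      (\<Sum>bs\<in>mode_lists k. \<integral>w. Z bs (\<rho> w) w * indicator (A \<inter> mode_event beta E k bs) w \<partial>M)"
    if \<rho>: "\<rho> \<in> stopping_times" "\<And>w. w \<in> space M \<Longrightarrow> tau k w \<le> \<rho> w" for \<rho>
  proof (rule mode_decomposition(2)[OF sch AM A(2), where g="\<lambda>bs w. Z bs (\<rho> w) w"])
    fix bs assume bs: "bs \<in> mode_lists k"
    show "integrable M (\<lambda>w. Z bs (\<rho> w) w)" using snell_fromD(2,4)[OF S[OF bs]] \<rho>(1) by (rule stopped_integrable)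
    show "AE w in M. w \<in> mode_event beta E k bs \<longrightarrow> Y (rule_history tau beta k w) (\<rho> w) w = Z bs (\<rho> w) w"
      using e[OF bs] AE_space by eventually_elim (use \<rho>(2) stopping_timesD(3)[OF \<rho>(1)] in auto)
  qed
  have 1: "(\<integral>w. Y (rule_history tau beta k w) (\<sigma> w) w * indicator A w \<partial>M) =
      (\<Sum>bs\<in>mode_lists k. \<integral>w. Z bs (\<sigma> w) w * indicator (A \<inter> mode_event beta E k bs) w \<partial>M)"
    by (rule dec[OF \<sigma>])
  have 2: "(\<integral>w. Y (rule_history tau beta k w) (tau k w) w * indicator A w \<partial>M) =
      (\<Sum>bs\<in>mode_lists k. \<integral>w. Z bs (tau k w) w * indicator (A \<inter> mode_event beta E k bs) w \<partial>M)"
    by (rule dec[OF st order_refl])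
  show ?thesis
    unfolding 1 2
  proof (rule sum_mono)
    fix bs assume bs: "bs \<in> mode_lists k"
    show "(\<integral>w. Z bs (\<sigma> w) w * indicator (A \<inter> mode_event beta E k bs) w \<partial>M) \<le> (\<integral>w. Z bs (tau k w) w * indicator (A \<inter> mode_event beta E k bs) w \<partial>M)"
      by (rule optional_sampling[OF snell_fromD(2,4,6)[OF S[OF bs]] st \<sigma>(1) _ \<sigma>(2)])
        (use A(1) mode_event_sets[OF sch] in auto)
  qed
qed

text \<open>On each event of realised modes \<open>\<theta>\<close> is the hitting time of one
  envelope, so its properties follow by gluing finitely many of them. Gluing is legitimate because
  the realised modes are known at \<open>tau k\<close>, which none of these hitting times
  precedes.\<close>

lemma scheme_hitting:
  assumes sch: "scheme tau beta E"
    and \<theta>: "\<And>w. w \<in> E k \<Longrightarrow> \<theta> w = Inf (insert T {s\<in>{tau k w..T}. Y (rule_history tau beta k w) s w = best_switch_value Y (rule_history tau beta k w) s w})"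
    and \<theta>off: "\<And>w. w \<in> space M \<Longrightarrow> w \<notin> E k \<Longrightarrow> \<theta> w = T"
  shows "\<theta> \<in> stopping_times"
    "AE w in M. w \<in> E k \<and> \<theta> w < T \<longrightarrow> Y (rule_history tau beta k w) (\<theta> w) w = best_switch_value Y (rule_history tau beta k w) (\<theta> w) w"
    "\<And>A. A \<in> sets (pre_sigma (tau k)) \<Longrightarrow> A \<subseteq> E k \<Longrightarrow>
      (\<integral>w. Y (rule_history tau beta k w) (\<theta> w) w * indicator A w \<partial>M) = (\<integral>w. Y (rule_history tau beta k w) (tau k w) w * indicator A w \<partial>M)"
proof -
  obtain Z X where me: "\<forall>bs\<in>mode_lists k. mode_envelope tau beta E k bs (Z bs) (X bs)" using scheme_envelopes[OF sch] by blast
  note S = mode_envelopesD(1)[OF me] and e = mode_envelopesD(2)[OF me]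
  note D = schemeD[OF sch]
  note st = D(4)[of k]
  let ?G = "mode_event beta E k"
  define \<theta>b where "\<theta>b bs w = Inf (insert T {s\<in>{tau k w..T}. Z bs s w = X bs s w})" for bs w
  note hit = snell_hitting_time[OF S, of _ "\<theta>b _", OF _ \<theta>b_def]
  have \<theta>b_ge: "tau k w \<le> \<theta>b bs w" if "w \<in> space M" for bs w
  proof -
    have "{s\<in>{tau k w..T}. Z bs s w = X bs s w} \<subseteq> {tau k w..T}" by auto
    from Inf_insert_upper(1)[OF this stopping_timesD(3)[OF st that]] show ?thesis by (simp add: \<theta>b_def)
  qed
  have eall: "AE w in M. \<forall>bs\<in>mode_lists k. w \<in> ?G bs \<longrightarrow> \<theta> w = \<theta>b bs w"
  proof (rule AE_finite_allI[OF finite_mode_lists])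
    fix bs assume bs: "bs \<in> mode_lists k"
    show "AE w in M. w \<in> ?G bs \<longrightarrow> \<theta> w = \<theta>b bs w"
      using e[OF bs]
    proof eventually_elim
      case (elim w)
      show ?case
      proof
        assume w: "w \<in> ?G bs"
        then have "w \<in> E k" by (simp add: mode_event_def)
        have "{s\<in>{tau k w..T}. Y (rule_history tau beta k w) s w = best_switch_value Y (rule_history tau beta k w) s w} = {s\<in>{tau k w..T}. Z bs s w = X bs s w}"
          using elim w by auto
        then show "\<theta> w = \<theta>b bs w" unfolding \<theta>[OF \<open>w \<in> E k\<close>] \<theta>b_def by simp
      qed
    qed
  qed
  have \<theta>_range: "tau k w \<le> \<theta> w \<and> \<theta> w \<le> T" if w: "w \<in> space M" for w
  proof (cases "w \<in> E k")
    case True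
    have "{s\<in>{tau k w..T}. Y (rule_history tau beta k w) s w = best_switch_value Y (rule_history tau beta k w) s w} \<subseteq> {tau k w..T}" by auto
    from Inf_insert_upper(1)[OF this stopping_timesD(3)[OF st w]] show ?thesis by (simp add: \<theta>[OF True])
  next
    case False
    then show ?thesis using \<theta>off[OF w] stopping_timesD(3)[OF st w] by simp
  qed
  show \<theta>st: "\<theta> \<in> stopping_times"
  proof (rule stopping_timesI)
    show "\<theta> w \<in> {0..T}" if "w \<in> space M" for w
      using \<theta>_range[OF that] stopping_timesD(2)[OF st that] by simp
    fix t assume t: "0 \<le> t" "t < T"
    have U: "(\<Union>bs\<in>mode_lists k. {w\<in>?G bs. \<theta>b bs w \<le> t}) \<in> sets (F t)"
    proof (rule sets.finite_UN[OF finite_mode_lists])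
      fix bs assume bs: "bs \<in> mode_lists k"
      have "sets (pre_sigma (tau k)) \<subseteq> sets (pre_sigma (\<theta>b bs))"
        by (rule pre_sigma_mono[OF st hit(1)[OF bs] \<theta>b_ge])
      then have "?G bs \<in> sets (pre_sigma (\<theta>b bs))" using mode_event_sets[OF sch] by blast
      then show "{w\<in>?G bs. \<theta>b bs w \<le> t} \<in> sets (F t)" unfolding sets_pre_sigma'[OF hit(1)[OF bs]] by blast
    qed
    show "{w\<in>space M. \<theta> w \<le> t} \<in> sets (F t)"
    proof (rule sets_F_AE_cong[OF U t(1)])
      show "AE w in M. w \<in> (\<Union>bs\<in>mode_lists k. {w\<in>?G bs. \<theta>b bs w \<le> t}) \<longleftrightarrow> w \<in> {w\<in>space M. \<theta> w \<le> t}"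
        using eall AE_space
      proof eventually_elim
        case (elim w)
        show ?case
        proof
          assume "w \<in> (\<Union>bs\<in>mode_lists k. {w\<in>?G bs. \<theta>b bs w \<le> t})"
          then show "w \<in> {w\<in>space M. \<theta> w \<le> t}" using elim by auto
        next
          assume a: "w \<in> {w\<in>space M. \<theta> w \<le> t}"
          then have "w \<in> E k" using \<theta>off[of w] t by force
          then obtain bs where bs: "bs \<in> mode_lists k" "w \<in> ?G bs" using mode_event_cover[OF sch] by blast
          then have "\<theta>b bs w \<le> t" using elim(1) a by auto
          with bs show "w \<in> (\<Union>bs\<in>mode_lists k. {w\<in>?G bs. \<theta>b bs w \<le> t})" by blast
        qed
      qed
    qed simp
  qed
  note mode_envelopesD(3)[OF me]
  moreover have "AE w in M. \<forall>bs\<in>mode_lists k. \<theta>b bs w < T \<longrightarrow> Z bs (\<theta>b bs w) w = X bs (\<theta>b bs w) w"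
    by (rule AE_finite_allI[OF finite_mode_lists hit(2)])
  ultimately show "AE w in M. w \<in> E k \<and> \<theta> w < T \<longrightarrow> Y (rule_history tau beta k w) (\<theta> w) w = best_switch_value Y (rule_history tau beta k w) (\<theta> w) w"
    using eall AE_space
  proof eventually_elim
    case (elim w)
    show ?case
    proof (intro impI, elim conjE)
      assume a: "w \<in> E k" "\<theta> w < T"
      then obtain bs where bs: "bs \<in> mode_lists k" "w \<in> ?G bs" using mode_event_cover[OF sch] by blast
      have eq: "\<theta> w = \<theta>b bs w" using elim(3) bs by blast
      have "\<theta> w \<in> {tau k w..T}" using \<theta>_range[OF elim(4)] by simp
      then have "Z bs (\<theta> w) w = Y (rule_history tau beta k w) (\<theta> w) w" "X bs (\<theta> w) w = best_switch_value Y (rule_history tau beta k w) (\<theta> w) w"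
        using elim(1) bs by blast+
      moreover have "Z bs (\<theta> w) w = X bs (\<theta> w) w" using elim(2) bs(1) a(2) eq by auto
      ultimately show "Y (rule_history tau beta k w) (\<theta> w) w = best_switch_value Y (rule_history tau beta k w) (\<theta> w) w" by simp
    qed
  qed
  fix A assume A: "A \<in> sets (pre_sigma (tau k))" "A \<subseteq> E k"
  have AM: "A \<in> sets M" using A(1) pre_sigma_sets_M[OF st] sets_F_subset by blast
  have "(\<integral>w. Y (rule_history tau beta k w) (\<theta> w) w * indicator A w \<partial>M) =
      (\<Sum>bs\<in>mode_lists k. \<integral>w. Z bs (\<theta>b bs w) w * indicator (A \<inter> ?G bs) w \<partial>M)"
  proof (rule mode_decomposition(2)[OF sch AM A(2), where g="\<lambda>bs w. Z bs (\<theta>b bs w) w"])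
    fix bs assume bs: "bs \<in> mode_lists k"
    show "integrable M (\<lambda>w. Z bs (\<theta>b bs w) w)" using snell_fromD(2,4)[OF S[OF bs]] hit(1)[OF bs] by (rule stopped_integrable)
    show "AE w in M. w \<in> ?G bs \<longrightarrow> Y (rule_history tau beta k w) (\<theta> w) w = Z bs (\<theta>b bs w) w"
      using e[OF bs] eall AE_space
    proof eventually_elim
      case (elim w)
      then show ?case using bs \<theta>_range[OF elim(3)] by auto
    qed
  qed
  also have "\<dots> = (\<Sum>bs\<in>mode_lists k. \<integral>w. Z bs (tau k w) w * indicator (A \<inter> ?G bs) w \<partial>M)"
    using hit(3) A(1) mode_event_sets[OF sch] by (intro sum.cong refl) auto
  also have "\<dots> = (\<integral>w. Y (rule_history tau beta k w) (tau k w) w * indicator A w \<partial>M)"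
  proof (rule mode_decomposition(2)[OF sch AM A(2), where g="\<lambda>bs w. Z bs (tau k w) w", symmetric])
    fix bs assume bs: "bs \<in> mode_lists k"
    show "integrable M (\<lambda>w. Z bs (tau k w) w)" using snell_fromD(2,4)[OF S[OF bs]] st by (rule stopped_integrable)
    show "AE w in M. w \<in> ?G bs \<longrightarrow> Y (rule_history tau beta k w) (tau k w) w = Z bs (tau k w) w"
      using e[OF bs] AE_space by eventually_elim (use stopping_timesD(3)[OF st] in auto)
  qed
  finally show "(\<integral>w. Y (rule_history tau beta k w) (\<theta> w) w * indicator A w \<partial>M) = (\<integral>w. Y (rule_history tau beta k w) (tau k w) w * indicator A w \<partial>M)" .
qed

text \<open>\<open>family_bounded\<close> controls a process tied to the family only at
  \<open>T\<close>, whereas the value at the intermediate time \<open>tau k\<close> is wanted. On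
  \<open>E k\<close> the cut-off plan coincides with the history already observed at
  \<open>tau k\<close>, so the conditional expectations defining that process can be evaluated from
  \<open>tau k\<close> on. The constant does not depend on the scheme or on \<open>k\<close>, so
  remaining values are bounded uniformly over the stages.\<close>

lemma scheme_value_bound:
  obtains C :: ennreal where "C < \<infinity>" "\<And>tau beta E k. scheme tau beta E \<Longrightarrow>
    (\<integral>\<^sup>+w. ennreal ((Y (rule_history tau beta k w) (tau k w) w)\<^sup>2) * indicator (E k) w \<partial>M) \<le> C"
proof -
  obtain Zu where Zu: "\<forall>u\<in>controls_finite b0. at_random_index Y (\<lambda>s w. history_of (u w)) (\<lambda>_. T) (Zu u)"
    "(SUP u\<in>controls_finite b0. sup_moment2 (Zu u)) < \<infinity>"
    using family unfolding verification_family_def family_bounded_def by blast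
  show ?thesis
  proof (rule that[OF Zu(2)])
    fix tau :: "nat \<Rightarrow> 'a \<Rightarrow> real" and beta E k assume sch: "scheme tau beta E"
    note D = schemeD[OF sch]
    note st = D(4)[of k]
    define u where "u = scheme_plan (trunc_times k tau) beta (trunc_events k E)"
    define W where "W = Zu u"
    have u: "u \<in> controls_finite b0" unfolding u_def by (rule trunc_control[OF sch])
    have ari: "at_random_index Y (\<lambda>s w. history_of (u w)) (\<lambda>_. T) W" unfolding W_def by (rule Zu(1)[rule_format, OF u])
    have hist: "history_of (u w) = rule_history tau beta k w" if "w \<in> E k" for w
      unfolding u_def trunc_plan_on[OF sch that] by (rule history_of_plan_of)
    obtain Z X where me: "\<forall>bs\<in>mode_lists k. mode_envelope tau beta E k bs (Z bs) (X bs)" using scheme_envelopes[OF sch] by blast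
    note S = mode_envelopesD(1)[OF me] and e = mode_envelopesD(2)[OF me]
    have WZ: "AE w in M. w \<in> mode_event beta E k bs \<longrightarrow> W (tau k w) w = Z bs (tau k w) w" if bs: "bs \<in> mode_lists k" for bs
    proof -
      let ?G = "mode_event beta E k bs"
      note Sb = snell_fromD[OF S[OF bs]]
      \<comment> \<open>Starting at \<open>T + 1\<close> off the event makes the time interval empty
        there, so equality of the processes is asserted on the event alone.\<close>
      have "AE w in M. \<forall>s\<in>{(if w \<in> ?G then tau k w else T + 1)..T}. W s w = Z bs s w"
      proof (rule cadlag_process_eq)
        show "cadlag_process W" using ari by (simp add: at_random_index_def)
        show "cadlag_process (Z bs)" by (rule Sb(2))
        show "0 \<le> (if w \<in> ?G then tau k w else T + 1)" if "w \<in> space M" for w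
          using stopping_timesD(2)[OF st that] T_nonneg by simp
        fix s assume s: "s \<in> {0..T}"
        \<comment> \<open>An event known at time \<open>s\<close> on which the history is already
          the observed one; its indicator can be pulled out of the conditional expectation.\<close>
        define B where "B = {w\<in>?G. tau k w \<le> s}"
        have B: "B \<in> sets (F s)" unfolding B_def using mode_event_sets[OF sch, of k bs] sets_pre_sigma'[OF st] by blast
        define V where "V w = Y (history_of (u w)) (max s (last_time (history_of (u w)))) w" for w
        have V: "integrable M V" "AE w in M. W s w = real_cond_exp M (F s) V w"
          using ari s unfolding at_random_index_def Let_def V_def by blast+
        have BM: "B \<in> sets M" using B sets_F_subset by blast
        have sst: "(\<lambda>_. s) \<in> stopping_times" by (rule const_stopping_times[OF s])
        have Zi: "integrable M (Z bs s)" using stopped_integrable[OF Sb(2,4) sst] by simp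
        have iB: "(indicator B :: 'a \<Rightarrow> real) \<in> borel_measurable (F s)" using B by simp
        have iV: "integrable M (\<lambda>w. indicator B w * V w)"
          using integrable_real_mult_indicator[OF BM V(1)] by (simp add: mult.commute)
        have iZ: "integrable M (\<lambda>w. indicator B w * Z bs s w)"
          using integrable_real_mult_indicator[OF BM Zi] by (simp add: mult.commute)
        have VZ: "AE w in M. indicator B w * V w = indicator B w * Z bs s w"
          using e[OF bs]
        proof eventually_elim
          case (elim w)
          show ?case
          proof (cases "w \<in> B")
            case True
            then have w: "w \<in> ?G" "w \<in> E k" "tau k w \<le> s" by (auto simp: B_def mode_event_def)
            then show ?thesis using elim s by (simp add: V_def hist scheme_history(2)[OF sch] max_absorb1)
          qed simp
        qed
        have "AE w in M. real_cond_exp M (F s) (\<lambda>w. indicator B w * V w) w = indicator B w * real_cond_exp M (F s) V w"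
          by (rule sigma_finite_subalgebra.real_cond_exp_mult[OF sigma_finite_F iB _ iV]) (use V(1) in auto)
        moreover have "AE w in M. real_cond_exp M (F s) (\<lambda>w. indicator B w * Z bs s w) w = indicator B w * Z bs s w"
          by (rule cond_exp_F_meas[OF iZ]) (use iB progressive_F[OF _ s, of "Z bs"] Sb(2) in \<open>auto simp: cadlag_process_def\<close>)
        moreover have "AE w in M. real_cond_exp M (F s) (\<lambda>w. indicator B w * V w) w = real_cond_exp M (F s) (\<lambda>w. indicator B w * Z bs s w) w"
          by (rule cond_exp_cong[OF VZ]) (use iV iZ in auto)
        ultimately show "AE w in M. (if w \<in> ?G then tau k w else T + 1) \<le> s \<longrightarrow> W s w = Z bs s w"
          using V(2)
        proof eventually_elim
          case (elim w)
          show ?case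
          proof
            assume "(if w \<in> ?G then tau k w else T + 1) \<le> s"
            then have "w \<in> B" using s by (auto simp: B_def split: if_splits)
            then show "W s w = Z bs s w" using elim by simp
          qed
        qed
      qed
      then show ?thesis using AE_space by eventually_elim (use stopping_timesD(3)[OF st] in auto)
    qed
    have "AE w in M. \<forall>bs\<in>mode_lists k. (w \<in> mode_event beta E k bs \<longrightarrow> W (tau k w) w = Z bs (tau k w) w)"
      by (rule AE_finite_allI[OF finite_mode_lists WZ])
    moreover note mode_envelopesD(3)[OF me]
    ultimately have YW: "AE w in M. w \<in> E k \<longrightarrow> Y (rule_history tau beta k w) (tau k w) w = W (tau k w) w"
      using AE_space
    proof eventually_elim
      case (elim w)
      show ?case
      proof
        assume "w \<in> E k"
        then obtain bs where bs: "bs \<in> mode_lists k" "w \<in> mode_event beta E k bs" using mode_event_cover[OF sch] by blast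
        have "Z bs (tau k w) w = Y (rule_history tau beta k w) (tau k w) w"
          using elim(2) bs stopping_timesD(3)[OF st elim(3)] by auto
        then show "Y (rule_history tau beta k w) (tau k w) w = W (tau k w) w" using elim(1) bs by simp
      qed
    qed
    have "(\<integral>\<^sup>+w. ennreal ((Y (rule_history tau beta k w) (tau k w) w)\<^sup>2) * indicator (E k) w \<partial>M) \<le> sup_moment2 W"
      unfolding sup_moment2_def
    proof (rule nn_integral_mono_AE)
      show "AE w in M. ennreal ((Y (rule_history tau beta k w) (tau k w) w)\<^sup>2) * indicator (E k) w \<le> (SUP s\<in>{0..T}. ennreal (\<bar>W s w\<bar>\<^sup>2))"
        using YW AE_space
      proof eventually_elim
        case (elim w)
        show ?case
        proof (cases "w \<in> E k")
          case True
          have "tau k w \<in> {0..T}" using stopping_timesD(2,3)[OF st elim(2)] by simp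
          then have "ennreal (\<bar>W (tau k w) w\<bar>\<^sup>2) \<le> (SUP s\<in>{0..T}. ennreal (\<bar>W s w\<bar>\<^sup>2))" by (rule SUP_upper)
          then show ?thesis using True elim(1) by simp
        qed simp
      qed
    qed
    also have "\<dots> \<le> (SUP u\<in>controls_finite b0. sup_moment2 (Zu u))" unfolding W_def by (rule SUP_upper[OF u])
    finally show "(\<integral>\<^sup>+w. ennreal ((Y (rule_history tau beta k w) (tau k w) w)\<^sup>2) * indicator (E k) w \<partial>M) \<le> (SUP u\<in>controls_finite b0. sup_moment2 (Zu u))" .
  qed
qed

end

section \<open>Switching costs\<close>

context usual_basis
begin

text \<open>Uniform integrability from bounded second moments:
  \<open>\<bar>f\<bar> \<le> \<delta> * f^2 + 1 / (4 * \<delta>)\<close>, where the first term has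
  small mean and the second is integrated over a vanishing event.\<close>

lemma tendsto_L2_bounded_vanishing:
  fixes f :: "nat \<Rightarrow> 'a \<Rightarrow> real"
  assumes f: "\<And>k. integrable M (f k)" "\<And>k. integrable M (\<lambda>w. (f k w)\<^sup>2)" "\<And>k. (\<integral>w. (f k w)\<^sup>2 \<partial>M) \<le> C"
    and B: "\<And>k. B k \<in> sets M" "(\<lambda>k. measure M (B k)) \<longlonglongrightarrow> 0"
  shows "(\<lambda>k. \<integral>w. f k w * indicator (B k) w \<partial>M) \<longlonglongrightarrow> 0"
proof (rule LIMSEQ_I)
  fix r :: real assume r: "0 < r"
  have "0 \<le> (\<integral>w. (f 0 w)\<^sup>2 \<partial>M)" by simp
  then have C: "0 \<le> C" using f(3)[of 0] by linarith
  \<comment> \<open>With this choice \<open>\<delta> * C\<close> is at most \<open>r / 2\<close>;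
    the summand 1 avoids division by zero. The threshold \<open>2 * \<delta> * r\<close> for the
    probabilities makes the other term smaller than \<open>r / 2\<close>.\<close>
  define \<delta> where "\<delta> = r / (2 * (C + 1))"
  have \<delta>: "0 < \<delta>" using r C by (simp add: \<delta>_def)
  have \<delta>C: "\<delta> * C \<le> r / 2" using r C by (simp add: \<delta>_def field_simps)
  have "\<forall>\<^sub>F k in sequentially. measure M (B k) < 2 * \<delta> * r" using order_tendstoD(2)[OF B(2)] r \<delta> by simp
  then obtain n where n: "\<And>k. n \<le> k \<Longrightarrow> measure M (B k) < 2 * \<delta> * r" by (auto simp: eventually_sequentially)
  have "norm ((\<integral>w. f k w * indicator (B k) w \<partial>M) - 0) < r" if k: "n \<le> k" for k
  proof -
    have i: "integrable M (\<lambda>w. f k w * indicator (B k) w)" by (rule integrable_real_mult_indicator[OF B(1) f(1)])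
    have i2: "integrable M (\<lambda>w. \<delta> * (f k w)\<^sup>2 + indicator (B k) w / (4 * \<delta>))"
      using f(2)[of k] B(1)[of k] by (intro Bochner_Integration.integrable_add) (auto simp: integrable_real_indicator emeasure_eq_measure)
    have pt: "\<bar>f k w * indicator (B k) w\<bar> \<le> \<delta> * (f k w)\<^sup>2 + indicator (B k) w / (4 * \<delta>)" for w
    proof (cases "w \<in> B k")
      case True
      have "0 \<le> (2 * \<delta> * \<bar>f k w\<bar> - 1)\<^sup>2" by simp
      then have "4 * \<delta> * \<bar>f k w\<bar> \<le> 4 * \<delta>\<^sup>2 * (f k w)\<^sup>2 + 1" by (simp add: power2_diff power_mult_distrib)
      then show ?thesis using True \<delta> by (simp add: field_simps power2_eq_square)
    qed (use \<delta> in simp)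
    have "\<bar>\<integral>w. f k w * indicator (B k) w \<partial>M\<bar> \<le> (\<integral>w. \<bar>f k w * indicator (B k) w\<bar> \<partial>M)" by (rule integral_abs_bound)
    also have "\<dots> \<le> (\<integral>w. \<delta> * (f k w)\<^sup>2 + indicator (B k) w / (4 * \<delta>) \<partial>M)"
      by (rule integral_mono[OF integrable_abs[OF i] i2 pt])
    also have "\<dots> = \<delta> * (\<integral>w. (f k w)\<^sup>2 \<partial>M) + measure M (B k) / (4 * \<delta>)"
      using f(2)[of k] B(1)[of k] by (subst Bochner_Integration.integral_add) (auto simp: integrable_real_indicator emeasure_eq_measure)
    also have "\<dots> \<le> \<delta> * C + measure M (B k) / (4 * \<delta>)" using f(3)[of k] \<delta> by simp
    also have "\<dots> < r"
    proof -
      have "measure M (B k) / (4 * \<delta>) < r / 2" using n[OF k] \<delta> by (simp add: field_simps)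
      then show ?thesis using \<delta>C by linarith
    qed
    finally show ?thesis by simp
  qed
  then show "\<exists>no. \<forall>n\<ge>no. norm ((\<integral>w. f n w * indicator (B n) w \<partial>M) - 0) < r" by blast
qed

lemma measure_decseq_null:
  assumes E: "\<And>k. E k \<in> sets M" "decseq E" "AE w in M. \<exists>k. w \<notin> E k"
  shows "(\<lambda>k. measure M (E k)) \<longlonglongrightarrow> 0"
proof -
  have "(\<lambda>k. measure M (E k)) \<longlonglongrightarrow> measure M (\<Inter>k. E k)"
    using E(1) by (intro finite_Lim_measure_decseq E(2)) auto
  moreover have "AE w in M. w \<notin> (\<Inter>k. E k)" using E(3) by eventually_elim auto
  then have "measure M (\<Inter>k. E k) = 0" using E(1) by (subst prob_eq_0) auto
  ultimately show ?thesis by simp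
qed

end

context switching_problem
begin

definition step_cost :: "(nat \<Rightarrow> 'a \<Rightarrow> real) \<Rightarrow> (nat \<Rightarrow> 'a \<Rightarrow> nat) \<Rightarrow> (nat \<Rightarrow> 'a set) \<Rightarrow> nat \<Rightarrow> 'a \<Rightarrow> real" where
  "step_cost tau beta E i w = (if w \<in> E (Suc i) then c (beta i w) (beta (Suc i) w) (tau (Suc i) w) w else 0)"

lemma scheme_modes:
  assumes "scheme tau beta E" "w \<in> E k" shows "beta k w \<in> {1..m}"
  using last_mode_range[OF scheme_history(1)[OF assms]] by (simp add: scheme_history(3)[OF assms])

lemma plan_cost_scheme:
  assumes sch: "scheme tau beta E"
  shows "plan_cost b0 (scheme_plan tau beta E w) w = (\<Sum>i. ennreal (step_cost tau beta E i w))"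
  unfolding plan_cost_def
proof (rule suminf_cong)
  fix i
  have "prev_mode b0 (scheme_plan tau beta E w) i = beta i w" if "w \<in> E (Suc i)"
  proof (cases i)
    case (Suc k)
    then have "w \<in> E (Suc k)" using schemeD(7)[OF sch, of i] that by blast
    then show ?thesis using Suc by (simp add: prev_mode_def scheme_plan_def)
  qed (simp add: prev_mode_def schemeD(2)[OF sch])
  then show "(case scheme_plan tau beta E w i of None \<Rightarrow> 0 | Some (t, b') \<Rightarrow> ennreal (c (prev_mode b0 (scheme_plan tau beta E w) i) b' t w)) = ennreal (step_cost tau beta E i w)"
    by (simp add: step_cost_def scheme_plan_def)
qed

end

context verified_family
begin

text \<open>The random pair of modes takes finitely many values, and for each of them the cost is a
  square integrable process stopped at \<open>tau (Suc i)\<close>.\<close>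

lemma step_cost_integrable:
  assumes sch: "scheme tau beta E"
  shows "integrable M (step_cost tau beta E i)"
proof -
  note D = schemeD[OF sch]
  define I where "I = (SIGMA b:{1..m}. alternatives m b)"
  have I: "finite I" by (simp add: I_def)
  define G where "G p = {w\<in>space M. w \<in> E (Suc i) \<and> beta i w = fst p \<and> beta (Suc i) w = snd p}" for p
  have [measurable]: "beta j \<in> measurable M (count_space UNIV)" for j by (rule measurable_pre_sigma_M[OF D(4,5)])
  have [measurable]: "E j \<in> sets M" for j by (rule D(12))
  have G: "G p \<in> sets M" for p unfolding G_def by measurable
  have "step_cost tau beta E i w = (\<Sum>p\<in>I. c (fst p) (snd p) (tau (Suc i) w) w * indicator (G p) w)" if w: "w \<in> space M" for w
  proof (cases "w \<in> E (Suc i)")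
    case True
    have "beta i w \<in> {1..m}" using scheme_modes[OF sch] D(7) True by blast
    then have p: "(beta i w, beta (Suc i) w) \<in> I" using D(9)[OF True] by (simp add: I_def)
    have "(\<Sum>p\<in>I. c (fst p) (snd p) (tau (Suc i) w) w * indicator (G p) w) =
      (\<Sum>p\<in>I. if p = (beta i w, beta (Suc i) w) then c (fst p) (snd p) (tau (Suc i) w) w else 0)"
      using True w by (intro sum.cong refl) (auto simp: G_def indicator_def prod_eq_iff)
    also have "\<dots> = c (beta i w) (beta (Suc i) w) (tau (Suc i) w) w"
      using p by (simp add: sum.delta[OF I])
    finally show ?thesis using True by (simp add: step_cost_def)
  qed (simp add: step_cost_def G_def)
  moreover have "integrable M (\<lambda>w. \<Sum>p\<in>I. c (fst p) (snd p) (tau (Suc i) w) w * indicator (G p) w)"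
  proof (rule Bochner_Integration.integrable_sum)
    fix p assume "p \<in> I"
    then have "c (fst p) (snd p) \<in> S2_qlc" by (intro costs_S2) (auto simp: I_def)
    then show "integrable M (\<lambda>w. c (fst p) (snd p) (tau (Suc i) w) w * indicator (G p) w)"
      by (intro stopped_integrable_on[OF _ _ D(4) G]) (simp_all add: S2_qlc_def S2_def)
  qed
  ultimately show ?thesis by (subst Bochner_Integration.integrable_cong[OF refl]) auto
qed

lemma step_cost_nonneg:
  assumes sch: "scheme tau beta E"
  shows "AE w in M. \<forall>i. 0 \<le> step_cost tau beta E i w"
proof -
  note D = schemeD[OF sch]
  have cn: "AE w in M. \<forall>t\<in>{0..T}. 0 \<le> c b b' t w" if "b \<in> {1..m}" "b' \<in> alternatives m b" for b b'
    using sa1 that unfolding standing_assumption_1_def costs_nonneg_def by blast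
  have "AE w in M. \<forall>b\<in>{1..m}. \<forall>b'\<in>alternatives m b. \<forall>t\<in>{0..T}. 0 \<le> c b b' t w"
    by (intro AE_finite_allI cn) auto
  then show ?thesis using AE_space
  proof eventually_elim
    case (elim w)
    show ?case
    proof
      fix i
      show "0 \<le> step_cost tau beta E i w"
      proof (cases "w \<in> E (Suc i)")
        case True
        have "beta i w \<in> {1..m}" using scheme_modes[OF sch] D(7) True by blast
        moreover have "tau (Suc i) w \<in> {0..T}" using stopping_timesD(2,3)[OF D(4) elim(2)] by simp
        ultimately show ?thesis using elim(1) D(9)[OF True] True by (simp add: step_cost_def)
      qed (simp add: step_cost_def)
    qed
  qed
qed

definition mode_loop :: "real list \<Rightarrow> nat list \<Rightarrow> bool" where
  "mode_loop ts bs \<longleftrightarrow> ts \<noteq> [] \<and> length bs = length ts \<and> sorted ts \<and> set ts \<subseteq> {0..T} \<and> set bs \<subseteq> {1..m} \<and>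
     (\<forall>i<length bs. bs ! i \<noteq> bs ! (Suc i mod length bs))"

text \<open>\<open>no_free_loop\<close> holds outside a null set depending on the loop, while loops
  have uncountably many possible times. Loops with times on grids are countable in number; rounding
  up preserves the order of the times, and right-continuity of the costs carries the lower bound to
  all loops at once. This is what allows loops formed by the random times of a scheme.\<close>

lemma loop_cost:
  "\<exists>\<epsilon>>0. AE w in M. \<forall>ts bs. mode_loop ts bs \<longrightarrow> \<epsilon> \<le> (\<Sum>i<length ts. c (bs ! i) (bs ! (Suc i mod length bs)) (ts ! i) w)"
proof -
  have "no_free_loop" using sa1 by (simp add: standing_assumption_1_def)
  then have "\<exists>\<epsilon>>0. \<forall>ts bs. mode_loop ts bs \<longrightarrow> (AE w in M. \<epsilon> \<le> (\<Sum>i<length ts. c (bs ! i) (bs ! (Suc i mod length bs)) (ts ! i) w))"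
    unfolding no_free_loop_def mode_loop_def .
  then obtain \<epsilon> where e: "0 < \<epsilon>" and el: "\<forall>ts bs. mode_loop ts bs \<longrightarrow> (AE w in M. \<epsilon> \<le> (\<Sum>i<length ts. c (bs ! i) (bs ! (Suc i mod length bs)) (ts ! i) w))" by blast
  define S where "S = {p. mode_loop (fst p) (snd p) \<and> set (fst p) \<subseteq> (\<Union>l. grid T l)}"
  have "S \<subseteq> lists (\<Union>l. grid T l) \<times> lists {1..m}" by (simp only: S_def mode_loop_def lists_eq_set subset_iff mem_Times_iff mem_Collect_eq) blast
  moreover have "countable (lists (\<Union>l. grid T l) \<times> lists {1..m})"
    by (intro countable_SIGMA countable_lists countable_UN countableI_type countable_finite[OF finite_grid] countable_finite[OF finite_atLeastAtMost])
  ultimately have cS: "countable S" by (rule countable_subset)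
  have "AE w in M. \<forall>p\<in>S. \<epsilon> \<le> (\<Sum>i<length (fst p). c (snd p ! i) (snd p ! (Suc i mod length (snd p))) (fst p ! i) w)"
    unfolding AE_ball_countable[OF cS]
  proof
    fix p assume "p \<in> S"
    then have "mode_loop (fst p) (snd p)" by (simp add: S_def)
    then show "AE w in M. \<epsilon> \<le> (\<Sum>i<length (fst p). c (snd p ! i) (snd p ! (Suc i mod length (snd p))) (fst p ! i) w)"
      by (rule el[rule_format])
  qed
  moreover have cc: "AE w in M. cadlag_on T (\<lambda>t. c b b' t w)" if "b \<in> {1..m}" "b' \<in> alternatives m b" for b b'
    using costs_S2[OF that] by (simp add: S2_qlc_def S2_def cadlag_process_def)
  have "AE w in M. \<forall>b\<in>{1..m}. \<forall>b'\<in>alternatives m b. cadlag_on T (\<lambda>t. c b b' t w)"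
    by (intro AE_finite_allI cc) auto
  ultimately have "AE w in M. \<forall>ts bs. mode_loop ts bs \<longrightarrow> \<epsilon> \<le> (\<Sum>i<length ts. c (bs ! i) (bs ! (Suc i mod length bs)) (ts ! i) w)"
  proof eventually_elim
    case (elim w)
    show ?case
    proof (intro allI impI)
      fix ts bs assume L: "mode_loop ts bs"
      then have ts: "length bs = length ts" "sorted ts" "ts \<noteq> []" and r: "t \<in> {0..T}" if "t \<in> set ts" for t using that by (auto simp: mode_loop_def)
      have sb: "set bs \<subseteq> {1..m}" using L by (simp add: mode_loop_def)
      have len: "length bs = length ts" "ts \<noteq> []" using L by (simp_all add: mode_loop_def)
      have rng: "ts ! i \<in> {0..T}" if "i < length ts" for i using r[of "ts ! i"] that by simp
      define tl where "tl l = map (grid_up T l) ts" for l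
      have "sorted (tl l)" for l
        unfolding tl_def sorted_iff_nth_mono length_map
      proof (intro allI impI)
        fix i j assume ij: "i \<le> j" "j < length ts"
        have "ts ! i \<le> ts ! j" using L ij by (simp add: mode_loop_def sorted_iff_nth_mono)
        then show "map (grid_up T l) ts ! i \<le> map (grid_up T l) ts ! j"
          using ij rng[of j] by (simp add: grid_up_mono)
      qed
      moreover have "set (tl l) \<subseteq> {0..T}" "set (tl l) \<subseteq> (\<Union>l. grid T l)" for l
        using r grid_up_range[OF T_pos, of _ l] grid_up_in[of _ T l] by (auto simp: tl_def)
      ultimately have "(tl l, bs) \<in> S" for l using L len by (auto simp: S_def mode_loop_def tl_def)
      with elim(1) have "\<epsilon> \<le> (\<Sum>i<length ts. c (bs ! i) (bs ! (Suc i mod length bs)) (grid_up T l (ts ! i)) w)" for l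
        using bspec[OF elim(1), of "(tl l, bs)"] by (simp add: tl_def)
      moreover have "(\<lambda>l. \<Sum>i<length ts. c (bs ! i) (bs ! (Suc i mod length bs)) (grid_up T l (ts ! i)) w) \<longlonglongrightarrow>
          (\<Sum>i<length ts. c (bs ! i) (bs ! (Suc i mod length bs)) (ts ! i) w)"
      proof (rule tendsto_sum)
        fix i assume "i \<in> {..<length ts}"
        then have i: "i < length ts" by simp
        let ?j = "Suc i mod length bs"
        have j: "?j < length bs" using len by simp
        have bj: "bs ! i \<in> {1..m}" "bs ! ?j \<in> {1..m}"
          by (rule subsetD[OF sb nth_mem], use i j len in simp)+
        have "bs ! i \<noteq> bs ! ?j" using L i len unfolding mode_loop_def by simp
        then have b: "bs ! i \<in> {1..m}" "bs ! ?j \<in> alternatives m (bs ! i)" using bj by auto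
        show "(\<lambda>l. c (bs ! i) (bs ! ?j) (grid_up T l (ts ! i)) w) \<longlonglongrightarrow> c (bs ! i) (bs ! ?j) (ts ! i) w"
          using elim(2)[rule_format, OF b] rng[OF i]
        proof (rule cadlag_on_right)
          show "grid_up T l (ts ! i) \<in> {ts ! i..T}" for l
            using rng[OF i] grid_up_ge[of "ts ! i" T l] grid_up_range[OF T_pos, of "ts ! i" l] by simp
          show "(\<lambda>l. grid_up T l (ts ! i)) \<longlonglongrightarrow> ts ! i" using rng[OF i] by (intro grid_up_tendsto T_pos) auto
        qed
      qed
      ultimately show "\<epsilon> \<le> (\<Sum>i<length ts. c (bs ! i) (bs ! (Suc i mod length bs)) (ts ! i) w)"
        by (intro LIMSEQ_le_const) auto
    qed
  qed
  with e show ?thesis by blast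
qed

text \<open>Among \<open>m + 1\<close> consecutive modes two coincide, and the interventions between
  them form a loop. Infinitely many disjoint blocks of interventions therefore each cost at least
  \<open>\<epsilon>\<close>.\<close>

lemma infinite_scheme_cost:
  assumes sch: "scheme tau beta E"
  shows "AE w in M. (\<forall>k. w \<in> E k) \<longrightarrow> (\<Sum>i. ennreal (step_cost tau beta E i w)) = \<infinity>"
proof -
  note D = schemeD[OF sch]
  obtain \<epsilon> where e: "0 < \<epsilon>" and le: "AE w in M. \<forall>ts bs. mode_loop ts bs \<longrightarrow> \<epsilon> \<le> (\<Sum>i<length ts. c (bs ! i) (bs ! (Suc i mod length bs)) (ts ! i) w)"
    using loop_cost by blast
  from le step_cost_nonneg[OF sch] AE_space show ?thesis
  proof eventually_elim
    case (elim w)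
    let ?C = "\<lambda>i. step_cost tau beta E i w"
    show ?case
    proof
      assume w: "\<forall>k. w \<in> E k"
      \<comment> \<open>The modes with index \<open>k\<close> to \<open>k + m\<close> involve
        \<open>m\<close> transitions; the block contains one more, which can only add to a
        nonnegative cost.\<close>
      have block: "\<epsilon> \<le> (\<Sum>i\<in>{k..<k + Suc m}. ?C i)" for k
      proof -
        have "(\<lambda>i. beta i w) ` {k..k + m} \<subseteq> {1..m}" using scheme_modes[OF sch] w by blast
        then have "card ((\<lambda>i. beta i w) ` {k..k + m}) \<le> m" using card_mono[of "{1..m}"] by fastforce
        then have "\<not> inj_on (\<lambda>i. beta i w) {k..k + m}" by (intro pigeonhole) simp
        then obtain p' q' where pq': "p' \<in> {k..k + m}" "q' \<in> {k..k + m}" "beta p' w = beta q' w" "p' \<noteq> q'" by (auto simp: inj_on_def)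
        define p q where "p = min p' q'" and "q = max p' q'"
        have pq: "k \<le> p" "p < q" "q \<le> k + m" "beta p w = beta q w" using pq' by (auto simp: p_def q_def min_def max_def)
        define ts bs where "ts = map (\<lambda>i. tau (Suc i) w) [p..<q]" and "bs = map (\<lambda>i. beta i w) [p..<q]"
        \<comment> \<open>The last transition of the loop leads to the mode with index
          \<open>q\<close>. It coincides with the one with index \<open>p\<close>, which is what the
          wrap-around index returns.\<close>
        have nx: "bs ! (Suc i mod length bs) = beta (Suc (p + i)) w" if "i < q - p" for i
        proof (cases "Suc i = q - p")
          case True
          then have "Suc (p + i) = q" using pq by simp
          then show ?thesis using True pq by (simp add: bs_def)
        next
          case False
          then have "Suc i < q - p" using that by simp
          then show ?thesis by (simp add: bs_def)
        qed
        have bi: "bs ! i = beta (p + i) w" "ts ! i = tau (Suc (p + i)) w" if "i < q - p" for i using that by (simp_all add: bs_def ts_def)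
        have "mode_loop ts bs" unfolding mode_loop_def
        proof (intro conjI allI impI)
          show "ts \<noteq> []" "length bs = length ts" using pq by (simp_all add: ts_def bs_def)
          show "sorted ts" unfolding sorted_iff_nth_mono using D(14)[OF elim(3)] by (auto simp: ts_def)
          show "set ts \<subseteq> {0..T}" using stopping_timesD(2,3)[OF D(4) elim(3)] by (auto simp: ts_def)
          show "set bs \<subseteq> {1..m}" using scheme_modes[OF sch] w by (auto simp: bs_def simp del: atLeastAtMost_iff)
          fix i assume "i < length bs"
          then have i: "i < q - p" by (simp add: bs_def)
          show "bs ! i \<noteq> bs ! (Suc i mod length bs)"
            unfolding nx[OF i] bi(1)[OF i] using D(9)[of w "p + i"] w by auto
        qed
        with elim(1) have "\<epsilon> \<le> (\<Sum>i<length ts. c (bs ! i) (bs ! (Suc i mod length bs)) (ts ! i) w)" by blast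
        also have "\<dots> = (\<Sum>i<q - p. ?C (p + i))"
          by (rule sum.cong) (use w nx bi in \<open>auto simp: ts_def step_cost_def\<close>)
        also have "\<dots> = (\<Sum>i\<in>{p..<q}. ?C i)"
          using sum.shift_bounds_nat_ivl[of ?C 0 p "q - p"] pq by (simp add: atLeast0LessThan add.commute)
        also have "\<dots> \<le> (\<Sum>i\<in>{k..<k + Suc m}. ?C i)"
          using pq elim(2) by (intro sum_mono2) auto
        finally show ?thesis .
      qed
      have ge: "real n * \<epsilon> \<le> (\<Sum>i<n * Suc m. ?C i)" for n
      proof (induction n)
        case (Suc n)
        have "(\<Sum>i<N + L. ?C i) = (\<Sum>i<N. ?C i) + (\<Sum>i\<in>{N..<N + L}. ?C i)" for N L
          using sum.atLeastLessThan_concat[of 0 N "N + L" ?C] by (simp add: atLeast0LessThan)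
        from this[of "n * Suc m" "Suc m"] have "(\<Sum>i<Suc n * Suc m. ?C i) = (\<Sum>i<n * Suc m. ?C i) + (\<Sum>i\<in>{n * Suc m..<n * Suc m + Suc m}. ?C i)"
          by (simp only: mult_Suc add.commute)
        moreover have "real (Suc n) * \<epsilon> = real n * \<epsilon> + \<epsilon>" by (simp add: distrib_right)
        ultimately show ?case using Suc block[of "n * Suc m"] by linarith
      qed simp
      show "(\<Sum>i. ennreal (?C i)) = \<infinity>"
      proof (rule ccontr)
        assume "(\<Sum>i. ennreal (?C i)) \<noteq> \<infinity>"
        then obtain r where r: "0 \<le> r" "(\<Sum>i. ennreal (?C i)) = ennreal r" by (cases "\<Sum>i. ennreal (?C i)") auto
        obtain n where n: "r < real n * \<epsilon>" using ex_less_of_nat_mult[OF e] by blast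
        have "ennreal (\<Sum>i<n * Suc m. ?C i) = (\<Sum>i<n * Suc m. ennreal (?C i))" using elim(2) by (simp add: sum_ennreal)
        also have "\<dots> \<le> ennreal r" unfolding r(2)[symmetric] by (intro sum_le_suminf) auto
        finally have "(\<Sum>i<n * Suc m. ?C i) \<le> r" using r(1) by simp
        then show False using ge[of n] n by linarith
      qed
    qed
  qed
qed

section \<open>Value of the family along a scheme\<close>

lemma expected_plan_cost:
  assumes sch: "scheme tau beta E"
  shows "(\<integral>\<^sup>+w. plan_cost b0 (scheme_plan tau beta E w) w \<partial>M) = (\<Sum>i. ennreal (\<integral>w. step_cost tau beta E i w \<partial>M))"
    "0 \<le> (\<integral>w. step_cost tau beta E i w \<partial>M)"
proof -
  let ?sc = "step_cost tau beta E"
  have nn: "AE w in M. 0 \<le> ?sc i w" for i using step_cost_nonneg[OF sch] by eventually_elim simp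
  have "(\<integral>\<^sup>+w. plan_cost b0 (scheme_plan tau beta E w) w \<partial>M) = (\<Sum>i. \<integral>\<^sup>+w. ennreal (?sc i w) \<partial>M)"
    unfolding plan_cost_scheme[OF sch] using step_cost_integrable[OF sch] by (intro nn_integral_suminf) auto
  also have "\<dots> = (\<Sum>i. ennreal (\<integral>w. ?sc i w \<partial>M))"
    by (intro suminf_cong nn_integral_eq_integral step_cost_integrable[OF sch] nn)
  finally show "(\<integral>\<^sup>+w. plan_cost b0 (scheme_plan tau beta E w) w \<partial>M) = (\<Sum>i. ennreal (\<integral>w. ?sc i w \<partial>M))" .
  show "0 \<le> (\<integral>w. ?sc i w \<partial>M)" by (rule integral_nonneg_AE[OF nn])
qed

definition stage_value :: "(nat \<Rightarrow> 'a \<Rightarrow> real) \<Rightarrow> (nat \<Rightarrow> 'a \<Rightarrow> nat) \<Rightarrow> nat \<Rightarrow> 'a set \<Rightarrow> real" where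
  "stage_value tau beta k A = (\<integral>w. Y (rule_history tau beta k w) (tau k w) w * indicator A w \<partial>M)"

definition trunc_payoff :: "(nat \<Rightarrow> 'a \<Rightarrow> real) \<Rightarrow> (nat \<Rightarrow> 'a \<Rightarrow> nat) \<Rightarrow> (nat \<Rightarrow> 'a set) \<Rightarrow> nat \<Rightarrow> 'a \<Rightarrow> real" where
  "trunc_payoff tau beta E k w = Psi w (scheme_plan (trunc_times k tau) beta (trunc_events k E) w)"

definition cost_between :: "(nat \<Rightarrow> 'a \<Rightarrow> real) \<Rightarrow> (nat \<Rightarrow> 'a \<Rightarrow> nat) \<Rightarrow> (nat \<Rightarrow> 'a set) \<Rightarrow> nat \<Rightarrow> nat \<Rightarrow> 'a set \<Rightarrow> real" where
  "cost_between tau beta E n k A = (\<Sum>i\<in>{n..<k}. \<integral>w. step_cost tau beta E i w * indicator A w \<partial>M)"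

text \<open>What remains of the value of the family after \<open>k\<close> interventions, plus what was earned before.\<close>

definition gain where
  "gain tau beta E n A k = stage_value tau beta k (A \<inter> E k)
     + (\<integral>w. trunc_payoff tau beta E k w * indicator (A - E k) w \<partial>M) - cost_between tau beta E n k A"

lemma trunc_payoff_integrable: "scheme tau beta E \<Longrightarrow> integrable M (trunc_payoff tau beta E k)"
  unfolding trunc_payoff_def using Psi_integrable trunc_control controls_finite_subset by blast

text \<open>The two ways in which a stage can end. An intervention exchanges the value for a switch
  value, which the obstacle, and hence the family, dominates; otherwise \<open>tau (Suc k)\<close>
  is \<open>T\<close> and the terminal value of the family is the payoff of the history.\<close>

lemma step_AE:
  assumes sch: "scheme tau beta E"
  shows "AE w in M. (w \<in> E (Suc k) \<longrightarrow> Y (rule_history tau beta (Suc k) w) (tau (Suc k) w) w - step_cost tau beta E k w \<le> Y (rule_history tau beta k w) (tau (Suc k) w) w)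
     \<and> (w \<in> E k - E (Suc k) \<longrightarrow> Y (rule_history tau beta k w) (tau (Suc k) w) w = trunc_payoff tau beta E (Suc k) w)"
  using scheme_AE[OF sch, of k] AE_space
proof eventually_elim
  case (elim w)
  note D = schemeD[OF sch]
  let ?H = "rule_history tau beta k w"
  have t: "tau (Suc k) w \<in> {tau k w..T}" using D(8)[OF elim(2)] stopping_timesD(3)[OF D(4) elim(2)] by simp
  show ?case
  proof (intro conjI impI)
    assume w: "w \<in> E (Suc k)"
    then have wk: "w \<in> E k" using D(7) by blast
    note lm = scheme_history(3)[OF sch wk]
    have "switch_value Y ?H (tau (Suc k) w) w (beta (Suc k) w) \<le> best_switch_value Y ?H (tau (Suc k) w) w"
      unfolding best_switch_value_def using D(9)[OF w] by (intro Max_ge) (auto simp: lm)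
    also have "\<dots> \<le> Y ?H (tau (Suc k) w) w" using elim(1) wk t by blast
    finally show "Y (rule_history tau beta (Suc k) w) (tau (Suc k) w) w - step_cost tau beta E k w \<le> Y ?H (tau (Suc k) w) w"
      using w by (simp add: switch_value_def step_cost_def rule_history_Suc lm)
  next
    assume w: "w \<in> E k - E (Suc k)"
    then have "trunc_payoff tau beta E (Suc k) w = Psi w (plan_of ?H)"
      using trunc_plan_off[OF sch, of w "Suc k"] scheme_plan_last[OF sch, of w k] by (simp add: trunc_payoff_def)
    then show "Y ?H (tau (Suc k) w) w = trunc_payoff tau beta E (Suc k) w"
      using elim D(10)[OF elim(2), of k] w by simp
  qed
qed

text \<open>The decrease of the gain splits into what is lost by waiting until
  \<open>tau (Suc k)\<close> and what is lost by the choice made there. For an arbitrary scheme both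
  parts are nonnegative when \<open>A\<close> is known at the initial stage; along the rule both
  vanish.\<close>

lemma gain_step:
  assumes sch: "scheme tau beta E" and A: "A \<in> sets M" and n: "n \<le> k"
  defines "x \<equiv> \<lambda>w. Y (rule_history tau beta k w) (tau (Suc k) w) w"
    and "y \<equiv> \<lambda>w. Y (rule_history tau beta (Suc k) w) (tau (Suc k) w) w - step_cost tau beta E k w"
  shows "integrable M (\<lambda>w. x w * indicator (A \<inter> E (Suc k)) w)" "integrable M (\<lambda>w. y w * indicator (A \<inter> E (Suc k)) w)"
    "gain tau beta E n A k - gain tau beta E n A (Suc k) = (stage_value tau beta k (A \<inter> E k) - (\<integral>w. x w * indicator (A \<inter> E k) w \<partial>M))
      + ((\<integral>w. x w * indicator (A \<inter> E (Suc k)) w \<partial>M) - (\<integral>w. y w * indicator (A \<inter> E (Suc k)) w \<partial>M))"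
proof -
  note D = schemeD[OF sch]
  have sets: "A \<inter> E (Suc k) \<in> sets M" "A \<inter> E k \<in> sets M" "A \<inter> (E k - E (Suc k)) \<in> sets M" "A - E k \<in> sets M" "A - E (Suc k) \<in> sets M"
    using A D(12) by auto
  have sub: "A \<inter> E (Suc k) \<subseteq> E k" "A \<inter> E k \<subseteq> E k" "A \<inter> (E k - E (Suc k)) \<subseteq> E k" using D(7)[of k] by auto
  have xi: "integrable M (\<lambda>w. x w * indicator B w)" if "B \<in> sets M" "B \<subseteq> E k" for B
    unfolding x_def by (rule scheme_value_integrable[OF sch that D(4) D(8)])
  show xi1: "integrable M (\<lambda>w. x w * indicator (A \<inter> E (Suc k)) w)" by (rule xi[OF sets(1) sub(1)])
  have xi2: "integrable M (\<lambda>w. x w * indicator (A \<inter> (E k - E (Suc k))) w)" by (rule xi[OF sets(3) sub(3)])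
  have si: "integrable M (\<lambda>w. step_cost tau beta E k w * indicator A w)"
    by (rule integrable_real_mult_indicator[OF A step_cost_integrable[OF sch]])
  have vi: "integrable M (\<lambda>w. Y (rule_history tau beta (Suc k) w) (tau (Suc k) w) w * indicator (A \<inter> E (Suc k)) w)"
    by (rule scheme_value_integrable[OF sch sets(1) _ D(4)]) auto
  have yeq: "y w * indicator (A \<inter> E (Suc k)) w = Y (rule_history tau beta (Suc k) w) (tau (Suc k) w) w * indicator (A \<inter> E (Suc k)) w - step_cost tau beta E k w * indicator A w" for w
    by (auto simp: y_def indicator_def step_cost_def)
  show yi: "integrable M (\<lambda>w. y w * indicator (A \<inter> E (Suc k)) w)" unfolding yeq by (rule Bochner_Integration.integrable_diff[OF vi si])
  have y: "(\<integral>w. y w * indicator (A \<inter> E (Suc k)) w \<partial>M) = stage_value tau beta (Suc k) (A \<inter> E (Suc k)) - (\<integral>w. step_cost tau beta E k w * indicator A w \<partial>M)"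
    unfolding yeq stage_value_def by (rule Bochner_Integration.integral_diff[OF vi si])
  have "(\<integral>w. x w * indicator (A \<inter> E k) w \<partial>M) = (\<integral>w. x w * indicator (A \<inter> E (Suc k)) w + x w * indicator (A \<inter> (E k - E (Suc k))) w \<partial>M)"
    using D(7)[of k] by (intro Bochner_Integration.integral_cong refl) (auto simp: indicator_def)
  also have "\<dots> = (\<integral>w. x w * indicator (A \<inter> E (Suc k)) w \<partial>M) + (\<integral>w. x w * indicator (A \<inter> (E k - E (Suc k))) w \<partial>M)"
    by (rule Bochner_Integration.integral_add[OF xi1 xi2])
  also have "(\<integral>w. x w * indicator (A \<inter> (E k - E (Suc k))) w \<partial>M) = (\<integral>w. trunc_payoff tau beta E (Suc k) w * indicator (A \<inter> (E k - E (Suc k))) w \<partial>M)"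
  proof (rule integral_cong_AE)
    show "(\<lambda>w. x w * indicator (A \<inter> (E k - E (Suc k))) w) \<in> borel_measurable M" using xi2 by simp
    show "(\<lambda>w. trunc_payoff tau beta E (Suc k) w * indicator (A \<inter> (E k - E (Suc k))) w) \<in> borel_measurable M"
      using integrable_real_mult_indicator[OF sets(3) trunc_payoff_integrable[OF sch]] by simp
    show "AE w in M. x w * indicator (A \<inter> (E k - E (Suc k))) w = trunc_payoff tau beta E (Suc k) w * indicator (A \<inter> (E k - E (Suc k))) w"
      using step_AE[OF sch, of k] by eventually_elim (auto simp: x_def indicator_def)
  qed
  finally have x: "(\<integral>w. x w * indicator (A \<inter> E k) w \<partial>M) = (\<integral>w. x w * indicator (A \<inter> E (Suc k)) w \<partial>M) + (\<integral>w. trunc_payoff tau beta E (Suc k) w * indicator (A \<inter> (E k - E (Suc k))) w \<partial>M)" .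
  have "(\<integral>w. trunc_payoff tau beta E (Suc k) w * indicator (A - E (Suc k)) w \<partial>M) =
    (\<integral>w. trunc_payoff tau beta E k w * indicator (A - E k) w + trunc_payoff tau beta E (Suc k) w * indicator (A \<inter> (E k - E (Suc k))) w \<partial>M)"
  proof (rule Bochner_Integration.integral_cong[OF refl])
    fix w
    have "trunc_payoff tau beta E (Suc k) w = trunc_payoff tau beta E k w" if "w \<notin> E k"
    proof -
      have "w \<notin> E (Suc k)" using that D(7) by blast
      then show ?thesis using that by (simp add: trunc_payoff_def trunc_plan_off[OF sch])
    qed
    then show "trunc_payoff tau beta E (Suc k) w * indicator (A - E (Suc k)) w =
       trunc_payoff tau beta E k w * indicator (A - E k) w + trunc_payoff tau beta E (Suc k) w * indicator (A \<inter> (E k - E (Suc k))) w"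
      using D(7)[of k] by (auto simp: indicator_def)
  qed
  also have "\<dots> = (\<integral>w. trunc_payoff tau beta E k w * indicator (A - E k) w \<partial>M) + (\<integral>w. trunc_payoff tau beta E (Suc k) w * indicator (A \<inter> (E k - E (Suc k))) w \<partial>M)"
    by (intro Bochner_Integration.integral_add integrable_real_mult_indicator sets trunc_payoff_integrable[OF sch])
  finally have p: "(\<integral>w. trunc_payoff tau beta E (Suc k) w * indicator (A - E (Suc k)) w \<partial>M) =
     (\<integral>w. trunc_payoff tau beta E k w * indicator (A - E k) w \<partial>M) + (\<integral>w. trunc_payoff tau beta E (Suc k) w * indicator (A \<inter> (E k - E (Suc k))) w \<partial>M)" .
  have c: "cost_between tau beta E n (Suc k) A = cost_between tau beta E n k A + (\<integral>w. step_cost tau beta E k w * indicator A w \<partial>M)"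
    using n by (simp add: cost_between_def)
  show "gain tau beta E n A k - gain tau beta E n A (Suc k) = (stage_value tau beta k (A \<inter> E k) - (\<integral>w. x w * indicator (A \<inter> E k) w \<partial>M))
      + ((\<integral>w. x w * indicator (A \<inter> E (Suc k)) w \<partial>M) - (\<integral>w. y w * indicator (A \<inter> E (Suc k)) w \<partial>M))"
    unfolding gain_def x y p c by simp
qed

lemma pre_sigma_stage:
  assumes sch: "scheme tau beta E" and A: "A \<in> sets (pre_sigma (tau n))" and n: "n \<le> k"
  shows "A \<inter> E k \<in> sets (pre_sigma (tau k))" "A \<in> sets M"
proof -
  note D = schemeD[OF sch]
  have "A \<in> sets (pre_sigma (tau k))" using pre_sigma_mono[OF D(4,4), of n k] D(14)[OF _ n] A by blast
  then show "A \<inter> E k \<in> sets (pre_sigma (tau k))" using D(6) by blast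
  show "A \<in> sets M" using A pre_sigma_sets_M[OF D(4)] sets_F_subset by blast
qed

lemma gain_le_stage_value:
  assumes sch: "scheme tau beta E" and A: "A \<in> sets (pre_sigma (tau n))" "A \<subseteq> E n" and n: "n \<le> k"
  shows "gain tau beta E n A k \<le> stage_value tau beta n A"
  using n
proof (induction k rule: dec_induct)
  case base
  have e: "A \<inter> E n = A" "A - E n = {}" using A(2) by blast+
  show ?case unfolding gain_def cost_between_def e by simp
next
  case (step k)
  note D = schemeD[OF sch]
  note g = gain_step[OF sch pre_sigma_stage(2)[OF sch A(1) order_refl] step(1)]
  have "(\<integral>w. Y (rule_history tau beta k w) (tau (Suc k) w) w * indicator (A \<inter> E k) w \<partial>M) \<le> stage_value tau beta k (A \<inter> E k)"
    unfolding stage_value_def by (rule scheme_optional_sampling[OF sch pre_sigma_stage(1)[OF sch A(1) step(1)] _ D(4) D(8)]) auto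
  moreover have "(\<integral>w. (Y (rule_history tau beta (Suc k) w) (tau (Suc k) w) w - step_cost tau beta E k w) * indicator (A \<inter> E (Suc k)) w \<partial>M)
     \<le> (\<integral>w. Y (rule_history tau beta k w) (tau (Suc k) w) w * indicator (A \<inter> E (Suc k)) w \<partial>M)"
    by (rule integral_mono_AE[OF g(2,1)]) (use step_AE[OF sch, of k] in eventually_elim, auto simp: indicator_def)
  ultimately show ?case using g(3) step(3) by linarith
qed

text \<open>On \<open>E k\<close> further interventions remain possible after stage
  \<open>k\<close>. Waiting until \<open>T\<close> instead collects the payoff of the cut-off plan,
  and by optional sampling this is in mean no more than the value at that stage.\<close>

lemma gain_ge_payoff:
  assumes sch: "scheme tau beta E" and A: "A \<in> sets (pre_sigma (tau n))" and n: "n \<le> k"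
  shows "(\<integral>w. trunc_payoff tau beta E k w * indicator A w \<partial>M) - cost_between tau beta E n k A \<le> gain tau beta E n A k"
proof -
  note D = schemeD[OF sch]
  note As = pre_sigma_stage[OF sch A n]
  have Tst: "(\<lambda>_. T) \<in> stopping_times" using T_nonneg by (intro const_stopping_times) auto
  have Ek: "A \<inter> E k \<in> sets M" "A - E k \<in> sets M" using As(2) D(12) by auto
  have pi: "integrable M (\<lambda>w. trunc_payoff tau beta E k w * indicator B w)" if "B \<in> sets M" for B
    by (rule integrable_real_mult_indicator[OF that trunc_payoff_integrable[OF sch]])
  have "(\<integral>w. trunc_payoff tau beta E k w * indicator (A \<inter> E k) w \<partial>M) = (\<integral>w. Y (rule_history tau beta k w) T w * indicator (A \<inter> E k) w \<partial>M)"
  proof (rule integral_cong_AE)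
    show "(\<lambda>w. trunc_payoff tau beta E k w * indicator (A \<inter> E k) w) \<in> borel_measurable M" using pi[OF Ek(1)] by simp
    show "(\<lambda>w. Y (rule_history tau beta k w) T w * indicator (A \<inter> E k) w) \<in> borel_measurable M"
      using scheme_value_integrable[OF sch Ek(1) _ Tst stopping_timesD(3)[OF D(4)]] by simp
    show "AE w in M. trunc_payoff tau beta E k w * indicator (A \<inter> E k) w = Y (rule_history tau beta k w) T w * indicator (A \<inter> E k) w"
      using scheme_AE[OF sch, of k] by eventually_elim (auto simp: indicator_def trunc_payoff_def trunc_plan_on[OF sch])
  qed
  also have "\<dots> \<le> stage_value tau beta k (A \<inter> E k)"
    unfolding stage_value_def by (rule scheme_optional_sampling[OF sch As(1) _ Tst stopping_timesD(3)[OF D(4)]]) auto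
  finally have "(\<integral>w. trunc_payoff tau beta E k w * indicator (A \<inter> E k) w \<partial>M) \<le> stage_value tau beta k (A \<inter> E k)" .
  moreover have "(\<integral>w. trunc_payoff tau beta E k w * indicator A w \<partial>M) =
    (\<integral>w. trunc_payoff tau beta E k w * indicator (A \<inter> E k) w + trunc_payoff tau beta E k w * indicator (A - E k) w \<partial>M)"
    by (intro Bochner_Integration.integral_cong refl) (auto simp: indicator_def)
  moreover have "\<dots> = (\<integral>w. trunc_payoff tau beta E k w * indicator (A \<inter> E k) w \<partial>M) + (\<integral>w. trunc_payoff tau beta E k w * indicator (A - E k) w \<partial>M)"
    by (rule Bochner_Integration.integral_add[OF pi[OF Ek(1)] pi[OF Ek(2)]])
  ultimately show ?thesis by (simp add: gain_def)
qed

text \<open>Cut-off and full payoff differ only on \<open>E k\<close>, which shrinks to a null set,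
  and \<open>Psi\<close> is bounded in L2 uniformly over controls. The bound \<open>4 * C\<close> on
  the squared difference comes from \<open>(a - b)^2 \<le> 2 * a^2 + 2 * b^2\<close>.\<close>

lemma payoff_tendsto:
  assumes sch: "scheme tau beta E" and fin: "AE w in M. \<exists>k. w \<notin> E k" and A: "A \<in> sets M"
  shows "(\<lambda>k. \<integral>w. trunc_payoff tau beta E k w * indicator A w \<partial>M) \<longlonglongrightarrow> (\<integral>w. Psi w (scheme_plan tau beta E w) * indicator A w \<partial>M)"
    "(\<lambda>k. \<integral>w. trunc_payoff tau beta E k w * indicator (A - E k) w \<partial>M) \<longlonglongrightarrow> (\<integral>w. Psi w (scheme_plan tau beta E w) * indicator A w \<partial>M)"
proof -
  note D = schemeD[OF sch]
  let ?P = "\<lambda>w. Psi w (scheme_plan tau beta E w)" and ?p = "trunc_payoff tau beta E"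
  obtain C where C: "\<And>u. u \<in> controls b0 \<Longrightarrow> integrable M (\<lambda>w. (Psi w (u w))\<^sup>2)"
    "\<And>u. u \<in> controls b0 \<Longrightarrow> (\<integral>w. (Psi w (u w))\<^sup>2 \<partial>M) \<le> C" "0 \<le> C" using Psi_L2_bound by blast
  have u: "scheme_plan tau beta E \<in> controls b0" using scheme_control[OF sch fin] controls_finite_subset by blast
  have uk: "scheme_plan (trunc_times k tau) beta (trunc_events k E) \<in> controls b0" for k using trunc_control[OF sch] controls_finite_subset by blast
  have i: "integrable M ?P" "integrable M (?p k)" for k using Psi_integrable[OF u] trunc_payoff_integrable[OF sch] by auto
  have i2: "integrable M (\<lambda>w. (?P w)\<^sup>2)" "integrable M (\<lambda>w. (?p k w)\<^sup>2)" for k using C(1)[OF u] C(1)[OF uk] by (simp_all add: trunc_payoff_def)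
  have decE: "decseq E" using D(7) by (intro decseq_SucI)
  have B: "A \<inter> E k \<in> sets M" "A - E k \<in> sets M" for k using A D(12) by auto
  have "AE w in M. \<exists>k. w \<notin> A \<inter> E k" using fin by eventually_elim auto
  then have m0: "(\<lambda>k. measure M (A \<inter> E k)) \<longlonglongrightarrow> 0"
    using decE B by (intro measure_decseq_null) (auto simp: decseq_def)
  have d2: "integrable M (\<lambda>w. (?p k w - ?P w)\<^sup>2)" "(\<integral>w. (?p k w - ?P w)\<^sup>2 \<partial>M) \<le> 4 * C" for k
  proof -
    have dom: "(?p k w - ?P w)\<^sup>2 \<le> 2 * (?p k w)\<^sup>2 + 2 * (?P w)\<^sup>2" for w
    proof -
      have "0 \<le> (?p k w + ?P w)\<^sup>2" by simp
      then show ?thesis by (simp add: power2_sum power2_diff)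
    qed
    have s: "integrable M (\<lambda>w. 2 * (?p k w)\<^sup>2 + 2 * (?P w)\<^sup>2)" using i2 by (intro Bochner_Integration.integrable_add integrable_mult_right) auto
    show d: "integrable M (\<lambda>w. (?p k w - ?P w)\<^sup>2)"
      by (rule Bochner_Integration.integrable_bound[OF s]) (use i dom in \<open>auto intro!: borel_measurable_power borel_measurable_diff borel_measurable_integrable\<close>)
    have "(\<integral>w. (?p k w - ?P w)\<^sup>2 \<partial>M) \<le> (\<integral>w. 2 * (?p k w)\<^sup>2 + 2 * (?P w)\<^sup>2 \<partial>M)" by (rule integral_mono[OF d s dom])
    also have "\<dots> = 2 * (\<integral>w. (?p k w)\<^sup>2 \<partial>M) + 2 * (\<integral>w. (?P w)\<^sup>2 \<partial>M)"
      using i2 by (subst Bochner_Integration.integral_add) auto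
    also have "\<dots> \<le> 4 * C" using C(2)[OF u] C(2)[OF uk, of k] by (simp add: trunc_payoff_def)
    finally show "(\<integral>w. (?p k w - ?P w)\<^sup>2 \<partial>M) \<le> 4 * C" .
  qed
  have off: "?p k w = ?P w" if "w \<notin> E k" for k w using trunc_plan_off[OF sch that] by (simp add: trunc_payoff_def)
  have z: "(\<lambda>k. \<integral>w. (?p k w - ?P w) * indicator (A \<inter> E k) w \<partial>M) \<longlonglongrightarrow> 0"
    using i by (intro tendsto_L2_bounded_vanishing[OF _ d2 B(1) m0]) auto
  have e1: "(\<integral>w. (?p k w - ?P w) * indicator (A \<inter> E k) w \<partial>M) = (\<integral>w. ?p k w * indicator A w \<partial>M) - (\<integral>w. ?P w * indicator A w \<partial>M)" for k
    unfolding Bochner_Integration.integral_diff[OF integrable_real_mult_indicator[OF A i(2)] integrable_real_mult_indicator[OF A i(1)], symmetric]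
    by (intro Bochner_Integration.integral_cong refl) (auto simp: indicator_def off)
  show "(\<lambda>k. \<integral>w. ?p k w * indicator A w \<partial>M) \<longlonglongrightarrow> (\<integral>w. ?P w * indicator A w \<partial>M)"
    using z[unfolded e1] by (rule LIM_zero_cancel)
  have "(\<lambda>k. \<integral>w. ?P w * indicator (A \<inter> E k) w \<partial>M) \<longlonglongrightarrow> 0"
    using i i2 by (intro tendsto_L2_bounded_vanishing[OF _ _ C(2)[OF u] B(1) m0]) auto
  from tendsto_diff[OF tendsto_const this]
  have "(\<lambda>k. (\<integral>w. ?P w * indicator A w \<partial>M) - (\<integral>w. ?P w * indicator (A \<inter> E k) w \<partial>M)) \<longlonglongrightarrow> (\<integral>w. ?P w * indicator A w \<partial>M)" by simp
  moreover have "(\<integral>w. ?P w * indicator A w \<partial>M) - (\<integral>w. ?P w * indicator (A \<inter> E k) w \<partial>M) = (\<integral>w. ?p k w * indicator (A - E k) w \<partial>M)" for k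
    unfolding Bochner_Integration.integral_diff[OF integrable_real_mult_indicator[OF A i(1)] integrable_real_mult_indicator[OF B(1) i(1)], symmetric]
    by (intro Bochner_Integration.integral_cong refl) (auto simp: indicator_def off)
  ultimately show "(\<lambda>k. \<integral>w. ?p k w * indicator (A - E k) w \<partial>M) \<longlonglongrightarrow> (\<integral>w. ?P w * indicator A w \<partial>M)" by simp
qed

theorem payoff_le_stage_value:
  assumes sch: "scheme tau beta E" and fin: "AE w in M. \<exists>k. w \<notin> E k"
    and A: "A \<in> sets (pre_sigma (tau n))" "A \<subseteq> E n"
    and L: "(\<lambda>k. cost_between tau beta E n k A) \<longlonglongrightarrow> L"
  shows "(\<integral>w. Psi w (scheme_plan tau beta E w) * indicator A w \<partial>M) - L \<le> stage_value tau beta n A"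
proof (rule LIMSEQ_le_const2)
  show "(\<lambda>k. (\<integral>w. trunc_payoff tau beta E k w * indicator A w \<partial>M) - cost_between tau beta E n k A) \<longlonglongrightarrow>
     (\<integral>w. Psi w (scheme_plan tau beta E w) * indicator A w \<partial>M) - L"
    by (intro tendsto_diff payoff_tendsto[OF sch fin] L pre_sigma_stage(2)[OF sch A(1) order_refl])
  show "\<exists>N. \<forall>k\<ge>N. (\<integral>w. trunc_payoff tau beta E k w * indicator A w \<partial>M) - cost_between tau beta E n k A \<le> stage_value tau beta n A"
    using gain_ge_payoff[OF sch A(1)] gain_le_stage_value[OF sch A] order_trans by blast
qed

text \<open>The conditions under which both losses of \<open>gain_step\<close> vanish from stage
  \<open>n\<close> on. The first \<open>n\<close> interventions are arbitrary but take place
  everywhere, so that the comparison at \<open>tau n\<close> concerns the whole space.\<close>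

definition optimal_from where
  "optimal_from n tau beta E \<longleftrightarrow> scheme tau beta E \<and> E n = space M \<and> (\<forall>k\<ge>n.
     (\<forall>B. B \<in> sets (pre_sigma (tau k)) \<and> B \<subseteq> E k \<longrightarrow>
       (\<integral>w. Y (rule_history tau beta k w) (tau (Suc k) w) w * indicator B w \<partial>M) = stage_value tau beta k B) \<and>
     (AE w in M. w \<in> E (Suc k) \<longrightarrow> Y (rule_history tau beta k w) (tau (Suc k) w) w =
        Y (rule_history tau beta (Suc k) w) (tau (Suc k) w) w - step_cost tau beta E k w))"

lemma optimal_gain:
  assumes opt: "optimal_from n tau beta E" and A: "A \<in> sets (pre_sigma (tau n))" and n: "n \<le> k"
  shows "gain tau beta E n A k = stage_value tau beta n A"
  using n
proof (induction k rule: dec_induct)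
  have sch: "scheme tau beta E" and En: "E n = space M" using opt by (auto simp: optimal_from_def)
  note D = schemeD[OF sch]
  {
    case base
    have "A \<subseteq> space M" using sets.sets_into_space[OF A] by (simp add: space_pre_sigma)
    then have e: "A \<inter> E n = A" "A - E n = {}" using En by blast+
    show ?case unfolding gain_def cost_between_def e by simp
  next
    case (step k)
    note g = gain_step[OF sch pre_sigma_stage(2)[OF sch A order_refl] step(1)]
    have "(\<integral>w. Y (rule_history tau beta k w) (tau (Suc k) w) w * indicator (A \<inter> E k) w \<partial>M) = stage_value tau beta k (A \<inter> E k)"
      using opt step(1) pre_sigma_stage(1)[OF sch A step(1)] unfolding optimal_from_def by blast
    moreover have "(\<integral>w. (Y (rule_history tau beta (Suc k) w) (tau (Suc k) w) w - step_cost tau beta E k w) * indicator (A \<inter> E (Suc k)) w \<partial>M)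
       = (\<integral>w. Y (rule_history tau beta k w) (tau (Suc k) w) w * indicator (A \<inter> E (Suc k)) w \<partial>M)"
    proof (rule integral_cong_AE)
      have "AE w in M. w \<in> E (Suc k) \<longrightarrow> Y (rule_history tau beta k w) (tau (Suc k) w) w =
        Y (rule_history tau beta (Suc k) w) (tau (Suc k) w) w - step_cost tau beta E k w"
        using opt step(1) unfolding optimal_from_def by blast
      then show "AE w in M. (Y (rule_history tau beta (Suc k) w) (tau (Suc k) w) w - step_cost tau beta E k w) * indicator (A \<inter> E (Suc k)) w
        = Y (rule_history tau beta k w) (tau (Suc k) w) w * indicator (A \<inter> E (Suc k)) w"
        by eventually_elim (auto simp: indicator_def)
    qed (rule borel_measurable_integrable[OF g(2)] borel_measurable_integrable[OF g(1)])+
    ultimately show ?case using g(3) step(3) by linarith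
  }
qed

text \<open>Constancy of the gain expresses the expected costs through values and payoffs, both
  bounded in L2 uniformly in \<open>k\<close>. Bounded expected costs exclude infinitely many
  interventions. Once \<open>E k\<close> is known to shrink to a null set, the remaining value
  vanishes in the limit, and the costs converge to the payoff minus the value at stage
  \<open>n\<close>.\<close>

theorem optimal_payoff:
  assumes opt: "optimal_from n tau beta E"
  shows "AE w in M. \<exists>k. w \<notin> E k"
    "\<And>A. A \<in> sets (pre_sigma (tau n)) \<Longrightarrow> (\<lambda>k. cost_between tau beta E n k A) \<longlonglongrightarrow>
       (\<integral>w. Psi w (scheme_plan tau beta E w) * indicator A w \<partial>M) - stage_value tau beta n A"
proof -
  have sch: "scheme tau beta E" using opt by (simp add: optimal_from_def)
  note D = schemeD[OF sch]
  let ?p = "trunc_payoff tau beta E" and ?sc = "step_cost tau beta E"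
  define f where "f k w = Y (rule_history tau beta k w) (tau k w) w * indicator (E k) w" for k w
  have "\<exists>Cf<\<infinity>. \<forall>k. (\<integral>\<^sup>+w. ennreal ((Y (rule_history tau beta k w) (tau k w) w)\<^sup>2) * indicator (E k) w \<partial>M) \<le> Cf"
    by (rule scheme_value_bound) (use sch in blast)
  then obtain Cf where Cf: "Cf < \<infinity>" "\<And>k. (\<integral>\<^sup>+w. ennreal ((Y (rule_history tau beta k w) (tau k w) w)\<^sup>2) * indicator (E k) w \<partial>M) \<le> Cf" by blast
  define C where "C = enn2real Cf"
  have C0: "0 \<le> C" by (simp add: C_def)
  have fi: "integrable M (f k)" for k unfolding f_def by (rule scheme_value_integrable[OF sch D(12) _ D(4)]) auto
  have fn: "(\<integral>\<^sup>+w. ennreal ((f k w)\<^sup>2) \<partial>M) \<le> ennreal C" for k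
  proof -
    have "(\<integral>\<^sup>+w. ennreal ((f k w)\<^sup>2) \<partial>M) = (\<integral>\<^sup>+w. ennreal ((Y (rule_history tau beta k w) (tau k w) w)\<^sup>2) * indicator (E k) w \<partial>M)"
      by (intro nn_integral_cong) (auto simp: f_def indicator_def)
    then show ?thesis using Cf by (simp add: C_def)
  qed
  have f2: "integrable M (\<lambda>w. (f k w)\<^sup>2)" for k
    using fi[of k] fn[of k] by (intro integrableI_bounded) (auto intro: le_less_trans)
  have fC: "(\<integral>w. (f k w)\<^sup>2 \<partial>M) \<le> C" for k
    using fn[of k] nn_integral_eq_integral[OF f2[of k]] C0 by simp
  obtain Cp where Cp: "\<And>u. u \<in> controls b0 \<Longrightarrow> integrable M (\<lambda>w. (Psi w (u w))\<^sup>2)"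
    "\<And>u. u \<in> controls b0 \<Longrightarrow> (\<integral>w. (Psi w (u w))\<^sup>2 \<partial>M) \<le> Cp" "0 \<le> Cp" using Psi_L2_bound by blast
  have uk: "scheme_plan (trunc_times k tau) beta (trunc_events k E) \<in> controls b0" for k using trunc_control[OF sch] controls_finite_subset by blast
  have p2: "integrable M (\<lambda>w. (?p k w)\<^sup>2)" "(\<integral>w. (?p k w)\<^sup>2 \<partial>M) \<le> Cp" for k
    using Cp(1,2)[OF uk] by (simp_all add: trunc_payoff_def)
  \<comment> \<open>A crude bound from \<open>\<bar>g\<bar> \<le> 1 + g^2\<close>; it holds for
    every event, so neither \<open>B\<close> nor the stage enters the constant.\<close>
  have bnd: "\<bar>\<integral>w. g w * indicator B w \<partial>M\<bar> \<le> 1 + K"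
    if g: "integrable M g" "integrable M (\<lambda>w. (g w)\<^sup>2)" "(\<integral>w. (g w)\<^sup>2 \<partial>M) \<le> K" and B: "B \<in> sets M" for g :: "'a \<Rightarrow> real" and B K
  proof -
    have "\<bar>g w * indicator B w\<bar> \<le> 1 + (g w)\<^sup>2" for w
    proof -
      have "0 \<le> (\<bar>g w\<bar> - 1)\<^sup>2" by simp
      then have "2 * \<bar>g w\<bar> \<le> 1 + (g w)\<^sup>2" by (simp add: power2_diff)
      then show ?thesis by (auto simp: indicator_def)
    qed
    moreover have i: "integrable M (\<lambda>w. g w * indicator B w)" by (rule integrable_real_mult_indicator[OF B g(1)])
    ultimately have "\<bar>\<integral>w. g w * indicator B w \<partial>M\<bar> \<le> (\<integral>w. 1 + (g w)\<^sup>2 \<partial>M)"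
      using g(2) by (intro order.trans[OF integral_abs_bound] integral_mono integrable_abs) auto
    also have "\<dots> = 1 + (\<integral>w. (g w)\<^sup>2 \<partial>M)" using g(2) by (subst Bochner_Integration.integral_add) (auto simp: prob_space)
    finally show ?thesis using g(3) by linarith
  qed
  have sv: "stage_value tau beta k (A \<inter> E k) = (\<integral>w. f k w * indicator A w \<partial>M)" for k A
    unfolding stage_value_def f_def by (intro Bochner_Integration.integral_cong refl) (auto simp: indicator_def)
  have cost: "cost_between tau beta E n k A = (\<integral>w. f k w * indicator A w \<partial>M) + (\<integral>w. ?p k w * indicator (A - E k) w \<partial>M) - stage_value tau beta n A"
    if "A \<in> sets (pre_sigma (tau n))" "n \<le> k" for k A
    using optimal_gain[OF opt that] by (simp add: gain_def sv)
  \<comment> \<open>The terms \<open>1 + C\<close> and \<open>1 + Cp\<close> bound the remaining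
    value and the payoff; the first \<open>n\<close> costs, which the gain leaves out, are finite
    and added separately.\<close>
  define K where "K = (\<Sum>i<n. \<integral>w. ?sc i w \<partial>M) + (2 + C + Cp + \<bar>stage_value tau beta n (space M)\<bar>)"
  have part: "(\<Sum>i<k. \<integral>w. ?sc i w \<partial>M) \<le> K" for k
  proof -
    define k' where "k' = max n k"
    have "(\<Sum>i<k. \<integral>w. ?sc i w \<partial>M) \<le> (\<Sum>i<k'. \<integral>w. ?sc i w \<partial>M)" using expected_plan_cost(2)[OF sch] by (intro sum_mono2) (auto simp: k'_def)
    also have "\<dots> = (\<Sum>i<n. \<integral>w. ?sc i w \<partial>M) + cost_between tau beta E n k' (space M)"
      using sum.atLeastLessThan_concat[of 0 n k' "\<lambda>i. \<integral>w. ?sc i w \<partial>M"]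
      by (simp add: cost_between_def integral_indicator_space atLeast0LessThan k'_def)
    also have "cost_between tau beta E n k' (space M) \<le> 2 + C + Cp + \<bar>stage_value tau beta n (space M)\<bar>"
    proof -
      have k': "n \<le> k'" by (simp add: k'_def)
      have B: "space M - E k' \<in> sets M" using D(12) by auto
      show ?thesis
        unfolding cost[OF space_in_pre_sigma k']
        using abs_le_D1[OF bnd[OF fi f2 fC sets.top, of k']] abs_le_D1[OF bnd[OF trunc_payoff_integrable[OF sch] p2 B, of k']]
          abs_ge_minus_self[of "stage_value tau beta n (space M)"]
        by linarith
    qed
    finally show ?thesis by (simp add: K_def)
  qed
  have K0: "0 \<le> K" using part[of 0] by simp
  have "(\<integral>\<^sup>+w. (\<Sum>i. ennreal (?sc i w)) \<partial>M) = (\<Sum>i. ennreal (\<integral>w. ?sc i w \<partial>M))"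
    using expected_plan_cost(1)[OF sch] unfolding plan_cost_scheme[OF sch] .
  also have "\<dots> \<le> ennreal K"
    unfolding suminf_eq_SUP using part expected_plan_cost(2)[OF sch] by (intro SUP_least) (simp add: sum_ennreal ennreal_leI)
  finally have "(\<integral>\<^sup>+w. (\<Sum>i. ennreal (?sc i w)) \<partial>M) < \<infinity>" by (rule le_less_trans) simp
  then have "AE w in M. (\<Sum>i. ennreal (?sc i w)) \<noteq> \<infinity>"
    using step_cost_integrable[OF sch] by (intro nn_integral_PInf_AE) auto
  with infinite_scheme_cost[OF sch] show fin: "AE w in M. \<exists>k. w \<notin> E k" by eventually_elim blast
  fix A assume A: "A \<in> sets (pre_sigma (tau n))"
  note AM = pre_sigma_stage(2)[OF sch A order_refl]
  have "decseq E" using D(7) by (intro decseq_SucI)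
  then have E0: "(\<lambda>k. measure M (A \<inter> E k)) \<longlonglongrightarrow> 0"
    using fin D(12) AM by (intro measure_decseq_null) (auto simp: decseq_def elim!: eventually_mono)
  have "(\<lambda>k. \<integral>w. f k w * indicator (A \<inter> E k) w \<partial>M) \<longlonglongrightarrow> 0"
    using AM D(12) by (intro tendsto_L2_bounded_vanishing[OF fi f2 fC _ E0]) auto
  moreover have "(\<integral>w. f k w * indicator (A \<inter> E k) w \<partial>M) = (\<integral>w. f k w * indicator A w \<partial>M)" for k
    by (intro Bochner_Integration.integral_cong refl) (auto simp: f_def indicator_def)
  ultimately have "(\<lambda>k. (\<integral>w. f k w * indicator A w \<partial>M) + (\<integral>w. ?p k w * indicator (A - E k) w \<partial>M) - stage_value tau beta n A)
     \<longlonglongrightarrow> 0 + (\<integral>w. Psi w (scheme_plan tau beta E w) * indicator A w \<partial>M) - stage_value tau beta n A"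
    by (intro tendsto_diff tendsto_add payoff_tendsto(2)[OF sch fin AM] tendsto_const) simp
  then show "(\<lambda>k. cost_between tau beta E n k A) \<longlonglongrightarrow>
       (\<integral>w. Psi w (scheme_plan tau beta E w) * indicator A w \<partial>M) - stage_value tau beta n A"
    unfolding add_0 by (rule Lim_transform_eventually) (use cost[OF A] in \<open>auto intro!: eventually_sequentiallyI[of n]\<close>)
qed

end

section \<open>The switching rule\<close>

context switching_problem
begin

text \<open>Later modes are set to 0, which is not a mode; the cut-off events are empty
  there.\<close>

definition trunc_modes :: "nat \<Rightarrow> (nat \<Rightarrow> 'a \<Rightarrow> nat) \<Rightarrow> nat \<Rightarrow> 'a \<Rightarrow> nat" where
  "trunc_modes k beta j = (if j \<le> k then beta j else (\<lambda>_. 0))"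

text \<open>Being a scheme is expressed for an initial segment by cutting off what follows. The rule
  is built step by step, and measurability of each new time and mode relies on the results for
  schemes, applied to the segment before it.\<close>

definition scheme_upto :: "nat \<Rightarrow> (nat \<Rightarrow> 'a \<Rightarrow> real) \<Rightarrow> (nat \<Rightarrow> 'a \<Rightarrow> nat) \<Rightarrow> (nat \<Rightarrow> 'a set) \<Rightarrow> bool" where
  "scheme_upto k tau beta E \<longleftrightarrow> scheme (trunc_times k tau) (trunc_modes k beta) (trunc_events k E)"

lemma trunc_simps:
  "j \<le> k \<Longrightarrow> trunc_times k tau j = tau j" "k < j \<Longrightarrow> trunc_times k tau j = (\<lambda>_. T)"
  "j \<le> k \<Longrightarrow> trunc_modes k beta j = beta j" "k < j \<Longrightarrow> trunc_modes k beta j = (\<lambda>_. 0)"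
  "j \<le> k \<Longrightarrow> trunc_events k E j = E j" "k < j \<Longrightarrow> trunc_events k E j = {}"
  by (simp_all add: trunc_times_def trunc_modes_def trunc_events_def)

lemma rule_history_trunc: "rule_history (trunc_times k tau) (trunc_modes k beta) k = rule_history tau beta k"
  by (rule ext, unfold rule_history_def, intro map_cong) (auto simp: trunc_simps)

lemma scheme_uptoD:
  assumes S: "scheme_upto k tau beta E"
  shows "\<And>j. j \<le> k \<Longrightarrow> tau j \<in> stopping_times"
    "\<And>j. j \<le> k \<Longrightarrow> beta j \<in> measurable (pre_sigma (tau j)) (count_space UNIV)"
    "\<And>j. j \<le> k \<Longrightarrow> E j \<in> sets (pre_sigma (tau j))"
    "tau 0 = (\<lambda>_. 0)" "beta 0 = (\<lambda>_. b0)" "E 0 = space M"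
    "\<And>j. j < k \<Longrightarrow> E (Suc j) \<subseteq> E j" "\<And>j w. j < k \<Longrightarrow> w \<in> space M \<Longrightarrow> tau j w \<le> tau (Suc j) w"
    "\<And>j w. j < k \<Longrightarrow> w \<in> E (Suc j) \<Longrightarrow> beta (Suc j) w \<in> alternatives m (beta j w)"
    "\<And>j w. j < k \<Longrightarrow> w \<in> space M \<Longrightarrow> w \<notin> E (Suc j) \<Longrightarrow> tau (Suc j) w = T"
    "\<And>w. w \<in> E k \<Longrightarrow> w \<in> space M"
proof -
  note D = schemeD[OF S[unfolded scheme_upto_def]]
  show "tau j \<in> stopping_times" "beta j \<in> measurable (pre_sigma (tau j)) (count_space UNIV)" "E j \<in> sets (pre_sigma (tau j))" if "j \<le> k" for j
    using D(4)[of j] D(5)[of j] D(6)[of j] that by (simp_all add: trunc_simps)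
  show "tau 0 = (\<lambda>_. 0)" "beta 0 = (\<lambda>_. b0)" "E 0 = space M" using D(1-3) by (simp_all add: trunc_simps)
  show "w \<in> space M" if "w \<in> E k" for w using D(11)[of w k] that by (simp add: trunc_simps)
  fix j assume j: "j < k"
  then have j': "j \<le> k" "Suc j \<le> k" by simp_all
  show "E (Suc j) \<subseteq> E j" using D(7)[of j] j' by (simp add: trunc_simps)
  show "tau j w \<le> tau (Suc j) w" if "w \<in> space M" for w using D(8)[OF that, of j] j' by (simp add: trunc_simps)
  show "beta (Suc j) w \<in> alternatives m (beta j w)" if "w \<in> E (Suc j)" for w
    using D(9)[of w j] j' that by (simp add: trunc_simps)
  show "tau (Suc j) w = T" if "w \<in> space M" "w \<notin> E (Suc j)" for w
    using D(10)[OF that(1), of j] j' that by (simp add: trunc_simps)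
qed

lemma scheme_uptoI:
  assumes "\<And>j. j \<le> k \<Longrightarrow> tau j \<in> stopping_times"
    "\<And>j. j \<le> k \<Longrightarrow> beta j \<in> measurable (pre_sigma (tau j)) (count_space UNIV)"
    "\<And>j. j \<le> k \<Longrightarrow> E j \<in> sets (pre_sigma (tau j))"
    "tau 0 = (\<lambda>_. 0)" "beta 0 = (\<lambda>_. b0)" "E 0 = space M"
    "\<And>j. j < k \<Longrightarrow> E (Suc j) \<subseteq> E j" "\<And>j w. j < k \<Longrightarrow> w \<in> space M \<Longrightarrow> tau j w \<le> tau (Suc j) w"
    "\<And>j w. j < k \<Longrightarrow> w \<in> E (Suc j) \<Longrightarrow> beta (Suc j) w \<in> alternatives m (beta j w)"
    "\<And>j w. j < k \<Longrightarrow> w \<in> space M \<Longrightarrow> w \<notin> E (Suc j) \<Longrightarrow> tau (Suc j) w = T"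
  shows "scheme_upto k tau beta E"
  unfolding scheme_upto_def scheme_def
proof (intro conjI allI)
  have Tst: "(\<lambda>_. T) \<in> stopping_times" using T_nonneg by (intro const_stopping_times) auto
  show "trunc_times k tau 0 = (\<lambda>_. 0)" "trunc_modes k beta 0 = (\<lambda>_. b0)" "trunc_events k E 0 = space M"
    using assms(4-6) by (simp_all add: trunc_simps)
  fix j
  have cs: "j < k \<or> j = k \<or> k < j" by linarith
  show "trunc_times k tau j \<in> stopping_times" using cs assms(1)[of j] Tst by (auto simp: trunc_simps)
  show "trunc_modes k beta j \<in> measurable (pre_sigma (trunc_times k tau j)) (count_space UNIV)"
    using cs assms(2)[of j] by (auto simp: trunc_simps)
  show "trunc_events k E j \<in> sets (pre_sigma (trunc_times k tau j))" using cs assms(3)[of j] by (auto simp: trunc_simps)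
  show "trunc_events k E (Suc j) \<subseteq> trunc_events k E j" using cs assms(7)[of j] by (auto simp: trunc_simps)
  show "\<forall>w\<in>space M. trunc_times k tau j w \<le> trunc_times k tau (Suc j) w \<and>
      (w \<in> trunc_events k E (Suc j) \<longrightarrow> trunc_modes k beta (Suc j) w \<in> alternatives m (trunc_modes k beta j w)) \<and>
      (w \<notin> trunc_events k E (Suc j) \<longrightarrow> trunc_times k tau (Suc j) w = T)"
  proof
    fix w assume w: "w \<in> space M"
    from cs consider "j < k" | "j = k" | "k < j" by blast
    then show "trunc_times k tau j w \<le> trunc_times k tau (Suc j) w \<and>
      (w \<in> trunc_events k E (Suc j) \<longrightarrow> trunc_modes k beta (Suc j) w \<in> alternatives m (trunc_modes k beta j w)) \<and>
      (w \<notin> trunc_events k E (Suc j) \<longrightarrow> trunc_times k tau (Suc j) w = T)"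
    proof cases
      case 1
      then show ?thesis using assms(8,10)[OF 1 w] assms(9)[OF 1, of w] by (simp add: trunc_simps)
    next
      case 2
      then show ?thesis using stopping_timesD(3)[OF assms(1) w, of k] by (simp add: trunc_simps)
    qed (simp add: trunc_simps)
  qed
qed

lemma scheme_of_upto:
  assumes S: "\<And>k. n \<le> k \<Longrightarrow> scheme_upto k tau beta E"
  shows "scheme tau beta E"
proof -
  have S': "scheme_upto (max n (Suc j)) tau beta E" for j by (rule S) simp
  note D = scheme_uptoD[OF S']
  have j: "j \<le> max n (Suc j)" "j < max n (Suc j)" for j by simp_all
  show ?thesis
    unfolding scheme_def
    using D(4-6) D(1-3)[OF j(1)] D(7)[OF j(2)] D(8)[OF j(2)] D(9)[OF j(2)] D(10)[OF j(2)] by blast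
qed

lemma scheme_upto_Suc:
  assumes S: "scheme_upto k tau beta E" and t: "tau (Suc k) \<in> stopping_times"
    and b: "beta (Suc k) \<in> measurable (pre_sigma (tau (Suc k))) (count_space UNIV)"
    and E: "E (Suc k) \<in> sets (pre_sigma (tau (Suc k)))" "E (Suc k) \<subseteq> E k"
    and le: "\<And>w. w \<in> space M \<Longrightarrow> tau k w \<le> tau (Suc k) w"
    and alt: "\<And>w. w \<in> E (Suc k) \<Longrightarrow> beta (Suc k) w \<in> alternatives m (beta k w)"
    and off: "\<And>w. w \<in> space M \<Longrightarrow> w \<notin> E (Suc k) \<Longrightarrow> tau (Suc k) w = T"
  shows "scheme_upto (Suc k) tau beta E"
proof (rule scheme_uptoI)
  note D = scheme_uptoD[OF S]
  show "tau 0 = (\<lambda>_. 0)" "beta 0 = (\<lambda>_. b0)" "E 0 = space M" by (rule D)+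
  show "tau j \<in> stopping_times" "beta j \<in> measurable (pre_sigma (tau j)) (count_space UNIV)" "E j \<in> sets (pre_sigma (tau j))" if "j \<le> Suc k" for j
    using D(1-3) t b E(1) that by (auto simp: le_Suc_eq)
  fix j assume "j < Suc k"
  then consider "j < k" | "j = k" by linarith
  note cs = this
  show "E (Suc j) \<subseteq> E j" by (rule cs; use D(7) E(2) in simp)
  show "tau j w \<le> tau (Suc j) w" if "w \<in> space M" for w by (rule cs; use D(8) le that in simp)
  show "beta (Suc j) w \<in> alternatives m (beta j w)" if "w \<in> E (Suc j)" for w
    by (rule cs) (use D(9)[of j w] alt[of w] that in auto)
  show "tau (Suc j) w = T" if "w \<in> space M" "w \<notin> E (Suc j)" for w
    by (rule cs) (use D(10)[of j w] off[of w] that in auto)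
qed

end

context verified_family
begin

text \<open>Within each event of realised modes the value is a progressive process stopped at
  \<open>tau k\<close>. It equals the finite sum over these events almost surely, which suffices by
  completeness.\<close>

lemma stage_value_measurable:
  assumes sch: "scheme tau beta E"
  shows "(\<lambda>w. Y (rule_history tau beta k w) (tau k w) w * indicator (E k) w) \<in> borel_measurable (pre_sigma (tau k))"
proof -
  note st = schemeD(4)[OF sch, of k]
  obtain Z X where me: "\<forall>bs\<in>mode_lists k. mode_envelope tau beta E k bs (Z bs) (X bs)" using scheme_envelopes[OF sch] by blast
  note S = mode_envelopesD(1)[OF me] and e = mode_envelopesD(2)[OF me]
  have "(\<lambda>w. \<Sum>bs\<in>mode_lists k. Z bs (tau k w) w * indicator (mode_event beta E k bs) w) \<in> borel_measurable (pre_sigma (tau k))"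
  proof (rule borel_measurable_sum)
    fix bs assume "bs \<in> mode_lists k"
    then have "progressive (Z bs)" using snell_fromD(2)[OF S] by (simp add: cadlag_process_def)
    then show "(\<lambda>w. Z bs (tau k w) w * indicator (mode_event beta E k bs) w) \<in> borel_measurable (pre_sigma (tau k))"
      by (intro borel_measurable_times progressive_stopped[OF _ st] borel_measurable_indicator mode_event_sets[OF sch])
  qed
  moreover note mode_envelopesD(3)[OF me]
  then have "AE w in M. (\<Sum>bs\<in>mode_lists k. Z bs (tau k w) w * indicator (mode_event beta E k bs) w) = Y (rule_history tau beta k w) (tau k w) w * indicator (E k) w"
    using AE_space
  proof eventually_elim
    case (elim w)
    have t: "tau k w \<in> {tau k w..T}" using stopping_timesD(3)[OF st elim(2)] by simp
    show ?case
    proof (cases "w \<in> E k")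
      case True
      obtain bs where bs: "bs \<in> mode_lists k" "w \<in> mode_event beta E k bs"
        and un: "\<And>bs'. bs' \<in> mode_lists k \<Longrightarrow> w \<in> mode_event beta E k bs' \<Longrightarrow> bs' = bs"
        using mode_event_cover[OF sch True] by blast
      have "(\<Sum>bs'\<in>mode_lists k. Z bs' (tau k w) w * indicator (mode_event beta E k bs') w) = (\<Sum>bs'\<in>mode_lists k. if bs' = bs then Z bs' (tau k w) w else 0)"
      proof (rule sum.cong[OF refl])
        fix bs' assume bs': "bs' \<in> mode_lists k"
        show "Z bs' (tau k w) w * indicator (mode_event beta E k bs') w = (if bs' = bs then Z bs' (tau k w) w else 0)"
          using un[OF bs'] bs(2) by (cases "w \<in> mode_event beta E k bs'") (simp_all, blast)
      qed
      also have "\<dots> = Z bs (tau k w) w" using bs(1) by (simp add: sum.delta[OF finite_mode_lists])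
      also have "\<dots> = Y (rule_history tau beta k w) (tau k w) w" using elim(1) bs t by blast
      finally show ?thesis using True by simp
    qed (simp add: mode_event_def)
  qed
  ultimately show ?thesis by (rule measurable_pre_sigma_AE_cong[OF st]) simp
qed

lemma step_cost_measurable:
  assumes sch: "scheme tau beta E"
  shows "step_cost tau beta E i \<in> borel_measurable (pre_sigma (tau (Suc i)))"
proof -
  note D = schemeD[OF sch]
  let ?N = "pre_sigma (tau (Suc i))"
  have sub: "sets (pre_sigma (tau i)) \<subseteq> sets ?N" using pre_sigma_mono[OF D(4,4) D(8)] .
  have [measurable]: "beta i \<in> measurable ?N (count_space UNIV)"
    by (rule measurable_from_subalg[OF _ D(5)]) (use sub in \<open>simp add: subalgebra_def space_pre_sigma\<close>)
  have [measurable]: "beta (Suc i) \<in> measurable ?N (count_space UNIV)" "E (Suc i) \<in> sets ?N" by (rule D)+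
  define I where "I = (SIGMA b:{1..m}. alternatives m b)"
  have I: "finite I" by (simp add: I_def)
  define G where "G p = {w\<in>space ?N. w \<in> E (Suc i) \<and> beta i w = fst p \<and> beta (Suc i) w = snd p}" for p
  have G: "G p \<in> sets ?N" for p unfolding G_def by measurable
  have "(\<lambda>w. \<Sum>p\<in>I. c (fst p) (snd p) (tau (Suc i) w) w * indicator (G p) w) \<in> borel_measurable ?N"
  proof (rule borel_measurable_sum)
    fix p assume "p \<in> I"
    then have "progressive (c (fst p) (snd p))" by (intro c_progressive) (auto simp: I_def)
    then show "(\<lambda>w. c (fst p) (snd p) (tau (Suc i) w) w * indicator (G p) w) \<in> borel_measurable ?N"
      by (intro borel_measurable_times progressive_stopped[OF _ D(4)] borel_measurable_indicator G)
  qed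
  moreover have "step_cost tau beta E i w = (\<Sum>p\<in>I. c (fst p) (snd p) (tau (Suc i) w) w * indicator (G p) w)" if w: "w \<in> space ?N" for w
  proof (cases "w \<in> E (Suc i)")
    case True
    have "beta i w \<in> {1..m}" using scheme_modes[OF sch] D(7) True by blast
    then have p: "(beta i w, beta (Suc i) w) \<in> I" using D(9)[OF True] by (simp add: I_def)
    have "(\<Sum>p\<in>I. c (fst p) (snd p) (tau (Suc i) w) w * indicator (G p) w) =
      (\<Sum>p\<in>I. if p = (beta i w, beta (Suc i) w) then c (fst p) (snd p) (tau (Suc i) w) w else 0)"
      using True w by (intro sum.cong refl) (auto simp: G_def indicator_def prod_eq_iff)
    also have "\<dots> = c (beta i w) (beta (Suc i) w) (tau (Suc i) w) w"
      using p by (simp add: sum.delta[OF I])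
    finally show ?thesis using True by (simp add: step_cost_def)
  qed (simp add: step_cost_def G_def)
  ultimately show ?thesis by (subst measurable_cong)
qed

text \<open>Switching to the fixed mode \<open>b'\<close> is a hypothetical continuation of the
  scheme, so the switch value is a stage value minus a step cost of an extended scheme and inherits
  their measurability.\<close>

lemma switch_value_measurable:
  assumes S: "scheme_upto k tau beta E" and t: "tau (Suc k) \<in> stopping_times"
    and E: "E (Suc k) \<in> sets (pre_sigma (tau (Suc k)))" "E (Suc k) \<subseteq> E k"
    and le: "\<And>w. w \<in> space M \<Longrightarrow> tau k w \<le> tau (Suc k) w"
    and off: "\<And>w. w \<in> space M \<Longrightarrow> w \<notin> E (Suc k) \<Longrightarrow> tau (Suc k) w = T"
    and b': "b' \<in> {1..m}"
  shows "\<exists>g\<in>borel_measurable (pre_sigma (tau (Suc k))). \<forall>w\<in>E (Suc k). b' \<noteq> beta k w \<longrightarrow>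
     switch_value Y (rule_history tau beta k w) (tau (Suc k) w) w b' = g w"
proof -
  note D = scheme_uptoD[OF S]
  \<comment> \<open>Switching to the current mode is forbidden, so where \<open>b'\<close> is the
    current mode some other mode replaces it. The extension is then a scheme everywhere, while the
    claim concerns only points where \<open>b'\<close> is allowed.\<close>
  define \<pi> where "\<pi> b = (if b' \<noteq> b then b' else (SOME b''. b'' \<in> alternatives m b))" for b
  have \<pi>: "\<pi> b \<in> alternatives m b" for b
  proof (cases "b' = b")
    case True
    have "\<exists>x. x \<in> alternatives m b" by (rule ex_in_conv[THEN iffD2, OF alternatives_nonempty])
    then show ?thesis unfolding \<pi>_def using True by (simp only: if_False simp_thms) (rule someI_ex)
  qed (use b' in \<open>simp add: \<pi>_def\<close>)
  define beta' where "beta' = beta(Suc k := \<lambda>w. \<pi> (beta k w))"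
  have bk: "beta k \<in> measurable (pre_sigma (tau (Suc k))) (count_space UNIV)"
    by (rule measurable_from_subalg[OF _ D(2)[OF order_refl]])
      (use pre_sigma_mono[OF D(1)[OF order_refl] t le] in \<open>simp add: subalgebra_def space_pre_sigma\<close>)
  have "trunc_modes k beta' = trunc_modes k beta" by (auto simp: trunc_modes_def beta'_def)
  then have "scheme_upto k tau beta' E" using S by (simp add: scheme_upto_def)
  then have "scheme_upto (Suc k) tau beta' E"
  proof (rule scheme_upto_Suc[OF _ t _ E le _ off])
    show "beta' (Suc k) \<in> measurable (pre_sigma (tau (Suc k))) (count_space UNIV)"
      using measurable_compose[OF bk, of \<pi> "count_space UNIV"] by (simp add: beta'_def)
    show "beta' (Suc k) w \<in> alternatives m (beta' k w)" for w using \<pi> by (simp add: beta'_def)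
  qed
  then have sch: "scheme (trunc_times (Suc k) tau) (trunc_modes (Suc k) beta') (trunc_events (Suc k) E)" by (simp add: scheme_upto_def)
  define g where "g w = Y (rule_history tau beta' (Suc k) w) (tau (Suc k) w) w * indicator (E (Suc k)) w
      - step_cost (trunc_times (Suc k) tau) (trunc_modes (Suc k) beta') (trunc_events (Suc k) E) k w" for w
  show ?thesis
  proof (rule bexI[of _ g], intro ballI impI)
    show "g \<in> borel_measurable (pre_sigma (tau (Suc k)))"
      unfolding g_def using stage_value_measurable[OF sch, of "Suc k"] step_cost_measurable[OF sch, of k]
      by (intro borel_measurable_diff) (simp_all add: trunc_simps rule_history_trunc)
    fix w assume w: "w \<in> E (Suc k)" "b' \<noteq> beta k w"
    have wk: "w \<in> trunc_events k E k" using w(1) E(2) by (auto simp: trunc_simps)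
    have lm: "last_mode (rule_history tau beta k w) = beta k w"
      using scheme_history(3)[OF S[unfolded scheme_upto_def] wk] by (simp add: rule_history_trunc trunc_simps)
    have h: "rule_history tau beta' k w = rule_history tau beta k w"
      by (auto simp: rule_history_def beta'_def)
    show "switch_value Y (rule_history tau beta k w) (tau (Suc k) w) w b' = g w"
      using w by (simp add: g_def switch_value_def lm step_cost_def trunc_simps rule_history_Suc h) (simp add: beta'_def \<pi>_def)
  qed
qed

text \<open>The rule continued after \<open>n\<close> prescribed interventions, stated pointwise;
  that its times are stopping times and its events measurable is derived by induction from the
  segment before. Reaching \<open>T\<close> counts as no intervention.\<close>

definition rule_from where
  "rule_from n tau beta E \<longleftrightarrow> (\<forall>k\<ge>n. E (Suc k) = {w\<in>space M. tau (Suc k) w < T} \<and> (\<forall>w\<in>space M.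
     (w \<in> E k \<longrightarrow> tau (Suc k) w = Inf (insert T {s\<in>{tau k w..T}. Y (rule_history tau beta k w) s w = best_switch_value Y (rule_history tau beta k w) s w})) \<and>
     (w \<notin> E k \<longrightarrow> tau (Suc k) w = T) \<and>
     (w \<in> E (Suc k) \<longrightarrow> is_arg_max (switch_value Y (rule_history tau beta k w) (tau (Suc k) w) w)
        (\<lambda>b. b \<in> alternatives m (last_mode (rule_history tau beta k w))) (beta (Suc k) w))))"

lemma rule_fromD:
  assumes R: "rule_from n tau beta E" and k: "n \<le> k"
  shows "E (Suc k) = {w\<in>space M. tau (Suc k) w < T}"
    "\<And>w. w \<in> space M \<Longrightarrow> w \<in> E k \<Longrightarrow> tau (Suc k) w = Inf (insert T {s\<in>{tau k w..T}. Y (rule_history tau beta k w) s w = best_switch_value Y (rule_history tau beta k w) s w})"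
    "\<And>w. w \<in> space M \<Longrightarrow> w \<notin> E k \<Longrightarrow> tau (Suc k) w = T"
    "\<And>w. w \<in> space M \<Longrightarrow> w \<in> E (Suc k) \<Longrightarrow> is_arg_max (switch_value Y (rule_history tau beta k w) (tau (Suc k) w) w)
        (\<lambda>b. b \<in> alternatives m (last_mode (rule_history tau beta k w))) (beta (Suc k) w)"
  using R k unfolding rule_from_def by blast+

lemma rule_step:
  assumes S: "scheme_upto k tau beta E" and R: "rule_from n tau beta E" and k: "n \<le> k"
  shows "tau (Suc k) \<in> stopping_times" "E (Suc k) \<in> sets (pre_sigma (tau (Suc k)))" "E (Suc k) \<subseteq> E k"
    "\<And>w. w \<in> space M \<Longrightarrow> tau k w \<le> tau (Suc k) w"
    "\<And>w. w \<in> space M \<Longrightarrow> w \<notin> E (Suc k) \<Longrightarrow> tau (Suc k) w = T"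
    "\<And>w. w \<in> E k \<Longrightarrow> last_mode (rule_history tau beta k w) = beta k w"
proof -
  note D = scheme_uptoD[OF S] and Rk = rule_fromD[OF R k]
  have sch: "scheme (trunc_times k tau) (trunc_modes k beta) (trunc_events k E)" using S by (simp add: scheme_upto_def)
  have tT: "tau k w \<le> T" if "w \<in> space M" for w using stopping_timesD(3)[OF D(1)[OF order_refl] that] .
  show "last_mode (rule_history tau beta k w) = beta k w" if "w \<in> E k" for w
    using scheme_history(3)[OF sch, of w k] that by (simp add: rule_history_trunc trunc_simps)
  show t: "tau (Suc k) \<in> stopping_times"
    by (rule scheme_hitting(1)[OF sch, of k])
      (use Rk(2,3) D(11) in \<open>auto simp: trunc_simps rule_history_trunc\<close>)
  show le: "tau k w \<le> tau (Suc k) w" if w: "w \<in> space M" for w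
  proof (cases "w \<in> E k")
    case True
    show ?thesis unfolding Rk(2)[OF w True] using tT[OF w] by (intro cInf_greatest) auto
  qed (use Rk(3)[OF w] tT[OF w] in simp)
  show "E (Suc k) \<in> sets (pre_sigma (tau (Suc k)))"
    unfolding sets_pre_sigma'[OF t]
  proof (intro CollectI allI)
    fix s
    have "{w\<in>space M. tau (Suc k) w < T} \<in> sets (F T)"
    proof -
      have "{w\<in>space M. tau (Suc k) w < T} = (\<Union>i. {w\<in>space M. tau (Suc k) w \<le> T - 1 / Suc i})"
      proof (intro set_eqI iffI)
        fix w assume w: "w \<in> {w\<in>space M. tau (Suc k) w < T}"
        then obtain i where "1 / Suc i < T - tau (Suc k) w" using nat_approx_posE[of "T - tau (Suc k) w"] by auto
        then have "tau (Suc k) w \<le> T - 1 / Suc i" by simp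
        then show "w \<in> (\<Union>i. {w\<in>space M. tau (Suc k) w \<le> T - 1 / Suc i})" using w by blast
      next
        fix w assume "w \<in> (\<Union>i. {w\<in>space M. tau (Suc k) w \<le> T - 1 / Suc i})"
        then obtain i where w: "w \<in> space M" "tau (Suc k) w \<le> T - 1 / Suc i" by blast
        have "0 < 1 / real (Suc i)" by simp
        then have "tau (Suc k) w < T" using w(2) by linarith
        then show "w \<in> {w\<in>space M. tau (Suc k) w < T}" using w(1) by simp
      qed
      moreover have "{w\<in>space M. tau (Suc k) w \<le> T - 1 / Suc i} \<in> sets (F T)" for i
        using stopping_timesD(4)[OF t, of "T - 1 / Suc i"] sets_F_mono[of "T - 1 / Suc i" T] by auto
      ultimately show ?thesis by auto
    qed
    then show "{w\<in>E (Suc k). tau (Suc k) w \<le> s} \<in> sets (F s)"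
    proof (cases "s < T")
      case True
      then have "{w\<in>E (Suc k). tau (Suc k) w \<le> s} = {w\<in>space M. tau (Suc k) w \<le> s}" by (auto simp: Rk(1))
      then show ?thesis using stopping_timesD(4)[OF t] by simp
    next
      case False
      then have "{w\<in>E (Suc k). tau (Suc k) w \<le> s} = {w\<in>space M. tau (Suc k) w < T}" by (auto simp: Rk(1))
      moreover have "sets (F T) \<subseteq> sets (F s)" using False by (intro sets_F_mono) simp
      ultimately show ?thesis using \<open>{w\<in>space M. tau (Suc k) w < T} \<in> sets (F T)\<close> by auto
    qed
  qed
  show "E (Suc k) \<subseteq> E k" using Rk(1,3) by force
  show "tau (Suc k) w = T" if "w \<in> space M" "w \<notin> E (Suc k)" for w
    using that stopping_timesD(3)[OF t that(1)] by (simp add: Rk(1))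
qed

text \<open>A hitting time of the envelope loses nothing by waiting, and a maximising mode loses
  nothing by the choice. Measurability of the next mode is requested only for segments already known
  to be schemes, which is the form in which it can be proved for a constructed rule.\<close>

theorem rule_optimal:
  assumes S: "scheme_upto n tau beta E" and En: "E n = space M" and R: "rule_from n tau beta E"
    and meas: "\<And>k. n \<le> k \<Longrightarrow> scheme_upto k tau beta E \<Longrightarrow> beta (Suc k) \<in> measurable (pre_sigma (tau (Suc k))) (count_space UNIV)"
  shows "optimal_from n tau beta E"
proof -
  have U: "scheme_upto k tau beta E" if "n \<le> k" for k
    using that
  proof (induction k rule: dec_induct)
    case (step k)
    note r = rule_step[OF step(3) R step(1)] and Rk = rule_fromD[OF R step(1)]
    show ?case
    proof (rule scheme_upto_Suc[OF step(3) r(1) meas[OF step(1,3)] r(2-4) _ r(5)])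
      fix w assume w: "w \<in> E (Suc k)"
      then have "w \<in> space M" "w \<in> E k" using Rk(1) r(3) by auto
      then show "beta (Suc k) w \<in> alternatives m (beta k w)"
        using Rk(4)[OF _ w] r(6)[of w] by (simp add: is_arg_max_def)
    qed
  qed (rule S)
  then have sch: "scheme tau beta E" by (rule scheme_of_upto)
  note D = schemeD[OF sch]
  have "(\<integral>w. Y (rule_history tau beta k w) (tau (Suc k) w) w * indicator B w \<partial>M) = stage_value tau beta k B"
    if "n \<le> k" "B \<in> sets (pre_sigma (tau k))" "B \<subseteq> E k" for k B
    unfolding stage_value_def
    by (rule scheme_hitting(3)[OF sch rule_fromD(2)[OF R that(1) D(11)] rule_fromD(3)[OF R that(1)] that(2,3)])
  moreover have "AE w in M. w \<in> E (Suc k) \<longrightarrow> Y (rule_history tau beta k w) (tau (Suc k) w) w =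
      Y (rule_history tau beta (Suc k) w) (tau (Suc k) w) w - step_cost tau beta E k w" if k: "n \<le> k" for k
  proof -
    note Rk = rule_fromD[OF R k]
    have "AE w in M. w \<in> E k \<and> tau (Suc k) w < T \<longrightarrow> Y (rule_history tau beta k w) (tau (Suc k) w) w = best_switch_value Y (rule_history tau beta k w) (tau (Suc k) w) w"
      by (rule scheme_hitting(2)[OF sch Rk(2)[OF D(11)] Rk(3)])
    then show ?thesis
      using AE_space
    proof eventually_elim
      case (elim w)
      show ?case
      proof
        assume w: "w \<in> E (Suc k)"
        then have wk: "w \<in> E k" "tau (Suc k) w < T" using D(7) Rk(1) by blast+
        let ?H = "rule_history tau beta k w"
        have am: "is_arg_max (switch_value Y ?H (tau (Suc k) w) w) (\<lambda>b. b \<in> alternatives m (last_mode ?H)) (beta (Suc k) w)"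
          by (rule Rk(4)[OF elim(2) w])
        have "best_switch_value Y ?H (tau (Suc k) w) w = switch_value Y ?H (tau (Suc k) w) w (beta (Suc k) w)"
          unfolding best_switch_value_def using am by (intro Max_eqI) (auto simp: is_arg_max_linorder)
        then show "Y ?H (tau (Suc k) w) w = Y (rule_history tau beta (Suc k) w) (tau (Suc k) w) w - step_cost tau beta E k w"
          using elim(1) wk w by (simp add: switch_value_def step_cost_def rule_history_Suc scheme_history(3)[OF sch])
      qed
    qed
  qed
  ultimately show ?thesis unfolding optimal_from_def using sch En by blast
qed

end

lemma Inf_insert_trivial: "(T :: real) \<le> t \<Longrightarrow> Inf (insert T {s\<in>{t..T}. P s}) = T"
proof -
  assume "T \<le> t"
  then have "insert T {s\<in>{t..T}. P s} = {T}" by auto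
  then show ?thesis by (simp only: cInf_singleton)
qed

lemma ex_is_arg_max:
  fixes f :: "'b \<Rightarrow> real"
  assumes "finite A" "A \<noteq> {}" shows "\<exists>x. is_arg_max f (\<lambda>x. x \<in> A) x"
proof -
  have "Max (f ` A) \<in> f ` A" using assms by (intro Max_in) auto
  then obtain x where x: "x \<in> A" "f x = Max (f ` A)" by auto
  have "f y \<le> f x" if "y \<in> A" for y unfolding x(2) using assms(1) that by (intro Max_ge) auto
  then show ?thesis using x(1) by (auto simp: is_arg_max_linorder)
qed

context usual_basis
begin

lemma AE_le_of_set_integrals:
  assumes G: "subalgebra M G" and f: "integrable M f" "f \<in> borel_measurable G" and g: "integrable M g" "g \<in> borel_measurable G"
    and le: "\<And>A. A \<in> sets G \<Longrightarrow> (\<integral>w. f w * indicator A w \<partial>M) \<le> (\<integral>w. g w * indicator A w \<partial>M)"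
  shows "AE w in M. f w \<le> (g w :: real)"
proof -
  let ?A = "{w\<in>space G. g w < f w}"
  have A: "?A \<in> sets G" using f(2) g(2) by measurable
  then have AM: "?A \<in> sets M" and sp: "space G = space M" using G by (auto simp: subalgebra_def)
  have i: "integrable M (\<lambda>w. (f w - g w) * indicator ?A w)"
    by (rule integrable_real_mult_indicator[OF AM Bochner_Integration.integrable_diff[OF f(1) g(1)]])
  have nn: "AE w in M. 0 \<le> (f w - g w) * indicator ?A w" by (auto simp: indicator_def)
  have "(\<integral>w. (f w - g w) * indicator ?A w \<partial>M) = (\<integral>w. f w * indicator ?A w \<partial>M) - (\<integral>w. g w * indicator ?A w \<partial>M)"
    unfolding left_diff_distrib
    by (rule Bochner_Integration.integral_diff[OF integrable_real_mult_indicator[OF AM f(1)] integrable_real_mult_indicator[OF AM g(1)]])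
  also have "\<dots> \<le> 0" using le[OF A] by simp
  finally have "(\<integral>w. (f w - g w) * indicator ?A w \<partial>M) = 0" using integral_nonneg_AE[OF nn] by linarith
  then have "AE w in M. (f w - g w) * indicator ?A w = 0" using integral_nonneg_eq_0_iff_AE[OF i nn] by simp
  then show ?thesis using AE_space
  proof eventually_elim
    case (elim w)
    show ?case
    proof (rule ccontr)
      assume "\<not> f w \<le> g w"
      then have "w \<in> ?A" using elim(2) sp by simp
      then show False using elim(1) \<open>\<not> f w \<le> g w\<close> by simp
    qed
  qed
qed

end

context switching_problem
begin

section \<open>Controls as schemes\<close>

lemma rule_history_cong: "(\<And>j. 0 < j \<Longrightarrow> j \<le> k \<Longrightarrow> tau j w = tau' j w \<and> beta j w = beta' j w) \<Longrightarrow>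
    rule_history tau beta k w = rule_history tau' beta' k w"
  unfolding rule_history_def by (intro map_cong) auto

lemma last_rule_history:
  "tau 0 = (\<lambda>_. 0) \<Longrightarrow> last_time (rule_history tau beta k w) = tau k w"
  "beta 0 = (\<lambda>_. b0) \<Longrightarrow> last_mode (rule_history tau beta k w) = beta k w"
  by (cases k; simp add: rule_history_0 rule_history_Suc last_time_def last_mode_def)+

text \<open>Controls are total functions of which only the values on \<open>space M\<close> matter;
  plans obtained from a rule and from a scheme are identified only there.\<close>

lemma controls_cong:
  assumes u: "u \<in> controls b" and uv: "\<And>w. w \<in> space M \<Longrightarrow> v w = u w"
  shows "v \<in> controls b"
  unfolding controls_def
proof (intro CollectI conjI allI ballI)
  note C = controlsD[OF u]
  show "v w \<in> plans T m b" if "w \<in> space M" for w using C(1) uv that by simp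
  have it: "intervention_time v i w = intervention_time u i w" if "w \<in> space M" for i w using uv[OF that] by (simp add: intervention_time_def)
  fix i
  show st: "intervention_time v i \<in> stopping_times"
    by (rule stopping_times_AE_cong[OF C(2)[of i]]) (use it stopping_timesD(2,3)[OF C(2), of _ i] in auto)
  have sets_eq: "sets (pre_sigma (intervention_time v i)) = sets (pre_sigma (intervention_time u i))"
    using pre_sigma_mono[OF st C(2)] pre_sigma_mono[OF C(2) st] it by (intro antisym) auto
  have "intervention_mode v i \<in> measurable (pre_sigma (intervention_time v i)) (count_space UNIV) \<longleftrightarrow> intervention_mode u i \<in> measurable (pre_sigma (intervention_time v i)) (count_space UNIV)"
    by (rule measurable_cong) (simp add: space_pre_sigma intervention_mode_def uv)
  then show "intervention_mode v i \<in> measurable (pre_sigma (intervention_time v i)) (count_space UNIV)"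
    using C(3)[of i] by (simp only: measurable_cong_sets[OF sets_eq refl])
next
  show "AE w in M. (\<lambda>i. intervention_time v i w) \<longlonglongrightarrow> T"
    using controlsD(4)[OF u] AE_space by eventually_elim (simp add: intervention_time_def uv)
qed

lemma J_cong: "(\<And>w. w \<in> space M \<Longrightarrow> v w = u w) \<Longrightarrow> J v = J u"
  unfolding J_def by (intro arg_cong2[where f="(-)"] arg_cong[where f=ereal] arg_cong[where f=enn2ereal] Bochner_Integration.integral_cong nn_integral_cong refl) simp_all

text \<open>Brings arbitrary controls, also those with infinitely many interventions, into the form
  to which the gain estimates apply.\<close>

lemma control_scheme:
  assumes u: "u \<in> controls b0"
  shows "\<exists>tau beta E. scheme tau beta E \<and> (\<forall>w\<in>space M. scheme_plan tau beta E w = u w)"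
proof -
  note C = controlsD[OF u]
  define tau where "tau j = (case j of 0 \<Rightarrow> (\<lambda>_. 0) | Suc i \<Rightarrow> intervention_time u i)" for j
  \<comment> \<open>Missing interventions get the dummy mode 0; a scheme constrains the range of its
    modes only on the events \<open>E\<close>.\<close>
  define md where "md x = (case x of None \<Rightarrow> 0 | Some b \<Rightarrow> b)" for x :: "nat option"
  define beta where "beta j = (case j of 0 \<Rightarrow> (\<lambda>_. b0) | Suc i \<Rightarrow> (\<lambda>w. md (intervention_mode u i w)))" for j
  define E where "E j = (case j of 0 \<Rightarrow> space M | Suc i \<Rightarrow> {w\<in>space M. u w i \<noteq> None})" for j
  have some: "t \<in> {0..T} \<and> b' \<in> alternatives m (prev_mode b0 (u w) i) \<and> (\<forall>k<i. u w k \<noteq> None \<and> fst (the (u w k)) \<le> t)"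
    if "w \<in> space M" "u w i = Some (t, b')" for w i t b'
  proof -
    have "case u w i of None \<Rightarrow> u w (Suc i) = None
     | Some (t, b') \<Rightarrow> t \<in> {0..T} \<and> b' \<in> alternatives m (prev_mode b0 (u w) i) \<and> (\<forall>k<i. u w k \<noteq> None \<and> fst (the (u w k)) \<le> t)"
      using C(1)[OF that(1)] unfolding plans_def by blast
    then show ?thesis unfolding that(2) option.case prod.case .
  qed
  have "scheme tau beta E"
    unfolding scheme_def
  proof (intro conjI allI)
    show "tau 0 = (\<lambda>_. 0)" "beta 0 = (\<lambda>_. b0)" "E 0 = space M" by (simp_all add: tau_def beta_def E_def)
    fix j
    show st: "tau j \<in> stopping_times" using C(2) const_stopping_times[of 0] T_nonneg by (cases j) (simp_all add: tau_def)
    show "beta j \<in> measurable (pre_sigma (tau j)) (count_space UNIV)"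
      using measurable_compose[OF C(3), of md "count_space UNIV"] by (cases j) (simp_all add: tau_def beta_def)
    show "E j \<in> sets (pre_sigma (tau j))"
    proof (cases j)
      case (Suc i)
      have "intervention_mode u i -` {None} \<inter> space (pre_sigma (intervention_time u i)) \<in> sets (pre_sigma (intervention_time u i))"
        by (rule measurable_sets[OF C(3)]) simp
      note c = sets.compl_sets[OF this]
      have "E j = space (pre_sigma (intervention_time u i)) - intervention_mode u i -` {None} \<inter> space (pre_sigma (intervention_time u i))"
        by (auto simp: Suc E_def space_pre_sigma intervention_mode_def)
      moreover have "tau j = intervention_time u i" by (simp add: Suc tau_def)
      ultimately show ?thesis using c by (simp only:)
    qed (simp add: E_def space_in_pre_sigma)
    show "E (Suc j) \<subseteq> E j"
    proof (cases j)
      case (Suc i)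
      have "u w i \<noteq> None" if "w \<in> space M" "u w (Suc i) \<noteq> None" for w
        using plans_None_mono[OF C(1)[OF that(1)], of i "Suc i"] that(2) by fastforce
      then show ?thesis unfolding Suc E_def nat.case by blast
    qed (auto simp: E_def)
    show "\<forall>w\<in>space M. tau j w \<le> tau (Suc j) w \<and> (w \<in> E (Suc j) \<longrightarrow> beta (Suc j) w \<in> alternatives m (beta j w)) \<and>
             (w \<notin> E (Suc j) \<longrightarrow> tau (Suc j) w = T)"
    proof
      fix w assume w: "w \<in> space M"
      show "tau j w \<le> tau (Suc j) w \<and> (w \<in> E (Suc j) \<longrightarrow> beta (Suc j) w \<in> alternatives m (beta j w)) \<and>
             (w \<notin> E (Suc j) \<longrightarrow> tau (Suc j) w = T)"
      proof (cases "u w j")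
        case None
        then show ?thesis using stopping_timesD(3)[OF st w] by (simp add: tau_def E_def intervention_time_def)
      next
        case (Some p)
        obtain t b where p: "p = (t, b)" by (cases p)
        note s = some[OF w Some[unfolded p]]
        show ?thesis
        proof (cases j)
          case 0
          then show ?thesis using s Some w by (simp add: p tau_def E_def beta_def md_def intervention_time_def intervention_mode_def prev_mode_def)
        next
          case (Suc i)
          then obtain t' b' where q: "u w i = Some (t', b')" using s by auto
          have "t' \<le> t" using s Suc q by auto
          then show ?thesis using s Some w q Suc by (simp add: p tau_def E_def beta_def md_def intervention_time_def intervention_mode_def prev_mode_def)
        qed
      qed
    qed
  qed
  moreover have "scheme_plan tau beta E w = u w" if "w \<in> space M" for w
  proof
    fix i show "scheme_plan tau beta E w i = u w i"
      using that by (cases "u w i") (auto simp: scheme_plan_def tau_def beta_def E_def md_def intervention_time_def intervention_mode_def)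
  qed
  ultimately show ?thesis by blast
qed

end

context verified_family
begin

text \<open>Time and mode of the next intervention are functions of the history so far, so the rule
  is an iteration on histories, carried out pathwise. That it consists of stopping times and
  measurable modes is shown afterwards.\<close>

lemma rule_extension:
  assumes S: "scheme_upto n tau0 beta0 E0" and En: "E0 n = space M"
  shows "\<exists>tau beta E. (\<forall>j\<le>n. tau j = tau0 j \<and> beta j = beta0 j) \<and> rule_from n tau beta E \<and> optimal_from n tau beta E \<and> (\<forall>j>n. E j = {w\<in>space M. tau j w < T})"
proof -
  \<comment> \<open>Taking the least maximiser is the measurable selection; 0 stands in when there
    is no intervention before \<open>T\<close>.\<close>
  define nxt where "nxt w h = (let t = Inf (insert T {s\<in>{last_time h..T}. Y h s w = best_switch_value Y h s w}) in
     (t, if t < T then LEAST b. is_arg_max (switch_value Y h t w) (\<lambda>b. b \<in> alternatives m (last_mode h)) b else 0))" for w h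
  define S' where "S' k w = ((\<lambda>h. h @ [nxt w h]) ^^ k) (rule_history tau0 beta0 n w)" for k w
  define tau where "tau j = (if j \<le> n then tau0 j else (\<lambda>w. fst (last (S' (j - n) w))))" for j
  define beta where "beta j = (if j \<le> n then beta0 j else (\<lambda>w. snd (last (S' (j - n) w))))" for j
  define E where "E j = (if j \<le> n then E0 j else {w\<in>space M. tau j w < T})" for j
  have S'_Suc: "S' (Suc k) w = S' k w @ [nxt w (S' k w)]" for k w by (simp add: S'_def)
  have hist': "rule_history tau beta (n + k) w = S' k w" for k w
  proof (induction k)
    case 0
    show ?case by (auto simp: S'_def tau_def beta_def intro!: rule_history_cong)
  next
    case (Suc k)
    then show ?case by (simp add: rule_history_Suc S'_Suc tau_def beta_def Suc_diff_le)
  qed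
  have hist: "rule_history tau beta k w = S' (k - n) w" if "n \<le> k" for k w using hist'[of "k - n"] that by simp
  have nx: "(tau (Suc k) w, beta (Suc k) w) = nxt w (rule_history tau beta k w)" if "n \<le> k" for k w
    using that by (simp add: tau_def beta_def hist[OF that] Suc_diff_le S'_Suc)
  note D = scheme_uptoD[OF S]
  have 0: "tau 0 = (\<lambda>_. 0)" "beta 0 = (\<lambda>_. b0)" using D(4,5) by (simp_all add: tau_def beta_def)
  have next_time: "tau (Suc k) w = Inf (insert T {s\<in>{tau k w..T}. Y (rule_history tau beta k w) s w = best_switch_value Y (rule_history tau beta k w) s w})"
    if "n \<le> k" for k w
    using arg_cong[OF nx[OF that, of w], of fst] by (simp add: nxt_def Let_def last_rule_history(1)[where tau=tau, OF 0(1)])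
  have next_mode: "beta (Suc k) w = (if tau (Suc k) w < T then LEAST b. is_arg_max (switch_value Y (rule_history tau beta k w) (tau (Suc k) w) w) (\<lambda>b. b \<in> alternatives m (beta k w)) b else 0)"
    if "n \<le> k" for k w
    using arg_cong[OF nx[OF that, of w], of snd] arg_cong[OF nx[OF that, of w], of fst]
    by (simp add: nxt_def Let_def last_rule_history(2)[where beta=beta, OF 0(2)])
  have Suc_E: "E (Suc k) = {w\<in>space M. tau (Suc k) w < T}" if "n \<le> k" for k using that by (simp add: E_def)
  have R: "rule_from n tau beta E"
    unfolding rule_from_def
  proof (intro allI impI conjI ballI)
    fix k assume k: "n \<le> k"
    show "E (Suc k) = {w\<in>space M. tau (Suc k) w < T}" by (rule Suc_E[OF k])
    fix w assume w: "w \<in> space M"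
    show "tau (Suc k) w = Inf (insert T {s\<in>{tau k w..T}. Y (rule_history tau beta k w) s w = best_switch_value Y (rule_history tau beta k w) s w})" by (rule next_time[OF k])
    show "tau (Suc k) w = T" if "w \<notin> E k"
    proof -
      \<comment> \<open>Intervention number \<open>n\<close> takes place everywhere, so a missing
        one has a larger index and its time already equals \<open>T\<close>.\<close>
      have "\<not> k \<le> n" using that En w k by (auto simp: E_def)
      then have "T \<le> tau k w" using that w by (simp add: E_def)
      then show ?thesis unfolding next_time[OF k] by (rule Inf_insert_trivial)
    qed
    show "is_arg_max (switch_value Y (rule_history tau beta k w) (tau (Suc k) w) w)
        (\<lambda>b. b \<in> alternatives m (last_mode (rule_history tau beta k w))) (beta (Suc k) w)" if "w \<in> E (Suc k)"
    proof -
      have "tau (Suc k) w < T" using that Suc_E[OF k] by simp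
      then have b: "beta (Suc k) w = (LEAST b. is_arg_max (switch_value Y (rule_history tau beta k w) (tau (Suc k) w) w) (\<lambda>b. b \<in> alternatives m (beta k w)) b)"
        using next_mode[OF k, of w] by simp
      show ?thesis
        unfolding last_rule_history(2)[where beta=beta, OF 0(2)] b
        by (rule LeastI_ex, rule ex_is_arg_max) (use alternatives_nonempty in auto)
    qed
  qed
  have meas: "beta (Suc k) \<in> measurable (pre_sigma (tau (Suc k))) (count_space UNIV)" if k: "n \<le> k" and Sk: "scheme_upto k tau beta E" for k
  proof -
    let ?N = "pre_sigma (tau (Suc k))" and ?H = "rule_history tau beta k"
    note r = rule_step[OF Sk R k]
    have "\<forall>b'\<in>{1..m}. \<exists>g. g \<in> borel_measurable ?N \<and> (\<forall>w\<in>E (Suc k). b' \<noteq> beta k w \<longrightarrow> switch_value Y (?H w) (tau (Suc k) w) w b' = g w)"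
      using switch_value_measurable[OF Sk r(1-5)] by blast
    from bchoice[OF this] obtain g where gm: "\<And>b'. b' \<in> {1..m} \<Longrightarrow> g b' \<in> borel_measurable ?N"
      and g: "\<And>b' w. b' \<in> {1..m} \<Longrightarrow> w \<in> E (Suc k) \<Longrightarrow> b' \<noteq> beta k w \<Longrightarrow> switch_value Y (?H w) (tau (Suc k) w) w b' = g b' w" by blast
    have bk[measurable]: "beta k \<in> measurable ?N (count_space UNIV)"
      by (rule measurable_from_subalg[OF _ scheme_uptoD(2)[OF Sk order_refl]])
        (use pre_sigma_mono[OF scheme_uptoD(1)[OF Sk order_refl] r(1,4)] in \<open>simp add: subalgebra_def space_pre_sigma\<close>)
    have Em[measurable]: "E (Suc k) \<in> sets ?N" by (rule r(2))
    \<comment> \<open>Being a maximiser is rewritten with the measurable functions \<open>g\<close>,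
      which represent the switch values on \<open>E (Suc k)\<close>; the least mode satisfying it is
      then measurable.\<close>
    define Q where "Q b w \<longleftrightarrow> b \<in> {1..m} \<and> b \<noteq> beta k w \<and> (\<forall>b'\<in>{1..m}. b' \<noteq> beta k w \<longrightarrow> g b' w \<le> g b w)" for b w
    have Qm: "Measurable.pred ?N (Q b)" for b
    proof (cases "b \<in> {1..m}")
      case True
      have [measurable]: "g b \<in> borel_measurable ?N" by (rule gm[OF True])
      have "Measurable.pred ?N (\<lambda>w. \<forall>b'\<in>{1..m}. b' \<noteq> beta k w \<longrightarrow> g b' w \<le> g b w)"
      proof (rule pred_intros_finite)
        fix b' assume "b' \<in> {1..m}"
        then have [measurable]: "g b' \<in> borel_measurable ?N" by (rule gm)
        show "Measurable.pred ?N (\<lambda>w. b' \<noteq> beta k w \<longrightarrow> g b' w \<le> g b w)" by measurable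
      qed simp
      then have "Measurable.pred ?N (\<lambda>w. b \<noteq> beta k w \<and> (\<forall>b'\<in>{1..m}. b' \<noteq> beta k w \<longrightarrow> g b' w \<le> g b w))" by measurable
      moreover have "Q b = (\<lambda>w. b \<noteq> beta k w \<and> (\<forall>b'\<in>{1..m}. b' \<noteq> beta k w \<longrightarrow> g b' w \<le> g b w))"
        by (rule ext) (simp only: Q_def True simp_thms)
      ultimately show ?thesis by (simp only:)
    next
      case False
      then have "Q b = (\<lambda>_. False)" by (auto simp: Q_def)
      then show ?thesis by simp
    qed
    then have "(\<lambda>w. LEAST b. Q b w) \<in> measurable ?N (count_space UNIV)" by measurable
    then have "(\<lambda>w. if w \<in> E (Suc k) then LEAST b. Q b w else 0) \<in> measurable ?N (count_space UNIV)" by measurable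
    moreover have "beta (Suc k) w = (if w \<in> E (Suc k) then LEAST b. Q b w else 0)" if w: "w \<in> space ?N" for w
    proof (cases "w \<in> E (Suc k)")
      case True
      have q: "is_arg_max (switch_value Y (?H w) (tau (Suc k) w) w) (\<lambda>b. b \<in> alternatives m (beta k w)) b = Q b w" for b
      proof -
        define A where "A = alternatives m (beta k w)"
        have sv: "switch_value Y (?H w) (tau (Suc k) w) w y = g y w" if "y \<in> A" for y using g[OF _ True, of y] that by (simp add: A_def)
        have "Q b w \<longleftrightarrow> b \<in> A \<and> (\<forall>y. y \<in> A \<longrightarrow> g y w \<le> g b w)" unfolding Q_def A_def by blast
        also have "\<dots> \<longleftrightarrow> b \<in> A \<and> (\<forall>y. y \<in> A \<longrightarrow> switch_value Y (?H w) (tau (Suc k) w) w y \<le> switch_value Y (?H w) (tau (Suc k) w) w b)" by (simp add: sv cong: conj_cong)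
        finally show ?thesis by (simp only: is_arg_max_linorder A_def)
      qed
      have "tau (Suc k) w < T" using True Suc_E[OF k] by simp
      then show ?thesis unfolding next_mode[OF k, of w] q using True by simp
    next
      case False
      then have "\<not> tau (Suc k) w < T" using Suc_E[OF k] w by (simp add: space_pre_sigma)
      then show ?thesis using next_mode[OF k, of w] False by simp
    qed
    ultimately show ?thesis by (subst measurable_cong)
  qed
  have Sn: "scheme_upto n tau beta E"
  proof -
    have "trunc_times n tau = trunc_times n tau0" "trunc_modes n beta = trunc_modes n beta0" "trunc_events n E = trunc_events n E0"
      by (simp_all add: fun_eq_iff trunc_times_def trunc_modes_def trunc_events_def tau_def beta_def E_def)
    then show ?thesis using S by (simp add: scheme_upto_def)
  qed
  have "optimal_from n tau beta E"
    by (rule rule_optimal[OF Sn _ R meas]) (simp add: E_def En)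
  then show ?thesis
    by (intro exI[of _ tau] exI[of _ beta] exI[of _ E]) (simp add: R, simp add: tau_def beta_def E_def)
qed

section \<open>Uniqueness and optimality\<close>

lemma cost_from_start: "cost_between tau beta E 0 k (space M) = (\<Sum>i<k. \<integral>w. step_cost tau beta E i w \<partial>M)"
  by (simp add: cost_between_def integral_indicator_space atLeast0LessThan)

lemma J_scheme:
  assumes sch: "scheme tau beta E" and L: "(\<lambda>k. cost_between tau beta E 0 k (space M)) \<longlonglongrightarrow> L"
  shows "J (scheme_plan tau beta E) = ereal ((\<integral>w. Psi w (scheme_plan tau beta E w) \<partial>M) - L)"
proof -
  have s: "(\<lambda>i. \<integral>w. step_cost tau beta E i w \<partial>M) sums L" using L unfolding cost_from_start sums_def .
  have L0: "0 \<le> L" by (rule sums_le[OF _ sums_zero s]) (rule expected_plan_cost(2)[OF sch])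
  have "(\<integral>\<^sup>+w. plan_cost b0 (scheme_plan tau beta E w) w \<partial>M) = ennreal L"
    unfolding expected_plan_cost(1)[OF sch] by (rule suminf_ennreal_eq[OF expected_plan_cost(2)[OF sch] s])
  then show ?thesis using L0 by (simp add: J_def)
qed

lemma stage_value_0: "tau 0 = (\<lambda>_. 0) \<Longrightarrow> stage_value tau beta 0 (space M) = (\<integral>w. Y [] 0 w \<partial>M)"
  by (simp add: stage_value_def rule_history_0 integral_indicator_space)

text \<open>Infinite expected costs make the objective minus infinity. If they are finite, almost
  surely only finitely many interventions take place, and the limiting form of the gain estimate
  applies.\<close>

lemma J_le_value:
  assumes u: "u \<in> controls b0"
  shows "J u \<le> ereal (\<integral>w. Y [] 0 w \<partial>M)"
proof -
  obtain tau beta E where sch: "scheme tau beta E" and eq: "\<And>w. w \<in> space M \<Longrightarrow> scheme_plan tau beta E w = u w"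
    using control_scheme[OF u] by blast
  note D = schemeD[OF sch]
  let ?sc = "step_cost tau beta E"
  have J: "J u = J (scheme_plan tau beta E)" by (rule J_cong) (simp add: eq)
  show ?thesis
  proof (cases "(\<integral>\<^sup>+w. plan_cost b0 (scheme_plan tau beta E w) w \<partial>M) = \<infinity>")
    case True
    show ?thesis unfolding J unfolding J_def True by simp
  next
    case False
    then have "summable (\<lambda>i. \<integral>w. ?sc i w \<partial>M)"
      unfolding expected_plan_cost(1)[OF sch] infinity_ennreal_def
      by (intro summable_suminf_not_top expected_plan_cost(2)[OF sch])
    then have L: "(\<lambda>k. cost_between tau beta E 0 k (space M)) \<longlonglongrightarrow> (\<Sum>i. \<integral>w. ?sc i w \<partial>M)"
      unfolding cost_from_start by (rule summable_LIMSEQ)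
    have "AE w in M. (\<Sum>i. ennreal (?sc i w)) \<noteq> \<infinity>"
      using False step_cost_integrable[OF sch] unfolding plan_cost_scheme[OF sch] by (intro nn_integral_PInf_AE) auto
    with infinite_scheme_cost[OF sch] have fin: "AE w in M. \<exists>k. w \<notin> E k" by eventually_elim blast
    show ?thesis
      using payoff_le_stage_value[OF sch fin space_in_pre_sigma _ L] D(3)
      by (simp add: J J_scheme[OF sch L] stage_value_0[where tau=tau, OF D(1)] integral_indicator_space)
  qed
qed

lemma optimal_control:
  assumes opt: "optimal_from 0 tau beta E"
  shows "scheme_plan tau beta E \<in> controls b0" "J (scheme_plan tau beta E) = ereal (\<integral>w. Y [] 0 w \<partial>M)"
proof -
  have sch: "scheme tau beta E" using opt by (simp add: optimal_from_def)
  show "scheme_plan tau beta E \<in> controls b0"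
    using scheme_control[OF sch optimal_payoff(1)[OF opt]] controls_finite_subset by blast
  show "J (scheme_plan tau beta E) = ereal (\<integral>w. Y [] 0 w \<partial>M)"
    using J_scheme[OF sch optimal_payoff(2)[OF opt space_in_pre_sigma]]
    by (simp add: stage_value_0[where tau=tau, OF schemeD(1)[OF sch]] integral_indicator_space)
qed

lemma scheme_upto_0: "tau 0 = (\<lambda>_. 0) \<Longrightarrow> beta 0 = (\<lambda>_. b0) \<Longrightarrow> E 0 = space M \<Longrightarrow> scheme_upto 0 tau beta E"
  by (rule scheme_uptoI) (use const_stopping_times[of 0] T_nonneg space_in_pre_sigma in auto)

lemma switching_rule_exists: "\<exists>tau beta. switching_rule Y tau beta"
proof -
  have "scheme_upto 0 (\<lambda>_ _. 0) (\<lambda>_ _. b0) (\<lambda>_. space M)" by (rule scheme_upto_0) simp_all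
  from rule_extension[OF this refl] obtain tau beta E
    where 0: "tau 0 = (\<lambda>_. 0)" "beta 0 = (\<lambda>_. b0)" and R: "rule_from 0 tau beta E" and opt: "optimal_from 0 tau beta E" by auto
  have sch: "scheme tau beta E" using opt by (simp add: optimal_from_def)
  note D = schemeD[OF sch] and Rk = rule_fromD[OF R le0]
  have "tau (Suc j) w = Inf (insert T {s \<in> {tau j w..T}. Y (rule_history tau beta j w) s w = best_switch_value Y (rule_history tau beta j w) s w})"
    if w: "w \<in> space M" for j w
  proof (cases "w \<in> E j")
    case False
    then obtain i where i: "j = Suc i" using D(3) w by (cases j) auto
    then have "tau j w = T" using D(10)[OF w, of i] False by simp
    then show ?thesis using Rk(3)[OF w False] by (simp only: Inf_insert_trivial order_refl)
  qed (rule Rk(2)[OF w])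
  moreover have "is_arg_max (switch_value Y (rule_history tau beta j w) (tau (Suc j) w) w)
     (\<lambda>b. b \<in> alternatives m (last_mode (rule_history tau beta j w))) (beta (Suc j) w)" if "w \<in> space M" "tau (Suc j) w < T" for j w
    by (rule Rk(4)[OF that(1)]) (use that in \<open>simp add: Rk(1)\<close>)
  ultimately have "switching_rule Y tau beta"
    unfolding switching_rule_def Let_def using D(5) 0 by simp
  then show ?thesis by blast
qed

lemma switching_rule_optimal:
  assumes rule: "switching_rule Y tau beta"
  shows "rule_control tau beta \<in> controls b0" "AE w in M. finite {j. tau j w < T}"
    "J (rule_control tau beta) = ereal (\<integral>w. Y [] 0 w \<partial>M)"
proof -
  \<comment> \<open>The rule fixes the entries with index 0 on \<open>space M\<close> only, whereas
    a scheme requires constant functions; entries from 1 on are unchanged.\<close>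
  define tau' beta' where "tau' = tau(0 := \<lambda>_. 0)" and "beta' = beta(0 := \<lambda>_. b0)"
  define E where "E j = (if j = 0 then space M else {w\<in>space M. tau j w < T})" for j
  have h: "rule_history tau' beta' k w = rule_history tau beta k w" for k w
    by (rule rule_history_cong) (simp add: tau'_def beta'_def)
  have t': "tau' k w = tau k w" if "w \<in> space M" for k w
    using rule that unfolding switching_rule_def by (cases k) (simp_all add: tau'_def)
  have Suc: "tau' (Suc k) = tau (Suc k)" "beta' (Suc k) = beta (Suc k)" for k by (simp_all add: tau'_def beta'_def)
  have nt: "tau (Suc k) w = Inf (insert T {s \<in> {tau k w..T}. Y (rule_history tau beta k w) s w = best_switch_value Y (rule_history tau beta k w) s w})"
    and am: "tau (Suc k) w < T \<Longrightarrow> is_arg_max (switch_value Y (rule_history tau beta k w) (tau (Suc k) w) w)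
     (\<lambda>b. b \<in> alternatives m (last_mode (rule_history tau beta k w))) (beta (Suc k) w)" if "w \<in> space M" for k w
    using rule that unfolding switching_rule_def Let_def by blast+
  have R: "rule_from 0 tau' beta' E"
    unfolding rule_from_def h Suc
  proof (intro allI impI conjI ballI)
    fix k show "E (Suc k) = {w\<in>space M. tau (Suc k) w < T}" by (simp add: E_def)
    fix w assume w: "w \<in> space M"
    show "tau (Suc k) w = Inf (insert T {s \<in> {tau' k w..T}. Y (rule_history tau beta k w) s w = best_switch_value Y (rule_history tau beta k w) s w})"
      unfolding t'[OF w] by (rule nt[OF w])
    show "tau (Suc k) w = T" if "w \<notin> E k"
    proof -
      have "T \<le> tau k w" using that w by (auto simp: E_def split: if_splits)
      then show ?thesis unfolding nt[OF w] by (rule Inf_insert_trivial)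
    qed
    show "is_arg_max (switch_value Y (rule_history tau beta k w) (tau (Suc k) w) w)
     (\<lambda>b. b \<in> alternatives m (last_mode (rule_history tau beta k w))) (beta (Suc k) w)" if "w \<in> E (Suc k)"
      by (rule am[OF w]) (use that in \<open>simp add: E_def\<close>)
  qed
  have opt: "optimal_from 0 tau' beta' E"
  proof (rule rule_optimal[OF scheme_upto_0 _ R])
    show "tau' 0 = (\<lambda>_. 0)" "beta' 0 = (\<lambda>_. b0)" "E 0 = space M" "E 0 = space M" by (simp_all add: tau'_def beta'_def E_def)
    show "beta' (Suc k) \<in> measurable (pre_sigma (tau' (Suc k))) (count_space UNIV)" for k
      using rule unfolding switching_rule_def Suc by blast
  qed
  have eq: "rule_control tau beta w = scheme_plan tau' beta' E w" if "w \<in> space M" for w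
    using that by (auto simp: rule_control_def scheme_plan_def E_def Suc)
  show "rule_control tau beta \<in> controls b0" by (rule controls_cong[OF optimal_control(1)[OF opt] eq])
  show "J (rule_control tau beta) = ereal (\<integral>w. Y [] 0 w \<partial>M)"
    unfolding optimal_control(2)[OF opt, symmetric] by (rule J_cong[OF eq])
  have sch: "scheme tau' beta' E" using opt by (simp add: optimal_from_def)
  show "AE w in M. finite {j. tau j w < T}"
    using optimal_payoff(1)[OF opt] AE_space
  proof eventually_elim
    case (elim w)
    then obtain k where k: "w \<notin> E k" by blast
    have "j < k" if "tau j w < T" for j
    proof (rule ccontr)
      assume "\<not> j < k"
      then have "w \<notin> E j" using schemeD(13)[OF sch, of k j] k by auto
      then show False using that elim(2) by (auto simp: E_def split: if_splits)
    qed
    then have "{j. tau j w < T} \<subseteq> {..<k}" by blast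
    then show ?case by (rule finite_subset) simp
  qed
qed

lemma value_eq_sup: "ereal (\<integral>w. Y [] 0 w \<partial>M) = (SUP u\<in>controls b0. J u)"
proof (rule antisym)
  obtain tau beta where r: "switching_rule Y tau beta" using switching_rule_exists by blast
  show "ereal (\<integral>w. Y [] 0 w \<partial>M) \<le> (SUP u\<in>controls b0. J u)"
    unfolding switching_rule_optimal(3)[OF r, symmetric] by (rule SUP_upper[OF switching_rule_optimal(1)[OF r]])
  show "(SUP u\<in>controls b0. J u) \<le> ereal (\<integral>w. Y [] 0 w \<partial>M)" by (rule SUP_least[OF J_le_value])
qed

text \<open>With a trivial initial sigma-algebra, \<open>Y [] 0\<close> and its mean have equal
  integrals over all events of \<open>F 0\<close>, since these have probability 0 or 1; both being
  measurable at time 0, they agree.\<close>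

lemma value_constant:
  assumes triv: "\<forall>A\<in>sets (F 0). measure M A = 0 \<or> measure M A = 1"
  shows "AE w in M. Y [] 0 w = (\<integral>w. Y [] 0 w \<partial>M)"
proof -
  let ?f = "Y [] 0" and ?k = "\<integral>w. Y [] 0 w \<partial>M"
  have sm: "cadlag_supermartingale (Y [])" using family histories_Nil unfolding verification_family_def by blast
  have f: "integrable M ?f" "?f \<in> borel_measurable (F 0)"
    using sm T_nonneg progressive_F[of "Y []" 0] unfolding cadlag_supermartingale_def cadlag_process_def by auto
  have eq: "(\<integral>w. ?f w * indicator A w \<partial>M) = (\<integral>w. ?k * indicator A w \<partial>M)" if A: "A \<in> sets (F 0)" for A
  proof -
    have AM: "A \<in> sets M" using A sets_F_subset by blast
    from triv A consider "prob A = 0" | "prob A = 1" by blast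
    then show ?thesis
    proof cases
      case 1
      then have "AE w in M. w \<notin> A" using prob_eq_0[OF AM] by simp
      then have "(\<integral>w. ?f w * indicator A w \<partial>M) = (\<integral>w. 0 \<partial>M)"
        by (intro integral_cong_AE borel_measurable_integrable[OF integrable_real_mult_indicator[OF AM f(1)]]) (auto elim!: eventually_mono)
      then show ?thesis using 1 AM by simp
    next
      case 2
      then have "AE w in M. w \<in> A" using prob_eq_1[OF AM] by simp
      then have "(\<integral>w. ?f w * indicator A w \<partial>M) = ?k"
        by (intro integral_cong_AE borel_measurable_integrable[OF integrable_real_mult_indicator[OF AM f(1)]] borel_measurable_integrable[OF f(1)]) (auto elim!: eventually_mono)
      then show ?thesis using 2 AM by simp
    qed
  qed
  have "AE w in M. ?f w \<le> ?k" "AE w in M. ?k \<le> ?f w"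
    by (rule AE_le_of_set_integrals[OF subalgebra_F[of 0]]; use f eq in simp)+
  then show ?thesis by eventually_elim simp
qed

text \<open>The rule of \<open>Y\<close> is run after the given \<open>n\<close> interventions and
  used as a competitor for \<open>Y'\<close>. Its payoff and limiting costs reproduce the value of
  \<open>Y\<close> exactly and bound that of \<open>Y'\<close> from below. Neither quantity mentions
  a family, which is why the two can be compared.\<close>

lemma stage_value_le:
  assumes fam: "verification_family Y'" and S: "scheme_upto n tau beta E" and En: "E n = space M" and A: "A \<in> sets (pre_sigma (tau n))"
  shows "stage_value tau beta n A \<le> verified_family.stage_value M Y' tau beta n A"
proof -
  interpret Y': verified_family M F T m b0 Psi c Y' by unfold_locales (rule sa1 fam)+
  from rule_extension[OF S En] obtain tau' beta' E'
    where e: "\<forall>j\<le>n. tau' j = tau j \<and> beta' j = beta j" and opt: "optimal_from n tau' beta' E'" by blast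
  have sch: "scheme tau' beta' E'" and En': "E' n = space M" using opt by (simp_all add: optimal_from_def)
  have A': "A \<in> sets (pre_sigma (tau' n))" "A \<subseteq> E' n" using A e En' sets.sets_into_space[OF A] by (auto simp: space_pre_sigma)
  have h: "rule_history tau' beta' n = rule_history tau beta n" using e by (intro ext rule_history_cong) auto
  have "stage_value tau' beta' n A \<le> Y'.stage_value tau' beta' n A"
    using Y'.payoff_le_stage_value[OF sch optimal_payoff(1)[OF opt] A' optimal_payoff(2)[OF opt A'(1)]] by simp
  then show ?thesis using e by (simp add: stage_value_def Y'.stage_value_def h)
qed

lemma stage_value_AE_le:
  assumes fam: "verification_family Y'" and S: "scheme_upto n tau beta E" and En: "E n = space M"
  shows "AE w in M. Y (rule_history tau beta n w) (tau n w) w \<le> Y' (rule_history tau beta n w) (tau n w) w"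
proof -
  interpret Y': verified_family M F T m b0 Psi c Y' by unfold_locales (rule sa1 fam)+
  note D = scheme_uptoD[OF S] and sch = S[unfolded scheme_upto_def]
  have st: "tau n \<in> stopping_times" by (rule D(1)) simp
  let ?f = "\<lambda>w. Y (rule_history tau beta n w) (tau n w) w * indicator (space M) w"
    and ?g = "\<lambda>w. Y' (rule_history tau beta n w) (tau n w) w * indicator (space M) w"
  have tr: "trunc_times n tau n = tau n" "trunc_events n E n = space M" by (simp_all add: trunc_simps En)
  have sp: "space M \<in> sets M" "space M \<subseteq> trunc_events n E n" by (simp_all add: tr)
  have st': "trunc_times n tau n \<in> stopping_times" by (simp add: tr st)
  have i: "integrable M ?f" "integrable M ?g"
    using scheme_value_integrable[OF sch sp st' order_refl] Y'.scheme_value_integrable[OF sch sp st' order_refl]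
    unfolding rule_history_trunc tr by blast+
  have ms: "?f \<in> borel_measurable (pre_sigma (tau n))" "?g \<in> borel_measurable (pre_sigma (tau n))"
    using stage_value_measurable[OF sch, of n] Y'.stage_value_measurable[OF sch, of n] unfolding rule_history_trunc tr by blast+
  have "AE w in M. ?f w \<le> ?g w"
  proof (rule AE_le_of_set_integrals[OF pre_sigma_subalgebra[OF st] i(1) ms(1) i(2) ms(2)])
    fix A assume A: "A \<in> sets (pre_sigma (tau n))"
    have sv: "(\<integral>w. ?f w * indicator A w \<partial>M) = stage_value tau beta n A" "(\<integral>w. ?g w * indicator A w \<partial>M) = Y'.stage_value tau beta n A"
      unfolding stage_value_def Y'.stage_value_def by (auto intro!: Bochner_Integration.integral_cong)
    show "(\<integral>w. ?f w * indicator A w \<partial>M) \<le> (\<integral>w. ?g w * indicator A w \<partial>M)"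
      unfolding sv by (rule stage_value_le[OF fam S En A])
  qed
  then show ?thesis using AE_space by eventually_elim simp
qed

text \<open>A fixed history followed by a switch at the stopping time \<open>t\<close> is a segment
  of \<open>Suc (length h)\<close> interventions that all take place, so the two families can be
  compared at \<open>t\<close> in both directions.\<close>

lemma switched_value_AE_eq:
  assumes fam: "verification_family Y'" and h: "h \<in> histories" and b: "b \<in> alternatives m (last_mode h)"
    and t: "t \<in> stopping_times" "\<And>w. w \<in> space M \<Longrightarrow> last_time h \<le> t w"
  shows "AE w in M. Y (h @ [(t w, b)]) (t w) w = Y' (h @ [(t w, b)]) (t w) w"
proof -
  interpret Y': verified_family M F T m b0 Psi c Y' by unfold_locales (rule sa1 fam)+
  define n where "n = Suc (length h)"
  define H where "H w = h @ [(t w, b)]" for w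
  define tau where "tau j = (if j = 0 then (\<lambda>_. 0) else (\<lambda>w. fst (H w ! (j - 1))))" for j
  define beta where "beta j = (if j = 0 then (\<lambda>_. b0) else (\<lambda>w. snd (H w ! (j - 1))))" for j
  have Hh: "H w \<in> histories" if "w \<in> space M" for w
    using h b t(2)[OF that] stopping_timesD(3)[OF t(1) that] by (simp add: H_def histories_snoc)
  have Hn: "fst (H w ! i) \<in> {0..T} \<and> snd (H w ! i) \<in> alternatives m (if i = 0 then b0 else snd (H w ! (i - 1))) \<and> (\<forall>k<i. fst (H w ! k) \<le> fst (H w ! i))"
    if "w \<in> space M" "i < n" for w i
    using Hh[OF that(1)] that(2) unfolding histories_iff by (simp add: H_def n_def)
  have tcase: "tau j = (\<lambda>_. 0) \<or> tau j = t \<or> (\<exists>i<length h. tau j = (\<lambda>_. fst (h ! i)))" if "j \<le> n" for j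
  proof (cases j)
    case (Suc i)
    have "i < length h \<or> i = length h" using Suc that by (auto simp: n_def)
    then show ?thesis using Suc by (auto simp: tau_def H_def nth_append)
  qed (simp add: tau_def)
  have hT: "fst (h ! i) \<in> {0..T}" if "i < length h" for i using h that unfolding histories_iff by blast
  have st: "tau j \<in> stopping_times" if "j \<le> n" for j
    using tcase[OF that] t(1) const_stopping_times[of 0] const_stopping_times[OF hT] T_nonneg by auto
  have "beta j = (\<lambda>_. beta j undefined)" for j
    by (rule ext) (auto simp: beta_def H_def nth_append nth_Cons split: nat.splits)
  then have bm: "beta j \<in> measurable N (count_space UNIV)" for j N using measurable_const[of "beta j undefined" "count_space UNIV" N] by simp
  have S: "scheme_upto n tau beta (\<lambda>_. space M)"
  proof (rule scheme_uptoI[OF st bm space_in_pre_sigma])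
    show "tau 0 = (\<lambda>_. 0)" "beta 0 = (\<lambda>_. b0)" by (simp_all add: tau_def beta_def)
    fix j w assume j: "j < n" and w: "w \<in> space M"
    note Hj = Hn[OF w j]
    show "tau j w \<le> tau (Suc j) w" "beta (Suc j) w \<in> alternatives m (beta j w)"
      using Hj by (cases j; simp add: tau_def beta_def)+
  qed auto
  have hist: "rule_history tau beta n w = H w" for w
  proof (rule nth_equalityI)
    show "length (rule_history tau beta n w) = length (H w)" by (simp add: length_rule_history H_def n_def)
    fix i assume "i < length (rule_history tau beta n w)"
    then show "rule_history tau beta n w ! i = H w ! i"
      by (simp add: length_rule_history rule_history_nth tau_def beta_def)
  qed
  have tn: "tau n = t" by (auto simp: tau_def n_def H_def)
  have "AE w in M. Y (H w) (t w) w \<le> Y' (H w) (t w) w" "AE w in M. Y' (H w) (t w) w \<le> Y (H w) (t w) w"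
    using stage_value_AE_le[OF fam S refl] Y'.stage_value_AE_le[OF family S refl] unfolding hist tn by blast+
  then show ?thesis unfolding H_def by eventually_elim simp
qed

text \<open>Stage values determine the family only at the last time of a history. The Snell property
  recovers the other times: its rewards involve the family only through the obstacle at stopping
  times, where the extended histories end, and there both families agree.\<close>

lemma family_AE_le:
  assumes fam: "verification_family Y'" and h: "h \<in> histories" and s: "s \<in> {0..T}"
  shows "AE w in M. Y h s w \<le> Y' h s w"
proof -
  interpret Y': verified_family M F T m b0 Psi c Y' by unfold_locales (rule sa1 fam)+
  let ?r = "\<lambda>Y \<tau> w. if \<tau> w \<ge> T then Psi w (plan_of h) else best_switch_value Y h (\<tau> w) w"
  let ?Q = "\<lambda>Y. {real_cond_exp M (F s) (?r Y \<tau>) | \<tau>. \<tau> \<in> stopping_times_from (\<lambda>_. max s (last_time h))}"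
  have ess: "is_ess_sup M (?Q Y) (Y h s)" "is_ess_sup M (?Q Y') (Y' h s)"
    using family fam h s unfolding verification_family_def snell_property_def by blast+
  obtain Z X where en: "envelope (\<lambda>_. h) (\<lambda>_. last_time h) Z X" using deterministic_envelope[OF h] by blast
  have Xc: "cadlag_process X" using en unfolding envelope_def snell_from_def by blast
  have Pm: "(\<lambda>w. Psi w (plan_of h)) \<in> borel_measurable M"
    using Psi_integrable[of "\<lambda>_. plan_of h"] const_control[OF h] controls_finite_subset by auto
  show ?thesis
  proof (rule is_ess_sup_least[OF ess(1) is_ess_sup_measurable[OF ess(2)]])
    fix W assume "W \<in> ?Q Y"
    then obtain \<tau> where \<tau>: "\<tau> \<in> stopping_times" "AE w in M. max s (last_time h) \<le> \<tau> w"
      and \<tau>f: "\<tau> \<in> stopping_times_from (\<lambda>_. max s (last_time h))" and W: "W = real_cond_exp M (F s) (?r Y \<tau>)"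
      unfolding stopping_times_from_def by blast
    \<comment> \<open>\<open>\<tau>\<close> is at least \<open>last_time h\<close> only almost
      surely; raising it makes the extended history admissible everywhere.\<close>
    define t where "t w = max (last_time h) (\<tau> w)" for w
    have t: "t \<in> stopping_times" unfolding t_def by (intro max_stopping_times const_stopping_times last_time_range[OF h] \<tau>(1))
    have "AE w in M. Y (h @ [(t w, b)]) (t w) w = Y' (h @ [(t w, b)]) (t w) w" if "b \<in> alternatives m (last_mode h)" for b
      by (rule switched_value_AE_eq[OF fam h that t]) (simp add: t_def)
    then have "AE w in M. \<forall>b\<in>alternatives m (last_mode h). Y (h @ [(t w, b)]) (t w) w = Y' (h @ [(t w, b)]) (t w) w"
      by (intro AE_finite_allI) auto
    then have bsv: "AE w in M. best_switch_value Y h (\<tau> w) w = best_switch_value Y' h (\<tau> w) w"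
      using \<tau>(2)
    proof eventually_elim
      case (elim w)
      then have "t w = \<tau> w" by (simp add: t_def)
      then show ?case using elim(1) unfolding best_switch_value_def switch_value_def by (intro arg_cong[where f=Max] image_cong) auto
    qed
    have "AE w in M. \<forall>s\<in>{last_time h..T}. X s w = best_switch_value Y h s w"
      using en unfolding envelope_def by (auto elim!: eventually_mono)
    then have "AE w in M. X (\<tau> w) w = best_switch_value Y h (\<tau> w) w"
      using \<tau>(2) AE_space by eventually_elim (use stopping_timesD(3)[OF \<tau>(1)] in auto)
    then have bm: "(\<lambda>w. best_switch_value Y h (\<tau> w) w) \<in> borel_measurable M"
      using Xc \<tau>(1) by (intro measurable_M_AE_cong[OF progressive_stopped_M[of X \<tau>]]) (auto simp: cadlag_process_def)
    then have bm': "(\<lambda>w. best_switch_value Y' h (\<tau> w) w) \<in> borel_measurable M" by (rule measurable_M_AE_cong[OF _ bsv]) simp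
    have [measurable]: "\<tau> \<in> borel_measurable M" by (rule stopping_times_measurable[OF \<tau>(1)])
    have "AE w in M. W w = real_cond_exp M (F s) (?r Y' \<tau>) w"
      unfolding W
    proof (rule cond_exp_cong)
      show "AE w in M. ?r Y \<tau> w = ?r Y' \<tau> w" using bsv by eventually_elim simp
      show "?r Y \<tau> \<in> borel_measurable M" "?r Y' \<tau> \<in> borel_measurable M" using Pm bm bm' by measurable
    qed
    moreover have "AE w in M. real_cond_exp M (F s) (?r Y' \<tau>) w \<le> Y' h s w"
      by (rule is_ess_sup_upper[OF ess(2)]) (use \<tau>f in blast)
    ultimately show "AE w in M. W w \<le> Y' h s w" by eventually_elim simp
  qed
qed

lemma family_unique:
  assumes fam: "verification_family Y'"
  shows "indistinguishable_families Y Y'"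
  unfolding indistinguishable_families_def
proof
  interpret Y': verified_family M F T m b0 Psi c Y' by unfold_locales (rule sa1 fam)+
  fix h assume h: "h \<in> histories"
  have c: "cadlag_process (Y h)" "cadlag_process (Y' h)"
    using family fam h unfolding verification_family_def cadlag_supermartingale_def by blast+
  have "AE w in M. 0 \<le> s \<longrightarrow> Y h s w = Y' h s w" if "s \<in> {0..T}" for s
    using family_AE_le[OF fam h that] Y'.family_AE_le[OF family h that] by eventually_elim simp
  then show "AE w in M. \<forall>s\<in>{0..T}. Y h s w = Y' h s w"
    using cadlag_process_eq[where \<gamma>="\<lambda>_. 0", OF c] by simp
qed

end

theorem theorem3p2:
  fixes M :: "'a measure" and F :: "real \<Rightarrow> 'a measure" and T :: real
    and m b0 :: nat
    and Psi :: "'a \<Rightarrow> plan \<Rightarrow> real"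
    and c :: "nat \<Rightarrow> nat \<Rightarrow> real \<Rightarrow> 'a \<Rightarrow> real"
    and Y :: "history \<Rightarrow> real \<Rightarrow> 'a \<Rightarrow> real"
  assumes "switching_problem M F T m b0 Psi c"
    and "switching_problem.standing_assumption_1 M F T m b0 Psi c"
    and "switching_problem.standing_assumption_2 M F T m b0 Psi c"
    and "switching_problem.verification_family M F T m b0 Psi c Y"
  shows
    "(\<forall>Y'. switching_problem.verification_family M F T m b0 Psi c Y' \<longrightarrow>
        switching_problem.indistinguishable_families M T m b0 Y Y') \<and>
     (ereal (\<integral>\<omega>. Y [] 0 \<omega> \<partial>M) =
        (SUP u\<in>switching_problem.controls M F T m b0. switching_problem.J M b0 Psi c u) \<and>
      ((\<forall>A\<in>sets (F 0). measure M A = 0 \<or> measure M A = 1) \<longrightarrow>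
        (AE \<omega> in M. ereal (Y [] 0 \<omega>) =
          (SUP u\<in>switching_problem.controls M F T m b0. switching_problem.J M b0 Psi c u)))) \<and>
     ((\<exists>tau beta. switching_problem.switching_rule M F T m b0 c Y tau beta) \<and>
      (\<forall>tau beta. switching_problem.switching_rule M F T m b0 c Y tau beta \<longrightarrow>
        switching_problem.rule_control T tau beta
          \<in> switching_problem.controls M F T m b0 \<and>
        (AE \<omega> in M. finite {j. tau j \<omega> < T}) \<and>
        switching_problem.J M b0 Psi c (switching_problem.rule_control T tau beta) =
          (SUP u\<in>switching_problem.controls M F T m b0. switching_problem.J M b0 Psi c u)))"
proof -
  interpret switching_problem M F T m b0 Psi c by (rule assms(1))
  interpret verified_family M F T m b0 Psi c Y by unfold_locales (rule assms(2,4))+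
  show ?thesis
  proof (intro conjI allI impI)
    show "indistinguishable_families Y Y'" if "verification_family Y'" for Y' by (rule family_unique[OF that])
    show "ereal (\<integral>\<omega>. Y [] 0 \<omega> \<partial>M) = (SUP u\<in>controls b0. J u)" by (rule value_eq_sup)
    show "AE \<omega> in M. ereal (Y [] 0 \<omega>) = (SUP u\<in>controls b0. J u)" if "\<forall>A\<in>sets (F 0). measure M A = 0 \<or> measure M A = 1"
      using value_constant[OF that] by eventually_elim (simp add: value_eq_sup[symmetric])
    show "\<exists>tau beta. switching_rule Y tau beta" by (rule switching_rule_exists)
    fix tau beta assume r: "switching_rule Y tau beta"
    show "rule_control tau beta \<in> controls b0" "AE \<omega> in M. finite {j. tau j \<omega> < T}"
      "J (rule_control tau beta) = (SUP u\<in>controls b0. J u)"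
      using switching_rule_optimal[OF r] by (simp_all add: value_eq_sup[symmetric])
  qed
qed

end
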